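(* Let $0<\alpha<4$ and let $\phi\in L^2_w(\mathbb R^4)$ be a distributional solution of $$\Delta^2\phi(x)=\left(\int_{\mathbb R^4}\frac{e^{U(y)}\phi(y)}{|x-y|^\alpha}\,dy\right)e^{U(x)}+\left(\int_{\mathbb R^4}\frac{e^{U(y)}}{|x-y|^\alpha}\,dy\right)e^{U(x)}\phi(x)\quad\text{in }\mathbb R^4 .$$ Then $\phi\in C^\infty(\mathbb R^4)\cap L^\infty(\mathbb R^4)$ and $\phi=\sum_{j=1}^5a_j\phi_j$ for suitable constants $a_1,\dots,a_5\in\mathbb R$, where $$\phi_j(x)=\frac{(8-\alpha)x_j}{1+|x|^2}\ (1\le j\le4),\qquad \phi_5(x)=\frac{8-\alpha}{2}\,\frac{1-|x|^2}{1+|x|^2}.$$ The same conclusion holds at every bubble $U_{\mu,\zeta}$ ($\mu>0$, $\zeta\in\mathbb R^4$) after translation and dilation, i.e. with $U$ replaced by $U_{\mu,\zeta}$, and with the weight and the functions $\phi_j$ replaced by their compositions with $x\mapsto\mu(x-\zeta)$. In addition, on the form domain $\{S^*\Phi:\Phi\in H^2(\mathbb S^4)\}$ the quadratic form $\mathcal Q_U$ has Morse index one, its kernel is generated by $\phi_1,\dots,\phi_5$, and it is coercive on the orthogonal complement of the constant functions and $\phi_1,\dots,\phi_5$.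
   Context: All functions are real-valued. For $\mu>0$, $\zeta\in\mathbb R^4$, $$U_{\mu,\zeta}(x)=\frac{8-\alpha}{2}\log\frac{C_\alpha\mu}{1+\mu^2|x-\zeta|^2},\quad C_\alpha=\left(\frac{12(8-\alpha)(6-\alpha)(4-\alpha)}{\pi^2}\right)^{1/(8-\alpha)},\quad U:=U_{1,0}.$$ $L^2_w(\mathbb R^4)$ is the space of measurable $\phi$ with $\int_{\mathbb R^4}|\phi(x)|^2(1+|x|^2)^{-4}\,dx<\infty$. A distributional solution is one for which the equation holds when tested against every $\varphi\in C_c^\infty(\mathbb R^4)$, with $\Delta^2$ moved onto $\varphi$. Let $\omega(x)=2/(1+|x|^2)$ and let $$S(x)=\left(\frac{2x}{1+|x|^2},\frac{1-|x|^2}{1+|x|^2}\right)$$ be stereographic projection $\mathbb R^4\to\mathbb S^4\setminus\{(0,0,0,0,-1)\}$, with $S^*\Phi=\Phi\circ S$. The quadratic form is $$\mathcal Q_U(\phi)=\int_{\mathbb R^4}|\Delta\phi|^2dx-\iint\frac{e^{U(x)}\phi(x)e^{U(y)}\phi(y)}{|x-y|^\alpha}dxdy-\int_{\mathbb R^4}\left(\int_{\mathbb R^4}\frac{e^{U(y)}}{|x-y|^\alpha}dy\right)e^{U(x)}\phi(x)^2dx .$$ Orthogonality is with respect to $\int_{\mathbb R^4}\phi\psi\,\omega^4\,dx$ (which corresponds to the $L^2(\mathbb S^4)$ inner product under $S$). Coercivity on a subspace means that there is $c>0$ with $\mathcal Q_U(\phi)\ge c\int_{\mathbb R^4}|\Delta\phi|^2dx$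 for all $\phi$ in the subspace. The Morse index is the maximal dimension of a subspace on which the form is negative definite; the kernel of the form is the set of $\phi$ in the form domain for which the associated bilinear form vanishes against every element of the form domain. *)

theory Defs
  imports "HOL-Analysis.Analysis" "HOL-Library.Function_Algebras" "HOL-Library.Extended_Nat"
begin

definition partial :: "'a::euclidean_space \<Rightarrow> ('a \<Rightarrow> real) \<Rightarrow> 'a \<Rightarrow> real" where
  "partial b f x = frechet_derivative f (at x) b"

primrec Ck :: "nat \<Rightarrow> ('a::euclidean_space \<Rightarrow> real) \<Rightarrow> bool" where
  "Ck 0 f \<longleftrightarrow> continuous_on UNIV f"
| "Ck (Suc k) f \<longleftrightarrow> (\<forall>x. f differentiable (at x)) \<and> (\<forall>b\<in>Basis. Ck k (partial b f))"

definition smooth :: "('a::euclidean_space \<Rightarrow> real) \<Rightarrow> bool" where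
  "smooth f \<longleftrightarrow> (\<forall>k. Ck k f)"

definition laplacian :: "('a::euclidean_space \<Rightarrow> real) \<Rightarrow> 'a \<Rightarrow> real" where
  "laplacian f x = (\<Sum>b\<in>Basis. partial b (partial b f) x)"

definition test_fun :: "('a::euclidean_space \<Rightarrow> real) \<Rightarrow> bool" where
  "test_fun \<psi> \<longleftrightarrow> smooth \<psi> \<and> compact (closure {x. \<psi> x \<noteq> 0})"

text \<open>Elements of the function spaces below are functions, not classes modulo null sets.\<close>

definition L1_loc :: "('a::euclidean_space \<Rightarrow> real) set" where
  "L1_loc = {f. \<forall>K. compact K \<longrightarrow> set_integrable lebesgue K f}"

definition L2_loc :: "('a::euclidean_space \<Rightarrow> real) set" where
  "L2_loc = {f \<in> borel_measurable lebesgue.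
     \<forall>K. compact K \<longrightarrow> set_integrable lebesgue K (\<lambda>x. (f x)\<^sup>2)}"

definition has_weak_partial ::
    "('a::euclidean_space \<Rightarrow> real) \<Rightarrow> 'a \<Rightarrow> ('a \<Rightarrow> real) \<Rightarrow> bool" where
  "has_weak_partial f b g \<longleftrightarrow> f \<in> L1_loc \<and> g \<in> L1_loc \<and>
     (\<forall>\<psi>. test_fun \<psi> \<longrightarrow>
        (LINT x|lebesgue. f x * partial b \<psi> x) = - (LINT x|lebesgue. g x * \<psi> x))"

primrec Hk_loc :: "nat \<Rightarrow> ('a::euclidean_space \<Rightarrow> real) set" where
  "Hk_loc 0 = L2_loc"
| "Hk_loc (Suc k) =
     {f \<in> L2_loc. \<forall>b\<in>Basis. \<exists>g\<in>Hk_loc k. has_weak_partial f b g}"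

definition has_weak_laplacian ::
    "('a::euclidean_space \<Rightarrow> real) \<Rightarrow> ('a \<Rightarrow> real) \<Rightarrow> bool" where
  "has_weak_laplacian f g \<longleftrightarrow> f \<in> L1_loc \<and> g \<in> L1_loc \<and>
     (\<forall>\<psi>. test_fun \<psi> \<longrightarrow>
        (LINT x|lebesgue. f x * laplacian \<psi> x) = (LINT x|lebesgue. g x * \<psi> x))"

text \<open>The weak Laplacian is determined up to a null set; it is only used under integrals.\<close>

definition weak_laplacian :: "('a::euclidean_space \<Rightarrow> real) \<Rightarrow> 'a \<Rightarrow> real" where
  "weak_laplacian f = (SOME g. has_weak_laplacian f g)"

definition C_alpha :: "real \<Rightarrow> real" where
  "C_alpha \<alpha> = (12 * (8 - \<alpha>) * (6 - \<alpha>) * (4 - \<alpha>) / pi\<^sup>2) powr (1 / (8 - \<alpha>))"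

definition bubble :: "real \<Rightarrow> real \<Rightarrow> real^4 \<Rightarrow> real^4 \<Rightarrow> real" where
  "bubble \<alpha> \<mu> \<zeta> x =
     (8 - \<alpha>) / 2 * ln (C_alpha \<alpha> * \<mu> / (1 + \<mu>\<^sup>2 * (norm (x - \<zeta>))\<^sup>2))"

definition riesz :: "real \<Rightarrow> (real^4 \<Rightarrow> real) \<Rightarrow> real^4 \<Rightarrow> real" where
  "riesz \<alpha> f x = (LINT y|lebesgue. f y / norm (x - y) powr \<alpha>)"

definition weighted_L2 :: "(real^4 \<Rightarrow> real) \<Rightarrow> (real^4 \<Rightarrow> real) set" where
  "weighted_L2 w = {\<phi> \<in> borel_measurable lebesgue. integrable lebesgue (\<lambda>x. \<bar>\<phi> x\<bar>\<^sup>2 * w x)}"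

definition weight :: "real^4 \<Rightarrow> real" where
  "weight x = 1 / (1 + (norm x)\<^sup>2) ^ 4"

definition distributional_solution ::
    "real \<Rightarrow> (real^4 \<Rightarrow> real) \<Rightarrow> (real^4 \<Rightarrow> real) \<Rightarrow> bool" where
  "distributional_solution \<alpha> U \<phi> \<longleftrightarrow>
     (\<forall>\<psi>. test_fun \<psi> \<longrightarrow>
        (LINT x|lebesgue. \<phi> x * laplacian (laplacian \<psi>) x) =
        (LINT x|lebesgue.
           (riesz \<alpha> (\<lambda>y. exp (U y) * \<phi> y) x * exp (U x)
            + riesz \<alpha> (\<lambda>y. exp (U y)) x * exp (U x) * \<phi> x) * \<psi> x))"

text \<open>Indexed by \<open>j = 1, \<dots>, 5\<close>. The index type \<open>4\<close> has the elements \<open>1, 2, 3, 4\<close>, with \<open>4 = 0\<close>.\<close>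

definition phi :: "real \<Rightarrow> nat \<Rightarrow> real^4 \<Rightarrow> real" where
  "phi \<alpha> j x =
     (if j \<le> 4 then (8 - \<alpha>) * x $ of_nat j / (1 + (norm x)\<^sup>2)
      else (8 - \<alpha>) / 2 * ((1 - (norm x)\<^sup>2) / (1 + (norm x)\<^sup>2)))"

text \<open>The ambient space of the four-sphere is \<^typ>\<open>(real^4) \<times> real\<close>, with the Euclidean norm.\<close>

definition stereo :: "real^4 \<Rightarrow> (real^4) \<times> real" where
  "stereo x = ((2 / (1 + (norm x)\<^sup>2)) *\<^sub>R x, (1 - (norm x)\<^sup>2) / (1 + (norm x)\<^sup>2))"

definition stereo' :: "real^4 \<Rightarrow> (real^4) \<times> real" where
  "stereo' x = ((2 / (1 + (norm x)\<^sup>2)) *\<^sub>R x, - ((1 - (norm x)\<^sup>2) / (1 + (norm x)\<^sup>2)))"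

text \<open>
  The Sobolev space of the compact manifold \<open>sphere 0 1\<close> in local coordinates: the expression of
  the function in each chart of an atlas lies in the local Sobolev space. The atlas consists of
  the stereographic charts omitting \<open>(0, -1)\<close> and \<open>(0, 1)\<close>. Values off the sphere are irrelevant.
\<close>

definition H2_sphere :: "((real^4) \<times> real \<Rightarrow> real) set" where
  "H2_sphere = {\<Phi>. \<Phi> \<circ> stereo \<in> Hk_loc 2 \<and> \<Phi> \<circ> stereo' \<in> Hk_loc 2}"

definition form_domain :: "(real^4 \<Rightarrow> real) set" where
  "form_domain = {\<Phi> \<circ> stereo |\<Phi>. \<Phi> \<in> H2_sphere}"

definition bilin_form ::
    "real \<Rightarrow> (real^4 \<Rightarrow> real) \<Rightarrow> (real^4 \<Rightarrow> real) \<Rightarrow> (real^4 \<Rightarrow> real) \<Rightarrow> real" where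
  "bilin_form \<alpha> U \<phi> \<psi> =
     (LINT x|lebesgue. weak_laplacian \<phi> x * weak_laplacian \<psi> x)
     - (LINT (x, y)|lebesgue. exp (U x) * \<phi> x * (exp (U y) * \<psi> y) / norm (x - y) powr \<alpha>)
     - (LINT x|lebesgue. riesz \<alpha> (\<lambda>y. exp (U y)) x * exp (U x) * (\<phi> x * \<psi> x))"

definition quad_form :: "real \<Rightarrow> (real^4 \<Rightarrow> real) \<Rightarrow> (real^4 \<Rightarrow> real) \<Rightarrow> real" where
  "quad_form \<alpha> U \<phi> =
     (LINT x|lebesgue. \<bar>weak_laplacian \<phi> x\<bar>\<^sup>2)
     - (LINT (x, y)|lebesgue. exp (U x) * \<phi> x * (exp (U y) * \<phi> y) / norm (x - y) powr \<alpha>)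
     - (LINT x|lebesgue. riesz \<alpha> (\<lambda>y. exp (U y)) x * exp (U x) * (\<phi> x)\<^sup>2)"

lemma quad_form_eq_bilin_form: "quad_form \<alpha> U \<phi> = bilin_form \<alpha> U \<phi> \<phi>"
  by (simp add: quad_form_def bilin_form_def power2_eq_square)

definition form_kernel ::
    "(real^4 \<Rightarrow> real) set \<Rightarrow> ((real^4 \<Rightarrow> real) \<Rightarrow> (real^4 \<Rightarrow> real) \<Rightarrow> real) \<Rightarrow> (real^4 \<Rightarrow> real) set" where
  "form_kernel D B = {\<phi> \<in> D. \<forall>\<psi>\<in>D. B \<phi> \<psi> = 0}"

interpretation fun_space: vector_space "\<lambda>(c::real) (f::real^4 \<Rightarrow> real). (\<lambda>x. c * f x)"
  by unfold_locales (auto simp: fun_eq_iff algebra_simps)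

text \<open>
  Working with functions instead of classes modulo null sets does not change the dimension: a form
  that is negative off the zero function on \<open>V\<close> and invariant under changes on null sets forces
  \<open>V\<close> to contain no null function except zero. The dimension \<open>dim\<close> is meaningful for finitely
  generated subspaces only; the supremum in \<^typ>\<open>enat\<close> accounts for infinite dimension.
\<close>

definition morse_index ::
    "(real^4 \<Rightarrow> real) set \<Rightarrow> ((real^4 \<Rightarrow> real) \<Rightarrow> real) \<Rightarrow> enat" where
  "morse_index D Q =
     Sup {enat (fun_space.dim V) |V. fun_space.subspace V \<and> V \<subseteq> D \<and>
       (\<exists>B. finite B \<and> V = fun_space.span B) \<and> (\<forall>\<phi>\<in>V. \<phi> \<noteq> 0 \<longrightarrow> Q \<phi> < 0)}"

definition omega :: "real^4 \<Rightarrow> real" where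
  "omega x = 2 / (1 + (norm x)\<^sup>2)"

definition orthogonal_omega :: "(real^4 \<Rightarrow> real) \<Rightarrow> (real^4 \<Rightarrow> real) \<Rightarrow> bool" where
  "orthogonal_omega \<phi> \<psi> \<longleftrightarrow> (LINT x|lebesgue. \<phi> x * \<psi> x * omega x ^ 4) = 0"

definition coercive_on :: "(real^4 \<Rightarrow> real) set \<Rightarrow> ((real^4 \<Rightarrow> real) \<Rightarrow> real) \<Rightarrow> bool" where
  "coercive_on V Q \<longleftrightarrow>
     (\<exists>c>0. \<forall>\<phi>\<in>V. Q \<phi> \<ge> c * (LINT x|lebesgue. \<bar>weak_laplacian \<phi> x\<bar>\<^sup>2))"

end

theory Submission
  imports Defs "HOL-Computational_Algebra.Polynomial"
begin

text \<open>
  In stereographic coordinates \<open>\<Delta>\<^sup>2\<close> becomes the Paneitz operator: \<open>\<Delta>\<^sup>2 f = \<omega>\<^sup>4 (L\<^sup>2 - 2 L) f\<close>, where \<open>L\<close> is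
  the Laplacian of the four-sphere, with eigenvalues \<open>- l (l + 3)\<close>. By conformal covariance the
  convolution with the bubble is \<open>3 (8 - \<alpha>) K\<close> for a Markov operator \<open>K\<close> of the sphere, and the
  potential is the constant \<open>3 (8 - \<alpha>)\<close> times \<open>\<omega>\<^sup>4\<close>. The inversion at \<open>x\<close> is the sphere reflection that moves \<open>x\<close> to
  the pole; it shows that \<open>K 1 = 1\<close> and that \<open>K\<close> has the eigenvalue \<open>\<alpha> / (8 - \<alpha>)\<close> on the
  coordinate functions, hence the linearized operator vanishes on the latter: \<open>24 = 3 \<alpha> + 3 (8 - \<alpha>)\<close>.
  On the orthogonal complement of the harmonics of degree at most one the Paneitz operator is at
  least \<open>120\<close>, while \<open>\<parallel>K\<parallel> \<le> 1\<close> bounds the rest by \<open>6 (8 - \<alpha>) < 48\<close>. This gives nondegeneracy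
  and coercivity; the constants are the only negative direction.

  A distributional solution may be tested with the polynomials that vanish to second order at the
  pole, by cutoff; modulo the coordinate functions these are all polynomials. Elements of the form
  domain are approximated by polynomials since \<open>1 - L\<close> is a bijection of the polynomials and
  \<open>L \<phi>\<close> is square integrable on the sphere.
\<close>

section \<open>Smooth functions\<close>

text \<open>Test functions have compact support in R^4, so on the sphere they vanish near the pole.
  Cutting off a polynomial of lower than second order there produces an error that is unbounded in
  L^2; at second order the error stays bounded without tending to 0, which suffices because it lives
  where \<open>\<phi>\<close> has little mass. The linear functions escape this argument and need
  none: by the symmetry of K both sides of the tested equation agree on them for every
  \<open>\<phi>\<close>, thanks to 24 = 3 \<alpha> + 3 (8 - \<alpha>). Constants do carry
  information: the Paneitz operator kills them and K fixes them, so a solution has mean zero. With P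
  = L^2 - 2 L one has P + 1 = (1 - L)^2. This is why 1 - L controls at once the L^2 norm and the
  norm of the Laplacian, and why weak solutions are strong limits of polynomials. The constants:
  \<open>C_alpha\<close> is normalized so that the potential is exactly 3 (8 - \<alpha>); the
  Paneitz eigenvalues l (l + 3) (l (l + 3) + 2) are 0, 24, 120 for l = 0, 1, 2; coercivity holds
  with 1 - 48/120 = 3/5.\<close>

lemma partial_eqI: "(f has_derivative D) (at x) \<Longrightarrow> partial b f x = D b"
  unfolding partial_def by (metis frechet_derivative_at)

lemma partial_const [simp]: "partial b (\<lambda>x. c) = (\<lambda>x. 0)"
  by (rule ext, rule partial_eqI[where D="\<lambda>_. 0"]) simp

lemma partial_add:
  assumes "f differentiable (at x)" "g differentiable (at x)"
  shows "partial b (\<lambda>x. f x + g x) x = partial b f x + partial b g x"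
  using partial_eqI[OF has_derivative_add[OF frechet_derivative_works[THEN iffD1, OF assms(1)]
        frechet_derivative_works[THEN iffD1, OF assms(2)]]]
  by (simp add: partial_def)

lemma partial_mult:
  assumes "f differentiable (at x)" "g differentiable (at x)"
  shows "partial b (\<lambda>x. f x * g x) x = f x * partial b g x + partial b f x * g x"
  using partial_eqI[OF has_derivative_mult[OF frechet_derivative_works[THEN iffD1, OF assms(1)]
        frechet_derivative_works[THEN iffD1, OF assms(2)]]]
  by (simp add: partial_def)

lemma partial_cmult:
  assumes "f differentiable (at x)"
  shows "partial b (\<lambda>x. c * f x) x = c * partial b f x"
  using partial_mult[of "\<lambda>_. c" x f b] assms by simp

lemma partial_diff:
  assumes "f differentiable (at x)" "g differentiable (at x)"
  shows "partial b (\<lambda>x. f x - g x) x = partial b f x - partial b g x"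
  using partial_add[of f x "\<lambda>x. -1 * g x" b] partial_cmult[of g x b "-1"] assms by simp

lemma partial_sum:
  assumes "finite I" "\<And>i. i \<in> I \<Longrightarrow> f i differentiable (at x)"
  shows "partial b (\<lambda>x. \<Sum>i\<in>I. f i x) x = (\<Sum>i\<in>I. partial b (f i) x)"
  using assms
proof (induction I rule: finite_induct)
  case (insert i I)
  have "(\<lambda>x. \<Sum>i\<in>I. f i x) differentiable (at x)"
    using insert by (intro differentiable_sum) auto
  then show ?case using insert by (simp add: partial_add)
qed simp

lemma partial_inner [simp]: "partial b (\<lambda>x. x \<bullet> v) = (\<lambda>x. b \<bullet> v)"
  by (rule ext, rule partial_eqI) (auto intro!: derivative_eq_intros)

lemma partial_affine:
  fixes f :: "'a::euclidean_space \<Rightarrow> real"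
  assumes "f differentiable (at (c *\<^sub>R x + a))"
  shows "partial b (\<lambda>x. f (c *\<^sub>R x + a)) x = c * partial b f (c *\<^sub>R x + a)"
proof -
  let ?D = "frechet_derivative f (at (c *\<^sub>R x + a))"
  have D: "(f has_derivative ?D) (at (c *\<^sub>R x + a))"
    using assms frechet_derivative_works by blast
  have "((\<lambda>x. f (c *\<^sub>R x + a)) has_derivative (\<lambda>h. ?D (c *\<^sub>R h))) (at x)"
    by (rule has_derivative_compose[where f="\<lambda>x. c *\<^sub>R x + a" and g=f, OF _ D]) (auto intro!: derivative_eq_intros)
  then have "partial b (\<lambda>x. f (c *\<^sub>R x + a)) x = ?D (c *\<^sub>R b)" by (rule partial_eqI)
  also have "\<dots> = c * ?D b"
    using linear_cmul[OF has_derivative_linear[OF D]] by simp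
  finally show ?thesis by (simp add: partial_def)
qed

lemma partial_compose_real:
  assumes "(G has_real_derivative G') (at (f x))" "f differentiable (at x)"
  shows "partial b (\<lambda>x. G (f x)) x = G' * partial b f x"
proof -
  have "(f has_derivative frechet_derivative f (at x)) (at x)"
    using assms frechet_derivative_works by blast
  from has_derivative_compose[OF this, of G "\<lambda>h. G' * h"] assms(1)
  show ?thesis unfolding partial_def[of _ f]
    by (intro partial_eqI) (auto simp: has_field_derivative_def)
qed

lemma Ck_differentiable: "Ck (Suc k) f \<Longrightarrow> f differentiable (at x)" by simp

lemma Ck_SucD: "Ck (Suc k) f \<Longrightarrow> Ck k f"
proof (induction k arbitrary: f)
  case 0
  then show ?case
    by (auto simp: continuous_on_eq_continuous_at intro: differentiable_imp_continuous_within)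
next
  case (Suc k)
  then show ?case by (metis Ck.simps(2))
qed

lemma Ck_const: "Ck k (\<lambda>x. c)"
  by (induction k arbitrary: c) auto

lemma Ck_add: "Ck k f \<Longrightarrow> Ck k g \<Longrightarrow> Ck k (\<lambda>x. f x + g x)"
proof (induction k arbitrary: f g)
  case (Suc k)
  have "partial b (\<lambda>x. f x + g x) = (\<lambda>x. partial b f x + partial b g x)" for b
    using Suc.prems by (intro ext partial_add) auto
  then show ?case using Suc by auto
qed (auto intro: continuous_intros)

lemma Ck_mult: "Ck k f \<Longrightarrow> Ck k g \<Longrightarrow> Ck k (\<lambda>x. f x * g x)"
proof (induction k arbitrary: f g)
  case (Suc k)
  have "partial b (\<lambda>x. f x * g x) = (\<lambda>x. f x * partial b g x + partial b f x * g x)" for b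
    using Suc.prems by (intro ext partial_mult) auto
  moreover have "Ck k f" "Ck k g" using Suc.prems Ck_SucD by blast+
  ultimately show ?case using Suc by (auto intro!: Ck_add)
qed (auto intro: continuous_intros)

lemma Ck_affine: "Ck k f \<Longrightarrow> Ck k (\<lambda>x. f (c *\<^sub>R x + a))"
proof (induction k arbitrary: f)
  case 0
  then have "continuous_on UNIV f" by simp
  then have "continuous_on UNIV (f \<circ> (\<lambda>x. c *\<^sub>R x + a))"
    by (intro continuous_on_compose continuous_intros) (auto intro: continuous_on_subset)
  then show ?case by (simp add: o_def)
next
  case (Suc k)
  have "partial b (\<lambda>x. f (c *\<^sub>R x + a)) = (\<lambda>x. c * partial b f (c *\<^sub>R x + a))" for b
    using Suc.prems by (intro ext partial_affine) auto
  moreover have "(\<lambda>x. f (c *\<^sub>R x + a)) differentiable (at x)" for x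
    using differentiable_compose[of f "\<lambda>x. c *\<^sub>R x + a" x UNIV] Suc.prems
    by (auto intro!: derivative_intros)
  ultimately show ?case using Suc by (auto intro!: Ck_mult Ck_const)
qed

lemma smooth_differentiable: "smooth f \<Longrightarrow> f differentiable (at x)"
  using Ck_differentiable unfolding smooth_def by blast

lemma smooth_partial: "smooth f \<Longrightarrow> b \<in> Basis \<Longrightarrow> smooth (partial b f)"
  unfolding smooth_def by (metis Ck.simps(2))

lemma smooth_continuous: "smooth f \<Longrightarrow> continuous_on S f"
  unfolding smooth_def by (metis Ck.simps(1) continuous_on_subset top_greatest)

text \<open>A class of differentiable functions that is stable under partial derivatives is treated
  as a whole: the induction on the order runs over all its members, so no formula for higher
  derivatives is needed.\<close>

lemma smooth_coinduct:
  assumes "f \<in> F" "\<And>f x. f \<in> F \<Longrightarrow> f differentiable (at x)"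
    "\<And>f b. f \<in> F \<Longrightarrow> b \<in> Basis \<Longrightarrow> partial b f \<in> F"
  shows "smooth f"
proof -
  have "\<forall>f\<in>F. Ck k f" for k
  proof (induction k)
    case 0
    then show ?case using assms(2)
      by (auto simp: continuous_on_eq_continuous_at intro: differentiable_imp_continuous_within)
  qed (use assms in auto)
  then show ?thesis using assms(1) by (auto simp: smooth_def)
qed

lemma smooth_const [simp, intro]: "smooth (\<lambda>x. c)" by (simp add: smooth_def Ck_const)
lemma smooth_add [intro]: "smooth f \<Longrightarrow> smooth g \<Longrightarrow> smooth (\<lambda>x. f x + g x)"
  by (simp add: smooth_def Ck_add)
lemma smooth_mult [intro]: "smooth f \<Longrightarrow> smooth g \<Longrightarrow> smooth (\<lambda>x. f x * g x)"
  by (simp add: smooth_def Ck_mult)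
lemma smooth_diff [intro]: "smooth f \<Longrightarrow> smooth g \<Longrightarrow> smooth (\<lambda>x. f x - g x)"
  using smooth_add[of f "\<lambda>x. -1 * g x"] smooth_mult[of "\<lambda>_. -1" g] by simp
lemma smooth_sum [intro]: "(\<And>i. i \<in> I \<Longrightarrow> smooth (f i)) \<Longrightarrow> smooth (\<lambda>x. \<Sum>i\<in>I. f i x)"
  by (induction I rule: infinite_finite_induct) auto
lemma smooth_power [intro]: "smooth f \<Longrightarrow> smooth (\<lambda>x. f x ^ n)"
  by (induction n) auto
lemma smooth_affine: "smooth f \<Longrightarrow> smooth (\<lambda>x. f (c *\<^sub>R x + a))"
  by (simp add: smooth_def Ck_affine)
lemma smooth_inner [intro]: "smooth (\<lambda>x. x \<bullet> v)"
  by (rule smooth_coinduct[where F="insert (\<lambda>x. x \<bullet> v) (range (\<lambda>c x. c))"])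
     (auto intro!: derivative_intros simp: differentiable_def bounded_linear_inner_left
        intro: bounded_linear_imp_has_derivative)
lemma smooth_laplacian: "smooth f \<Longrightarrow> smooth (laplacian f)"
  unfolding laplacian_def[abs_def] by (intro smooth_sum smooth_partial)

lemma smooth_measurable: "smooth f \<Longrightarrow> f \<in> borel_measurable borel"
  using smooth_continuous borel_measurable_continuous_onI by blast

lemma laplacian_add:
  assumes "smooth f" "smooth g"
  shows "laplacian (\<lambda>x. f x + g x) x = laplacian f x + laplacian g x"
proof -
  have "partial b (\<lambda>x. f x + g x) = (\<lambda>x. partial b f x + partial b g x)" for b
    using assms by (intro ext partial_add smooth_differentiable)
  then show ?thesis unfolding laplacian_def sum.distrib[symmetric] using assms
    by (intro sum.cong refl) (simp add: partial_add smooth_differentiable smooth_partial)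
qed

lemma laplacian_mult:
  assumes "smooth f" "smooth g"
  shows "laplacian (\<lambda>x. f x * g x) x = f x * laplacian g x + g x * laplacian f x
     + 2 * (\<Sum>b\<in>Basis. partial b f x * partial b g x)"
proof -
  have "partial b (\<lambda>x. f x * g x) = (\<lambda>x. f x * partial b g x + partial b f x * g x)" for b
    using assms by (intro ext partial_mult smooth_differentiable)
  then have "laplacian (\<lambda>x. f x * g x) x
     = (\<Sum>b\<in>Basis. f x * partial b (partial b g) x + g x * partial b (partial b f) x + 2 * (partial b f x * partial b g x))"
    unfolding laplacian_def using assms
    by (intro sum.cong refl) (simp add: partial_add partial_mult smooth_differentiable smooth_partial smooth_mult)
  then show ?thesis by (simp add: laplacian_def sum.distrib sum_distrib_left)
qed

lemma laplacian_const [simp]: "laplacian (\<lambda>x. c) = (\<lambda>x. 0)"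
  by (simp add: laplacian_def[abs_def])

lemma laplacian_cmult: "smooth f \<Longrightarrow> laplacian (\<lambda>x. c * f x) x = c * laplacian f x"
  using laplacian_mult[of "\<lambda>_. c" f x] by simp

lemma laplacian_diff:
  assumes "smooth f" "smooth g"
  shows "laplacian (\<lambda>x. f x - g x) x = laplacian f x - laplacian g x"
  using laplacian_add[of f "\<lambda>x. -1 * g x" x] laplacian_cmult[of g "-1" x] assms
    smooth_mult[of "\<lambda>_. -1" g] by simp

lemma laplacian_affine:
  assumes "smooth f"
  shows "laplacian (\<lambda>x. f (c *\<^sub>R x + a)) x = c\<^sup>2 * laplacian f (c *\<^sub>R x + a)"
proof -
  have "partial b (\<lambda>x. f (c *\<^sub>R x + a)) = (\<lambda>x. c * partial b f (c *\<^sub>R x + a))" for b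
    using assms by (intro ext partial_affine smooth_differentiable)
  then show ?thesis unfolding laplacian_def sum_distrib_left
    using assms
    by (intro sum.cong refl)
       (simp add: partial_cmult partial_affine smooth_affine smooth_partial smooth_differentiable power2_eq_square)
qed

subsection \<open>Test functions and integration by parts\<close>

lemma test_fun_support:
  assumes "smooth f" "bounded {x. f x \<noteq> 0}"
  shows "test_fun f"
  using assms by (simp add: test_fun_def compact_closure)

lemma test_fun_smooth: "test_fun f \<Longrightarrow> smooth f" by (simp add: test_fun_def)

lemma test_fun_bounded_support: "test_fun f \<Longrightarrow> bounded {x. f x \<noteq> 0}"
  by (simp add: test_fun_def)

lemma test_fun_mult: "smooth g \<Longrightarrow> test_fun f \<Longrightarrow> test_fun (\<lambda>x. g x * f x)"
  by (rule test_fun_support) (auto intro: test_fun_smooth elim!: bounded_subset[OF test_fun_bounded_support])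

lemma test_fun_add: "test_fun f \<Longrightarrow> test_fun g \<Longrightarrow> test_fun (\<lambda>x. f x + g x)"
proof (rule test_fun_support)
  assume "test_fun f" "test_fun g"
  then have "bounded ({x. f x \<noteq> 0} \<union> {x. g x \<noteq> 0})"
    by (simp add: test_fun_bounded_support)
  then show "bounded {x. f x + g x \<noteq> 0}" by (rule bounded_subset) auto
qed (auto intro: test_fun_smooth)

lemma test_fun_zero: "test_fun (\<lambda>x. 0)" by (simp add: test_fun_def)

lemma test_fun_sum: "(\<And>i. i \<in> I \<Longrightarrow> test_fun (f i)) \<Longrightarrow> test_fun (\<lambda>x. \<Sum>i\<in>I. f i x)"
  by (induction I rule: infinite_finite_induct) (auto intro: test_fun_add test_fun_zero)

text \<open>Off the closure \<open>f\<close> vanishes in a whole neighbourhood; vanishing at the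
  point alone would say nothing about the derivative.\<close>

lemma partial_support: "partial b f x \<noteq> 0 \<Longrightarrow> x \<in> closure {x. f x \<noteq> 0}"
proof (rule ccontr)
  assume *: "partial b f x \<noteq> 0" "x \<notin> closure {x. f x \<noteq> 0}"
  have "(f has_derivative (\<lambda>_. 0)) (at x)"
  proof (rule has_derivative_transform_within_open[of "\<lambda>_. 0" _ _ UNIV "- closure {x. f x \<noteq> 0}"])
    show "open (- closure {x. f x \<noteq> 0})" by auto
    show "x \<in> - closure {x. f x \<noteq> 0}" using * by simp
    show "0 = f y" if "y \<in> - closure {x. f x \<noteq> 0}" for y
      using that closure_subset[of "{x. f x \<noteq> 0}"] by auto
  qed simp
  then show False using *(1) partial_eqI by force
qed

lemma test_fun_partial:
  assumes "test_fun f" "b \<in> Basis" shows "test_fun (partial b f)"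
proof (rule test_fun_support)
  show "bounded {x. partial b f x \<noteq> 0}"
    by (rule bounded_subset[of "closure {x. f x \<noteq> 0}"])
       (use assms partial_support in \<open>auto simp: test_fun_def\<close>)
qed (use assms in \<open>auto intro: smooth_partial test_fun_smooth\<close>)

lemma test_fun_laplacian: "test_fun f \<Longrightarrow> test_fun (laplacian f)"
  unfolding laplacian_def[abs_def] by (intro test_fun_sum test_fun_partial)

lemma test_fun_bound:
  assumes "test_fun f" obtains C where "C \<ge> 0" "\<And>x. \<bar>f x\<bar> \<le> C"
proof -
  let ?K = "closure {x. f x \<noteq> 0}"
  have "compact (f ` ?K)"
    using assms by (intro compact_continuous_image smooth_continuous) (auto simp: test_fun_def)
  then have "bounded (f ` ?K)" by (rule compact_imp_bounded)
  then obtain C where C: "\<And>y. y \<in> f ` ?K \<Longrightarrow> \<bar>y\<bar> \<le> C"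
    unfolding bounded_real by blast
  have "\<bar>f x\<bar> \<le> max C 0" for x
  proof (cases "f x = 0")
    case False
    then have "x \<in> ?K" using subsetD[OF closure_subset, of x "{x. f x \<noteq> 0}"] by simp
    then have "\<bar>f x\<bar> \<le> C" using C by simp
    then show ?thesis by simp
  qed simp
  then show ?thesis using that[of "max C 0"] by simp
qed

lemma set_integrable_continuous_lebesgue:
  fixes f :: "'a::euclidean_space \<Rightarrow> real"
  assumes "compact K" "continuous_on UNIV f"
  shows "set_integrable lebesgue K f"
proof -
  have "set_integrable lborel K f"
    unfolding set_integrable_def
    using borel_integrable_compact[OF assms(1) continuous_on_subset[OF assms(2)]] by simp
  moreover from this have "(\<lambda>x. indicator K x *\<^sub>R f x) \<in> borel_measurable lborel"
    unfolding set_integrable_def by (rule borel_measurable_integrable)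
  ultimately show ?thesis
    by (simp add: set_integrable_def integrable_completion)
qed

lemma continuous_lebesgue_measurable:
  fixes f :: "'a::euclidean_space \<Rightarrow> real"
  shows "continuous_on UNIV f \<Longrightarrow> f \<in> borel_measurable lebesgue"
  by (intro measurable_completion) (simp add: borel_measurable_continuous_onI)

lemma smooth_lebesgue_measurable: "smooth f \<Longrightarrow> f \<in> borel_measurable lebesgue"
  by (intro continuous_lebesgue_measurable smooth_continuous)

lemma L1_loc_mult_test:
  assumes "f \<in> L1_loc" "test_fun \<psi>"
  shows "integrable lebesgue (\<lambda>x. f x * \<psi> x)"
proof -
  let ?K = "closure {x. \<psi> x \<noteq> 0}"
  obtain C where C: "C \<ge> 0" "\<And>x. \<bar>\<psi> x\<bar> \<le> C" using test_fun_bound assms(2) by blast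
  have K: "compact ?K" using assms by (simp add: test_fun_def)
  have i: "integrable lebesgue (\<lambda>x. indicator ?K x * f x)"
    using assms(1) K by (auto simp: L1_loc_def set_integrable_def)
  have eq: "f x * \<psi> x = (indicator ?K x * f x) * \<psi> x" for x
    using closure_subset[of "{x. \<psi> x \<noteq> 0}"] by (auto simp: indicator_def)
  have m: "\<psi> \<in> borel_measurable lebesgue"
    using assms test_fun_smooth smooth_lebesgue_measurable by blast
  show ?thesis unfolding eq
    by (rule Bochner_Integration.integrable_bound[OF integrable_mult_left[OF i, of C]])
       (use C m i borel_measurable_integrable in \<open>auto simp: abs_mult intro!: mult_left_mono\<close>)
qed

lemma continuous_L1_loc: "continuous_on UNIV f \<Longrightarrow> f \<in> L1_loc"
  by (auto simp: L1_loc_def intro: set_integrable_continuous_lebesgue)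

lemma smooth_L1_loc: "smooth f \<Longrightarrow> f \<in> L1_loc"
  by (intro continuous_L1_loc smooth_continuous)

lemma test_fun_integrable: "test_fun f \<Longrightarrow> integrable lebesgue f"
  using L1_loc_mult_test[OF smooth_L1_loc[of "\<lambda>_. 1"], of f] by simp

text \<open>By translation invariance every difference quotient has integral zero, and dominated
  convergence passes to the derivative. No iterated integrals along lines are involved.\<close>

lemma integral_partial_eq_0:
  fixes f :: "'a::euclidean_space \<Rightarrow> real"
  assumes f: "test_fun f" and b: "b \<in> Basis"
  shows "(LINT x|lebesgue. partial b f x) = 0"
proof -
  define q where "q n x = real (Suc n) * (f (x + (1 / real (Suc n)) *\<^sub>R b) - f x)" for n x
  have sm: "smooth f" using f test_fun_smooth by blast
  have fb: "f \<in> borel_measurable borel" using sm smooth_measurable by blast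
  have pb: "partial b f \<in> borel_measurable borel" using sm b smooth_measurable smooth_partial by blast
  have fi: "integrable lborel f"
    using test_fun_integrable[OF f] fb integrable_completion[of f lborel] by simp
  obtain C where C: "C \<ge> 0" "\<And>x. \<bar>partial b f x\<bar> \<le> C"
    using test_fun_bound test_fun_partial[OF f b] by blast
  obtain R where R: "\<And>x. f x \<noteq> 0 \<Longrightarrow> norm x \<le> R"
    using test_fun_bounded_support[OF f] by (auto simp: bounded_iff)
  have der: "(f has_derivative frechet_derivative f (at x)) (at x)" for x
    using smooth_differentiable[OF sm] frechet_derivative_works by blast
  have dline: "((\<lambda>t. f (x + t *\<^sub>R b)) has_real_derivative partial b f (x + t *\<^sub>R b)) (at t)" for x t
  proof -
    have "((\<lambda>t. f (x + t *\<^sub>R b)) has_derivative (\<lambda>h. frechet_derivative f (at (x + t *\<^sub>R b)) (h *\<^sub>R b))) (at t)"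
      by (rule has_derivative_compose[where f="\<lambda>t. x + t *\<^sub>R b" and g=f, OF _ der]) (auto intro!: derivative_eq_intros)
    moreover have "frechet_derivative f (at (x + t *\<^sub>R b)) (h *\<^sub>R b) = partial b f (x + t *\<^sub>R b) * h" for h
      using linear_cmul[OF has_derivative_linear[OF der]] by (simp add: partial_def)
    ultimately show ?thesis by (simp add: has_field_derivative_def)
  qed
  have q0: "(\<integral>x. q n x \<partial>lborel) = 0" for n
  proof -
    have 1: "integrable lborel (\<lambda>x. f (x + c))" "(\<integral>x. f (x + c) \<partial>lborel) = (\<integral>x. f x \<partial>lborel)" for c
      using lborel_distr_plus[of c] fi fb
        integrable_distr_eq[of "(+) c" lborel borel f] integral_distr[of "(+) c" lborel borel f]
      by (simp_all add: add.commute)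
    show ?thesis unfolding q_def using 1 fi by (subst integral_mult_right_zero) (simp add: Bochner_Integration.integral_diff)
  qed
  have "(\<lambda>n. \<integral>x. q n x \<partial>lborel) \<longlonglongrightarrow> (\<integral>x. partial b f x \<partial>lborel)"
  \<comment> \<open>The mean value theorem bounds the quotients by the supremum of the derivative,
    and steps of length at most 1 keep their supports in the ball of radius R + 1.\<close>
  proof (rule integral_dominated_convergence[where w="\<lambda>x. indicator (cball 0 (R + 1)) x * C"])
    show "integrable lborel (\<lambda>x. indicator (cball 0 (R + 1)) x * C)"
      by (intro integrable_mult_left) (auto intro!: integrable_real_indicator emeasure_lborel_cball_finite)
    show "AE x in lborel. (\<lambda>n. q n x) \<longlonglongrightarrow> partial b f x"
    proof (rule AE_I2)
      fix x :: 'a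
      have l: "((\<lambda>h. (f (x + h *\<^sub>R b) - f x) / h) \<longlongrightarrow> partial b f x) (at 0)"
        using dline[of x 0] by (simp add: has_field_derivative_iff)
      have "(\<lambda>n. 1 / real (Suc n)) \<longlonglongrightarrow> 0" using LIMSEQ_inverse_real_of_nat by (simp add: inverse_eq_divide)
      then have "filterlim (\<lambda>n. 1 / real (Suc n)) (at 0) sequentially"
        by (auto simp: filterlim_at)
      from filterlim_compose[OF l this] show "(\<lambda>n. q n x) \<longlonglongrightarrow> partial b f x"
        by (simp add: q_def mult.commute)
    qed
    show "AE x in lborel. norm (q n x) \<le> indicator (cball 0 (R + 1)) x * C" for n
    proof (rule AE_I2)
      fix x :: 'a
      let ?h = "1 / real (Suc n)"
      have h: "0 < ?h" "?h \<le> 1" by auto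
      obtain z where "f (x + ?h *\<^sub>R b) - f (x + 0 *\<^sub>R b) = (?h - 0) * partial b f (x + z *\<^sub>R b)"
        using MVT2[of 0 ?h "\<lambda>t. f (x + t *\<^sub>R b)", OF h(1) dline] by auto
      then have "q n x = partial b f (x + z *\<^sub>R b)" by (simp add: q_def)
      then have 1: "\<bar>q n x\<bar> \<le> C" using C by simp
      have 2: "q n x = 0" if "norm x > R + 1"
      proof -
        have "norm (?h *\<^sub>R b) \<le> 1" using h b by simp
        moreover have "norm x \<le> norm (x + ?h *\<^sub>R b) + norm (?h *\<^sub>R b)"
          using norm_triangle_ineq4[of "x + ?h *\<^sub>R b" "?h *\<^sub>R b"] by (simp only: add_diff_cancel)
        ultimately have "norm (x + ?h *\<^sub>R b) > R" using that by linarith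
        then have "f (x + ?h *\<^sub>R b) = 0" using R by (metis not_le)
        moreover have "norm x > R" using that by linarith
        then have "f x = 0" using R by (metis not_le)
        ultimately show ?thesis by (simp add: q_def)
      qed
      show "norm (q n x) \<le> indicator (cball 0 (R + 1)) x * C"
        using 1 2 by (auto simp: indicator_def not_le)
    qed
    show "q n \<in> borel_measurable lborel" for n unfolding q_def using fb by measurable
  qed (use pb in simp)
  then have "(\<integral>x. partial b f x \<partial>lborel) = 0" unfolding q0 LIMSEQ_const_iff by simp
  then show ?thesis using pb by (simp add: integral_completion)
qed

lemma integral_by_parts:
  assumes "smooth f" "test_fun g" "b \<in> Basis"
  shows "(LINT x|lebesgue. f x * partial b g x) = - (LINT x|lebesgue. partial b f x * g x)"
proof -
  have "(LINT x|lebesgue. partial b (\<lambda>x. f x * g x) x) = 0"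
    using assms by (intro integral_partial_eq_0 test_fun_mult)
  moreover have "partial b (\<lambda>x. f x * g x) x = f x * partial b g x + partial b f x * g x" for x
    using assms by (simp add: partial_mult smooth_differentiable test_fun_smooth)
  moreover have "integrable lebesgue (\<lambda>x. f x * partial b g x)" "integrable lebesgue (\<lambda>x. partial b f x * g x)"
    using assms by (simp_all add: L1_loc_mult_test smooth_L1_loc test_fun_partial smooth_partial)
  ultimately show ?thesis by simp
qed

lemma smooth_weak_partial:
  "smooth f \<Longrightarrow> b \<in> Basis \<Longrightarrow> has_weak_partial f b (partial b f)"
  unfolding has_weak_partial_def
  by (auto simp: integral_by_parts intro: smooth_L1_loc smooth_partial)

lemma integral_laplacian_by_parts:
  assumes f: "smooth f" and g: "test_fun g"
  shows "(LINT x|lebesgue. f x * laplacian g x) = (LINT x|lebesgue. laplacian f x * g x)"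
proof -
  have i: "integrable lebesgue (\<lambda>x. f x * partial b (partial b g) x)"
    "integrable lebesgue (\<lambda>x. partial b (partial b f) x * g x)" if "b \<in> Basis" for b
    using assms that by (simp_all add: L1_loc_mult_test smooth_L1_loc test_fun_partial smooth_partial)
  have "(LINT x|lebesgue. f x * partial b (partial b g) x) = (LINT x|lebesgue. partial b (partial b f) x * g x)"
    if "b \<in> Basis" for b
    using assms that integral_by_parts[of f "partial b g" b] integral_by_parts[of "partial b f" g b]
    by (simp add: test_fun_partial smooth_partial)
  then show ?thesis
    using i by (simp add: laplacian_def sum_distrib_left sum_distrib_right Bochner_Integration.integral_sum)
qed

section \<open>A smooth cutoff on the line\<close>

text \<open>The witness is the whole sequence of derivatives, so smoothness is one existential
  statement; \<open>deriv\<close> recovers the sequence from its first member.\<close>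

definition smooth1 :: "(real \<Rightarrow> real) \<Rightarrow> bool" where
  "smooth1 G \<longleftrightarrow> (\<exists>D. D 0 = G \<and> (\<forall>n x. (D n has_real_derivative D (Suc n) x) (at x)))"

lemma smooth1_coinduct:
  assumes "f \<in> F" "\<And>g. g \<in> F \<Longrightarrow> \<exists>g'\<in>F. \<forall>x. (g has_real_derivative g' x) (at x)"
  shows "smooth1 f"
proof -
  have step: "deriv g \<in> F \<and> (\<forall>x. (g has_real_derivative deriv g x) (at x))" if g: "g \<in> F" for g
  proof -
    obtain g' where g': "g' \<in> F" "\<And>x. (g has_real_derivative g' x) (at x)"
      using assms(2)[OF g] by blast
    then have "deriv g = g'" by (intro ext DERIV_imp_deriv)
    then show ?thesis using g' by simp
  qed
  have F: "(deriv ^^ n) f \<in> F" for n by (induction n) (use assms(1) step in auto)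
  show ?thesis unfolding smooth1_def
    by (rule exI[of _ "\<lambda>n. (deriv ^^ n) f"]) (use F step in auto)
qed

lemma smooth1_DERIV:
  assumes "smooth1 G"
  shows "(G has_real_derivative deriv G x) (at x)" "smooth1 (deriv G)"
proof -
  obtain D where D: "D 0 = G" "\<And>n x. (D n has_real_derivative D (Suc n) x) (at x)"
    using assms unfolding smooth1_def by blast
  have d: "deriv G = D 1" using D by (intro ext DERIV_imp_deriv) (metis One_nat_def)
  show "(G has_real_derivative deriv G x) (at x)" unfolding d using D by (metis One_nat_def)
  show "smooth1 (deriv G)" unfolding smooth1_def d
    by (rule exI[of _ "\<lambda>n. D (Suc n)"]) (use D in auto)
qed

lemma smooth1_continuous: "smooth1 G \<Longrightarrow> continuous_on S G"
  by (meson DERIV_continuous_on smooth1_DERIV(1) has_field_derivative_at_within)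

text \<open>The induction on the order is over all \<open>G\<close> at once, since one derivative
  replaces \<open>G\<close> by \<open>deriv G\<close>.\<close>

lemma smooth_compose_real:
  assumes "smooth1 G" "smooth f" shows "smooth (\<lambda>x. G (f x))"
proof -
  have "\<forall>G. smooth1 G \<longrightarrow> Ck k (\<lambda>x. G (f x))" for k
  proof (induction k)
    case 0
    show ?case
    proof (intro allI impI)
      fix G :: "real \<Rightarrow> real" assume "smooth1 G"
      then have "continuous_on UNIV (G \<circ> f)"
        using assms by (intro continuous_on_compose smooth_continuous smooth1_continuous)
      then show "Ck 0 (\<lambda>x. G (f x))" by (simp add: o_def)
    qed
  next
    case (Suc k)
    show ?case
    proof (intro allI impI)
      fix G :: "real \<Rightarrow> real" assume G: "smooth1 G"
      have d: "(G has_real_derivative deriv G y) (at y)" for y using G by (rule smooth1_DERIV)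
      have "partial b (\<lambda>x. G (f x)) = (\<lambda>x. deriv G (f x) * partial b f x)" for b
        by (intro ext partial_compose_real d smooth_differentiable assms)
      moreover have "Ck k (\<lambda>x. deriv G (f x) * partial b f x)" if "b \<in> Basis" for b
        using Suc G smooth1_DERIV(2) smooth_partial[OF assms(2) that] unfolding smooth_def
        by (intro Ck_mult) auto
      moreover have "(\<lambda>x. G (f x)) differentiable (at x)" for x
      proof -
        have "G differentiable (at (f x))" using d real_differentiable_def by blast
        then show ?thesis
          using differentiable_compose[of G f x UNIV] smooth_differentiable[OF assms(2)] by simp
      qed
      ultimately show "Ck (Suc k) (\<lambda>x. G (f x))" by simp
    qed
  qed
  then show ?thesis using assms(1) by (simp add: smooth_def)
qed

text \<open>For \<open>p = 1\<close> this is the classical flat function exp (-1/t). The polynomial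
  factor in 1/t makes the family closed under differentiation.\<close>

definition pexp :: "real poly \<Rightarrow> real \<Rightarrow> real" where
  "pexp p t = (if t \<le> 0 then 0 else poly p (1 / t) * exp (- (1 / t)))"

lemma poly_div_exp_tendsto_0: "((\<lambda>y. poly p y * exp (- y)) \<longlongrightarrow> (0::real)) at_top"
proof -
  have "((\<lambda>y. \<Sum>i\<le>degree p. coeff p i * (y ^ i / exp y)) \<longlongrightarrow> (\<Sum>i\<le>degree p. coeff p i * 0)) at_top"
    by (intro tendsto_intros tendsto_power_div_exp_0)
  moreover have "(\<Sum>i\<le>degree p. coeff p i * (y ^ i / exp y)) = poly p y * exp (- y)" for y :: real
    by (simp add: poly_altdef exp_minus field_simps sum_divide_distrib sum_distrib_left)
  ultimately show ?thesis by simp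
qed

text \<open>For t > 0 the chain rule yields 1/t^2 times p - p' at 1/t, whence the factor
  \<open>[:0, 0, 1:]\<close>. At 0 the right difference quotient is of the same form with the
  polynomial X p, so it tends to 0.\<close>

lemma pexp_DERIV:
  "(pexp p has_real_derivative pexp ([:0, 0, 1:] * (p - pderiv p)) t) (at t)"
proof (cases "t = 0")
  case False
  show ?thesis
  proof (cases "t < 0")
    case True
    have "(pexp p has_real_derivative 0) (at t)"
      by (rule has_field_derivative_transform_within_open[of "\<lambda>_. 0" _ _ "{..<0}"])
         (use True in \<open>auto simp: pexp_def\<close>)
    then show ?thesis using True by (simp add: pexp_def)
  next
    case False
    then have t: "t > 0" using \<open>t \<noteq> 0\<close> by simp
    have "((\<lambda>t. poly p (1 / t) * exp (- (1 / t))) has_real_derivative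
        pexp ([:0, 0, 1:] * (p - pderiv p)) t) (at t)"
      using t by (auto intro!: derivative_eq_intros simp: pexp_def power2_eq_square field_simps)
    then show ?thesis
      by (rule has_field_derivative_transform_within_open[of _ _ _ "{0<..}"])
         (use t in \<open>auto simp: pexp_def\<close>)
  qed
next
  case True
  have r: "((\<lambda>h. pexp p h / h) \<longlongrightarrow> 0) (at_right 0)"
  proof -
    have "((\<lambda>h. poly ([:0, 1:] * p) (inverse h) * exp (- inverse h)) \<longlongrightarrow> 0) (at_right (0::real))"
      by (rule filterlim_compose[OF poly_div_exp_tendsto_0 filterlim_inverse_at_top_right])
    moreover have "eventually (\<lambda>h. poly ([:0, 1:] * p) (inverse h) * exp (- inverse h) = pexp p h / h) (at_right (0::real))"
      by (auto simp: eventually_at_filter pexp_def field_simps)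
    ultimately show ?thesis using tendsto_cong by fastforce
  qed
  have l: "((\<lambda>h. pexp p h / h) \<longlongrightarrow> 0) (at_left 0)"
    by (rule tendsto_eventually) (auto simp: eventually_at_filter pexp_def)
  have "((\<lambda>h. pexp p h / h) \<longlongrightarrow> 0) (at 0)"
    using l r filterlim_split_at by blast
  then show ?thesis using True by (simp add: has_field_derivative_iff pexp_def)
qed

text \<open>Of \<open>s - 1\<close> and \<open>2 - s\<close> at least one is positive, so the sum
  never vanishes and may serve as a denominator.\<close>

definition bump_denom :: "real \<Rightarrow> real" where
  "bump_denom s = pexp 1 (s - 1) + pexp 1 (2 - s)"

lemma bump_denom_pos: "bump_denom s > 0"
  by (auto simp: bump_denom_def pexp_def add_pos_pos)

text \<open>An algebra containing the quotient \<open>eta\<close> and closed under derivatives: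
  (1/d)' = - d' (1/d)^2 stays inside because the derivative of \<open>bump_denom\<close> is a
  combination of \<open>pexp\<close> terms.\<close>

inductive bump_class :: "(real \<Rightarrow> real) \<Rightarrow> bool" where
  "bump_class (\<lambda>s. c)"
| "bump_class (\<lambda>s. pexp p (s - 1))"
| "bump_class (\<lambda>s. pexp p (2 - s))"
| "bump_class (\<lambda>s. 1 / bump_denom s)"
| "bump_class f \<Longrightarrow> bump_class g \<Longrightarrow> bump_class (\<lambda>s. f s + g s)"
| "bump_class f \<Longrightarrow> bump_class g \<Longrightarrow> bump_class (\<lambda>s. f s * g s)"

lemma bump_class_DERIV:
  "bump_class f \<Longrightarrow> \<exists>f'. bump_class f' \<and> (\<forall>x. (f has_real_derivative f' x) (at x))"
proof (induction rule: bump_class.induct)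
  case (1 c)
  show ?case by (rule exI[of _ "\<lambda>_. 0"]) (auto intro: bump_class.intros)
next
  case (2 p)
  show ?case
  proof (intro exI[of _ "\<lambda>s. pexp ([:0, 0, 1:] * (p - pderiv p)) (s - 1)"] conjI bump_class.intros(2) allI)
    fix x
    have "((\<lambda>s. s - 1) has_real_derivative 1) (at x)" by (auto intro!: derivative_eq_intros)
    from DERIV_chain2[OF pexp_DERIV this]
    show "((\<lambda>s. pexp p (s - 1)) has_real_derivative pexp ([:0, 0, 1:] * (p - pderiv p)) (x - 1)) (at x)" by simp
  qed
next
  case (3 p)
  have "((\<lambda>s. pexp p (2 - s)) has_real_derivative (-1) * pexp ([:0, 0, 1:] * (p - pderiv p)) (2 - x)) (at x)" for x
  proof -
    have "((\<lambda>s. 2 - s) has_real_derivative -1) (at x)" by (auto intro!: derivative_eq_intros)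
    from DERIV_chain2[OF pexp_DERIV this] show ?thesis by simp
  qed
  then show ?case
    by (intro exI[of _ "\<lambda>s. (-1) * pexp ([:0, 0, 1:] * (p - pderiv p)) (2 - s)"] conjI allI
         bump_class.intros(6)[OF bump_class.intros(1) bump_class.intros(3)])
next
  case 4
  let ?q = "[:0, 0, 1:] * (1 - pderiv 1) :: real poly"
  let ?D = "\<lambda>s. pexp ?q (s - 1) + (-1) * pexp ?q (2 - s)"
  have "(bump_denom has_real_derivative ?D x) (at x)" for x
  proof -
    have "((\<lambda>s. s - 1) has_real_derivative 1) (at x)" "((\<lambda>s. 2 - s) has_real_derivative -1) (at x)"
      by (auto intro!: derivative_eq_intros)
    from DERIV_add[OF DERIV_chain2[OF pexp_DERIV this(1)] DERIV_chain2[OF pexp_DERIV this(2)], of 1 1]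
    show ?thesis by (simp add: bump_denom_def[abs_def])
  qed
  then have "((\<lambda>s. 1 / bump_denom s) has_real_derivative (-1) * (?D x * ((1 / bump_denom x) * (1 / bump_denom x)))) (at x)" for x
    using bump_denom_pos[of x] by (auto intro!: derivative_eq_intros simp: field_simps)
  moreover have D: "bump_class ?D"
    by (rule bump_class.intros(5)[OF bump_class.intros(2) bump_class.intros(6)[OF bump_class.intros(1) bump_class.intros(3)]])
  have "bump_class (\<lambda>x. (-1) * (?D x * ((1 / bump_denom x) * (1 / bump_denom x))))"
    by (rule bump_class.intros(6)[OF bump_class.intros(1) bump_class.intros(6)[OF D bump_class.intros(6)[OF bump_class.intros(4) bump_class.intros(4)]]])
  ultimately show ?case by blast
next
  case (5 f g)
  then obtain f' g' where *: "bump_class f'" "bump_class g'" "\<And>x. (f has_real_derivative f' x) (at x)"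
    "\<And>x. (g has_real_derivative g' x) (at x)" by blast
  then have "((\<lambda>x. f x + g x) has_real_derivative f' x + g' x) (at x)" for x by (intro DERIV_add)
  then show ?case using bump_class.intros(5)[OF *(1,2)] by blast
next
  case (6 f g)
  then obtain f' g' where *: "bump_class f'" "bump_class g'" "\<And>x. (f has_real_derivative f' x) (at x)"
    "\<And>x. (g has_real_derivative g' x) (at x)" by blast
  then have "((\<lambda>x. f x * g x) has_real_derivative f' x * g x + g' x * f x) (at x)" for x by (intro DERIV_mult)
  moreover have "bump_class (\<lambda>x. f' x * g x + g' x * f x)"
    by (rule bump_class.intros(5)[OF bump_class.intros(6)[OF *(1) 6(2)] bump_class.intros(6)[OF *(2) 6(1)]])
  ultimately show ?case by blast
qed

lemma bump_class_smooth1: "bump_class f \<Longrightarrow> smooth1 f"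
  by (rule smooth1_coinduct[of _ "Collect bump_class"]) (use bump_class_DERIV in auto)

definition eta :: "real \<Rightarrow> real" where "eta s = pexp 1 (s - 1) / bump_denom s"

lemma eta_smooth1: "smooth1 eta"
proof -
  have "bump_class (\<lambda>s. pexp 1 (s - 1) * (1 / bump_denom s))"
    by (intro bump_class.intros)
  then show ?thesis using bump_class_smooth1 by (simp add: eta_def[abs_def])
qed

lemma eta_0: "s \<le> 1 \<Longrightarrow> eta s = 0" by (simp add: eta_def pexp_def)
lemma eta_1: "s \<ge> 2 \<Longrightarrow> eta s = 1" using bump_denom_pos[of s]
  by (simp add: eta_def bump_denom_def pexp_def)

text \<open>Wide enough to contain \<open>eta\<close>, narrow enough that its members are bounded on
  the whole line and that G -> s G'(s) does not leave the class.\<close>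

definition cut :: "(real \<Rightarrow> real) \<Rightarrow> bool" where
  "cut G \<longleftrightarrow> smooth1 G \<and> (\<forall>s<1. G s = 0) \<and> (\<exists>c. \<forall>s>2. G s = c)"

lemma cut_eta: "cut eta"
  using eta_smooth1 eta_0 eta_1 by (force simp: cut_def)

lemma smooth1_affine: "smooth1 G \<Longrightarrow> smooth1 (\<lambda>s. a + b * G (c + d * s))"
proof (rule smooth1_coinduct[of _ "{(\<lambda>s. a + b * G (c + d * s)) |a b G. smooth1 G}"])
  fix g assume "g \<in> {(\<lambda>s. a + b * G (c + d * s)) |a b G. smooth1 G}"
  then obtain a b G where g: "g = (\<lambda>s. a + b * G (c + d * s))" "smooth1 G" by blast
  have "(g has_real_derivative 0 + (b * d) * deriv G (c + d * x)) (at x)" for x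
    unfolding g(1) by (auto intro!: derivative_eq_intros DERIV_chain2[OF smooth1_DERIV(1)[OF g(2)]])
  then show "\<exists>g'\<in>{(\<lambda>s. a + b * G (c + d * s)) |a b G. smooth1 G}. \<forall>x. (g has_real_derivative g' x) (at x)"
    using smooth1_DERIV(2)[OF g(2)] by (intro bexI[of _ "\<lambda>x. 0 + (b * d) * deriv G (c + d * x)"]) blast+
qed blast

text \<open>The derivative of s G is s G' + G, so the class used in the coinduction carries a second
  summand \<open>H\<close>.\<close>

lemma smooth1_ident_mult: "smooth1 G \<Longrightarrow> smooth1 (\<lambda>s. s * G s)"
proof (rule smooth1_coinduct[of _ "{(\<lambda>s. s * G s + H s) |G H. smooth1 G \<and> smooth1 H}"])
  assume "smooth1 G"
  moreover have "smooth1 (\<lambda>_. 0)" by (rule smooth1_coinduct[of _ "{\<lambda>_. 0}"]) auto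
  ultimately show "(\<lambda>s. s * G s) \<in> {(\<lambda>s. s * G s + H s) |G H. smooth1 G \<and> smooth1 H}" by force
next
  fix g assume "g \<in> {(\<lambda>s. s * G s + H s) |G H. smooth1 G \<and> smooth1 H}"
  then obtain G H where g: "g = (\<lambda>s. s * G s + H s)" "smooth1 G" "smooth1 H" by blast
  have add: "smooth1 (\<lambda>s. G s + deriv H s)"
  proof (rule smooth1_coinduct[of _ "{(\<lambda>s. A s + B s) |A B. smooth1 A \<and> smooth1 B}"])
    show "(\<lambda>s. G s + deriv H s) \<in> {(\<lambda>s. A s + B s) |A B. smooth1 A \<and> smooth1 B}"
      using g smooth1_DERIV(2) by blast
  next
    fix k assume "k \<in> {(\<lambda>s. A s + B s) |A B. smooth1 A \<and> smooth1 B}"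
    then obtain A B where k: "k = (\<lambda>s. A s + B s)" "smooth1 A" "smooth1 B" by blast
    show "\<exists>g'\<in>{(\<lambda>s. A s + B s) |A B. smooth1 A \<and> smooth1 B}. \<forall>x. (k has_real_derivative g' x) (at x)"
      unfolding k(1) using smooth1_DERIV(2)[OF k(2)] smooth1_DERIV(2)[OF k(3)]
      by (intro bexI[of _ "\<lambda>s. deriv A s + deriv B s"] allI DERIV_add smooth1_DERIV(1) k) blast
  qed
  have "(g has_real_derivative x * deriv G x + (G x + deriv H x)) (at x)" for x
    unfolding g(1) by (auto intro!: derivative_eq_intros smooth1_DERIV(1) g)
  then show "\<exists>g'\<in>{(\<lambda>s. s * G s + H s) |G H. smooth1 G \<and> smooth1 H}. \<forall>x. (g has_real_derivative g' x) (at x)"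
    using add smooth1_DERIV(2)[OF g(2)]
    by (intro bexI[of _ "\<lambda>x. x * deriv G x + (G x + deriv H x)"] allI CollectI
          exI[of _ "deriv G"] exI[of _ "\<lambda>x. G x + deriv H x"] conjI refl) auto
qed

lemma cut_theta: "cut G \<Longrightarrow> cut (\<lambda>s. s * deriv G s)"
proof -
  assume G: "cut G"
  then obtain c where c: "\<And>s. s > 2 \<Longrightarrow> G s = c" by (auto simp: cut_def)
  have "deriv G s = 0" if "s < 1" for s
  proof (rule DERIV_imp_deriv)
    show "(G has_real_derivative 0) (at s)"
      by (rule has_field_derivative_transform_within_open[of "\<lambda>_. 0" _ _ "{..<1}"])
         (use that G in \<open>auto simp: cut_def\<close>)
  qed
  moreover have "deriv G s = 0" if "s > 2" for s
  proof (rule DERIV_imp_deriv)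
    show "(G has_real_derivative 0) (at s)"
      by (rule has_field_derivative_transform_within_open[of "\<lambda>_. c" _ _ "{2<..}"])
         (use that c in auto)
  qed
  ultimately show ?thesis using G by (auto simp: cut_def intro!: smooth1_ident_mult smooth1_DERIV exI[of _ 0])
qed

lemma cut_bounded: assumes "cut G" obtains C where "C \<ge> 0" "\<And>s. \<bar>G s\<bar> \<le> C"
proof -
  obtain c where c: "\<And>s. s > 2 \<Longrightarrow> G s = c" "\<And>s. s < 1 \<Longrightarrow> G s = 0"
    using assms by (auto simp: cut_def)
  have "compact (G ` {1..2})"
    using assms by (intro compact_continuous_image smooth1_continuous) (auto simp: cut_def)
  then have "bounded (G ` {1..2})" by (rule compact_imp_bounded)
  then obtain B where B: "\<And>s. s \<in> {1..2} \<Longrightarrow> \<bar>G s\<bar> \<le> B" unfolding bounded_real by blast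
  have "\<bar>G s\<bar> \<le> \<bar>B\<bar> + \<bar>c\<bar>" for s
    using B[of s] c[of s] by (cases "s < 1"; cases "s > 2") auto
  then show ?thesis using that[of "\<bar>B\<bar> + \<bar>c\<bar>"] by simp
qed

section \<open>Square-integrable functions\<close>

definition L2fn :: "'a measure \<Rightarrow> ('a \<Rightarrow> real) set" where
  "L2fn M = {f \<in> borel_measurable M. integrable M (\<lambda>x. (f x)\<^sup>2)}"

lemma L2fnI: "f \<in> borel_measurable M \<Longrightarrow> integrable M (\<lambda>x. (f x)\<^sup>2) \<Longrightarrow> f \<in> L2fn M"
  by (simp add: L2fn_def)

lemma L2fn_measurable: "f \<in> L2fn M \<Longrightarrow> f \<in> borel_measurable M"
  by (simp add: L2fn_def)

lemma L2fn_square: "f \<in> L2fn M \<Longrightarrow> integrable M (\<lambda>x. (f x)\<^sup>2)"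
  by (simp add: L2fn_def)

lemma abs_mult_le_squares: "\<bar>a * b\<bar> \<le> (a\<^sup>2 + b\<^sup>2) / (2::real)"
proof -
  have "0 \<le> (\<bar>a\<bar> - \<bar>b\<bar>)\<^sup>2" by simp
  then show ?thesis by (simp add: power2_diff abs_mult)
qed

lemma L2fn_mult: "f \<in> L2fn M \<Longrightarrow> g \<in> L2fn M \<Longrightarrow> integrable M (\<lambda>x. f x * g x)"
  by (rule Bochner_Integration.integrable_bound[of _ "\<lambda>x. ((f x)\<^sup>2 + (g x)\<^sup>2) / 2"])
     (use abs_mult_le_squares in \<open>auto simp: L2fn_def\<close>)

lemma L2fn_add: assumes "f \<in> L2fn M" "g \<in> L2fn M" shows "(\<lambda>x. f x + g x) \<in> L2fn M"
proof (rule L2fnI)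
  have "integrable M (\<lambda>x. (f x)\<^sup>2 + (g x)\<^sup>2 + 2 * (f x * g x))"
    using assms by (intro Bochner_Integration.integrable_add integrable_mult_right L2fn_mult L2fn_square)
  then show "integrable M (\<lambda>x. (f x + g x)\<^sup>2)" by (simp add: power2_sum mult.assoc)
qed (use assms in \<open>auto simp: L2fn_def\<close>)

lemma L2fn_cmult: "f \<in> L2fn M \<Longrightarrow> (\<lambda>x. c * f x) \<in> L2fn M"
  by (auto simp: L2fn_def power_mult_distrib)

lemma L2fn_diff: "f \<in> L2fn M \<Longrightarrow> g \<in> L2fn M \<Longrightarrow> (\<lambda>x. f x - g x) \<in> L2fn M"
  using L2fn_add[of f M "\<lambda>x. -1 * g x"] L2fn_cmult[of g M "-1"] by simp

lemma L2fn_AE: "f \<in> L2fn M \<Longrightarrow> AE x in M. f x = g x \<Longrightarrow> g \<in> borel_measurable M \<Longrightarrow> g \<in> L2fn M"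
  by (rule L2fnI, assumption, rule integrable_cong_AE_imp[of M "\<lambda>x. (f x)\<^sup>2"])
     (auto simp: L2fn_def elim!: eventually_mono)

lemma square_sum_expand:
  assumes "f \<in> L2fn M" "g \<in> L2fn M"
  shows "(\<integral>x. (f x + c * g x)\<^sup>2 \<partial>M) = (\<integral>x. (f x)\<^sup>2 \<partial>M) + 2 * c * (\<integral>x. f x * g x \<partial>M) + c\<^sup>2 * (\<integral>x. (g x)\<^sup>2 \<partial>M)"
proof -
  have "(\<integral>x. (f x + c * g x)\<^sup>2 \<partial>M) = (\<integral>x. (f x)\<^sup>2 + 2 * c * (f x * g x) + c\<^sup>2 * (g x)\<^sup>2 \<partial>M)"
    by (intro Bochner_Integration.integral_cong refl) (simp add: power2_sum power_mult_distrib)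
  also have "\<dots> = (\<integral>x. (f x)\<^sup>2 \<partial>M) + 2 * c * (\<integral>x. f x * g x \<partial>M) + c\<^sup>2 * (\<integral>x. (g x)\<^sup>2 \<partial>M)"
    using assms by (simp add: L2fn_square L2fn_mult)
  finally show ?thesis .
qed

lemma nonneg_quadratic_discriminant:
  fixes a b c :: real
  assumes "\<And>t. 0 \<le> a + 2 * t * b + t\<^sup>2 * c" "0 \<le> c"
  shows "b\<^sup>2 \<le> a * c"
proof (cases "c = 0")
  case True
  have "b = 0"
  proof (rule ccontr)
    assume "b \<noteq> 0"
    \<comment> \<open>The value of t is chosen so that a + 2 t b = -1.\<close>
    then have "0 \<le> a + 2 * (- (a + 1) / (2 * b)) * b" using assms(1)[of "- (a + 1) / (2 * b)"] True by simp
    then show False using \<open>b \<noteq> 0\<close> by (simp add: field_simps)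
  qed
  then show ?thesis using True by simp
next
  case False
  have "0 \<le> c * (a + 2 * (- b / c) * b + (- b / c)\<^sup>2 * c)"
    by (rule mult_nonneg_nonneg[OF assms(2) assms(1)])
  also have "c * (a + 2 * (- b / c) * b + (- b / c)\<^sup>2 * c) = a * c - b\<^sup>2"
    using False by (simp add: field_simps power2_eq_square)
  finally show ?thesis by simp
qed

lemma L2fn_Cauchy_Schwarz:
  assumes "f \<in> L2fn M" "g \<in> L2fn M"
  shows "(\<integral>x. f x * g x \<partial>M)\<^sup>2 \<le> (\<integral>x. (f x)\<^sup>2 \<partial>M) * (\<integral>x. (g x)\<^sup>2 \<partial>M)"
proof (rule nonneg_quadratic_discriminant)
  fix t
  have "0 \<le> (\<integral>x. (f x + t * g x)\<^sup>2 \<partial>M)" by simp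
  then show "0 \<le> (\<integral>x. (f x)\<^sup>2 \<partial>M) + 2 * t * (\<integral>x. f x * g x \<partial>M) + t\<^sup>2 * (\<integral>x. (g x)\<^sup>2 \<partial>M)"
    using square_sum_expand[OF assms] by simp
qed simp

lemma square_add_le: "((a::real) + b)\<^sup>2 \<le> 2 * a\<^sup>2 + 2 * b\<^sup>2"
  using zero_le_power2[of "a - b"] unfolding power2_sum power2_diff by linarith

lemma L2fn_triangle:
  assumes "f \<in> L2fn M" "g \<in> L2fn M" "h \<in> L2fn M"
  shows "(\<integral>x. (f x - h x)\<^sup>2 \<partial>M) \<le> 2 * (\<integral>x. (f x - g x)\<^sup>2 \<partial>M) + 2 * (\<integral>x. (g x - h x)\<^sup>2 \<partial>M)"
proof -
  have "(\<integral>x. (f x - h x)\<^sup>2 \<partial>M) \<le> (\<integral>x. 2 * (f x - g x)\<^sup>2 + 2 * (g x - h x)\<^sup>2 \<partial>M)"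
  proof (intro integral_mono)
    show "(f x - h x)\<^sup>2 \<le> 2 * (f x - g x)\<^sup>2 + 2 * (g x - h x)\<^sup>2" for x
      using square_add_le[of "f x - g x" "g x - h x"] by simp
  qed (use assms in \<open>auto intro!: L2fn_square L2fn_diff Bochner_Integration.integrable_add integrable_mult_right\<close>)
  also have "\<dots> = 2 * (\<integral>x. (f x - g x)\<^sup>2 \<partial>M) + 2 * (\<integral>x. (g x - h x)\<^sup>2 \<partial>M)"
    using assms by (simp add: L2fn_square L2fn_diff)
  finally show ?thesis .
qed

definition L2conv :: "'a measure \<Rightarrow> (nat \<Rightarrow> 'a \<Rightarrow> real) \<Rightarrow> ('a \<Rightarrow> real) \<Rightarrow> bool" where
  "L2conv M f g \<longleftrightarrow> (\<forall>n. f n \<in> L2fn M) \<and> g \<in> L2fn M \<and> (\<lambda>n. \<integral>x. (f n x - g x)\<^sup>2 \<partial>M) \<longlonglongrightarrow> 0"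

lemma L2conv_inner:
  assumes "L2conv M f g" "h \<in> L2fn M"
  shows "(\<lambda>n. \<integral>x. f n x * h x \<partial>M) \<longlonglongrightarrow> (\<integral>x. g x * h x \<partial>M)"
proof -
  have fg: "f n \<in> L2fn M" "g \<in> L2fn M" for n using assms by (auto simp: L2conv_def)
  have "(\<lambda>n. (\<integral>x. (f n x - g x) * h x \<partial>M)\<^sup>2) \<longlonglongrightarrow> 0"
  proof (rule tendsto_sandwich[of "\<lambda>_. 0" _ _ "\<lambda>n. (\<integral>x. (f n x - g x)\<^sup>2 \<partial>M) * (\<integral>x. (h x)\<^sup>2 \<partial>M)"])
    show "(\<lambda>n. (\<integral>x. (f n x - g x)\<^sup>2 \<partial>M) * (\<integral>x. (h x)\<^sup>2 \<partial>M)) \<longlonglongrightarrow> 0"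
      using assms by (intro tendsto_mult_left_zero) (simp add: L2conv_def)
  qed (use fg assms in \<open>auto intro!: always_eventually L2fn_Cauchy_Schwarz L2fn_diff\<close>)
  then have "(\<lambda>n. \<integral>x. (f n x - g x) * h x \<partial>M) \<longlonglongrightarrow> 0"
    using tendsto_real_sqrt[of "\<lambda>n. (\<integral>x. (f n x - g x) * h x \<partial>M)\<^sup>2" 0] tendsto_rabs_zero_cancel by simp
  moreover have "(\<integral>x. (f n x - g x) * h x \<partial>M) = (\<integral>x. f n x * h x \<partial>M) - (\<integral>x. g x * h x \<partial>M)" for n
    using fg assms by (simp add: left_diff_distrib L2fn_mult)
  ultimately show ?thesis using LIM_zero_cancel by fastforce
qed

lemma L2conv_square:
  assumes "L2conv M f g"
  shows "(\<lambda>n. \<integral>x. (f n x)\<^sup>2 \<partial>M) \<longlonglongrightarrow> (\<integral>x. (g x)\<^sup>2 \<partial>M)"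
proof -
  have fg: "f n \<in> L2fn M" "g \<in> L2fn M" for n using assms by (auto simp: L2conv_def)
  have "(\<lambda>n. (\<integral>x. (f n x - g x)\<^sup>2 \<partial>M) + 2 * (\<integral>x. f n x * g x \<partial>M) - (\<integral>x. (g x)\<^sup>2 \<partial>M))
      \<longlonglongrightarrow> 0 + 2 * (\<integral>x. g x * g x \<partial>M) - (\<integral>x. (g x)\<^sup>2 \<partial>M)"
    using assms fg by (intro tendsto_intros L2conv_inner) (auto simp: L2conv_def)
  moreover have "(\<integral>x. (f n x - g x)\<^sup>2 \<partial>M) + 2 * (\<integral>x. f n x * g x \<partial>M) - (\<integral>x. (g x)\<^sup>2 \<partial>M) = (\<integral>x. (f n x)\<^sup>2 \<partial>M)" for n
    using square_sum_expand[OF fg(1) fg(2), of n "-1"] by simp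
  ultimately show ?thesis by (simp add: power2_eq_square)
qed

lemma L2conv_add: "L2conv M f g \<Longrightarrow> L2conv M f' g' \<Longrightarrow> L2conv M (\<lambda>n x. f n x + c * f' n x) (\<lambda>x. g x + c * g' x)"
proof -
  assume a: "L2conv M f g" "L2conv M f' g'"
  then have fg: "f n \<in> L2fn M" "g \<in> L2fn M" "f' n \<in> L2fn M" "g' \<in> L2fn M" for n by (auto simp: L2conv_def)
  have "(\<lambda>n. \<integral>x. (f n x + c * f' n x - (g x + c * g' x))\<^sup>2 \<partial>M) \<longlonglongrightarrow> 0"
  proof (rule tendsto_sandwich[of "\<lambda>_. 0" _ _ "\<lambda>n. 2 * (\<integral>x. (f n x - g x)\<^sup>2 \<partial>M) + 2 * (c\<^sup>2 * (\<integral>x. (f' n x - g' x)\<^sup>2 \<partial>M))"])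
    have "(\<lambda>n. 2 * (\<integral>x. (f n x - g x)\<^sup>2 \<partial>M) + 2 * (c\<^sup>2 * (\<integral>x. (f' n x - g' x)\<^sup>2 \<partial>M))) \<longlonglongrightarrow> 2 * 0 + 2 * (c\<^sup>2 * 0)"
      using a by (intro tendsto_intros) (auto simp: L2conv_def)
    then show "(\<lambda>n. 2 * (\<integral>x. (f n x - g x)\<^sup>2 \<partial>M) + 2 * (c\<^sup>2 * (\<integral>x. (f' n x - g' x)\<^sup>2 \<partial>M))) \<longlonglongrightarrow> 0" by simp
    show "\<forall>\<^sub>F n in sequentially. (\<integral>x. (f n x + c * f' n x - (g x + c * g' x))\<^sup>2 \<partial>M)
        \<le> 2 * (\<integral>x. (f n x - g x)\<^sup>2 \<partial>M) + 2 * (c\<^sup>2 * (\<integral>x. (f' n x - g' x)\<^sup>2 \<partial>M))"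
    proof (rule always_eventually, rule allI)
      fix n
      have "(\<integral>x. (f n x + c * f' n x - (g x + c * g' x))\<^sup>2 \<partial>M)
        = (\<integral>x. ((f n x - g x) - (- c * (f' n x - g' x)))\<^sup>2 \<partial>M)"
        by (simp add: algebra_simps)
      also have "\<dots> \<le> 2 * (\<integral>x. ((f n x - g x) - 0)\<^sup>2 \<partial>M) + 2 * (\<integral>x. (0 - (- c * (f' n x - g' x)))\<^sup>2 \<partial>M)"
        using fg by (intro L2fn_triangle[where g="\<lambda>_. 0"] L2fn_diff L2fn_cmult) (auto intro: L2fnI)
      also have "\<dots> = 2 * (\<integral>x. (f n x - g x)\<^sup>2 \<partial>M) + 2 * (c\<^sup>2 * (\<integral>x. (f' n x - g' x)\<^sup>2 \<partial>M))"
        by (simp add: power_mult_distrib)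
      finally show "(\<integral>x. (f n x + c * f' n x - (g x + c * g' x))\<^sup>2 \<partial>M)
        \<le> 2 * (\<integral>x. (f n x - g x)\<^sup>2 \<partial>M) + 2 * (c\<^sup>2 * (\<integral>x. (f' n x - g' x)\<^sup>2 \<partial>M))" .
    qed
  qed auto
  then show ?thesis using fg by (auto simp: L2conv_def intro!: L2fn_add L2fn_cmult)
qed

section \<open>Completeness of L^2 and density by orthogonal projection\<close>

text \<open>The pointwise core of completeness: increments of size sqrt H 2^-j sum to a tail of at
  most 2 sqrt H 2^-j, whose square is 4 H / 4^j.\<close>

lemma rapidly_Cauchy_limit:
  fixes a :: "nat \<Rightarrow> real"
  assumes "\<And>j. (a (Suc j) - a j)\<^sup>2 \<le> H / 4 ^ j" "0 \<le> H"
  shows "a \<longlonglongrightarrow> lim a" "(a j - lim a)\<^sup>2 \<le> 4 * H / 4 ^ j"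
proof -
  have d: "\<bar>a (Suc j) - a j\<bar> \<le> sqrt H * (1/2) ^ j" for j
  proof -
    have "\<bar>a (Suc j) - a j\<bar> \<le> sqrt (H / 4 ^ j)"
      using assms(1)[of j] by (metis real_sqrt_abs real_sqrt_le_iff)
    also have "\<dots> = sqrt H * (1/2) ^ j"
      by (simp add: real_sqrt_divide real_sqrt_power power_divide)
    finally show ?thesis .
  qed
  have s: "\<bar>a (j + k) - a j\<bar> \<le> sqrt H * (2 * (1/2) ^ j - 2 * (1/2) ^ (j + k))" for j k
  proof (induction k)
    case (Suc k)
    have "\<bar>a (j + Suc k) - a j\<bar> \<le> \<bar>a (Suc (j + k)) - a (j + k)\<bar> + \<bar>a (j + k) - a j\<bar>" by simp
    also have "\<dots> \<le> sqrt H * (1/2) ^ (j + k) + sqrt H * (2 * (1/2) ^ j - 2 * (1/2) ^ (j + k))"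
      using d Suc by (intro add_mono)
    finally show ?case by (simp add: algebra_simps)
  qed simp
  have s2: "\<bar>a n - a j\<bar> \<le> sqrt H * 2 * (1/2) ^ j" if "j \<le> n" for n j
  proof -
    have "\<bar>a n - a j\<bar> \<le> sqrt H * (2 * (1/2) ^ j - 2 * (1/2) ^ n)" using s[of j "n - j"] that by simp
    also have "\<dots> \<le> sqrt H * (2 * (1/2) ^ j)" using assms(2) by (intro mult_left_mono) auto
    finally show ?thesis by simp
  qed
  have "(\<lambda>j. sqrt H * 2 * (1/2) ^ j) \<longlonglongrightarrow> sqrt H * 2 * 0"
    by (intro tendsto_intros LIMSEQ_realpow_zero) auto
  then have z: "(\<lambda>j. sqrt H * 2 * (1/2) ^ j) \<longlonglongrightarrow> 0" by simp
  have "Cauchy a"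
  proof (rule metric_CauchyI)
    fix e :: real assume "e > 0"
    then obtain N where N: "\<bar>sqrt H * 2 * (1/2) ^ N\<bar> < e / 2"
      using LIMSEQ_D[OF z, of "e / 2"] by auto
    have "dist (a m) (a n) < e" if "m \<ge> N" "n \<ge> N" for m n
      using s2[OF that(1)] s2[OF that(2)] N unfolding dist_real_def by linarith
    then show "\<exists>N. \<forall>m\<ge>N. \<forall>n\<ge>N. dist (a m) (a n) < e" by blast
  qed
  then show l: "a \<longlonglongrightarrow> lim a" by (simp add: Cauchy_convergent convergent_LIMSEQ_iff[symmetric])
  have "\<bar>lim a - a j\<bar> \<le> sqrt H * 2 * (1/2) ^ j"
    by (rule LIMSEQ_le_const2[of "\<lambda>n. \<bar>a n - a j\<bar>"]) (use s2 l in \<open>auto intro!: tendsto_intros\<close>)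
  then have "\<bar>a j - lim a\<bar>\<^sup>2 \<le> (sqrt H * 2 * (1/2) ^ j)\<^sup>2"
    by (intro power_mono) (simp_all add: abs_minus_commute)
  then show "(a j - lim a)\<^sup>2 \<le> 4 * H / 4 ^ j"
    using assms(2) by (simp add: power_mult_distrib power_divide power_mult[symmetric] mult.commute[of _ 2] power_mult)
qed

text \<open>Riesz-Fischer: a subsequence with rapidly decreasing increments converges almost
  everywhere and in L^2 to the same limit, and the Cauchy property carries the L^2 convergence over
  to the full sequence.\<close>

theorem L2fn_complete:
  assumes f: "\<And>n. f n \<in> L2fn M"
    and C: "\<And>e. e > 0 \<Longrightarrow> \<exists>N. \<forall>m\<ge>N. \<forall>n\<ge>N. (\<integral>x. (f m x - f n x)\<^sup>2 \<partial>M) < e"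
  shows "\<exists>g. L2conv M f g"
proof -
  have "\<forall>j. \<exists>N. \<forall>m\<ge>N. \<forall>n\<ge>N. (\<integral>x. (f m x - f n x)\<^sup>2 \<partial>M) < 1 / 8 ^ j"
    using C by simp
  then obtain N where N: "\<And>j m n. m \<ge> N j \<Longrightarrow> n \<ge> N j \<Longrightarrow> (\<integral>x. (f m x - f n x)\<^sup>2 \<partial>M) < 1 / 8 ^ j"
    by metis
  \<comment> \<open>Partial sums of the thresholds are increasing and at least \<open>N j\<close>,
    so both \<open>r j\<close> and \<open>r (Suc j)\<close> lie beyond \<open>N j\<close>.\<close>
  define r where "r j = (\<Sum>i\<le>j. N i)" for j
  have rN: "r j \<ge> N j" "r (Suc j) \<ge> r j" for j by (auto simp: r_def intro: member_le_sum)
  define d where "d j x = (f (r (Suc j)) x - f (r j) x)\<^sup>2" for j x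
  have di: "integrable M (d j)" for j unfolding d_def using f by (intro L2fn_square L2fn_diff)
  have dm: "d j \<in> borel_measurable M" for j using di by auto
  have dn: "d j x \<ge> 0" for j x by (simp add: d_def)
  have db: "(\<integral>x. d j x \<partial>M) \<le> 1 / 8 ^ j" for j
    unfolding d_def using N[of j "r (Suc j)" "r j"] rN[of j] by simp
  \<comment> \<open>The weight 4^j against integrals of at most 8^-j leaves the summable 2^-j.
    Finiteness of \<open>H\<close> bounds all increments at once, with the decay 4^-j that the
    pointwise limit needs.\<close>
  define H where "H x = (\<Sum>j. ennreal (4 ^ j * d j x))" for x
  have Hm: "H \<in> borel_measurable M" unfolding H_def using dm by measurable
  have "(\<integral>\<^sup>+x. H x \<partial>M) = (\<Sum>j. \<integral>\<^sup>+x. ennreal (4 ^ j * d j x) \<partial>M)"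
    unfolding H_def using dm by (intro nn_integral_suminf) measurable
  also have "\<dots> = (\<Sum>j. ennreal (4 ^ j * (\<integral>x. d j x \<partial>M)))"
    using di dn by (simp add: nn_integral_eq_integral)
  also have "\<dots> \<le> (\<Sum>j. ennreal ((1/2) ^ j))"
  proof (intro suminf_le ennreal_leI)
    fix j
    have "4 ^ j * (\<integral>x. d j x \<partial>M) \<le> 4 ^ j * (1 / 8 ^ j)" using db by (intro mult_left_mono) auto
    also have "\<dots> = (1/2) ^ j" by (simp add: power_divide[symmetric] power_mult_distrib[symmetric] flip: power_divide)
    finally show "4 ^ j * (\<integral>x. d j x \<partial>M) \<le> (1/2) ^ j" .
  qed auto
  also have "\<dots> = ennreal (\<Sum>j. (1/2) ^ j)"
    by (intro suminf_ennreal2) (auto simp: summable_geometric_iff)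
  finally have Hfin: "(\<integral>\<^sup>+x. H x \<partial>M) < \<infinity>" by (simp add: le_less_trans)
  then have AEH: "AE x in M. H x \<noteq> \<infinity>" using Hm by (intro nn_integral_PInf_AE) auto
  define h where "h x = enn2real (H x)" for x
  have hm: "h \<in> borel_measurable M" unfolding h_def using Hm by measurable
  have hi: "integrable M h"
  proof (rule integrableI_bounded)
    have "(\<integral>\<^sup>+x. ennreal (norm (h x)) \<partial>M) = (\<integral>\<^sup>+x. H x \<partial>M)"
      by (rule nn_integral_cong_AE) (use AEH in \<open>auto simp: h_def ennreal_enn2real_if\<close>)
    then show "(\<integral>\<^sup>+x. ennreal (norm (h x)) \<partial>M) < \<infinity>" using Hfin by simp
  qed (use hm in auto)
  have hpos: "h x \<ge> 0" for x by (simp add: h_def)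
  have bnd: "AE x in M. \<forall>j. (f (r (Suc j)) x - f (r j) x)\<^sup>2 \<le> h x / 4 ^ j"
    using AEH
  proof eventually_elim
    case (elim x)
    show ?case
    proof
      fix j
      have "ennreal (4 ^ j * d j x) = (\<Sum>i\<in>{j}. ennreal (4 ^ i * d i x))" by simp
      also have "\<dots> \<le> H x" unfolding H_def by (intro sum_le_suminf) auto
      also have "\<dots> = ennreal (h x)" using elim by (simp add: h_def ennreal_enn2real_if)
      finally have "4 ^ j * d j x \<le> h x" using hpos by simp
      then show "(f (r (Suc j)) x - f (r j) x)\<^sup>2 \<le> h x / 4 ^ j" by (simp add: d_def field_simps)
    qed
  qed
  define g where "g x = lim (\<lambda>j. f (r j) x)" for x
  have gm: "g \<in> borel_measurable M" unfolding g_def by (intro borel_measurable_lim_metric L2fn_measurable f)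
  have lim: "AE x in M. \<forall>j. (f (r j) x - g x)\<^sup>2 \<le> 4 * h x / 4 ^ j"
    using bnd
  proof eventually_elim
    case (elim x)
    show ?case unfolding g_def
      by (intro allI rapidly_Cauchy_limit(2)[of "\<lambda>j. f (r j) x"]) (use elim hpos in auto)
  qed
  have diffL: "(\<lambda>x. f (r j) x - g x) \<in> L2fn M" "(\<integral>x. (f (r j) x - g x)\<^sup>2 \<partial>M) \<le> 4 / 4 ^ j * (\<integral>x. h x \<partial>M)" for j
  proof -
    have m: "(\<lambda>x. f (r j) x - g x) \<in> borel_measurable M" using f gm L2fn_measurable by (intro borel_measurable_diff) auto
    have i: "integrable M (\<lambda>x. 4 / 4 ^ j * h x)" using hi by simp
    have ae: "AE x in M. (f (r j) x - g x)\<^sup>2 \<le> 4 / 4 ^ j * h x" using lim by eventually_elim auto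
    have i2: "integrable M (\<lambda>x. (f (r j) x - g x)\<^sup>2)"
      by (rule Bochner_Integration.integrable_bound[OF i]) (use m ae hpos in \<open>auto elim!: eventually_mono\<close>)
    then show "(\<lambda>x. f (r j) x - g x) \<in> L2fn M" using m by (simp add: L2fn_def)
    have "(\<integral>x. (f (r j) x - g x)\<^sup>2 \<partial>M) \<le> (\<integral>x. 4 / 4 ^ j * h x \<partial>M)"
      by (rule integral_mono_AE[OF i2 i ae])
    then show "(\<integral>x. (f (r j) x - g x)\<^sup>2 \<partial>M) \<le> 4 / 4 ^ j * (\<integral>x. h x \<partial>M)" by simp
  qed
  have gL: "g \<in> L2fn M" using L2fn_diff[OF f diffL(1), of "r 0" 0] by simp
  have "(\<lambda>n. \<integral>x. (f n x - g x)\<^sup>2 \<partial>M) \<longlonglongrightarrow> 0"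
  proof (rule LIMSEQ_I)
    fix e :: real assume e: "e > 0"
    have "(\<lambda>j. 2 * (1/8) ^ j + 2 * (4 * (1/4) ^ j * (\<integral>x. h x \<partial>M))) \<longlonglongrightarrow> 2 * 0 + 2 * (4 * 0 * (\<integral>x. h x \<partial>M))"
      by (intro tendsto_intros LIMSEQ_realpow_zero) auto
    then have "\<forall>\<^sub>F j in sequentially. 2 * (1/8) ^ j + 2 * (4 * (1/4) ^ j * (\<integral>x. h x \<partial>M)) < e"
      using e by (intro order_tendstoD) auto
    then obtain j where j: "2 * (1/8) ^ j + 2 * (4 * (1/4) ^ j * (\<integral>x. h x \<partial>M)) < e"
      using eventually_happens by fastforce
    have "norm ((\<integral>x. (f n x - g x)\<^sup>2 \<partial>M) - 0) < e" if "n \<ge> N j" for n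
    proof -
      have "(\<integral>x. (f n x - g x)\<^sup>2 \<partial>M) \<le> 2 * (\<integral>x. (f n x - f (r j) x)\<^sup>2 \<partial>M) + 2 * (\<integral>x. (f (r j) x - g x)\<^sup>2 \<partial>M)"
        by (rule L2fn_triangle[OF f f gL])
      also have "\<dots> \<le> 2 * (1 / 8 ^ j) + 2 * (4 / 4 ^ j * (\<integral>x. h x \<partial>M))"
        using N[OF that rN(1)] diffL(2)[of j] by (intro add_mono) auto
      finally show ?thesis using j by (simp add: power_divide)
    qed
    then show "\<exists>no. \<forall>n\<ge>no. norm ((\<integral>x. (f n x - g x)\<^sup>2 \<partial>M) - 0) < e" by blast
  qed
  then show ?thesis using f gL by (auto simp: L2conv_def)
qed

text \<open>A minimizing sequence for the distance from \<open>u\<close> to \<open>A\<close>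
  converges, and the remaining error is orthogonal to \<open>A\<close>, hence zero by
  totality.\<close>

theorem L2fn_dense:
  assumes A: "A \<subseteq> L2fn M" "A \<noteq> {}"
    and add: "\<And>f g c. f \<in> A \<Longrightarrow> g \<in> A \<Longrightarrow> (\<lambda>x. f x + c * g x) \<in> A"
    and total: "\<And>h. h \<in> L2fn M \<Longrightarrow> (\<And>f. f \<in> A \<Longrightarrow> (\<integral>x. h x * f x \<partial>M) = 0) \<Longrightarrow> AE x in M. h x = 0"
    and u: "u \<in> L2fn M"
  shows "\<exists>f. (\<forall>n. f n \<in> A) \<and> L2conv M f u"
proof -
  define E where "E f = (\<integral>x. (f x - u x)\<^sup>2 \<partial>M)" for f
  define d where "d = Inf (E ` A)"
  have E0: "E f \<ge> 0" for f by (simp add: E_def)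
  have bdd: "bdd_below (E ` A)" using E0 by (intro bdd_belowI[of _ 0]) auto
  have dE: "d \<le> E f" if "f \<in> A" for f unfolding d_def using bdd that by (intro cInf_lower) auto
  have "\<forall>n. \<exists>f\<in>A. E f < d + 1 / real (Suc n)"
  proof
    fix n
    have "\<exists>y\<in>E ` A. y < d + 1 / real (Suc n)"
      unfolding d_def using A(2) bdd by (intro cInf_lessD) auto
    then show "\<exists>f\<in>A. E f < d + 1 / real (Suc n)" by blast
  qed
  then obtain f where f: "\<And>n. f n \<in> A" "\<And>n. E (f n) < d + 1 / real (Suc n)" by metis
  have fL: "f n \<in> L2fn M" for n using f A by blast
  have par: "(\<integral>x. (f m x - f n x)\<^sup>2 \<partial>M) \<le> 2 / real (Suc m) + 2 / real (Suc n)" for m n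
  proof -
    \<comment> \<open>\<open>A\<close> is only known to be closed under f + c g; the midpoint is
      reached by halving \<open>f m\<close> first.\<close>
    have half: "(\<lambda>x. (1/2) * f m x + (1/2) * f n x) \<in> A"
    proof -
      have "(\<lambda>x. f m x + (- 1/2) * f m x) \<in> A" by (rule add[OF f(1) f(1)])
      then have "(\<lambda>x. (f m x + (- 1/2) * f m x) + (1/2) * f n x) \<in> A" by (rule add[OF _ f(1)])
      moreover have "(\<lambda>x. (f m x + (- 1/2) * f m x) + (1/2) * f n x) = (\<lambda>x. (1/2) * f m x + (1/2) * f n x)" by (auto simp: fun_eq_iff)
      ultimately show ?thesis by simp
    qed
    have hL: "(\<lambda>x. (1/2) * f m x + (1/2) * f n x) \<in> L2fn M" using half A by blast
    \<comment> \<open>Parallelogram identity: the energy of the midpoint is at least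
      \<open>d\<close>, while the energies of both ends are close to \<open>d\<close>.\<close>
    have "(\<integral>x. (f m x - f n x)\<^sup>2 \<partial>M)
      = (\<integral>x. 2 * (f m x - u x)\<^sup>2 + 2 * (f n x - u x)\<^sup>2 - 4 * (((1/2) * f m x + (1/2) * f n x) - u x)\<^sup>2 \<partial>M)"
      by (intro Bochner_Integration.integral_cong refl) (simp add: power2_eq_square algebra_simps)
    also have "\<dots> = 2 * E (f m) + 2 * E (f n) - 4 * E (\<lambda>x. (1/2) * f m x + (1/2) * f n x)"
      unfolding E_def using L2fn_square[OF L2fn_diff[OF fL u]] L2fn_square[OF L2fn_diff[OF hL u]] by simp
    also have "\<dots> \<le> 2 * (d + 1 / real (Suc m)) + 2 * (d + 1 / real (Suc n)) - 4 * d"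
    proof -
      have arith: "a < d + x \<Longrightarrow> b < d + y \<Longrightarrow> d \<le> c \<Longrightarrow> 2 * a + 2 * b - 4 * c \<le> 2 * (d + x) + 2 * (d + y) - 4 * d"
        for a b c d x y :: real by argo
      show ?thesis by (rule arith[OF f(2) f(2) dE[OF half]])
    qed
    finally show ?thesis by (simp add: algebra_simps)
  qed
  have "\<exists>g. L2conv M f g"
  proof (rule L2fn_complete[OF fL])
    fix e :: real assume "e > 0"
    then obtain N where N: "1 / real (Suc N) < e / 4" using nat_approx_posE[of "e/4"] by auto
    have "(\<integral>x. (f m x - f n x)\<^sup>2 \<partial>M) < e" if "m \<ge> N" "n \<ge> N" for m n
    proof -
      have "1 / real (Suc m) \<le> 1 / real (Suc N)" "1 / real (Suc n) \<le> 1 / real (Suc N)"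
        using that by (auto intro!: divide_left_mono)
      then show ?thesis using par[of m n] N by simp
    qed
    then show "\<exists>N. \<forall>m\<ge>N. \<forall>n\<ge>N. (\<integral>x. (f m x - f n x)\<^sup>2 \<partial>M) < e" by blast
  qed
  then obtain g where g: "L2conv M f g" by blast
  then have gL: "g \<in> L2fn M" by (simp add: L2conv_def)
  let ?h = "\<lambda>x. g x - u x"
  have hL: "?h \<in> L2fn M" using gL u by (intro L2fn_diff)
  have u1: "L2conv M (\<lambda>n. u) u" using u by (simp add: L2conv_def)
  have const: "L2conv M (\<lambda>n. p) p" if "p \<in> L2fn M" for p using that by (simp add: L2conv_def)
  have lim: "(\<lambda>n. E (\<lambda>x. f n x + t * p x)) \<longlonglongrightarrow> (\<integral>x. (?h x + t * p x)\<^sup>2 \<partial>M)" if "p \<in> L2fn M" for p t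
  proof -
    have "L2conv M (\<lambda>n x. (f n x + (-1) * u x) + t * p x) (\<lambda>x. (g x + (-1) * u x) + t * p x)"
      by (intro L2conv_add g u1 const that)
    from L2conv_square[OF this] show ?thesis unfolding E_def by (simp add: algebra_simps)
  qed
  have lim0: "(\<lambda>n. E (f n)) \<longlonglongrightarrow> (\<integral>x. (?h x)\<^sup>2 \<partial>M)" using lim[OF u, of 0] by simp
  have "(\<lambda>n. d + 1 / real (Suc n)) \<longlonglongrightarrow> d + 0"
    using LIMSEQ_inverse_real_of_nat by (intro tendsto_intros) (simp add: inverse_eq_divide)
  then have "(\<integral>x. (?h x)\<^sup>2 \<partial>M) \<le> d + 0"
    by (rule LIMSEQ_le[OF lim0]) (use f(2) less_imp_le in blast)
  then have hd: "(\<integral>x. (?h x)\<^sup>2 \<partial>M) \<le> d" by simp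
  have "AE x in M. ?h x = 0"
  proof (rule total[OF hL])
    fix p assume p: "p \<in> A"
    then have pL: "p \<in> L2fn M" using A by blast
    \<comment> \<open>The error has energy at most \<open>d\<close>, its perturbation by t p is a
      limit of competitors and has energy at least \<open>d\<close>. The resulting quadratic in t
      has no constant term, so its linear term must vanish.\<close>
    have "0 \<le> 0 + 2 * t * (\<integral>x. ?h x * p x \<partial>M) + t\<^sup>2 * (\<integral>x. (p x)\<^sup>2 \<partial>M)" for t
    proof -
      have "d \<le> (\<integral>x. (?h x + t * p x)\<^sup>2 \<partial>M)"
        by (rule LIMSEQ_le_const[OF lim[OF pL]]) (use dE add[OF f(1) p] in blast)
      then show ?thesis using hd square_sum_expand[OF hL pL, of t] by linarith
    qed
    then have "(\<integral>x. ?h x * p x \<partial>M)\<^sup>2 \<le> 0 * (\<integral>x. (p x)\<^sup>2 \<partial>M)"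
      by (rule nonneg_quadratic_discriminant) auto
    then show "(\<integral>x. ?h x * p x \<partial>M) = 0" by simp
  qed
  then have "(\<integral>x. (?h x)\<^sup>2 \<partial>M) = 0" by (intro integral_eq_zero_AE) auto
  then have "L2conv M f u" using lim0 fL u by (simp add: L2conv_def E_def)
  then show ?thesis using f by blast
qed

section \<open>Calculus in stereographic coordinates\<close>

lemma omega_pos [simp]: "omega x > 0"
  unfolding omega_def by (intro divide_pos_pos) (auto intro: add_pos_nonneg)

lemma omega_nonneg [simp]: "omega x \<ge> 0" using omega_pos[of x] by linarith

lemma omega_nonzero [simp]: "omega x \<noteq> 0" using omega_pos[of x] by linarith

text \<open>The equation of the unit sphere in these coordinates. It eliminates |x|^2, so that the
  identities below become polynomial in \<open>omega\<close> and \<open>xi\<close>.\<close>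

lemma omega_norm: "omega x * (norm x)\<^sup>2 = 2 - omega x"
proof -
  have "1 + (norm x)\<^sup>2 > 0" by (intro add_pos_nonneg) auto
  then show ?thesis by (simp add: omega_def field_simps)
qed

lemma omega_le_2: "omega x \<le> 2"
  using omega_norm[of x] mult_nonneg_nonneg[of "omega x" "(norm x)\<^sup>2"] by simp

lemma omega_has_derivative: "(omega has_derivative (\<lambda>h. - (omega x)\<^sup>2 * (x \<bullet> h))) (at x)"
proof -
  have n: "1 + x \<bullet> x \<noteq> 0" using inner_ge_zero[of x] by linarith
  have "((\<lambda>x. 2 / (1 + x \<bullet> x)) has_derivative (\<lambda>h. - (2 / (1 + x \<bullet> x))\<^sup>2 * (x \<bullet> h))) (at x)"
    using n by (auto intro!: derivative_eq_intros simp: field_simps power2_eq_square inner_commute fun_eq_iff)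
  then show ?thesis by (simp add: omega_def[abs_def] power2_norm_eq_inner)
qed

text \<open>The component of \<open>stereo x\<close> along a horizontal direction \<open>b\<close>;
  the vertical component is \<open>omega x - 1\<close>.\<close>

definition xi :: "real^4 \<Rightarrow> real^4 \<Rightarrow> real" where "xi b x = omega x * (x \<bullet> b)"

lemma omega_partial: "partial b omega x = - omega x * xi b x"
  by (rule partial_eqI[OF omega_has_derivative, THEN trans]) (simp add: xi_def power2_eq_square)

lemma omega_differentiable: "omega differentiable (at x)"
  using omega_has_derivative differentiable_def by blast

lemma xi_differentiable: "xi b differentiable (at x)"
  unfolding xi_def[abs_def]
  by (intro differentiable_mult omega_differentiable) (rule smooth_differentiable[OF smooth_inner])

lemma xi_partial: "partial c (xi b) x = omega x * (c \<bullet> b) - xi c x * xi b x"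
  unfolding xi_def[of b, abs_def]
  by (subst partial_mult) (auto simp: omega_differentiable omega_partial xi_def smooth_differentiable smooth_inner)

lemma sum_xi_mult: "(\<Sum>b\<in>Basis. xi b x * (b \<bullet> v)) = xi v x"
proof -
  have "(\<Sum>b\<in>Basis. xi b x * (b \<bullet> v)) = omega x * (\<Sum>b\<in>Basis. (x \<bullet> b) * (v \<bullet> b))"
    by (simp add: xi_def sum_distrib_left mult.assoc inner_commute)
  also have "\<dots> = xi v x" by (simp add: xi_def euclidean_inner[symmetric])
  finally show ?thesis .
qed

lemma sum_xi_square: "(\<Sum>b\<in>Basis. xi b x * xi b x) = omega x * (2 - omega x)"
proof -
  have "(\<Sum>b\<in>Basis. xi b x * xi b x) = (omega x)\<^sup>2 * (\<Sum>b\<in>Basis. (x \<bullet> b) * (x \<bullet> b))"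
    by (simp add: xi_def sum_distrib_left power2_eq_square mult_ac)
  also have "\<dots> = omega x * (omega x * (norm x)\<^sup>2)"
    by (simp add: euclidean_inner[symmetric] power2_eq_square norm_eq_sqrt_inner)
  finally show ?thesis by (simp add: omega_norm)
qed

text \<open>As omega |x|^2 is at most 2, one factor omega survives in xi^2. This is what gives
  \<open>xi\<close> the weight one among the symbols below.\<close>

lemma abs_xi_le: "\<bar>xi b x\<bar> \<le> sqrt 2 * norm b * sqrt (omega x)"
proof -
  have "(xi b x)\<^sup>2 \<le> (omega x * norm x * norm b)\<^sup>2"
    unfolding xi_def power_mult_distrib
    using Cauchy_Schwarz_ineq[of x b] by (simp add: mult.assoc power2_norm_eq_inner mult_left_mono)
  also have "\<dots> = omega x * (omega x * (norm x)\<^sup>2) * (norm b)\<^sup>2" by (simp add: power2_eq_square mult_ac)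
  also have "\<dots> \<le> omega x * 2 * (norm b)\<^sup>2"
    unfolding omega_norm by (intro mult_right_mono mult_left_mono) auto
  finally have "sqrt ((xi b x)\<^sup>2) \<le> sqrt (omega x * 2 * (norm b)\<^sup>2)" by (rule real_sqrt_le_mono)
  then show ?thesis by (simp add: real_sqrt_mult mult_ac)
qed

subsection \<open>Symbols\<close>

text \<open>Families of functions depending on a cutoff parameter \<open>k\<close>; a symbol of weight \<open>n\<close> is
  of size \<open>\<omega>\<^sup>n\<^sup>/\<^sup>2\<close>, uniformly in \<open>k\<close>, and each derivative raises the weight by one. The cutoffs
  \<open>G (k \<omega>)\<close> keep their weight because \<open>\<partial>\<^sub>b (G (k \<omega>)) = - \<xi>\<^sub>b (\<theta> G) (k \<omega>)\<close> with \<open>\<theta> G s = s G' s\<close>.\<close>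

inductive symb :: "nat \<Rightarrow> (real \<Rightarrow> real^4 \<Rightarrow> real) \<Rightarrow> bool" where
  symb_const: "symb 0 (\<lambda>k x. c)"
| symb_zero: "symb n (\<lambda>k x. 0)"
| symb_xi: "symb 1 (\<lambda>k x. xi b x)"
| symb_omega: "symb 2 (\<lambda>k x. omega x)"
| symb_cut: "cut G \<Longrightarrow> symb 0 (\<lambda>k x. G (k * omega x))"
| symb_add: "symb n f \<Longrightarrow> symb n g \<Longrightarrow> symb n (\<lambda>k x. f k x + g k x)"
| symb_mult: "symb n f \<Longrightarrow> symb m g \<Longrightarrow> symb (n + m) (\<lambda>k x. f k x * g k x)"
| symb_lower: "symb (Suc n) f \<Longrightarrow> symb n f"

lemma cut_DERIV: "cut G \<Longrightarrow> (G has_real_derivative deriv G x) (at x)"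
  by (simp add: cut_def smooth1_DERIV)

lemma cut_omega_partial:
  assumes "cut G"
  shows "partial b (\<lambda>x. G (k * omega x)) x = - xi b x * (k * omega x * deriv G (k * omega x))"
proof -
  have "partial b (\<lambda>x. G (k * omega x)) x = deriv G (k * omega x) * partial b (\<lambda>x. k * omega x) x"
    using assms omega_differentiable
    by (intro partial_compose_real[of G "deriv G (k * omega x)" "\<lambda>x. k * omega x"] cut_DERIV differentiable_mult) auto
  then show ?thesis by (simp add: partial_cmult omega_differentiable omega_partial)
qed

lemma symb_differentiable: "symb n f \<Longrightarrow> f k differentiable (at x)"
proof (induction rule: symb.induct)
  case (symb_cut G)
  have "(G \<circ> (\<lambda>x. k * omega x)) differentiable (at x)"
  proof (rule differentiable_chain_at)
    show "(\<lambda>x. k * omega x) differentiable (at x)"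
      by (intro differentiable_mult omega_differentiable) auto
    show "G differentiable (at (k * omega x))"
      using cut_DERIV[OF symb_cut] real_differentiable_def by blast
  qed
  then show ?case by (simp add: o_def)
qed (auto intro: differentiable_add differentiable_mult simp: xi_differentiable omega_differentiable)

lemma symb_partial: "symb n f \<Longrightarrow> symb (Suc n) (\<lambda>k. partial b (f k))"
proof (induction rule: symb.induct)
  case (symb_xi c)
  have "symb 2 (\<lambda>k x. omega x * (b \<bullet> c) + (-1) * (xi b x * xi c x))"
    using symb_mult[OF symb.symb_omega symb.symb_const[of "b \<bullet> c"]]
      symb_mult[OF symb.symb_const[of "-1"] symb_mult[OF symb.symb_xi symb.symb_xi, of b c]]
    by (intro symb_add) (simp_all add: numeral_2_eq_2)
  moreover have "(\<lambda>k::real. partial b (xi c)) = (\<lambda>k x. omega x * (b \<bullet> c) + (-1) * (xi b x * xi c x))"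
    by (simp add: fun_eq_iff xi_partial)
  ultimately show ?case by (simp only: numeral_2_eq_2 One_nat_def)
next
  case symb_omega
  have "symb (0 + (2 + 1)) (\<lambda>k x. (-1) * (omega x * xi b x))"
    by (intro symb_mult symb.symb_const symb.symb_omega symb.symb_xi)
  moreover have "(\<lambda>k::real. partial b omega) = (\<lambda>k x. (-1) * (omega x * xi b x))"
    by (simp add: fun_eq_iff omega_partial)
  ultimately show ?case by (simp only: numeral_2_eq_2 add_0 One_nat_def add_Suc_right add_Suc add_0_right)
next
  case (symb_cut G)
  have "symb (0 + (1 + 0)) (\<lambda>k x. (-1) * (xi b x * (\<lambda>s. s * deriv G s) (k * omega x)))"
    by (intro symb_mult symb.symb_const symb.symb_cut symb.symb_xi cut_theta symb_cut)
  moreover have "(\<lambda>k x. (-1) * (xi b x * (\<lambda>s. s * deriv G s) (k * omega x))) = (\<lambda>k. partial b (\<lambda>x. G (k * omega x)))"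
    by (simp add: fun_eq_iff cut_omega_partial symb_cut)
  ultimately show ?case by simp
next
  case (symb_add n f g)
  have "(\<lambda>k. partial b (\<lambda>x. f k x + g k x)) = (\<lambda>k x. partial b (f k) x + partial b (g k) x)"
    using symb_differentiable[OF symb_add(1)] symb_differentiable[OF symb_add(2)]
    by (intro ext partial_add)
  then show ?case using symb_add by (simp add: symb.symb_add)
next
  case (symb_mult n f m g)
  have "(\<lambda>k. partial b (\<lambda>x. f k x * g k x)) = (\<lambda>k x. f k x * partial b (g k) x + partial b (f k) x * g k x)"
    using symb_differentiable[OF symb_mult(1)] symb_differentiable[OF symb_mult(2)]
    by (intro ext partial_mult)
  moreover have "symb (Suc (n + m)) (\<lambda>k x. f k x * partial b (g k) x + partial b (f k) x * g k x)"
    using symb.symb_mult[OF symb_mult(1,4)] symb.symb_mult[OF symb_mult(3,2)]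
    by (intro symb_add) auto
  ultimately show ?case by simp
qed (auto intro: symb.intros)

lemma symb_smooth: "symb n f \<Longrightarrow> smooth (f k)"
proof (rule smooth_coinduct[of _ "{f k |n f. symb n f}"])
  fix h b assume "h \<in> {f k |n f. symb n f}"
  then obtain n f where "h = f k" "symb n f" by blast
  then have "partial b h = (\<lambda>k. partial b (f k)) k" "symb (Suc n) (\<lambda>k. partial b (f k))"
    by (simp_all add: symb_partial)
  then show "partial b h \<in> {f k |n f. symb n f}"
    by (intro CollectI exI[of _ "Suc n"] exI[of _ "\<lambda>k. partial b (f k)"]) simp
qed (auto simp: symb_differentiable)

lemma symb_sum: "(\<And>i. i \<in> I \<Longrightarrow> symb n (f i)) \<Longrightarrow> symb n (\<lambda>k x. \<Sum>i\<in>I. f i k x)"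
  by (induction I rule: infinite_finite_induct) (auto intro: symb.intros)

lemma symb_cmult: "symb n f \<Longrightarrow> symb n (\<lambda>k x. c * f k x)"
  using symb_mult[OF symb_const, of n f c] by simp

lemma symb_laplacian: "symb n f \<Longrightarrow> symb (n + 2) (\<lambda>k. laplacian (f k))"
  unfolding laplacian_def[abs_def] using symb_partial[OF symb_partial]
  by (intro symb_sum) (simp add: numeral_2_eq_2)

text \<open>The constants do not depend on \<open>k\<close> because cutoff profiles are bounded on
  the whole line; one estimate then serves all cutoffs.\<close>

lemma symb_bound: "symb n f \<Longrightarrow> \<exists>C\<ge>0. \<forall>k x. \<bar>f k x\<bar> \<le> C * sqrt (omega x) ^ n"
proof (induction rule: symb.induct)
  case (symb_const c)
  then show ?case by (intro exI[of _ "\<bar>c\<bar>"]) auto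
next
  case (symb_zero n)
  show ?case by (intro exI[of _ 0]) auto
next
  case (symb_xi b)
  show ?case using abs_xi_le by (intro exI[of _ "sqrt 2 * norm b"]) auto
next
  case symb_omega
  show ?case by (intro exI[of _ 1]) auto
next
  case (symb_cut G)
  then show ?case using cut_bounded by (metis power_0 mult.right_neutral)
next
  case (symb_add n f g)
  then obtain C D where CD: "C \<ge> 0" "D \<ge> 0" "\<And>k x. \<bar>f k x\<bar> \<le> C * sqrt (omega x) ^ n"
    "\<And>k x. \<bar>g k x\<bar> \<le> D * sqrt (omega x) ^ n" by blast
  have "\<bar>f k x + g k x\<bar> \<le> (C + D) * sqrt (omega x) ^ n" for k x
    using CD(3)[of k x] CD(4)[of k x] by (simp add: distrib_right)
  then show ?case using CD by (intro exI[of _ "C + D"]) auto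
next
  case (symb_mult n f m g)
  then obtain C D where CD: "C \<ge> 0" "D \<ge> 0" "\<And>k x. \<bar>f k x\<bar> \<le> C * sqrt (omega x) ^ n"
    "\<And>k x. \<bar>g k x\<bar> \<le> D * sqrt (omega x) ^ m" by blast
  have "\<bar>f k x * g k x\<bar> \<le> (C * D) * sqrt (omega x) ^ (n + m)" for k x
  proof -
    have "\<bar>f k x * g k x\<bar> \<le> (C * sqrt (omega x) ^ n) * (D * sqrt (omega x) ^ m)"
      unfolding abs_mult using CD by (intro mult_mono) auto
    then show ?thesis by (simp add: power_add mult_ac)
  qed
  then show ?case using CD by (intro exI[of _ "C * D"]) auto
next
  case (symb_lower n f)
  then obtain C where C: "C \<ge> 0" "\<And>k x. \<bar>f k x\<bar> \<le> C * sqrt (omega x) ^ Suc n" by blast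
  have "\<bar>f k x\<bar> \<le> (C * sqrt 2) * sqrt (omega x) ^ n" for k x
  proof -
    have "C * (sqrt (omega x) * sqrt (omega x) ^ n) \<le> C * (sqrt 2 * sqrt (omega x) ^ n)"
      using C omega_le_2 by (intro mult_left_mono mult_right_mono) auto
    then show ?thesis using C(2)[of k x] by (simp add: mult_ac)
  qed
  then show ?case using C by (intro exI[of _ "C * sqrt 2"]) auto
qed

lemma partial_minus: "f differentiable (at x) \<Longrightarrow> partial b (\<lambda>x. - f x) x = - partial b f x"
  using partial_cmult[of f x b "-1"] by simp

lemma partial_partial_mult:
  assumes "smooth f" "smooth g" "b \<in> Basis"
  shows "partial a (partial b (\<lambda>x. f x * g x)) x = f x * partial a (partial b g) x + partial a (partial b f) x * g x
    + (partial a f x * partial b g x + partial b f x * partial a g x)"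
proof -
  have "partial b (\<lambda>x. f x * g x) = (\<lambda>x. f x * partial b g x + partial b f x * g x)"
    using assms by (intro ext partial_mult smooth_differentiable)
  then show ?thesis
    using assms by (simp add: partial_add partial_mult smooth_differentiable smooth_partial smooth_mult)
qed

lemma partial_partial_add:
  assumes "smooth f" "smooth g" "b \<in> Basis"
  shows "partial a (partial b (\<lambda>x. f x + g x)) x = partial a (partial b f) x + partial a (partial b g) x"
proof -
  have "partial b (\<lambda>x. f x + g x) = (\<lambda>x. partial b f x + partial b g x)"
    using assms by (intro ext partial_add smooth_differentiable)
  then show ?thesis
    using assms by (simp add: partial_add smooth_differentiable smooth_partial)
qed

lemma omega_smooth: "smooth omega" using symb_smooth[OF symb_omega] .
lemma xi_smooth: "smooth (xi b)" using symb_smooth[OF symb_xi] .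

text \<open>Equality of mixed derivatives by induction on symbols: explicit for the generators,
  inherited by sums and products through the Leibniz rule of second order.\<close>

lemma symb_partial_commute:
  assumes "symb n f" "a \<in> Basis" "b \<in> Basis"
  shows "partial a (partial b (f k)) x = partial b (partial a (f k)) x"
  using assms(1)
proof (induction arbitrary: x rule: symb.induct)
  case (symb_xi c)
  have "partial b (xi c) = (\<lambda>x. omega x * (b \<bullet> c) + (-1) * (xi b x * xi c x))" for b
    by (simp add: fun_eq_iff xi_partial)
  then show ?case
    by (simp add: partial_add partial_mult partial_diff partial_cmult smooth_differentiable smooth_mult smooth_add
        smooth_const omega_smooth xi_smooth omega_partial xi_partial inner_commute algebra_simps)
next
  case symb_omega
  have "partial b omega = (\<lambda>x. (-1) * (omega x * xi b x))" for b
    by (simp add: fun_eq_iff omega_partial)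
  then show ?case
    by (simp add: partial_mult partial_minus smooth_differentiable smooth_mult
        omega_smooth xi_smooth omega_partial xi_partial inner_commute algebra_simps)
next
  case (symb_cut G)
  let ?H = "\<lambda>s. s * deriv G s"
  have H: "cut ?H" using cut_theta[OF symb_cut] .
  have sH: "smooth (\<lambda>x. ?H (k * omega x))" using symb_smooth[OF symb.symb_cut[OF H], of k] by simp
  have p: "partial b (\<lambda>x. G (k * omega x)) = (\<lambda>x. (-1) * (xi b x * ?H (k * omega x)))" for b
    using cut_omega_partial[OF symb_cut] by (simp add: fun_eq_iff)
  have q: "partial a (\<lambda>x. (-1) * (xi b x * ?H (k * omega x))) x
      = (-1) * (xi b x * partial a (\<lambda>x. ?H (k * omega x)) x + (omega x * (a \<bullet> b) - xi a x * xi b x) * ?H (k * omega x))" for a b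
    by (subst partial_cmult, rule smooth_differentiable[OF smooth_mult[OF xi_smooth sH]],
        subst partial_mult[OF smooth_differentiable[OF xi_smooth] smooth_differentiable[OF sH]])
       (simp add: xi_partial)
  show ?case unfolding p q cut_omega_partial[OF H] by (simp add: inner_commute algebra_simps)
next
  case (symb_add n f g)
  then show ?case using assms symb_smooth[OF symb_add(1)] symb_smooth[OF symb_add(2)]
    by (simp add: partial_partial_add)
next
  case (symb_mult n f m g)
  then show ?case using assms symb_smooth[OF symb_mult(1)] symb_smooth[OF symb_mult(2)]
    by (simp add: partial_partial_mult)
qed auto

lemma symb_partial_laplacian:
  assumes "symb n f" "b \<in> Basis"
  shows "laplacian (partial b (f k)) x = partial b (laplacian (f k)) x"
proof -
  have "partial b (laplacian (f k)) x = (\<Sum>c\<in>Basis. partial b (partial c (partial c (f k))) x)"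
    unfolding laplacian_def[abs_def]
    by (rule partial_sum) (use symb_smooth[OF assms(1)] in \<open>auto intro: smooth_differentiable smooth_partial\<close>)
  also have "\<dots> = (\<Sum>c\<in>Basis. partial c (partial c (partial b (f k))) x)"
  proof (rule sum.cong[OF refl])
    fix c :: "real^4" assume c: "c \<in> Basis"
    have "partial b (partial c (f k)) = partial c (partial b (f k))"
      by (intro ext symb_partial_commute[OF assms(1)] assms c)
    moreover have "partial b (partial c (partial c (f k))) x = partial c (partial b (partial c (f k))) x"
      by (rule symb_partial_commute[OF symb_partial[OF assms(1)]]) (use assms c in auto)
    ultimately show "partial b (partial c (partial c (f k))) x = partial c (partial c (partial b (f k))) x" by simp
  qed
  finally show ?thesis by (simp add: laplacian_def)
qed

subsection \<open>The spherical Laplacian in stereographic coordinates\<close>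

text \<open>The Laplace-Beltrami operator of the round metric omega^2 |dx|^2 in dimension four,
  omega^-4 div (omega^2 grad f), expanded with grad omega = - omega xi.\<close>

definition Lop :: "(real^4 \<Rightarrow> real) \<Rightarrow> real^4 \<Rightarrow> real" where
  "Lop f x = (laplacian f x - 2 * (\<Sum>b\<in>Basis. xi b x * partial b f x)) / (omega x)\<^sup>2"

text \<open>The product of gradients in the round metric (carre du champ), which is the defect in
  the product rule for \<open>Lop\<close>.\<close>

definition Gam :: "(real^4 \<Rightarrow> real) \<Rightarrow> (real^4 \<Rightarrow> real) \<Rightarrow> real^4 \<Rightarrow> real" where
  "Gam f g x = (\<Sum>b\<in>Basis. partial b f x * partial b g x) / (omega x)\<^sup>2"

lemma laplacian_eq_Lop: "laplacian f x = (omega x)\<^sup>2 * Lop f x + 2 * (\<Sum>b\<in>Basis. xi b x * partial b f x)"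
  by (simp add: Lop_def)

lemma Lop_add: "smooth f \<Longrightarrow> smooth g \<Longrightarrow> Lop (\<lambda>x. f x + g x) x = Lop f x + Lop g x"
  by (simp add: Lop_def laplacian_add partial_add smooth_differentiable sum.distrib distrib_left add_divide_distrib diff_divide_distrib)

lemma Lop_mult:
  assumes "smooth f" "smooth g"
  shows "Lop (\<lambda>x. f x * g x) x = f x * Lop g x + g x * Lop f x + 2 * Gam f g x"
proof -
  have "(\<Sum>b\<in>Basis. xi b x * partial b (\<lambda>x. f x * g x) x)
     = f x * (\<Sum>b\<in>Basis. xi b x * partial b g x) + g x * (\<Sum>b\<in>Basis. xi b x * partial b f x)"
    using assms by (simp add: partial_mult smooth_differentiable sum_distrib_left sum.distrib[symmetric] algebra_simps)
  then show ?thesis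
    using assms by (simp add: Lop_def Gam_def laplacian_mult field_simps)
qed

lemma Lop_const [simp]: "Lop (\<lambda>x. c) x = 0" by (simp add: Lop_def)

lemma Gam_const [simp]: "Gam f (\<lambda>x. c) x = 0" "Gam (\<lambda>x. c) f x = 0" by (simp_all add: Gam_def)

lemma Lop_cmult: "smooth f \<Longrightarrow> Lop (\<lambda>x. c * f x) x = c * Lop f x"
  using Lop_mult[of "\<lambda>_. c" f x] by simp

lemma Lop_diff: "smooth f \<Longrightarrow> smooth g \<Longrightarrow> Lop (\<lambda>x. f x - g x) x = Lop f x - Lop g x"
  using Lop_add[of f "\<lambda>x. -1 * g x" x] Lop_cmult[of g "-1" x] smooth_mult[of "\<lambda>_. -1" g] by simp

lemma Lop_sum: "finite I \<Longrightarrow> (\<And>i. i \<in> I \<Longrightarrow> smooth (f i)) \<Longrightarrow> Lop (\<lambda>x. \<Sum>i\<in>I. f i x) x = (\<Sum>i\<in>I. Lop (f i) x)"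
  by (induction I rule: finite_induct) (auto simp: Lop_add smooth_sum)

lemma Gam_add: "smooth f \<Longrightarrow> smooth g \<Longrightarrow> Gam h (\<lambda>x. f x + g x) x = Gam h f x + Gam h g x"
  by (simp add: Gam_def partial_add smooth_differentiable sum.distrib distrib_left add_divide_distrib)

lemma Gam_mult: "smooth f \<Longrightarrow> smooth g \<Longrightarrow> Gam h (\<lambda>x. f x * g x) x = f x * Gam h g x + g x * Gam h f x"
  by (simp add: Gam_def partial_mult smooth_differentiable sum.distrib sum_distrib_left distrib_left
      add_divide_distrib[symmetric] mult_ac)

lemma omega_square_partial: "partial b (\<lambda>x. (omega x)\<^sup>2) x = - 2 * (omega x)\<^sup>2 * xi b x"
  unfolding power2_eq_square by (simp add: partial_mult omega_differentiable omega_partial)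

text \<open>In this form the symmetry of \<open>Lop\<close> with respect to omega^4 dx becomes
  visible.\<close>

lemma Lop_divergence:
  assumes "smooth f"
  shows "(\<Sum>b\<in>Basis. partial b (\<lambda>x. (omega x)\<^sup>2 * partial b f x) x) = (omega x)^4 * Lop f x"
proof -
  have "(\<Sum>b\<in>Basis. partial b (\<lambda>x. (omega x)\<^sup>2 * partial b f x) x)
     = (\<Sum>b\<in>Basis. (omega x)\<^sup>2 * partial b (partial b f) x - (omega x)\<^sup>2 * (2 * (xi b x * partial b f x)))"
    using assms
    by (intro sum.cong refl) (simp add: partial_mult omega_square_partial smooth_differentiable smooth_partial smooth_power omega_smooth)
  also have "\<dots> = (omega x)\<^sup>2 * (laplacian f x - 2 * (\<Sum>b\<in>Basis. xi b x * partial b f x))"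
    by (simp add: laplacian_def sum_subtractf sum_distrib_left right_diff_distrib)
  also have "\<dots> = (omega x)^4 * Lop f x"
    by (simp add: Lop_def field_simps flip: power_add)
  finally show ?thesis .
qed

lemma laplacian_omega: "laplacian omega x = - 2 * (omega x)^3"
proof -
  have "partial b omega = (\<lambda>x. (-1) * (omega x * xi b x))" for b by (simp add: fun_eq_iff omega_partial)
  then have "laplacian omega x = (\<Sum>b\<in>Basis. 2 * omega x * (xi b x * xi b x) - (omega x)\<^sup>2)"
    unfolding laplacian_def
    by (intro sum.cong refl) (simp add: partial_mult partial_minus smooth_differentiable smooth_mult
        omega_smooth xi_smooth omega_partial xi_partial power2_eq_square algebra_simps)
  also have "\<dots> = 2 * omega x * (omega x * (2 - omega x)) - 4 * (omega x)\<^sup>2"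
    by (simp add: sum_subtractf sum_distrib_left[symmetric] sum_xi_square)
  finally show ?thesis by (simp add: power2_eq_square power3_eq_cube algebra_simps)
qed

text \<open>\<open>omega - 1\<close> is the vertical coordinate of the sphere, an eigenfunction for
  the eigenvalue -4.\<close>

lemma Lop_omega: "Lop omega x = 4 - 4 * omega x"
proof -
  have "(\<Sum>b\<in>Basis. xi b x * partial b omega x) = - omega x * (\<Sum>b\<in>Basis. xi b x * xi b x)"
    by (simp add: omega_partial sum_distrib_left mult_ac)
  then show ?thesis unfolding Lop_def laplacian_omega sum_xi_square
    by (simp add: field_simps power2_eq_square power3_eq_cube)
qed

lemma laplacian_xi: "laplacian (xi v) x = - 2 * (omega x)\<^sup>2 * xi v x - 2 * omega x * xi v x"
proof -
  have "partial b (xi v) = (\<lambda>x. omega x * (b \<bullet> v) + (-1) * (xi b x * xi v x))" for b by (simp add: fun_eq_iff xi_partial)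
  then have "laplacian (xi v) x = (\<Sum>b\<in>Basis. 2 * xi v x * (xi b x * xi b x) - omega x * xi v x - 2 * omega x * (xi b x * (b \<bullet> v)))"
    unfolding laplacian_def
    by (intro sum.cong refl) (simp add: partial_add partial_mult partial_diff partial_cmult smooth_differentiable smooth_mult smooth_add
        omega_smooth xi_smooth omega_partial xi_partial power2_eq_square algebra_simps)
  also have "\<dots> = 2 * xi v x * (omega x * (2 - omega x)) - 4 * omega x * xi v x - 2 * omega x * xi v x"
    by (simp add: sum_subtractf sum_distrib_left[symmetric] sum_xi_square sum_xi_mult)
  finally show ?thesis by (simp add: power2_eq_square algebra_simps)
qed

lemma Lop_xi: "Lop (xi v) x = - 4 * xi v x"
proof -
  have "(\<Sum>b\<in>Basis. xi b x * partial b (xi v) x) = (\<Sum>b\<in>Basis. omega x * (xi b x * (b \<bullet> v)) - xi v x * (xi b x * xi b x))"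
    by (simp add: xi_partial algebra_simps)
  also have "\<dots> = omega x * xi v x - xi v x * (omega x * (2 - omega x))"
    by (simp add: sum_subtractf sum_distrib_left[symmetric] sum_xi_square sum_xi_mult)
  finally show ?thesis unfolding Lop_def laplacian_xi
    by (simp add: field_simps power2_eq_square)
qed

lemma Gam_omega_omega: "Gam omega omega x = omega x * (2 - omega x)"
proof -
  have "(\<Sum>b\<in>Basis. partial b omega x * partial b omega x) = (omega x)\<^sup>2 * (\<Sum>b\<in>Basis. xi b x * xi b x)"
    by (simp add: omega_partial sum_distrib_left power2_eq_square mult_ac)
  then show ?thesis by (simp add: Gam_def sum_xi_square)
qed

lemma Gam_omega_xi: "Gam omega (xi v) x = xi v x * (1 - omega x)"
proof -
  have "(\<Sum>b\<in>Basis. partial b omega x * partial b (xi v) x)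
     = (\<Sum>b\<in>Basis. omega x * xi v x * (xi b x * xi b x) - (omega x)\<^sup>2 * (xi b x * (b \<bullet> v)))"
    by (simp add: omega_partial xi_partial power2_eq_square algebra_simps)
  also have "\<dots> = omega x * xi v x * (omega x * (2 - omega x)) - (omega x)\<^sup>2 * xi v x"
    by (simp add: sum_subtractf sum_distrib_left[symmetric] sum_xi_square sum_xi_mult)
  finally show ?thesis by (simp add: Gam_def field_simps power2_eq_square)
qed

lemma Gam_xi_xi: "Gam (xi v) (xi w) x = v \<bullet> w - xi v x * xi w x"
proof -
  have "(\<Sum>b\<in>Basis. partial b (xi v) x * partial b (xi w) x)
     = (\<Sum>b\<in>Basis. (omega x)\<^sup>2 * ((v \<bullet> b) * (w \<bullet> b)) - omega x * xi w x * (xi b x * (b \<bullet> v)) - omega x * xi v x * (xi b x * (b \<bullet> w))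
        + xi v x * xi w x * (xi b x * xi b x))"
    by (simp add: xi_partial power2_eq_square algebra_simps inner_commute)
  also have "\<dots> = (omega x)\<^sup>2 * (v \<bullet> w) - 2 * omega x * xi v x * xi w x + xi v x * xi w x * (omega x * (2 - omega x))"
    by (simp add: sum_subtractf sum.distrib sum_distrib_left[symmetric] sum_xi_square sum_xi_mult euclidean_inner[symmetric])
  finally show ?thesis by (simp add: Gam_def field_simps power2_eq_square)
qed

lemma Gam_commute: "Gam f g x = Gam g f x"
  by (simp add: Gam_def mult.commute)

text \<open>The Paneitz operator of the sphere: the conformal factor intertwines \<open>\<Delta>\<^sup>2\<close> with \<open>L\<^sup>2 - 2L\<close>.\<close>

lemma bilaplacian_eq_Lop:
  assumes f: "symb n (\<lambda>k. f)" and h: "smooth h" "\<And>x. Lop f x = h x"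
  shows "laplacian (laplacian f) x = (omega x)^4 * (Lop h x - 2 * h x)"
proof -
  \<comment> \<open>The correction terms get names because they all cancel. In the final sum
    \<open>T\<close> occurs with the coefficients 4 and -4, \<open>Dh\<close> with -2 omega^2 and 2
    omega^2, and the coefficients of \<open>D\<close> add up to zero; only \<open>h\<close> and
    \<open>Lop h\<close> remain.\<close>
  define D where "D = (\<lambda>x. \<Sum>b\<in>Basis. xi b x * partial b f x)"
  define Dh where "Dh = (\<Sum>b\<in>Basis. xi b x * partial b h x)"
  define T where "T = (\<Sum>b\<in>Basis. \<Sum>c\<in>Basis. xi b x * xi c x * partial b (partial c f) x)"
  have sf: "smooth f" using symb_smooth[OF f] .
  have sm: "smooth (\<lambda>x. xi b x * partial b f x)" if "b \<in> Basis" for b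
    using sf xi_smooth that by (intro smooth_mult smooth_partial)
  have sD: "smooth D" unfolding D_def by (intro smooth_sum sm)
  have so: "smooth (\<lambda>x. (omega x)\<^sup>2)" by (intro smooth_power omega_smooth)
  have lap: "laplacian f = (\<lambda>x. (omega x)\<^sup>2 * h x + 2 * D x)"
    by (simp add: fun_eq_iff laplacian_eq_Lop h D_def)
  have lo2: "laplacian (\<lambda>x. (omega x)\<^sup>2) x = 4 * (omega x)^3 - 6 * (omega x)^4"
  proof -
    have "(\<Sum>b\<in>Basis. partial b omega x * partial b omega x) = (omega x)\<^sup>2 * (omega x * (2 - omega x))"
      using Gam_omega_omega[of x] by (simp add: Gam_def field_simps)
    then show ?thesis unfolding power2_eq_square
      by (simp add: laplacian_mult omega_smooth laplacian_omega) (simp add: algebra_simps power2_eq_square power3_eq_cube power4_eq_xxxx)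
  qed
  have lh: "laplacian (\<lambda>x. (omega x)\<^sup>2 * h x) x
     = (4 * (omega x)^3 - 6 * (omega x)^4) * h x - 2 * (omega x)\<^sup>2 * Dh + (omega x)^4 * Lop h x"
  proof -
    have "(\<Sum>b\<in>Basis. partial b (\<lambda>x. (omega x)\<^sup>2) x * partial b h x) = - 2 * (omega x)\<^sup>2 * Dh"
      by (simp add: omega_square_partial Dh_def sum_distrib_left mult_ac)
    then have "laplacian (\<lambda>x. (omega x)\<^sup>2 * h x) x = (omega x)\<^sup>2 * laplacian h x
      + h x * (4 * (omega x)^3 - 6 * (omega x)^4) + 2 * (- 2 * (omega x)\<^sup>2 * Dh)"
      by (simp add: laplacian_mult so h lo2)
    then show ?thesis unfolding laplacian_eq_Lop[of h] Dh_def[symmetric]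
      by (simp add: algebra_simps power2_eq_square power4_eq_xxxx)
  qed
  have pD: "partial b D x = omega x * partial b f x - xi b x * D x + (\<Sum>c\<in>Basis. xi c x * partial b (partial c f) x)"
    if b: "b \<in> Basis" for b
  proof -
    have "partial b D x = (\<Sum>c\<in>Basis. partial b (\<lambda>x. xi c x * partial c f x) x)"
      unfolding D_def by (rule partial_sum) (auto intro: smooth_differentiable sm)
    also have "\<dots> = (\<Sum>c\<in>Basis. (if c = b then omega x * partial c f x else 0) - xi b x * (xi c x * partial c f x)
       + xi c x * partial b (partial c f) x)"
      by (intro sum.cong refl)
         (use b sf in \<open>auto simp: partial_mult smooth_differentiable xi_smooth smooth_partial xi_partial inner_Basis algebra_simps\<close>)
    also have "\<dots> = omega x * partial b f x - xi b x * D x + (\<Sum>c\<in>Basis. xi c x * partial b (partial c f) x)"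
      using b by (simp add: sum.distrib sum_subtractf sum_distrib_left D_def)
    finally show ?thesis .
  qed
  have plap: "partial b (laplacian f) x = - 2 * (omega x)\<^sup>2 * xi b x * h x + (omega x)\<^sup>2 * partial b h x + 2 * partial b D x"
    if b: "b \<in> Basis" for b
    unfolding lap by (simp add: partial_add partial_mult partial_cmult smooth_differentiable smooth_mult so sD h omega_square_partial)
  have S1: "(\<Sum>b\<in>Basis. xi b x * partial b D x) = omega x * D x - omega x * (2 - omega x) * D x + T"
  proof -
    have "(\<Sum>b\<in>Basis. xi b x * partial b D x) = (\<Sum>b\<in>Basis. omega x * (xi b x * partial b f x) - D x * (xi b x * xi b x)
        + (\<Sum>c\<in>Basis. xi b x * xi c x * partial b (partial c f) x))"
      by (intro sum.cong refl) (simp add: pD algebra_simps sum_distrib_left)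
    then show ?thesis
      by (simp add: sum.distrib sum_subtractf sum_distrib_left[symmetric] sum_xi_square T_def D_def)
  qed
  have S2: "(\<Sum>b\<in>Basis. xi b x * partial b (laplacian f) x)
     = - 2 * (omega x)\<^sup>2 * (omega x * (2 - omega x)) * h x + (omega x)\<^sup>2 * Dh
       + 2 * (omega x * D x - omega x * (2 - omega x) * D x + T)"
  proof -
    have "(\<Sum>b\<in>Basis. xi b x * partial b (laplacian f) x)
      = (\<Sum>b\<in>Basis. (- 2 * (omega x)\<^sup>2 * h x) * (xi b x * xi b x) + (omega x)\<^sup>2 * (xi b x * partial b h x) + 2 * (xi b x * partial b D x))"
      by (intro sum.cong refl) (simp add: plap algebra_simps)
    also have "\<dots> = (- 2 * (omega x)\<^sup>2 * h x) * (omega x * (2 - omega x)) + (omega x)\<^sup>2 * Dh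
       + 2 * (omega x * D x - omega x * (2 - omega x) * D x + T)"
      unfolding sum.distrib sum_distrib_left[symmetric] sum_xi_square S1 Dh_def by simp
    finally show ?thesis by (simp add: mult_ac)
  qed
  have lD: "laplacian D x = (\<Sum>b\<in>Basis. xi b x * partial b (laplacian f) x)
      + (- 2 * (omega x)\<^sup>2 - 2 * omega x) * D x + 2 * (omega x * laplacian f x - T)"
  proof -
    have "laplacian D x = (\<Sum>b\<in>Basis. laplacian (\<lambda>x. xi b x * partial b f x) x)"
      unfolding D_def using sm
    proof -
      have "laplacian (\<lambda>x. \<Sum>b\<in>I. xi b x * partial b f x) x = (\<Sum>b\<in>I. laplacian (\<lambda>x. xi b x * partial b f x) x)"
        if "finite I" "I \<subseteq> Basis" for I using that
        by (induction I rule: finite_induct) (auto simp: laplacian_add smooth_sum sm subset_iff)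
      then show "laplacian (\<lambda>x. \<Sum>b\<in>Basis. xi b x * partial b f x) x = (\<Sum>b\<in>Basis. laplacian (\<lambda>x. xi b x * partial b f x) x)"
        by simp
    qed
    also have "\<dots> = (\<Sum>b\<in>Basis. xi b x * partial b (laplacian f) x
       + (- 2 * (omega x)\<^sup>2 - 2 * omega x) * (xi b x * partial b f x)
       + 2 * (omega x * partial b (partial b f) x - (\<Sum>c\<in>Basis. xi c x * xi b x * partial c (partial b f) x)))"
    proof (intro sum.cong refl)
      fix b :: "real^4" assume b: "b \<in> Basis"
      have "(\<Sum>c\<in>Basis. partial c (xi b) x * partial c (partial b f) x)
        = (\<Sum>c\<in>Basis. (if c = b then omega x * partial c (partial b f) x else 0) - xi c x * xi b x * partial c (partial b f) x)"
        by (intro sum.cong refl) (use b in \<open>auto simp: xi_partial inner_Basis algebra_simps\<close>)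
      also have "\<dots> = omega x * partial b (partial b f) x - (\<Sum>c\<in>Basis. xi c x * xi b x * partial c (partial b f) x)"
        using b by (simp add: sum_subtractf)
      finally have e: "(\<Sum>c\<in>Basis. partial c (xi b) x * partial c (partial b f) x)
        = omega x * partial b (partial b f) x - (\<Sum>c\<in>Basis. xi c x * xi b x * partial c (partial b f) x)" .
      show "laplacian (\<lambda>x. xi b x * partial b f x) x = xi b x * partial b (laplacian f) x
       + (- 2 * (omega x)\<^sup>2 - 2 * omega x) * (xi b x * partial b f x)
       + 2 * (omega x * partial b (partial b f) x - (\<Sum>c\<in>Basis. xi c x * xi b x * partial c (partial b f) x))"
        using b sf symb_partial_laplacian[OF f b]
        by (simp add: laplacian_mult xi_smooth smooth_partial e laplacian_xi) (simp add: algebra_simps)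
    qed
    also have "\<dots> = (\<Sum>b\<in>Basis. xi b x * partial b (laplacian f) x)
      + (- 2 * (omega x)\<^sup>2 - 2 * omega x) * D x + 2 * (omega x * laplacian f x - T)"
      unfolding sum.distrib sum_distrib_left[symmetric] sum_subtractf D_def T_def laplacian_def
      by (rule arg_cong[of _ _ "\<lambda>t. _ + _ + 2 * (_ - t)"]) (rule sum.swap[THEN trans], simp add: mult.commute)
    finally show ?thesis .
  qed
  have "laplacian (laplacian f) x = laplacian (\<lambda>x. (omega x)\<^sup>2 * h x) x + 2 * laplacian D x"
    unfolding lap[of] by (subst laplacian_add) (simp_all add: smooth_mult so h sD laplacian_cmult)
  moreover have "laplacian f x = (omega x)\<^sup>2 * h x + 2 * D x" using lap by simp
  ultimately show ?thesis unfolding lh lD S2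
    by (simp add: algebra_simps power2_eq_square power3_eq_cube power4_eq_xxxx)
qed

subsection \<open>Polynomials on the sphere\<close>

text \<open>A linear function of the ambient space restricted to the sphere, that is, a spherical
  harmonic of degree one.\<close>

definition sc :: "(real^4) \<times> real \<Rightarrow> real^4 \<Rightarrow> real" where "sc v x = v \<bullet> stereo x"

lemma sc_eq: "sc v x = xi (fst v) x + snd v * (omega x - 1)"
proof -
  have "1 + (norm x)\<^sup>2 > 0" by (intro add_pos_nonneg) auto
  then have "(1 - (norm x)\<^sup>2) / (1 + (norm x)\<^sup>2) = omega x - 1" by (simp add: omega_def field_simps)
  then show ?thesis by (simp add: sc_def stereo_def inner_prod_def xi_def omega_def inner_commute)
qed

lemma sc_alt: "sc v = (\<lambda>x. (xi (fst v) x + snd v * omega x) + (- snd v))"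
  by (simp add: fun_eq_iff sc_eq algebra_simps)

lemma sc_symb: "symb 1 (\<lambda>k x. xi (fst v) x + snd v * omega x)"
  using symb_lower[of 1 "\<lambda>k. omega"] symb_omega by (intro symb_add symb_xi symb_cmult) (simp add: numeral_2_eq_2)

lemma sc_smooth: "smooth (sc v)"
  unfolding sc_alt by (intro smooth_add smooth_mult xi_smooth omega_smooth smooth_const)

lemma Lop_sc: "Lop (sc v) x = - 4 * sc v x"
  unfolding sc_alt using Lop_add[of "\<lambda>x. xi (fst v) x + snd v * omega x" "\<lambda>_. - snd v" x]
    Lop_add[of "xi (fst v)" "\<lambda>x. snd v * omega x" x]
    Lop_cmult[OF omega_smooth, of "snd v" x]
    smooth_add[OF xi_smooth smooth_mult[OF smooth_const omega_smooth], of "fst v" "snd v"]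
    smooth_mult[OF smooth_const omega_smooth, of "snd v"]
  by (simp add: xi_smooth Lop_xi Lop_omega) (simp add: algebra_simps)

text \<open>The gradient of a linear function on the sphere is the tangential projection of its
  vector, so the inner product loses exactly the product of the normal components.\<close>

lemma Gam_sc: "Gam (sc v) (sc w) x = v \<bullet> w - sc v x * sc w x"
proof -
  have e: "Gam h (sc w) x = Gam h (xi (fst w)) x + snd w * Gam h omega x" for h w
    unfolding sc_alt
    by (simp add: Gam_add[OF smooth_add[OF xi_smooth smooth_mult[OF smooth_const omega_smooth]] smooth_const]
        Gam_add[OF xi_smooth smooth_mult[OF smooth_const omega_smooth]] Gam_mult[OF smooth_const omega_smooth]
       del: diff_conv_add_uminus add_uminus_conv_diff)
  show ?thesis
    unfolding e[of "sc v" w] Gam_commute[of "sc v" "xi (fst w)"] Gam_commute[of "sc v" omega] e[of "xi (fst w)" v] e[of omega v]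
      Gam_xi_xi Gam_omega_xi Gam_omega_omega Gam_commute[of "xi (fst w)" omega]
    by (simp add: sc_eq inner_prod_def inner_commute algebra_simps)
qed

text \<open>\<open>spol n f\<close>: \<open>f\<close> is the restriction to the sphere of a polynomial of degree less than \<open>n\<close>.\<close>

inductive spol :: "nat \<Rightarrow> (real^4 \<Rightarrow> real) \<Rightarrow> bool" where
  spol_zero: "spol n (\<lambda>x. 0)"
| spol_const: "spol (Suc n) (\<lambda>x. c)"
| spol_mult_sc: "spol n f \<Longrightarrow> spol (Suc n) (\<lambda>x. sc v x * f x)"
| spol_add: "spol n f \<Longrightarrow> spol n g \<Longrightarrow> spol n (\<lambda>x. f x + g x)"

text \<open>\<open>c\<close> is the value at the omitted pole, where \<open>omega\<close> vanishes,
  and \<open>g\<close> is of first order there. Splitting off the constant pays because the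
  Laplacian does not see it.\<close>

lemma spol_symb:
  "spol n f \<Longrightarrow> \<exists>c g. symb 1 (\<lambda>k. g) \<and> f = (\<lambda>x. g x + c)"
proof (induction rule: spol.induct)
  case (spol_zero n)
  show ?case by (intro exI[of _ 0] exI[of _ "\<lambda>x. 0"]) (auto intro: symb.intros)
next
  case (spol_const n c)
  show ?case by (intro exI[of _ c] exI[of _ "\<lambda>x. 0"]) (auto intro: symb.intros)
next
  case (spol_mult_sc n f v)
  then obtain c g where g: "symb 1 (\<lambda>k. g)" "f = (\<lambda>x. g x + c)" by blast
  let ?s = "\<lambda>x. xi (fst v) x + snd v * omega x"
  have "symb 1 (\<lambda>k x. c * ?s x + (?s x * g x + (- snd v) * g x))"
    using symb_lower[of 1 "\<lambda>k x. ?s x * g x"] symb_mult[OF sc_symb g(1), of v]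
    by (intro symb_add symb_cmult g sc_symb) simp
  moreover have "(\<lambda>x. sc v x * f x) = (\<lambda>x. (c * ?s x + (?s x * g x + (- snd v) * g x)) + (- snd v * c))"
    by (simp add: sc_alt g fun_eq_iff algebra_simps)
  ultimately show ?case by (intro exI[of _ "- snd v * c"] exI[of _ "\<lambda>x. c * ?s x + (?s x * g x + (- snd v) * g x)"] conjI)
next
  case (spol_add n f f')
  then obtain c g c' g' where g: "symb 1 (\<lambda>k. g)" "f = (\<lambda>x. g x + c)" "symb 1 (\<lambda>k. g')" "f' = (\<lambda>x. g' x + c')" by blast
  then show ?case
    by (intro exI[of _ "c + c'"] exI[of _ "\<lambda>x. g x + g' x"] conjI symb_add) (auto simp: fun_eq_iff)
qed

lemma spol_symb0: "spol n f \<Longrightarrow> symb 0 (\<lambda>k. f)"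
proof -
  assume "spol n f"
  then obtain c g where g: "symb 1 (\<lambda>k. g)" "f = (\<lambda>x. g x + c)" using spol_symb by blast
  show ?thesis unfolding g(2) using symb_lower[of 0] g(1) by (intro symb_add symb_const) simp
qed

lemma spol_smooth: "spol n f \<Longrightarrow> smooth f"
  using symb_smooth[OF spol_symb0] .

lemma spol_0: "spol 0 f \<Longrightarrow> f = (\<lambda>x. 0)"
proof -
  have "spol n f \<Longrightarrow> n = 0 \<Longrightarrow> f = (\<lambda>x. 0)" for n
    by (induction rule: spol.induct) auto
  then show "spol 0 f \<Longrightarrow> f = (\<lambda>x. 0)" by blast
qed

lemma spol_lift: "spol n f \<Longrightarrow> spol (Suc n) f"
  by (induction rule: spol.induct) (auto intro: spol.intros)

lemma spol_mono: "spol n f \<Longrightarrow> n \<le> m \<Longrightarrow> spol m f"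
  by (induction m) (auto intro: spol_lift simp: le_Suc_eq)

lemma spol_cmult: "spol n f \<Longrightarrow> spol n (\<lambda>x. c * f x)"
proof (induction rule: spol.induct)
  case (spol_mult_sc n f v)
  have "spol (Suc n) (\<lambda>x. sc v x * (c * f x))" by (rule spol.spol_mult_sc) (rule spol_mult_sc.IH)
  then show ?case by (simp add: mult_ac)
qed (auto intro: spol.intros simp: distrib_left)

lemma spol_diff: "spol n f \<Longrightarrow> spol n g \<Longrightarrow> spol n (\<lambda>x. f x - g x)"
  using spol_add[of n f "\<lambda>x. -1 * g x"] spol_cmult[of n g "-1"] by simp

lemma spol_sum: "(\<And>i. i \<in> I \<Longrightarrow> spol n (f i)) \<Longrightarrow> spol n (\<lambda>x. \<Sum>i\<in>I. f i x)"
  by (induction I rule: infinite_finite_induct) (auto intro: spol.intros)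

lemma spol_sc: "spol 2 (sc v)"
  using spol_mult_sc[OF spol_const[of 0 1], of v] by (simp add: numeral_2_eq_2)

lemma spol_mult: "spol n f \<Longrightarrow> spol m g \<Longrightarrow> spol (n + m) (\<lambda>x. f x * g x)"
proof (induction rule: spol.induct)
  case (spol_const n c)
  then show ?case by (intro spol_mono[OF spol_cmult]) auto
next
  case (spol_mult_sc n f v)
  have "spol (Suc (n + m)) (\<lambda>x. sc v x * (f x * g x))" by (rule spol.spol_mult_sc) (rule spol_mult_sc.IH[OF spol_mult_sc.prems])
  then show ?case by (simp add: mult_ac)
qed (auto intro: spol.intros simp: distrib_right)

text \<open>In both lemmas \<open>n - 1\<close> is the degree (truncated to \<open>0\<close> for \<open>f = 0\<close>), and the point is
  that the remainder \<open>r\<close> has lower degree than the leading term.\<close>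

lemma spol_Gam_sc:
  "spol n f \<Longrightarrow> \<exists>r. spol n r \<and> (\<forall>x. Gam (sc v) f x = r x - real (n - 1) * sc v x * f x)"
proof (induction rule: spol.induct)
  case (spol_zero n)
  show ?case by (intro exI[of _ "\<lambda>x. 0"]) (auto intro: spol.intros)
next
  case (spol_const n c)
  have "spol (Suc n) (\<lambda>x. real n * sc v x * c)"
  proof (cases n)
    case (Suc m)
    have "spol (Suc (Suc m)) (\<lambda>x. sc v x * (real n * c))" by (intro spol.intros)
    then show ?thesis using Suc by (simp add: mult_ac)
  qed (auto intro: spol.intros)
  then show ?case by (intro exI[of _ "\<lambda>x. real n * sc v x * c"]) auto
next
  case (spol_mult_sc n f w)
  then obtain r where r: "spol n r" "\<And>x. Gam (sc v) f x = r x - real (n - 1) * sc v x * f x" by blast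
  have "spol (Suc n) (\<lambda>x. (v \<bullet> w) * f x + sc w x * r x)"
    using r spol_mult_sc by (intro spol.intros spol_lift spol_cmult) auto
  moreover have "Gam (sc v) (\<lambda>x. sc w x * f x) x
    = ((v \<bullet> w) * f x + sc w x * r x) - real (Suc n - 1) * sc v x * (sc w x * f x)" for x
  proof -
    have "Gam (sc v) (\<lambda>x. sc w x * f x) x = sc w x * (r x - real (n - 1) * sc v x * f x) + f x * (v \<bullet> w - sc v x * sc w x)"
      using spol_smooth[OF spol_mult_sc(1)] by (simp add: Gam_mult sc_smooth r Gam_sc)
    \<comment> \<open>Truncated subtraction: \<open>n - 1\<close> is one less than \<open>n\<close>
      only for n > 0; for n = 0 the function is zero.\<close>
    then show ?thesis using spol_0[of f] spol_mult_sc(1) by (cases n) (auto simp: algebra_simps)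
  qed
  ultimately show ?case by blast
next
  case (spol_add n f g)
  then obtain r s where rs: "spol n r" "\<And>x. Gam (sc v) f x = r x - real (n - 1) * sc v x * f x"
    "spol n s" "\<And>x. Gam (sc v) g x = s x - real (n - 1) * sc v x * g x" by blast
  have "Gam (sc v) (\<lambda>x. f x + g x) x = (r x + s x) - real (n - 1) * sc v x * (f x + g x)" for x
    unfolding Gam_add[OF spol_smooth[OF spol_add(1)] spol_smooth[OF spol_add(2)]] rs(2,4) by (simp add: algebra_simps)
  then show ?case using spol.spol_add[OF rs(1,3)] by blast
qed

lemma spol_Lop:
  "spol n f \<Longrightarrow> \<exists>r. spol (n - 1) r \<and> (\<forall>x. Lop f x = r x - real (n - 1) * real (n + 2) * f x)"
proof (induction rule: spol.induct)
  case (spol_zero n)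
  show ?case by (intro exI[of _ "\<lambda>x. 0"]) (auto intro: spol.intros)
next
  case (spol_const n c)
  have "spol n (\<lambda>x. real n * real (n + 3) * c)" by (cases n) (auto intro: spol.intros)
  then show ?case by (intro exI[of _ "\<lambda>x. real n * real (n + 3) * c"]) (auto simp: algebra_simps)
next
  case (spol_mult_sc n f v)
  then obtain r where r: "spol (n - 1) r" "\<And>x. Lop f x = r x - real (n - 1) * real (n + 2) * f x" by blast
  obtain r' where r': "spol n r'" "\<And>x. Gam (sc v) f x = r' x - real (n - 1) * sc v x * f x"
    using spol_Gam_sc[OF spol_mult_sc(1)] by blast
  show ?case
  proof (cases n)
    case 0
    then have "f = (\<lambda>x. 0)" using spol_0 spol_mult_sc by blast
    then show ?thesis using 0 by (intro exI[of _ "\<lambda>x. 0"]) (auto intro: spol.intros)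
  next
    case (Suc m)
    have "spol n (\<lambda>x. sc v x * r x + 2 * r' x)"
      using r(1) r'(1) Suc by (intro spol_add spol_cmult) (auto intro: spol.spol_mult_sc)
    moreover have "Lop (\<lambda>x. sc v x * f x) x = (sc v x * r x + 2 * r' x) - real n * real (n + 3) * (sc v x * f x)" for x
    proof -
      have "Lop (\<lambda>x. sc v x * f x) x = sc v x * (r x - real (n - 1) * real (n + 2) * f x) + f x * (- 4 * sc v x)
         + 2 * (r' x - real (n - 1) * sc v x * f x)"
        by (simp add: Lop_mult sc_smooth spol_smooth[OF spol_mult_sc(1)] r r' Lop_sc)
      then show ?thesis using Suc by (simp add: algebra_simps)
    qed
    ultimately show ?thesis by (intro exI[of _ "\<lambda>x. sc v x * r x + 2 * r' x"]) (auto simp: algebra_simps)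
  qed
next
  case (spol_add n f g)
  then obtain r s where rs: "spol (n - 1) r" "\<And>x. Lop f x = r x - real (n - 1) * real (n + 2) * f x"
    "spol (n - 1) s" "\<And>x. Lop g x = s x - real (n - 1) * real (n + 2) * g x" by blast
  have "Lop (\<lambda>x. f x + g x) x = (r x + s x) - real (n - 1) * real (n + 2) * (f x + g x)" for x
    unfolding Lop_add[OF spol_smooth[OF spol_add(1)] spol_smooth[OF spol_add(2)]] rs(2,4) by (simp add: algebra_simps)
  then show ?case using spol.spol_add[OF rs(1,3)] by blast
qed

text \<open>Bounding the degree and prescribing the eigenvalue describes the harmonics of degree l
  without extending them harmonically to the ambient space.\<close>

definition harm :: "nat \<Rightarrow> (real^4 \<Rightarrow> real) \<Rightarrow> bool" where
  "harm l g \<longleftrightarrow> spol (Suc l) g \<and> (\<forall>x. Lop g x = - (real l * (real l + 3)) * g x)"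

lemma harm_cmult: "harm l g \<Longrightarrow> harm l (\<lambda>x. c * g x)"
  by (auto simp: harm_def spol_cmult Lop_cmult spol_smooth)

text \<open>The operator \<open>L + n (n + 3)\<close> lowers the degree of a polynomial of degree \<open>n\<close>, and it is
  invertible on the harmonics of lower degree.\<close>

lemma harmonic_decomposition:
  "spol (Suc n) f \<Longrightarrow> \<exists>g. (\<forall>l\<le>n. harm l (g l)) \<and> f = (\<lambda>x. \<Sum>l\<le>n. g l x)"
proof (induction n arbitrary: f)
  case 0
  obtain r where r: "spol 0 r" "\<And>x. Lop f x = r x"
    using spol_Lop[OF 0] by auto
  then have "harm 0 f" using 0 spol_0 by (auto simp: harm_def)
  then show ?case by (intro exI[of _ "\<lambda>_. f"]) auto
next
  case (Suc n)
  define N where "N = real (Suc n) * (real (Suc n) + 3)"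
  obtain r where r: "spol (Suc n) r" "\<And>x. Lop f x = r x - N * f x"
    using spol_Lop[OF Suc.prems] by (auto simp: N_def algebra_simps)
  obtain h where h: "\<And>l. l \<le> n \<Longrightarrow> harm l (h l)" "r = (\<lambda>x. \<Sum>l\<le>n. h l x)"
    using Suc.IH[OF r(1)] by blast
  define e where "e l = N - real l * (real l + 3)" for l
  have e: "e l > 0" if "l \<le> n" for l
  proof -
    have "real l * (real l + 3) < real (Suc n) * (real (Suc n) + 3)"
      using that by (intro mult_strict_mono) auto
    then show ?thesis by (simp add: e_def N_def)
  qed
  \<comment> \<open>On harmonics of degree l the operator L + N acts as the number
    \<open>e l\<close>, so the sum of the \<open>q l\<close> is a preimage of \<open>r\<close>;
    subtracting it from \<open>f\<close> leaves a solution of L p = - N p.\<close>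
  define q where "q l = (\<lambda>x. (1 / e l) * h l x)" for l
  have q: "harm l (q l)" if "l \<le> n" for l unfolding q_def using h that by (intro harm_cmult) auto
  define p where "p = (\<lambda>x. f x - (\<Sum>l\<le>n. q l x))"
  have qs: "spol (Suc (Suc n)) (\<lambda>x. \<Sum>l\<le>n. q l x)"
  proof (intro spol_sum)
    fix l assume "l \<in> {..n}"
    then have "spol (Suc l) (q l)" "Suc l \<le> Suc (Suc n)" using q by (auto simp: harm_def)
    then show "spol (Suc (Suc n)) (q l)" by (rule spol_mono)
  qed
  have ps: "spol (Suc (Suc n)) p" unfolding p_def by (intro spol_diff Suc.prems qs)
  have "Lop p x = - N * p x" for x
  proof -
    have "Lop p x = Lop f x - Lop (\<lambda>x. \<Sum>l\<le>n. q l x) x"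
      unfolding p_def by (rule Lop_diff) (use Suc.prems qs spol_smooth in blast)+
    also have "Lop (\<lambda>x. \<Sum>l\<le>n. q l x) x = (\<Sum>l\<le>n. Lop (q l) x)"
      using q by (intro Lop_sum) (auto simp: harm_def intro: spol_smooth)
    also have "\<dots> = (\<Sum>l\<le>n. h l x - N * q l x)"
    proof (intro sum.cong refl)
      fix l assume l: "l \<in> {..n}"
      then have "Lop (q l) x = - (real l * (real l + 3)) * q l x" using q by (simp add: harm_def)
      moreover have "h l x = e l * q l x" using e[of l] l by (simp add: q_def)
      ultimately show "Lop (q l) x = h l x - N * q l x" by (simp add: e_def algebra_simps)
    qed
    also have "\<dots> = r x - N * (\<Sum>l\<le>n. q l x)" using h by (simp add: sum_subtractf sum_distrib_left)
    finally show ?thesis by (simp add: r(2) p_def algebra_simps)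
  qed
  then have "harm (Suc n) p" using ps by (simp add: harm_def N_def)
  then show ?case using q
    by (intro exI[of _ "\<lambda>l. if l = Suc n then p else q l"]) (auto simp: p_def fun_eq_iff le_Suc_eq)
qed

lemma spol_1: assumes "spol 1 f" obtains c where "f = (\<lambda>x. c)"
proof -
  have "spol n f \<Longrightarrow> n = 1 \<Longrightarrow> \<exists>c. f = (\<lambda>x. c)" for n
  proof (induction rule: spol.induct)
    case (spol_mult_sc n f v)
    then show ?case using spol_0[of f] by auto
  next
    case (spol_add n f g)
    then obtain c d where "f = (\<lambda>x. c)" "g = (\<lambda>x. d)" by blast
    then show ?case by (intro exI[of _ "c + d"]) auto
  qed auto
  then show ?thesis using that assms by blast
qed

lemma spol_2: assumes "spol 2 f" obtains c v where "f = (\<lambda>x. c + sc v x)"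
proof -
  have "spol n f \<Longrightarrow> n = 2 \<Longrightarrow> \<exists>c v. f = (\<lambda>x. c + sc v x)" for n
  proof (induction rule: spol.induct)
    case (spol_zero n)
    show ?case by (intro exI[of _ 0]) (auto simp: sc_def)
  next
    case (spol_const n c)
    show ?case by (intro exI[of _ c] exI[of _ 0]) (auto simp: sc_def)
  next
    case (spol_mult_sc n f v)
    then obtain c where "f = (\<lambda>x. c)" using spol_1[of f] by auto
    then show ?case by (intro exI[of _ 0] exI[of _ "c *\<^sub>R v"]) (auto simp: sc_def)
  next
    case (spol_add n f g)
    then obtain c v d w where "f = (\<lambda>x. c + sc v x)" "g = (\<lambda>x. d + sc w x)" by blast
    then show ?case by (intro exI[of _ "c + d"] exI[of _ "v + w"]) (auto simp: sc_def inner_add_left)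
  qed
  then show ?thesis using that assms by blast
qed

lemma harm_0: assumes "harm 0 f" obtains c where "f = (\<lambda>x. c)"
  using assms spol_1 by (auto simp: harm_def)

lemma harm_1: assumes "harm 1 f" obtains v where "f = sc v"
proof -
  have "spol 2 f" using assms by (simp add: harm_def numeral_2_eq_2)
  then obtain c v where f: "f = (\<lambda>x. c + sc v x)" by (rule spol_2)
  \<comment> \<open>A comparison at one point suffices, since the unknown \<open>c\<close> is a
    constant.\<close>
  have "Lop f 0 = - 4 * sc v 0"
    unfolding f using Lop_add[of "\<lambda>_. c" "sc v" 0] by (simp add: sc_smooth Lop_sc)
  moreover have "Lop f 0 = - 4 * f 0" using assms by (simp add: harm_def)
  ultimately have "c = 0" by (simp add: f)
  then show ?thesis using that[of v] f by simp
qed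

lemma harm_const: "harm 0 (\<lambda>x. c)" by (simp add: harm_def spol_const)

lemma harm_sc: "harm 1 (sc v)" using spol_sc by (simp add: harm_def Lop_sc numeral_2_eq_2)

lemma spol_Lop_ex: "spol n f \<Longrightarrow> \<exists>h. spol n h \<and> (\<forall>x. Lop f x = h x)"
proof -
  assume f: "spol n f"
  then obtain r where r: "spol (n - 1) r" "\<And>x. Lop f x = r x - real (n - 1) * real (n + 2) * f x"
    using spol_Lop by blast
  have "spol n (\<lambda>x. r x - (real (n - 1) * real (n + 2)) * f x)"
    using spol_mono[OF r(1), of n] f by (intro spol_diff spol_cmult) auto
  then show ?thesis using r(2) by (intro exI[of _ "\<lambda>x. r x - (real (n - 1) * real (n + 2)) * f x"]) auto
qed

lemma spol_Lop_spol: "spol n f \<Longrightarrow> spol n (Lop f)"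
  using spol_Lop_ex[of n f] by (metis ext)

lemma spol_bilaplacian:
  "spol n f \<Longrightarrow> laplacian (laplacian f) x = (omega x)^4 * (Lop (Lop f) x - 2 * Lop f x)"
  using bilaplacian_eq_Lop[OF spol_symb0] spol_smooth[OF spol_Lop_spol] by blast

text \<open>The bridge to Stone-Weierstrass, whose approximants are polynomial functions on the
  ambient space.\<close>

lemma spol_real_polynomial:
  "real_polynomial_function p \<Longrightarrow> \<exists>n. spol n (\<lambda>x. p (stereo x))"
proof (induction rule: real_polynomial_function.induct)
  case (linear f)
  then have l: "linear f" by (rule bounded_linear.linear)
  have "f y = (\<Sum>b\<in>Basis. f b *\<^sub>R b) \<bullet> y" for y
  proof -
    have "f y = f (\<Sum>b\<in>Basis. (y \<bullet> b) *\<^sub>R b)" by (simp only: euclidean_representation)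
    also have "\<dots> = (\<Sum>b\<in>Basis. (y \<bullet> b) * f b)" by (simp add: linear_sum[OF l] linear_cmul[OF l])
    also have "\<dots> = (\<Sum>b\<in>Basis. f b *\<^sub>R b) \<bullet> y"
      unfolding inner_sum_left by (intro sum.cong refl) (simp add: inner_commute)
    finally show ?thesis .
  qed
  then have "(\<lambda>x. f (stereo x)) = sc (\<Sum>b\<in>Basis. f b *\<^sub>R b)"
    unfolding sc_def by (intro ext)
  then show ?case using spol_sc[of "\<Sum>b\<in>Basis. f b *\<^sub>R b"] by (intro exI[of _ 2]) simp
next
  case (const c)
  show ?case using spol_const by blast
next
  case (add f g)
  then obtain n m where "spol n (\<lambda>x. f (stereo x))" "spol m (\<lambda>x. g (stereo x))" by blast
  then have "spol (max n m) (\<lambda>x. f (stereo x) + g (stereo x))"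
    using spol_mono[of n _ "max n m"] spol_mono[of m _ "max n m"] by (intro spol_add) auto
  then show ?case by blast
next
  case (mult f g)
  then obtain n m where "spol n (\<lambda>x. f (stereo x))" "spol m (\<lambda>x. g (stereo x))" by blast
  from spol_mult[OF this] show ?case by blast
qed

section \<open>Inversions\<close>

text \<open>The equality of integrals requires no integrability: if one integrand is not integrable
  then neither is the other, and both integrals take the default value 0.\<close>

lemma integrable_lebesgue_change_of_variables:
  fixes g :: "real^'m::{finite,wellorder} \<Rightarrow> real^'m::_" and f :: "real^'m::_ \<Rightarrow> real"
  assumes S: "S \<in> sets lebesgue" and g: "\<And>x. x \<in> S \<Longrightarrow> (g has_derivative g' x) (at x)"
    and inj: "inj_on g S" and N: "negligible (- S)" "negligible (- g ` S)"
  shows "integrable lebesgue (\<lambda>x. \<bar>det (matrix (g' x))\<bar> * f (g x)) \<longleftrightarrow> integrable lebesgue f"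
    "(LINT x|lebesgue. \<bar>det (matrix (g' x))\<bar> * f (g x)) = (LINT x|lebesgue. f x)"
proof -
  have U: "h absolutely_integrable_on A \<longleftrightarrow> integrable lebesgue h"
    "h absolutely_integrable_on A \<Longrightarrow> integral A h = (LINT x|lebesgue. h x)"
    if "negligible (- A)" for h :: "real^'m::_ \<Rightarrow> real" and A
  proof -
    have "h absolutely_integrable_on A \<longleftrightarrow> h absolutely_integrable_on UNIV"
      by (rule absolutely_integrable_spike_set_eq)
         (auto intro: negligible_subset[OF that] simp: empty_imp_negligible)
    then show 1: "h absolutely_integrable_on A \<longleftrightarrow> integrable lebesgue h"
      by (simp add: set_integrable_def)
    assume "h absolutely_integrable_on A"
    then have "h absolutely_integrable_on UNIV" using 1 by (simp add: set_integrable_def)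
    then have "integral UNIV h = (LINT x|lebesgue. h x)"
      using set_lebesgue_integral_eq_integral(2)[of UNIV h] by (simp add: set_lebesgue_integral_def)
    moreover have "integral A h = integral UNIV h"
      by (rule integral_spike_set) (auto intro: negligible_subset[OF that] simp: empty_imp_negligible)
    ultimately show "integral A h = (LINT x|lebesgue. h x)" by simp
  qed
  let ?D = "\<lambda>x. \<bar>det (matrix (g' x))\<bar> * f (g x)"
  \<comment> \<open>The change of variables is stated for vector values, so the real function is
    read as a vector with one component.\<close>
  let ?v = "\<lambda>r::real. vec r :: real^1"
  have cov: "?D absolutely_integrable_on S \<and> integral S ?D = b
     \<longleftrightarrow> f absolutely_integrable_on (g ` S) \<and> integral (g ` S) f = b" for b
  proof -
    have "(\<lambda>x. \<bar>det (matrix (g' x))\<bar> *\<^sub>R ?v (f (g x))) absolutely_integrable_on S \<and>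
           integral S (\<lambda>x. \<bar>det (matrix (g' x))\<bar> *\<^sub>R ?v (f (g x))) = ?v b
     \<longleftrightarrow> (\<lambda>x. ?v (f x)) absolutely_integrable_on (g ` S) \<and> integral (g ` S) (\<lambda>x. ?v (f x)) = ?v b"
      by (rule has_absolute_integral_change_of_variables[OF S has_derivative_at_withinI[OF g] inj])
    then show ?thesis
      by (simp add: absolutely_integrable_on_1_iff integral_on_1_eq)
  qed
  show i: "integrable lebesgue ?D \<longleftrightarrow> integrable lebesgue f"
    using cov U(1)[OF N(1), of ?D] U(1)[OF N(2), of f] by blast
  show "(LINT x|lebesgue. ?D x) = (LINT x|lebesgue. f x)"
  proof (cases "integrable lebesgue f")
    case True
    then show ?thesis using i cov[of "integral S ?D"] U(1)[OF N(1), of ?D] U(2)[OF N(1), of ?D]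
        U(1)[OF N(2), of f] U(2)[OF N(2), of f] by simp
  next
    case False
    then show ?thesis using i by (simp add: not_integrable_integral_eq)
  qed
qed

definition inversion :: "real^4 \<Rightarrow> real \<Rightarrow> real^4 \<Rightarrow> real^4" where
  "inversion a r z = a + (r / (norm (z - a))\<^sup>2) *\<^sub>R (z - a)"

lemma norm_inversion: "r > 0 \<Longrightarrow> norm (inversion a r z - a) = r / norm (z - a)"
  by (simp add: inversion_def power2_eq_square)

lemma inversion_neq: "r > 0 \<Longrightarrow> z \<noteq> a \<Longrightarrow> inversion a r z \<noteq> a"
  by (simp add: inversion_def)

lemma inversion_inversion:
  assumes "r > 0" "z \<noteq> a" shows "inversion a r (inversion a r z) = z"
proof -
  have "inversion a r (inversion a r z) = a + (r / (r / norm (z - a))\<^sup>2) *\<^sub>R ((r / (norm (z - a))\<^sup>2) *\<^sub>R (z - a))"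
    using norm_inversion[OF assms(1), of a z] by (simp add: inversion_def)
  then show ?thesis using assms by (simp add: power2_eq_square)
qed

text \<open>The multiple r / |z - a|^2 of the reflection in the hyperplane orthogonal to
  \<open>z - a\<close>: inversions are conformal.\<close>

definition inversion_derivative :: "real^4 \<Rightarrow> real \<Rightarrow> real^4 \<Rightarrow> real^4 \<Rightarrow> real^4" where
  "inversion_derivative a r z h = (r / (norm (z - a))\<^sup>2) *\<^sub>R (h - (2 * ((z - a) \<bullet> h) / (norm (z - a))\<^sup>2) *\<^sub>R (z - a))"

lemma inversion_has_derivative:
  assumes "z \<noteq> a"
  shows "(inversion a r has_derivative inversion_derivative a r z) (at z)"
proof -
  have n: "(z - a) \<bullet> (z - a) \<noteq> 0" using assms by simp
  have "((\<lambda>z. a + (r / ((z - a) \<bullet> (z - a))) *\<^sub>R (z - a)) has_derivative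
    (\<lambda>h. (r / ((z - a) \<bullet> (z - a))) *\<^sub>R (h - (2 * ((z - a) \<bullet> h) / ((z - a) \<bullet> (z - a))) *\<^sub>R (z - a)))) (at z)"
    using n mult.left_commute[of _ "2::real"] by (auto intro!: derivative_eq_intros simp: fun_eq_iff power2_eq_square inner_commute scaleR_right_diff_distrib field_simps)
  then show ?thesis by (simp add: inversion_def[abs_def] inversion_derivative_def[abs_def] power2_norm_eq_inner)
qed

lemma reflection_inner:
  fixes w :: "'a::real_inner" assumes "w \<noteq> 0"
  shows "(v - (2 * (w \<bullet> v) / (norm w)\<^sup>2) *\<^sub>R w) \<bullet> (u - (2 * (w \<bullet> u) / (norm w)\<^sup>2) *\<^sub>R w) = v \<bullet> u"
  using assms by (simp add: inner_diff_left inner_diff_right power2_norm_eq_inner inner_commute field_simps)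

lemma inversion_det:
  assumes "z \<noteq> a" "r > 0"
  shows "\<bar>det (matrix (inversion_derivative a r z))\<bar> = r ^ 4 / norm (z - a) ^ 8"
proof -
  let ?w = "z - a" and ?c = "r / (norm (z - a))\<^sup>2"
  let ?R = "\<lambda>h. h - (2 * (?w \<bullet> h) / (norm ?w)\<^sup>2) *\<^sub>R ?w"
  have lin: "linear ?R"
    by (intro linearI) (auto simp: inner_add_right scaleR_left_distrib add_divide_distrib distrib_left scaleR_right_diff_distrib mult.left_commute)
  then have R: "orthogonal_transformation ?R"
    using reflection_inner[of ?w] assms by (simp add: orthogonal_transformation_def)
  have "matrix (inversion_derivative a r z) = matrix ((*\<^sub>R) ?c \<circ> ?R)"
    by (simp add: inversion_derivative_def[abs_def] o_def)
  also have "\<dots> = matrix ((*\<^sub>R) ?c) ** matrix ?R"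
    by (rule matrix_compose[OF lin]) (simp add: linear_scaleR)
  also have "\<dots> = mat ?c ** matrix ?R" by (simp only: matrix_scaleR)
  finally have "\<bar>det (matrix (inversion_derivative a r z))\<bar> = \<bar>det (mat ?c :: real^4^4)\<bar> * \<bar>det (matrix ?R)\<bar>"
    by (simp only: det_mul abs_mult)
  also have "det (mat ?c :: real^4^4) = ?c ^ 4"
    by (subst det_diagonal) (auto simp: mat_def)
  also have "\<bar>det (matrix ?R)\<bar> = 1" using R by (rule orthogonal_transformation_det)
  finally show ?thesis using assms by (simp add: power_divide power_mult[symmetric])
qed

lemma AE_off_point: "(\<And>z. z \<notin> {a} \<Longrightarrow> P z) \<Longrightarrow> AE z in lebesgue. P (z :: 'a::euclidean_space)"
  by (rule AE_I'[of "{a}"]) (auto simp: negligible_iff_null_sets[symmetric])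

lemma inversion_change_of_variables:
  fixes f :: "real^4 \<Rightarrow> real"
  assumes "r > 0"
  shows "integrable lebesgue (\<lambda>z. r ^ 4 / norm (z - a) ^ 8 * f (inversion a r z)) \<longleftrightarrow> integrable lebesgue f"
    "(LINT z|lebesgue. r ^ 4 / norm (z - a) ^ 8 * f (inversion a r z)) = (LINT z|lebesgue. f z)"
proof -
  define D where "D = (\<lambda>z. \<bar>det (matrix (inversion_derivative a r z))\<bar> * f (inversion a r z))"
  have im: "inversion a r ` (- {a}) = - {a}"
  proof (intro equalityI subsetI)
    fix y assume "y \<in> inversion a r ` (- {a})"
    then show "y \<in> - {a}" using inversion_neq[OF assms] by auto
  next
    fix y assume y: "y \<in> - {a}"
    then have "inversion a r y \<in> - {a}" "y = inversion a r (inversion a r y)"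
      using inversion_neq[OF assms, of y a] inversion_inversion[OF assms, of y a] by auto
    then show "y \<in> inversion a r ` (- {a})" by (rule image_eqI[rotated])
  qed
  have inj: "inj_on (inversion a r) (- {a})"
    by (rule inj_on_inverseI[of _ "inversion a r"]) (use inversion_inversion[OF assms] in auto)
  have cov: "integrable lebesgue D \<longleftrightarrow> integrable lebesgue f" "(LINT x|lebesgue. D x) = (LINT x|lebesgue. f x)"
    unfolding D_def
    by (rule integrable_lebesgue_change_of_variables[of "- {a}"]; use inversion_has_derivative im inj in simp)+
  let ?E = "\<lambda>z. r ^ 4 / norm (z - a) ^ 8 * f (inversion a r z)"
  have eq: "z \<notin> {a} \<Longrightarrow> D z = ?E z" for z using inversion_det[OF _ assms, of z a] by (simp add: D_def)
  have ne: "negligible {a}" by simp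
  have "D absolutely_integrable_on UNIV \<longleftrightarrow> ?E absolutely_integrable_on UNIV"
    by (rule absolutely_integrable_spike_eq[OF ne]) (use eq in auto)
  then have i: "integrable lebesgue D \<longleftrightarrow> integrable lebesgue ?E" by (simp add: set_integrable_def)
  then show "integrable lebesgue ?E \<longleftrightarrow> integrable lebesgue f" using cov by simp
  have "(LINT z|lebesgue. D z) = (LINT z|lebesgue. ?E z)"
  proof (cases "integrable lebesgue D")
    case True
    then show ?thesis using i
      by (intro integral_cong_AE AE_off_point[of a] eq) auto
  qed (use i in \<open>simp add: not_integrable_integral_eq\<close>)
  then show "(LINT z|lebesgue. ?E z) = (LINT z|lebesgue. f z)" using cov by simp
qed

section \<open>Integrals of the conformal factor and of the Riesz kernel\<close>

text \<open>Layer-cake argument: omega^p is an integral over the levels r >= |x|^2, and after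
  exchanging the integrals only the volume pi^2 r^2 / 2 of the ball of radius sqrt r enters. The
  condition p > 2 is convergence at infinity.\<close>

lemma nn_integral_omega_powr:
  assumes p: "p > 2"
  shows "(\<integral>\<^sup>+x. ennreal (omega x powr p) \<partial>lborel) = ennreal (2 powr p * pi\<^sup>2 / ((p - 1) * (p - 2)))"
proof -
  \<comment> \<open>Minus the derivative of (2 / (1 + r))^p, with r standing for |x|^2.\<close>
  define F where "F r = 2 powr p * p * (1 + r) powr (- p - 1)" for r :: real
  have Fb: "F \<in> borel_measurable borel" unfolding F_def by measurable
  have F0: "F r \<ge> 0" for r using p by (simp add: F_def)
  have to0: "((\<lambda>r. (1 + r) powr (- q)) \<longlongrightarrow> 0) at_top" if "q > 0" for q :: real
  proof -
    have "filterlim (\<lambda>r::real. 1 + r) at_top at_top"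
      by (rule filterlim_tendsto_add_at_top[OF tendsto_const filterlim_ident])
    then show ?thesis by (intro tendsto_neg_powr) (use that in auto)
  qed
  have om: "ennreal (omega x powr p) = (\<integral>\<^sup>+r. ennreal (F r) * indicator {(norm x)\<^sup>2..} r \<partial>lborel)" for x :: "real^4"
  proof -
    have "(\<integral>\<^sup>+r. ennreal (F r) * indicator {(norm x)\<^sup>2..} r \<partial>lborel)
       = ennreal (0 - (- (2 powr p) * (1 + (norm x)\<^sup>2) powr (- p)))"
    proof (rule nn_integral_FTC_atLeast[OF Fb])
      fix r :: real assume "(norm x)\<^sup>2 \<le> r"
      then have "1 + r > 0" by (smt (verit) zero_le_power2)
      then show "DERIV (\<lambda>r. - (2 powr p) * (1 + r) powr (- p)) r :> F r"
        by (auto intro!: derivative_eq_intros simp: F_def powr_diff field_simps)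
      show "F r \<ge> 0" by (rule F0)
    next
      have "((\<lambda>r. - (2 powr p) * (1 + r) powr (- p)) \<longlongrightarrow> - (2 powr p) * 0) at_top"
        using p by (intro tendsto_intros to0) auto
      then show "((\<lambda>r. - (2 powr p) * (1 + r) powr (- p)) \<longlongrightarrow> 0) at_top" by simp
    qed
    moreover have "2 powr p * (1 + (norm x)\<^sup>2) powr (- p) = omega x powr p"
      unfolding omega_def by (subst powr_divide) (auto simp: powr_minus_divide intro: add_nonneg_nonneg)
    ultimately show ?thesis by simp
  qed
  have vol: "(\<integral>\<^sup>+x. indicator {(norm (x::real^4))\<^sup>2..} r \<partial>lborel) = ennreal (pi\<^sup>2 / 2 * r\<^sup>2) * indicator {0..} r" for r :: real
  proof (cases "r \<ge> 0")
    case True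
    have "(\<integral>\<^sup>+x. indicator {(norm (x::real^4))\<^sup>2..} r \<partial>lborel) = (\<integral>\<^sup>+x. indicator (cball 0 (sqrt r)) (x::real^4) \<partial>lborel)"
      by (intro nn_integral_cong) (auto simp: indicator_def real_le_rsqrt sqrt_ge_absD)
    also have "\<dots> = emeasure lborel (cball 0 (sqrt r) :: (real^4) set)" by simp
    also have "\<dots> = ennreal (pi\<^sup>2 / 2 * r\<^sup>2)"
    proof -
      have "sqrt r ^ 4 = r\<^sup>2" using True by (metis real_sqrt_pow2 power_mult mult_2 numeral_Bit0 power_even_eq)
      then show ?thesis using True by (subst emeasure_cball) (auto simp: eval_unit_ball_vol)
    qed
    finally show ?thesis using True by simp
  next
    case False
    then have "indicator {(norm x)\<^sup>2..} r = (0::ennreal)" for x :: "real^4"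
      by (auto simp: indicator_def) (smt (verit) zero_le_power2)
    then show ?thesis using False by simp
  qed
  have "(\<integral>\<^sup>+x. ennreal (omega x powr p) \<partial>lborel)
     = (\<integral>\<^sup>+x. \<integral>\<^sup>+r. ennreal (F r) * indicator {(norm (x::real^4))\<^sup>2..} r \<partial>lborel \<partial>lborel)"
    by (simp add: om)
  also have "\<dots> = (\<integral>\<^sup>+r. \<integral>\<^sup>+x. ennreal (F r) * indicator {(norm (x::real^4))\<^sup>2..} r \<partial>lborel \<partial>lborel)"
  proof (rule lborel_pair.Fubini'[symmetric])
    have "(\<lambda>(x::real^4, r). ennreal (F r) * indicator {z. (norm (fst z))\<^sup>2 \<le> snd z} (x, r)) \<in> borel_measurable (lborel \<Otimes>\<^sub>M lborel)"
      using Fb by measurable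
    then show "(\<lambda>(x::real^4, r). ennreal (F r) * indicator {(norm x)\<^sup>2..} r) \<in> borel_measurable (lborel \<Otimes>\<^sub>M lborel)"
      by (simp add: indicator_def)
  qed
  also have "\<dots> = (\<integral>\<^sup>+r. ennreal (F r * (pi\<^sup>2 / 2 * r\<^sup>2)) * indicator {0..} r \<partial>lborel)"
  proof (rule nn_integral_cong)
    fix r :: real
    have "(\<integral>\<^sup>+x. ennreal (F r) * indicator {(norm (x::real^4))\<^sup>2..} r \<partial>lborel)
       = ennreal (F r) * (\<integral>\<^sup>+x. indicator {(norm (x::real^4))\<^sup>2..} r \<partial>lborel)"
    proof (rule nn_integral_cmult)
      have "(\<lambda>x::real^4. indicator {x. (norm x)\<^sup>2 \<le> r} x :: ennreal) \<in> borel_measurable lborel" by measurable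
      then show "(\<lambda>x. indicator {(norm (x::real^4))\<^sup>2..} r :: ennreal) \<in> borel_measurable lborel"
        by (simp add: indicator_def)
    qed
    then show "(\<integral>\<^sup>+x. ennreal (F r) * indicator {(norm (x::real^4))\<^sup>2..} r \<partial>lborel)
      = ennreal (F r * (pi\<^sup>2 / 2 * r\<^sup>2)) * indicator {0..} r"
      unfolding vol by (simp only: ennreal_mult'[OF F0] mult.assoc)
  qed
  also have "\<dots> = ennreal (0 - (pi\<^sup>2 / 2) * (2 powr p * p) * (1 / (2 - p) - 2 / (1 - p) - 1 / p))"
  proof -
    \<comment> \<open>The antiderivative comes from r^2 = (1 + r)^2 - 2 (1 + r) + 1.\<close>
    define H where "H r = (pi\<^sup>2 / 2) * (2 powr p * p) * ((1 + r) powr (2 - p) / (2 - p) - 2 * ((1 + r) powr (1 - p) / (1 - p)) - (1 + r) powr (- p) / p)" for r :: real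
    have "(\<integral>\<^sup>+r. ennreal (F r * (pi\<^sup>2 / 2 * r\<^sup>2)) * indicator {0..} r \<partial>lborel) = ennreal (0 - H 0)"
    proof (rule nn_integral_FTC_atLeast)
      show "(\<lambda>r. F r * (pi\<^sup>2 / 2 * r\<^sup>2)) \<in> borel_measurable borel" using Fb by measurable
      fix r :: real assume r: "0 \<le> r"
      then show "F r * (pi\<^sup>2 / 2 * r\<^sup>2) \<ge> 0" using F0 by simp
      have u: "1 + r > 0" using r by simp
      have d: "((\<lambda>r. (1 + r) powr q / q) has_real_derivative (1 + r) powr (q - 1)) (at r)" if "q \<noteq> 0" for q
        using u that by (auto intro!: derivative_eq_intros simp: field_simps)
      have p3: "(1 + r) powr (2 - p - 1) = (1 + r)\<^sup>2 * (1 + r) powr (- p - 1)"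
        "(1 + r) powr (1 - p - 1) = (1 + r) * (1 + r) powr (- p - 1)"
        using u powr_add[of "1 + r" 2 "- p - 1"] powr_add[of "1 + r" 1 "- p - 1"] by simp_all
      have "((\<lambda>r. (pi\<^sup>2 / 2) * (2 powr p * p) * ((1 + r) powr (2 - p) / (2 - p) - 2 * ((1 + r) powr (1 - p) / (1 - p)) + (1 + r) powr (- p) / (- p)))
         has_real_derivative (pi\<^sup>2 / 2) * (2 powr p * p) * ((1 + r) powr (2 - p - 1) - 2 * (1 + r) powr (1 - p - 1) + (1 + r) powr (- p - 1))) (at r)"
        by (intro DERIV_cmult DERIV_add DERIV_diff d) (use p in auto)
      moreover have "(pi\<^sup>2 / 2) * (2 powr p * p) * ((1 + r) powr (2 - p - 1) - 2 * (1 + r) powr (1 - p - 1) + (1 + r) powr (- p - 1))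
         = F r * (pi\<^sup>2 / 2 * r\<^sup>2)"
        unfolding p3 F_def by (simp add: power2_eq_square algebra_simps)
      ultimately show "DERIV H r :> F r * (pi\<^sup>2 / 2 * r\<^sup>2)" unfolding H_def[abs_def] by (simp only: divide_minus_right diff_conv_add_uminus)
    next
      have "(H \<longlongrightarrow> (pi\<^sup>2 / 2) * (2 powr p * p) * (0 / (2 - p) - 2 * (0 / (1 - p)) - 0 / p)) at_top"
        unfolding H_def[abs_def] using to0[of "p - 2"] to0[of "p - 1"] to0[of p] p
        by (intro tendsto_intros) auto
      then show "(H \<longlongrightarrow> 0) at_top" by simp
    qed
    then show ?thesis by (simp add: H_def)
  qed
  also have "0 - (pi\<^sup>2 / 2) * (2 powr p * p) * (1 / (2 - p) - 2 / (1 - p) - 1 / p) = 2 powr p * pi\<^sup>2 / ((p - 1) * (p - 2))"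
  proof -
    have k: "1 / (2 - p) - 2 / (1 - p) - 1 / p = - 2 / (p * ((p - 1) * (p - 2)))"
      using p by (simp add: divide_simps) (simp add: algebra_simps)
    show ?thesis unfolding k using p by simp
  qed
  finally show ?thesis .
qed

lemma omega_measurable [measurable]: "omega \<in> borel_measurable borel"
  using smooth_measurable[OF omega_smooth] .

lemma xi_measurable [measurable]: "xi b \<in> borel_measurable borel"
  using smooth_measurable[OF xi_smooth] .

lemma omega_powr_integral:
  assumes "p > 2"
  shows "integrable lebesgue (\<lambda>x. omega x powr p)"
    "(LINT x|lebesgue. omega x powr p) = 2 powr p * pi\<^sup>2 / ((p - 1) * (p - 2))"
proof -
  have "has_bochner_integral lborel (\<lambda>x. omega x powr p) (2 powr p * pi\<^sup>2 / ((p - 1) * (p - 2)))"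
    by (rule has_bochner_integral_nn_integral) (use assms nn_integral_omega_powr[OF assms] in auto)
  then show "integrable lebesgue (\<lambda>x. omega x powr p)"
    "(LINT x|lebesgue. omega x powr p) = 2 powr p * pi\<^sup>2 / ((p - 1) * (p - 2))"
    by (simp_all add: integrable_completion integral_completion has_bochner_integral_iff)
qed

section \<open>Conformal behaviour of the Riesz kernel under inversions\<close>

text \<open>The squared radius 1 + |x|^2 is the one for which the inversion at \<open>x\<close>
  comes from an isometry of the sphere: 1 + |z|^2 is merely multiplied by (1 + |x|^2) / |z -
  x|^2.\<close>

lemma omega_inversion:
  assumes "z \<noteq> x"
  shows "omega (inversion x (1 + (norm x)\<^sup>2) z) = omega z * (norm (z - x))\<^sup>2 / (1 + (norm x)\<^sup>2)"
proof -
  define w where "w = z - x"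
  define r where "r = 1 + (norm x)\<^sup>2"
  have r: "r > 0" unfolding r_def by (intro add_pos_nonneg) auto
  have w: "w \<bullet> w > 0" using assms by (simp add: w_def)
  have z: "z = w + x" by (simp add: w_def)
  have nz: "1 + z \<bullet> z > 0" using inner_ge_zero[of z] by linarith
  have xx: "x \<bullet> x = r - 1" by (simp add: r_def power2_norm_eq_inner)
  have e: "1 + z \<bullet> z = w \<bullet> w + 2 * (x \<bullet> w) + r"
    unfolding z by (simp add: inner_add_left inner_add_right inner_commute xx)
  have "1 + inversion x r z \<bullet> inversion x r z = r + 2 * (r / (w \<bullet> w)) * (x \<bullet> w) + (r / (w \<bullet> w))\<^sup>2 * (w \<bullet> w)"
  proof -
    define s where "s = r / (w \<bullet> w)"
    have "inversion x r z = x + s *\<^sub>R w" by (simp add: inversion_def s_def w_def power2_norm_eq_inner)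
    then have "1 + inversion x r z \<bullet> inversion x r z = 1 + x \<bullet> x + 2 * s * (x \<bullet> w) + s\<^sup>2 * (w \<bullet> w)"
      by (simp add: inner_add_left inner_add_right inner_commute power2_eq_square algebra_simps)
    then show ?thesis by (simp add: xx s_def)
  qed
  also have "\<dots> = (r / (w \<bullet> w)) * (1 + z \<bullet> z)"
    unfolding e using w by (simp add: field_simps power2_eq_square)
  finally have "omega (inversion x r z) = 2 / ((r / (w \<bullet> w)) * (1 + z \<bullet> z))"
    by (simp add: omega_def power2_norm_eq_inner)
  also have "\<dots> = omega z * (w \<bullet> w) / r"
    using w r nz by (simp add: omega_def power2_norm_eq_inner)
  finally show ?thesis by (simp add: r_def w_def power2_norm_eq_inner)
qed

text \<open>4 - \<alpha>/2 is the conformal exponent: the powers of |z - x| from the Jacobian (-8),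
  from the weight (8 - \<alpha>) and from the kernel (\<alpha>) add up to zero, so the singularity
  disappears.\<close>

lemma Riesz_kernel_inversion:
  fixes f :: "real^4 \<Rightarrow> real"
  defines "R \<equiv> \<lambda>x. inversion x (1 + (norm x)\<^sup>2)"
  shows "integrable lebesgue (\<lambda>y. omega y powr (4 - \<alpha> / 2) / norm (x - y) powr \<alpha> * f y)
      \<longleftrightarrow> integrable lebesgue (\<lambda>z. omega z powr (4 - \<alpha> / 2) * f (R x z))"
    "(LINT y|lebesgue. omega y powr (4 - \<alpha> / 2) / norm (x - y) powr \<alpha> * f y)
      = (omega x / 2) powr (\<alpha> / 2) * (LINT z|lebesgue. omega z powr (4 - \<alpha> / 2) * f (R x z))"
proof -
  define r where "r = 1 + (norm x)\<^sup>2"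
  have r: "r > 0" unfolding r_def by (intro add_pos_nonneg) auto
  let ?F = "\<lambda>y. omega y powr (4 - \<alpha> / 2) / norm (x - y) powr \<alpha> * f y"
  let ?c = "(omega x / 2) powr (\<alpha> / 2)"
  let ?G = "\<lambda>z. r ^ 4 / norm (z - x) ^ 8 * ?F (inversion x r z)"
  let ?H = "\<lambda>z. ?c * (omega z powr (4 - \<alpha> / 2) * f (R x z))"
  have eq: "?G z = ?H z" if "z \<notin> {x}" for z
  proof -
    define n where "n = norm (z - x)"
    have n: "n > 0" using that by (simp add: n_def)
    have o: "omega (inversion x r z) = omega z * n\<^sup>2 / r" using omega_inversion[of z x] that by (simp add: r_def n_def)
    have d: "norm (x - inversion x r z) = r / n"
      using norm_inversion[OF r, of x z] by (simp add: norm_minus_commute n_def)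
    have rn: "r ^ 4 = r powr 4" "n ^ 8 = n powr 8" "n\<^sup>2 = n powr 2" using r n by simp_all
    have "2 / t / 2 = 1 / t" if "t > 0" for t :: real using that by (simp add: field_simps)
    then have ox: "omega x / 2 = r powr (-1)" using r by (simp add: omega_def powr_minus_divide flip: r_def)
    have "r ^ 4 / n ^ 8 * ((omega z * n\<^sup>2 / r) powr (4 - \<alpha> / 2) / (r / n) powr \<alpha>)
       = ?c * omega z powr (4 - \<alpha> / 2)"
    proof -
      have "(omega z * n\<^sup>2 / r) powr (4 - \<alpha> / 2) = omega z powr (4 - \<alpha> / 2) * n powr (8 - \<alpha>) * r powr (- (4 - \<alpha> / 2))"
      proof -
        have "2 * (4 - \<alpha> / 2) = 8 - \<alpha>" by (simp add: field_simps)
        then show ?thesis unfolding rn(3) powr_divide powr_mult powr_powr powr_minus by (simp only: divide_inverse)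
      qed
      moreover have "(r / n) powr \<alpha> = r powr \<alpha> * n powr (- \<alpha>)"
        unfolding powr_divide powr_minus by (simp only: divide_inverse)
      ultimately have "r ^ 4 / n ^ 8 * ((omega z * n\<^sup>2 / r) powr (4 - \<alpha> / 2) / (r / n) powr \<alpha>)
        = omega z powr (4 - \<alpha> / 2) * (r powr 4 * r powr (- (4 - \<alpha> / 2)) * r powr (- \<alpha>)) * (n powr (- 8) * n powr (8 - \<alpha>) * n powr \<alpha>)"
        by (simp only: rn(1,2) powr_minus divide_inverse inverse_mult_distrib inverse_inverse_eq mult_ac)
      also have "r powr 4 * r powr (- (4 - \<alpha> / 2)) * r powr (- \<alpha>) = r powr (- (\<alpha> / 2))"
        by (simp add: powr_add[symmetric])
      also have "n powr (- 8) * n powr (8 - \<alpha>) * n powr \<alpha> = 1" using n by (simp add: powr_add[symmetric])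
      also have "r powr (- (\<alpha> / 2)) = ?c" unfolding ox powr_powr by simp
      finally show ?thesis by (simp add: mult_ac)
    qed
    then have "(r ^ 4 / n ^ 8 * ((omega z * n\<^sup>2 / r) powr (4 - \<alpha> / 2) / (r / n) powr \<alpha>)) * f (inversion x r z)
       = (?c * omega z powr (4 - \<alpha> / 2)) * f (inversion x r z)" by (rule arg_cong)
    then show ?thesis unfolding o d n_def[symmetric] R_def r_def[symmetric] by (simp only: mult.assoc)
  qed
  have ne: "negligible {x}" by simp
  have "?G absolutely_integrable_on UNIV \<longleftrightarrow> ?H absolutely_integrable_on UNIV"
    by (rule absolutely_integrable_spike_eq[OF ne]) (use eq in auto)
  then have i: "integrable lebesgue ?G \<longleftrightarrow> integrable lebesgue ?H" by (simp add: set_integrable_def)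
  have c0: "?c \<noteq> 0" using omega_pos[of x] by simp
  have iH: "integrable lebesgue ?H \<longleftrightarrow> integrable lebesgue (\<lambda>z. omega z powr (4 - \<alpha> / 2) * f (R x z))"
    using c0 by (simp add: integrable_mult_left_iff del: powr_eq_0_iff)
  have "(LINT z|lebesgue. ?G z) = (LINT z|lebesgue. ?H z)"
  proof (cases "integrable lebesgue ?G")
    case True
    then show ?thesis using i
      by (intro integral_cong_AE AE_off_point[of x] eq) auto
  qed (use i in \<open>simp add: not_integrable_integral_eq\<close>)
  then show "(LINT y|lebesgue. ?F y) = ?c * (LINT z|lebesgue. omega z powr (4 - \<alpha> / 2) * f (R x z))"
    using inversion_change_of_variables(2)[OF r, of x ?F] by (simp only: integral_mult_right_zero)
  show "integrable lebesgue ?F \<longleftrightarrow> integrable lebesgue (\<lambda>z. omega z powr (4 - \<alpha> / 2) * f (R x z))"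
    using inversion_change_of_variables(1)[OF r, of x ?F] i iH by blast
qed

text \<open>The reflected height is affine in \<open>omega z\<close> and \<open>xi x z\<close>, as
  it must be for an isometry of the sphere; this makes linear functions computable after the
  reflection.\<close>

lemma omega_inversion_alt:
  assumes "z \<noteq> x"
  shows "omega (inversion x (1 + (norm x)\<^sup>2) z) = omega x - omega x * omega z + omega z - omega x * xi x z"
proof -
  have "(norm (z - x))\<^sup>2 = (norm z)\<^sup>2 + (norm x)\<^sup>2 - 2 * (z \<bullet> x)"
    by (simp add: power2_norm_eq_inner inner_diff_left inner_diff_right inner_commute)
  moreover have "1 + (norm x)\<^sup>2 > 0" by (intro add_pos_nonneg) auto
  then have "1 / (1 + (norm x)\<^sup>2) = omega x / 2"
  proof -
    have "1 / t = 2 / t / 2" if "t > 0" for t :: real using that by (simp add: field_simps)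
    then show ?thesis using \<open>1 + (norm x)\<^sup>2 > 0\<close> unfolding omega_def by blast
  qed
  ultimately have "omega (inversion x (1 + (norm x)\<^sup>2) z)
    = (omega x * (omega z * (norm z)\<^sup>2) + omega z * (omega x * (norm x)\<^sup>2)) / 2 - omega x * xi x z"
    unfolding omega_inversion[OF assms] xi_def
    by (simp only: divide_inverse mult_1) (simp add: algebra_simps)
  then show ?thesis unfolding omega_norm by (simp add: algebra_simps)
qed

lemma xi_inversion:
  assumes "z \<noteq> x"
  shows "xi b (inversion x (1 + (norm x)\<^sup>2) z) = xi b z + (omega (inversion x (1 + (norm x)\<^sup>2) z) - omega z) * (x \<bullet> b)"
proof -
  define r where "r = 1 + (norm x)\<^sup>2"
  have r: "r > 0" unfolding r_def by (intro add_pos_nonneg) auto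
  have n: "norm (z - x) > 0" using assms by simp
  have "omega (inversion x r z) * ((r / (norm (z - x))\<^sup>2) * ((z - x) \<bullet> b)) = omega z * ((z - x) \<bullet> b)"
    unfolding r_def omega_inversion[OF assms] unfolding r_def[symmetric] using r n by simp
  moreover have "inversion x r z \<bullet> b = x \<bullet> b + (r / (norm (z - x))\<^sup>2) * ((z - x) \<bullet> b)"
    by (simp only: inversion_def inner_add_left inner_scaleR_left)
  ultimately have "xi b (inversion x r z) = omega (inversion x r z) * (x \<bullet> b) + omega z * ((z - x) \<bullet> b)"
    by (simp only: xi_def distrib_left)
  then show ?thesis unfolding r_def[symmetric]
    by (simp add: xi_def inner_diff_left left_diff_distrib right_diff_distrib)
qed

lemma Riesz_kernel_const:
  assumes "0 < \<alpha>" "\<alpha> < 4"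
  shows "integrable lebesgue (\<lambda>y. omega y powr (4 - \<alpha> / 2) / norm (x - y) powr \<alpha>)"
    "(LINT y|lebesgue. omega y powr (4 - \<alpha> / 2) / norm (x - y) powr \<alpha>)
      = (omega x / 2) powr (\<alpha> / 2) * (LINT z|lebesgue. omega z powr (4 - \<alpha> / 2))"
  using Riesz_kernel_inversion[of \<alpha> x "\<lambda>_. 1"] omega_powr_integral[of "4 - \<alpha> / 2"] assms by simp_all

lemma integral_odd:
  fixes f :: "real^4 \<Rightarrow> real"
  assumes "f \<in> borel_measurable borel" "\<And>x. f (- x) = - f x"
  shows "(LINT x|lebesgue. f x) = 0"
proof -
  have l: "lborel = distr lborel borel (\<lambda>x::real^4. - x)"
    using lborel_affine[of "-1" "0::real^4"] by (simp add: density_1 one_ennreal_def[symmetric])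
  have "(\<integral>x. f x \<partial>lborel) = (\<integral>x. f (- x) \<partial>lborel)"
    by (subst l, rule integral_distr) (use assms in auto)
  then have "(\<integral>x. f x \<partial>lborel) = 0" using assms by simp
  then show ?thesis using assms by (simp add: integral_completion)
qed

lemma omega_uminus [simp]: "omega (- x) = omega x" by (simp add: omega_def)

text \<open>The case of degree one of the Funk-Hecke formula: the inversion at \<open>x\<close> is the reflection of the
  sphere that exchanges \<open>S x\<close> with the pole, and the pole is an axis of symmetry of the weight.\<close>

lemma Riesz_kernel_sc:
  assumes \<alpha>: "0 < \<alpha>" "\<alpha> < 4"
  shows "integrable lebesgue (\<lambda>y. omega y powr (4 - \<alpha> / 2) / norm (x - y) powr \<alpha> * sc v y)"
    "(LINT y|lebesgue. omega y powr (4 - \<alpha> / 2) / norm (x - y) powr \<alpha> * sc v y)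
      = \<alpha> / (8 - \<alpha>) * sc v x * ((omega x / 2) powr (\<alpha> / 2) * (LINT z|lebesgue. omega z powr (4 - \<alpha> / 2)))"
proof -
  define p where "p = 4 - \<alpha> / 2"
  have p: "p > 2" using \<alpha> by (simp add: p_def)
  let ?R = "inversion x (1 + (norm x)\<^sup>2)"
  define A where "A = (LINT z|lebesgue. omega z powr p)"
  define B where "B = (LINT z|lebesgue. omega z powr (p + 1))"
  have i0: "integrable lebesgue (\<lambda>z. omega z powr p)" by (rule omega_powr_integral[OF p])
  have o1: "omega z powr p * omega z = omega z powr (p + 1)" for z by (simp add: powr_add)
  have i1: "integrable lebesgue (\<lambda>z. omega z powr p * omega z)"
    unfolding o1 using p by (intro omega_powr_integral) simp
  have ix: "integrable lebesgue (\<lambda>z. omega z powr p * xi b z)" "(LINT z|lebesgue. omega z powr p * xi b z) = 0" for b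
  proof -
    have "\<bar>xi b z\<bar> \<le> 2 * norm b" for z
    proof -
      have "sqrt 2 * norm b * sqrt (omega z) \<le> sqrt 2 * norm b * sqrt 2"
        using omega_le_2[of z] by (intro mult_left_mono) auto
      then show ?thesis using abs_xi_le[of b z] by (simp add: mult_ac)
    qed
    then show "integrable lebesgue (\<lambda>z. omega z powr p * xi b z)"
      by (intro Bochner_Integration.integrable_bound[OF integrable_mult_right[OF i0, of "2 * norm b"]] AE_I2 measurable_completion)
         (auto simp: abs_mult mult.commute intro: mult_right_mono)
    show "(LINT z|lebesgue. omega z powr p * xi b z) = 0"
      by (rule integral_odd) (auto simp: xi_def)
  qed
  \<comment> \<open>The closed form of the integrals gives B / A = 2 (p - 2) / p, and p = 4 -
    \<alpha>/2 turns 1 - B / A into the eigenvalue \<alpha> / (8 - \<alpha>).\<close>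
  have AB: "A - B = \<alpha> / (8 - \<alpha>) * A"
  proof -
    have "A = 2 powr p * pi\<^sup>2 / ((p - 1) * (p - 2))" unfolding A_def by (rule omega_powr_integral[OF p])
    moreover have "B = 2 powr p * 2 * pi\<^sup>2 / (p * (p - 1))"
      unfolding B_def using p by (subst omega_powr_integral(2)) (auto simp: powr_add)
    ultimately have "A * ((p - 1) * (p - 2)) = 2 powr p * pi\<^sup>2" "B * (p * (p - 1)) = 2 * (2 powr p * pi\<^sup>2)"
      using p by simp_all
    then have "B * (p * (p - 1)) = 2 * (A * ((p - 1) * (p - 2)))" by (simp only:)
    then have "(p - 1) * (B * p) = (p - 1) * (2 * A * (p - 2))" by (simp only: mult_ac)
    then have "B * p = 2 * A * (p - 2)" using p by (simp only: mult_cancel_left) auto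
    then have "B = A * (2 * (p - 2) / p)" using p by (simp add: field_simps)
    then have "A - B = A * (1 - 2 * (p - 2) / p)" by (simp add: algebra_simps)
    also have "1 - 2 * (p - 2) / p = \<alpha> / (8 - \<alpha>)" using \<alpha> by (simp add: p_def field_simps)
    finally show ?thesis by simp
  qed
  \<comment> \<open>After the reflection a linear function is the sum of \<open>xi u\<close>, a
    constant and a multiple of \<open>omega\<close>. The first is odd in z and integrates to zero;
    the other two have opposite coefficients \<open>sc v x\<close> and
    \<open>- sc v x\<close>.\<close>
  define u where "u = fst v - (omega x * (x \<bullet> fst v + snd v)) *\<^sub>R x"
  define c where "c = omega x * (x \<bullet> fst v + snd v) - snd v"
  define d where "d = snd v - omega x * (x \<bullet> fst v + snd v)"
  have scR: "sc v (?R z) = xi u z + c + d * omega z" if "z \<notin> {x}" for z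
  proof -
    have xu: "xi u z = xi (fst v) z - (omega x * (x \<bullet> fst v + snd v)) * xi x z"
      by (simp add: u_def xi_def inner_diff_right algebra_simps)
    show ?thesis using that unfolding sc_eq xu
      by (simp add: xi_inversion omega_inversion_alt c_def d_def algebra_simps)
  qed
  have scx: "c = sc v x" "d = - sc v x" by (simp_all add: c_def d_def sc_eq xi_def algebra_simps)
  let ?G = "\<lambda>z. omega z powr p * (xi u z + c + d * omega z)"
  have iG: "integrable lebesgue ?G"
    using i0 i1 ix(1)[of u] by (simp add: distrib_left mult.left_commute[of _ d])
  have IG: "(LINT z|lebesgue. ?G z) = sc v x * (A - B)"
  proof -
    have "(LINT z|lebesgue. ?G z) = (LINT z|lebesgue. omega z powr p * xi u z + c * omega z powr p + d * (omega z powr p * omega z))"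
      by (intro Bochner_Integration.integral_cong refl) (simp add: algebra_simps)
    also have "\<dots> = 0 + c * A + d * B" using i0 i1 ix[of u] by (simp add: A_def B_def o1)
    finally show ?thesis by (simp add: scx algebra_simps)
  qed
  have ne: "negligible {x}" by simp
  have "(\<lambda>z. omega z powr p * sc v (?R z)) absolutely_integrable_on UNIV \<longleftrightarrow> ?G absolutely_integrable_on UNIV"
    by (rule absolutely_integrable_spike_eq[OF ne]) (use scR in auto)
  then have i: "integrable lebesgue (\<lambda>z. omega z powr p * sc v (?R z))" using iG by (simp add: set_integrable_def)
  have e: "(LINT z|lebesgue. omega z powr p * sc v (?R z)) = (LINT z|lebesgue. ?G z)"
    using i iG scR by (intro integral_cong_AE AE_off_point[of x]) auto
  show "integrable lebesgue (\<lambda>y. omega y powr (4 - \<alpha> / 2) / norm (x - y) powr \<alpha> * sc v y)"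
    using Riesz_kernel_inversion(1)[of \<alpha> x "sc v"] i by (simp add: p_def)
  show "(LINT y|lebesgue. omega y powr (4 - \<alpha> / 2) / norm (x - y) powr \<alpha> * sc v y)
      = \<alpha> / (8 - \<alpha>) * sc v x * ((omega x / 2) powr (\<alpha> / 2) * (LINT z|lebesgue. omega z powr (4 - \<alpha> / 2)))"
    unfolding Riesz_kernel_inversion(2)[of \<alpha> x "sc v"] using e IG AB by (simp add: p_def A_def)
qed

section \<open>Cutoffs\<close>

lemma partial_cong_open:
  assumes "open U" "x \<in> U" "\<And>y. y \<in> U \<Longrightarrow> f y = g y"
  shows "partial b f x = partial b g x"
proof -
  have "(f has_derivative D) (at x) \<longleftrightarrow> (g has_derivative D) (at x)" for D
    using has_derivative_transform_within_open[of f D x UNIV U g] has_derivative_transform_within_open[of g D x UNIV U f] assms by auto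
  then show ?thesis by (simp add: partial_def frechet_derivative_def)
qed

lemma laplacian_cong_open:
  assumes "open U" "x \<in> U" "\<And>y. y \<in> U \<Longrightarrow> f y = g y"
  shows "laplacian f x = laplacian g x"
  unfolding laplacian_def
  by (intro sum.cong refl partial_cong_open[OF assms(1,2)] partial_cong_open[OF assms(1) _ assms(3)])

lemma cut_test_fun:
  assumes "cut G" "k > 0" shows "test_fun (\<lambda>x. G (k * omega x))"
proof (rule test_fun_support)
  show "smooth (\<lambda>x. G (k * omega x))" using symb_smooth[OF symb_cut[OF assms(1)]] .
  show "bounded {x. G (k * omega x) \<noteq> 0}"
  proof (rule boundedI)
    fix x assume "x \<in> {x. G (k * omega x) \<noteq> 0}"
    then have "k * omega x \<ge> 1" using assms(1) by (auto simp: cut_def not_less[symmetric])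
    moreover have "1 + (norm x)\<^sup>2 > 0" by (intro add_pos_nonneg) auto
    ultimately have "1 + (norm x)\<^sup>2 \<le> 2 * k" by (simp add: omega_def field_simps)
    then have "(norm x)\<^sup>2 \<le> 2 * k" by simp
    then show "norm x \<le> sqrt (2 * k)" by (simp add: real_le_rsqrt)
  qed
qed

text \<open>A function of \<open>omega\<close> rather than of |x|, so that all cutoffs form one
  symbol with the parameter k = n + 1 and share its uniform estimates.\<close>

definition cutoff :: "nat \<Rightarrow> (real^4 \<Rightarrow> real) \<Rightarrow> real^4 \<Rightarrow> real" where
  "cutoff n f x = eta (real (Suc n) * omega x) * f x"

text \<open>The strict inequality keeps the set open, so that on it the derivatives of a cutoff
  agree with those of the function.\<close>

definition core :: "nat \<Rightarrow> (real^4) set" where "core n = {x. real (Suc n) * omega x > 2}"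

lemma open_core: "open (core n)"
  unfolding core_def
  by (intro open_Collect_less continuous_intros smooth_continuous omega_smooth)

lemma eventually_core: "eventually (\<lambda>n. x \<in> core n) sequentially"
proof -
  obtain N where N: "real N > 2 / omega x" using reals_Archimedean2 by blast
  have "x \<in> core n" if "n \<ge> N" for n
  proof -
    have "2 / omega x < real (Suc n)" using N that by simp
    then show ?thesis by (simp add: core_def field_simps)
  qed
  then show ?thesis by (auto simp: eventually_sequentially)
qed

lemma cutoff_core: "x \<in> core n \<Longrightarrow> cutoff n f x = f x"
  by (simp add: cutoff_def core_def eta_1)

lemma cutoff_test_fun: "smooth f \<Longrightarrow> test_fun (cutoff n f)"
  using test_fun_mult[OF _ cut_test_fun[OF cut_eta], of f "real (Suc n)"]
  by (simp add: cutoff_def[abs_def] mult.commute)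

lemma cutoff_symb:
  assumes "symb w (\<lambda>k. f)" obtains F where "symb w F" "\<And>n. cutoff n f = F (real (Suc n))"
  using that[of "\<lambda>k x. eta (k * omega x) * f x"] symb_mult[OF symb_cut[OF cut_eta] assms]
  by (simp add: cutoff_def[abs_def])

lemma cutoff_limit: "(\<lambda>n. cutoff n f x) \<longlonglongrightarrow> f x"
  "(\<lambda>n. partial b (cutoff n f) x) \<longlonglongrightarrow> partial b f x"
  "(\<lambda>n. laplacian (cutoff n f) x) \<longlonglongrightarrow> laplacian f x"
proof -
  have e: "partial b (cutoff n f) x = partial b f x" "laplacian (cutoff n f) x = laplacian f x" if "x \<in> core n" for n
    by (rule partial_cong_open[OF open_core that cutoff_core], assumption)
       (rule laplacian_cong_open[OF open_core that cutoff_core])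
  show "(\<lambda>n. cutoff n f x) \<longlonglongrightarrow> f x" "(\<lambda>n. partial b (cutoff n f) x) \<longlonglongrightarrow> partial b f x"
    "(\<lambda>n. laplacian (cutoff n f) x) \<longlonglongrightarrow> laplacian f x"
    by (intro tendsto_eventually eventually_mono[OF eventually_core[of x]] e cutoff_core; assumption)+
qed

section \<open>The measure of the sphere\<close>

text \<open>The surface measure of the sphere in the stereographic chart; omega^4 is the
  Jacobian.\<close>

definition M4 :: "(real^4) measure" where "M4 = density lebesgue (\<lambda>x. ennreal (omega x ^ 4))"

lemma omega_lebesgue_measurable [measurable]: "omega \<in> borel_measurable lebesgue"
  using smooth_lebesgue_measurable[OF omega_smooth] .

lemma sets_M4 [simp, measurable_cong]: "sets M4 = sets lebesgue" by (simp add: M4_def)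
lemma space_M4 [simp]: "space M4 = UNIV" by (simp add: M4_def)
lemma measurable_M4 [simp]: "borel_measurable M4 = borel_measurable lebesgue"
  by (rule measurable_cong_sets) auto

lemma AE_M4: "(AE x in M4. P x) \<longleftrightarrow> (AE x in lebesgue. P x)"
proof -
  have "0 < omega x ^ 4" for x by simp
  then show ?thesis unfolding M4_def by (subst AE_density) auto
qed

lemma integral_M4:
  "f \<in> borel_measurable lebesgue \<Longrightarrow> (LINT x|M4. f x) = (LINT x|lebesgue. omega x ^ 4 * f x)"
  unfolding M4_def by (subst integral_density) auto

lemma integrable_M4:
  "f \<in> borel_measurable lebesgue \<Longrightarrow> integrable M4 f \<longleftrightarrow> integrable lebesgue (\<lambda>x. omega x ^ 4 * f x)"
  unfolding M4_def by (subst integrable_density) auto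

lemma omega_powr_nat: "omega x powr real n = omega x ^ n"
  by (simp add: powr_realpow)

lemma M4_const: "integrable M4 (\<lambda>x. c :: real)" "(LINT x|M4. c) = c * (8 * pi\<^sup>2 / 3)"
proof -
  have "2 powr real 4 = (16::real)" by (subst powr_realpow) auto
  then have *: "integrable lebesgue (\<lambda>x. omega x ^ 4)" "(LINT x|lebesgue. omega x ^ 4) = 8 * pi\<^sup>2 / 3"
    using omega_powr_integral[of "real 4"] unfolding omega_powr_nat by simp_all
  show "integrable M4 (\<lambda>x. c)" using *(1) by (subst integrable_M4) auto
  have "(LINT x|M4. c) = (LINT x|lebesgue. omega x ^ 4 * c)" by (rule integral_M4) auto
  then show "(LINT x|M4. c) = c * (8 * pi\<^sup>2 / 3)" using * by simp
qed

lemma bounded_integrable_M4: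
  fixes f :: "real^4 \<Rightarrow> real"
  assumes "f \<in> borel_measurable lebesgue" "\<And>x. \<bar>f x\<bar> \<le> C" shows "integrable M4 f"
  by (rule Bochner_Integration.integrable_bound[OF M4_const(1)[of C]]) (use assms(1) order_trans[OF assms(2) abs_ge_self] in auto)

lemma bounded_L2fn_M4:
  assumes "f \<in> borel_measurable lebesgue" "\<And>x. \<bar>f x\<bar> \<le> C" shows "f \<in> L2fn M4"
proof (rule L2fnI)
  have "\<bar>(f x)\<^sup>2\<bar> \<le> C\<^sup>2" for x using assms(2)[of x] abs_le_square_iff[of "f x" C] by fastforce
  then show "integrable M4 (\<lambda>x. (f x)\<^sup>2)" using assms(1) by (intro bounded_integrable_M4) auto
qed (use assms in auto)

lemma spol_bounded: assumes "spol n f" obtains C where "C \<ge> 0" "\<And>x. \<bar>f x\<bar> \<le> C"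
proof -
  obtain C where "C \<ge> 0" "\<And>x. \<bar>f x\<bar> \<le> C" using symb_bound[OF spol_symb0[OF assms]] by auto
  then show ?thesis using that by blast
qed

lemma spol_measurable: "spol n f \<Longrightarrow> f \<in> borel_measurable lebesgue"
  by (intro smooth_lebesgue_measurable spol_smooth)

lemma spol_L2fn: "spol n f \<Longrightarrow> f \<in> L2fn M4"
  using bounded_L2fn_M4 spol_measurable by (metis spol_bounded)

lemma omega_L1: "p > 2 \<Longrightarrow> integrable lebesgue (\<lambda>x. omega x powr p)"
  by (rule omega_powr_integral)

subsection \<open>Totality of the polynomials\<close>

lemma norm_stereo: "norm (stereo x) = 1"
proof -
  have n: "1 + (norm x)\<^sup>2 > 0" by (intro add_pos_nonneg) auto
  have "stereo x = (omega x *\<^sub>R x, omega x - 1)"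
    using n by (simp add: stereo_def omega_def field_simps)
  then have "(norm (stereo x))\<^sup>2 = (omega x)\<^sup>2 * (norm x)\<^sup>2 + (omega x - 1)\<^sup>2"
    by (simp add: norm_Pair power_mult_distrib)
  also have "(omega x)\<^sup>2 * (norm x)\<^sup>2 = omega x * (2 - omega x)"
    using omega_norm[of x] by (simp add: power2_eq_square)
  finally have "(norm (stereo x))\<^sup>2 = 1" by (simp add: power2_eq_square algebra_simps)
  then show ?thesis by (simp add: power2_eq_1_iff) (metis norm_ge_zero not_one_le_zero le_minus_one_simps(3))
qed

lemma stereo_alt: "stereo x = (omega x *\<^sub>R x, omega x - 1)"
proof -
  have n: "1 + (norm x)\<^sup>2 > 0" by (intro add_pos_nonneg) auto
  then show ?thesis by (simp add: stereo_def omega_def field_simps)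
qed

lemma stereo_inj: "stereo x = stereo y \<Longrightarrow> x = y"
  by (auto simp: stereo_alt)

lemma continuous_stereo: "continuous_on S stereo"
  unfolding stereo_alt[abs_def] by (intro continuous_intros smooth_continuous omega_smooth)

text \<open>Stone-Weierstrass on the compact sphere: uniform closeness of polynomials is enough
  against an integrable \<open>h\<close>. It is essential that \<open>F\<close> is continuous at the
  missing pole as well.\<close>

lemma spol_total_aux:
  fixes h :: "real^4 \<Rightarrow> real" and F :: "(real^4) \<times> real \<Rightarrow> real"
  assumes h: "integrable lebesgue h" and orth: "\<And>n f. spol n f \<Longrightarrow> (LINT x|lebesgue. h x * f x) = 0"
    and F: "continuous_on UNIV F"
  shows "integrable lebesgue (\<lambda>x. h x * F (stereo x))" "(LINT x|lebesgue. h x * F (stereo x)) = 0"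
proof -
  have cF: "continuous_on UNIV (\<lambda>x. F (stereo x))"
    using continuous_on_compose2[OF F continuous_stereo] by auto
  have cS: "continuous_on (sphere 0 1) F" using F continuous_on_subset by blast
  then have "bounded (F ` sphere 0 1)" by (intro compact_imp_bounded compact_continuous_image) auto
  then obtain B where B: "\<And>y. y \<in> sphere 0 1 \<Longrightarrow> \<bar>F y\<bar> \<le> B"
    unfolding bounded_real by blast
  have st: "stereo x \<in> sphere 0 1" for x by (simp add: norm_stereo)
  have prod: "integrable lebesgue (\<lambda>x. h x * g x)" if "g \<in> borel_measurable lebesgue" "\<And>x. \<bar>g x\<bar> \<le> C" for g C
    using that h
    by (intro Bochner_Integration.integrable_bound[OF integrable_mult_left[OF integrable_abs[OF h], of C]])
       (auto simp: abs_mult intro!: mult_left_mono order_trans[OF that(2)])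
  show iF: "integrable lebesgue (\<lambda>x. h x * F (stereo x))"
    using B st cF continuous_lebesgue_measurable by (intro prod[of _ B]) auto
  have "\<bar>LINT x|lebesgue. h x * F (stereo x)\<bar> \<le> 0 + e" if e: "e > 0" for e
  proof -
    define A where "A = (LINT x|lebesgue. \<bar>h x\<bar>)"
    have A: "A \<ge> 0" by (simp add: A_def)
    have e': "e / (A + 1) > 0" using e A by simp
    obtain g where g: "real_polynomial_function g" "\<And>y. y \<in> sphere 0 1 \<Longrightarrow> \<bar>F y - g y\<bar> < e / (A + 1)"
      using Stone_Weierstrass_real_polynomial_function[OF compact_sphere cS e'] by blast
    obtain n where n: "spol n (\<lambda>x. g (stereo x))" using spol_real_polynomial[OF g(1)] by blast
    obtain C where "\<And>x. \<bar>g (stereo x)\<bar> \<le> C" using spol_bounded[OF n] by blast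
    then have ig: "integrable lebesgue (\<lambda>x. h x * g (stereo x))"
      using spol_measurable[OF n] by (intro prod) auto
    have "(LINT x|lebesgue. h x * F (stereo x)) = (LINT x|lebesgue. h x * F (stereo x) - h x * g (stereo x))"
      using iF ig orth[OF n] by simp
    also have "\<bar>\<dots>\<bar> \<le> (LINT x|lebesgue. \<bar>h x\<bar> * (e / (A + 1)))"
    proof (rule order_trans[OF integral_abs_bound], rule integral_mono)
      show "integrable lebesgue (\<lambda>x. \<bar>h x * F (stereo x) - h x * g (stereo x)\<bar>)" using iF ig by simp
      show "integrable lebesgue (\<lambda>x. \<bar>h x\<bar> * (e / (A + 1)))" using h by simp
      show "\<bar>h x * F (stereo x) - h x * g (stereo x)\<bar> \<le> \<bar>h x\<bar> * (e / (A + 1))" for x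
        using g(2)[OF st, of x] by (simp only: right_diff_distrib[symmetric] abs_mult) (intro mult_left_mono, auto)
    qed
    also have "\<dots> = A * (e / (A + 1))" by (simp add: A_def)
    also have "\<dots> \<le> e" using A e by (simp add: field_simps)
    finally show ?thesis by simp
  qed
  then have "\<bar>LINT x|lebesgue. h x * F (stereo x)\<bar> \<le> 0" by (rule field_le_epsilon)
  then show "(LINT x|lebesgue. h x * F (stereo x)) = 0" by simp
qed

text \<open>Indicators of compact sets are limits of continuous functions on the sphere, so
  \<open>h\<close> integrates to zero over every compact set. Exhausting the sets where
  \<open>h\<close> is positive or negative by compact sets shows that both are null.\<close>

lemma spol_total:
  assumes h: "integrable lebesgue h" and orth: "\<And>n f. spol n f \<Longrightarrow> (LINT x|lebesgue. h x * f x) = 0"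
  shows "AE x in lebesgue. h x = 0"
proof -
  have comp: "(LINT x|lebesgue. h x * indicator K x) = 0" if K: "compact K" "K \<noteq> {}" for K
  proof -
    \<comment> \<open>Tents of slope n around the image of \<open>K\<close>. The image is closed and
      \<open>stereo\<close> is injective, so they converge to the indicator of
      \<open>K\<close>.\<close>
    define F where "F n y = max 0 (1 - real n * infdist y (stereo ` K))" for n y
    have cF: "continuous_on UNIV (F n)" for n
      unfolding F_def by (intro continuous_intros)
    have cl: "closed (stereo ` K)"
      by (intro compact_imp_closed compact_continuous_image continuous_stereo K)
    have "(\<lambda>n. LINT x|lebesgue. h x * F n (stereo x)) \<longlonglongrightarrow> (LINT x|lebesgue. h x * indicator K x)"
    proof (rule integral_dominated_convergence[where w="\<lambda>x. \<bar>h x\<bar>"])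
      have "K \<in> sets lebesgue" using K by (simp add: lmeasurable_compact fmeasurableD)
      then show "(\<lambda>x. h x * indicator K x) \<in> borel_measurable lebesgue"
        using h by (intro borel_measurable_times borel_measurable_integrable borel_measurable_indicator) auto
      show "(\<lambda>x. h x * F n (stereo x)) \<in> borel_measurable lebesgue" for n
        using spol_total_aux(1)[OF h orth cF] by auto
      show "integrable lebesgue (\<lambda>x. \<bar>h x\<bar>)" using h by simp
      show "AE x in lebesgue. (\<lambda>n. h x * F n (stereo x)) \<longlonglongrightarrow> h x * indicator K x"
      proof (intro AE_I2 tendsto_mult tendsto_const)
        fix x
        show "(\<lambda>n. F n (stereo x)) \<longlonglongrightarrow> indicator K x"
        proof (cases "x \<in> K")
          case True
          then have "infdist (stereo x) (stereo ` K) = 0" by simp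
          then show ?thesis using True by (simp add: F_def)
        next
          case False
          then have "stereo x \<notin> stereo ` K" using stereo_inj by auto
          then have d: "infdist (stereo x) (stereo ` K) > 0"
            using in_closed_iff_infdist_zero[OF cl] K infdist_nonneg[of "stereo x" "stereo ` K"] by fastforce
          obtain N where N: "real N > 1 / infdist (stereo x) (stereo ` K)" using reals_Archimedean2 by blast
          have "F n (stereo x) = 0" if "n \<ge> N" for n
          proof -
            have "1 / infdist (stereo x) (stereo ` K) < real n" using N that by linarith
            then show ?thesis using d by (simp add: F_def field_simps)
          qed
          then have "eventually (\<lambda>n. F n (stereo x) = 0) sequentially" by (auto simp: eventually_sequentially)
          then show ?thesis using False by (simp add: tendsto_eventually)
        qed
      qed
      show "AE x in lebesgue. norm (h x * F n (stereo x)) \<le> \<bar>h x\<bar>" for n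
      proof (intro AE_I2)
        fix x
        have "\<bar>F n (stereo x)\<bar> \<le> 1" by (simp add: F_def infdist_nonneg)
        then show "norm (h x * F n (stereo x)) \<le> \<bar>h x\<bar>"
          using mult_left_mono[of "\<bar>F n (stereo x)\<bar>" 1 "\<bar>h x\<bar>"] by (simp add: abs_mult)
      qed
    qed
    then show ?thesis using spol_total_aux(2)[OF h orth cF] by (simp add: LIMSEQ_const_iff)
  qed
  have null: "K \<in> null_sets lebesgue" if K: "compact K" "\<And>x. x \<in> K \<Longrightarrow> s * h x > 0" for K s
  proof (cases "K = {}")
    case False
    have Ks: "K \<in> sets lebesgue" using K by (simp add: lmeasurable_compact fmeasurableD)
    have i: "integrable lebesgue (\<lambda>x. h x * indicator K x)"
      using Ks h by (intro integrable_real_mult_indicator) auto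
    have "(LINT x|lebesgue. s * (h x * indicator K x)) = 0"
      using comp[OF K(1) False] by simp
    moreover have "AE x in lebesgue. 0 \<le> s * (h x * indicator K x)"
      using K(2) by (auto simp: indicator_def intro: less_imp_le)
    ultimately have "AE x in lebesgue. s * (h x * indicator K x) = 0"
      using i integral_nonneg_eq_0_iff_AE[of lebesgue "\<lambda>x. s * (h x * indicator K x)"] by simp
    then have "AE x in lebesgue. x \<notin> K"
    proof eventually_elim
      case (elim x)
      then show ?case using K(2)[of x] by (auto simp: indicator_def)
    qed
    then show ?thesis using Ks AE_iff_null_sets by blast
  qed simp
  have "negligible {x. s * h x > 0}" for s
  proof -
    have "{x. s * h x > 0} \<in> sets lebesgue"
      using borel_measurable_less[of "\<lambda>_. 0" lebesgue "\<lambda>x. s * h x"] h by auto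
    then obtain C T where CT: "fsigma C" "T \<in> null_sets lebesgue" "C \<union> T = {x. s * h x > 0}"
      by (rule lebesgue_set_almost_fsigma)
    then obtain Fn :: "nat \<Rightarrow> (real^4) set" where Fn: "range Fn \<subseteq> Collect compact" "C = \<Union>(range Fn)"
      unfolding fsigma_Union_compact by blast
    have "negligible (Fn n)" for n
      unfolding negligible_iff_null_sets by (rule null[of _ s]) (use Fn CT in auto)
    then have "negligible C" unfolding Fn(2) by (rule negligible_Union_nat)
    then have "negligible (C \<union> T)" using CT(2) by (intro negligible_Un) (simp_all add: negligible_iff_null_sets)
    then show ?thesis by (simp only: CT(3))
  qed
  from this[of 1] this[of "-1"] have "negligible ({x. 1 * h x > 0} \<union> {x. -1 * h x > 0})"
    by (rule negligible_Un)
  then have "{x. h x \<noteq> 0} \<in> null_sets lebesgue"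
    unfolding negligible_iff_null_sets[symmetric] by (rule negligible_subset) auto
  then show ?thesis by (rule AE_I') auto
qed

text \<open>The cutoffs of \<open>g\<close> annihilate the polynomials on the sphere, which are total.\<close>

lemma test_fun_total:
  fixes g :: "real^4 \<Rightarrow> real"
  assumes g: "g \<in> L1_loc" and orth: "\<And>\<psi>. test_fun \<psi> \<Longrightarrow> (LINT x|lebesgue. g x * \<psi> x) = 0"
  shows "AE x in lebesgue. g x = 0"
proof -
  have "AE x in lebesgue. g x * eta (real (Suc n) * omega x) = 0" for n
  proof (rule spol_total)
    show "integrable lebesgue (\<lambda>x. g x * eta (real (Suc n) * omega x))"
      by (intro L1_loc_mult_test g cut_test_fun cut_eta) simp
    fix m f assume "spol m f"
    then have "test_fun (cutoff n f)" by (intro cutoff_test_fun spol_smooth)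
    from orth[OF this] show "(LINT x|lebesgue. g x * eta (real (Suc n) * omega x) * f x) = 0"
      by (simp add: cutoff_def mult.assoc)
  qed
  then have "AE x in lebesgue. \<forall>n. g x * eta (real (Suc n) * omega x) = 0" unfolding AE_all_countable by blast
  then show ?thesis
  proof eventually_elim
    case (elim x)
    obtain n where "x \<in> core n" using eventually_happens[OF eventually_core[of x]] by auto
    then show ?case using elim[rule_format, of n] by (simp add: core_def eta_1)
  qed
qed

lemma spol_total_M4:
  assumes h: "h \<in> L2fn M4" and orth: "\<And>n f. spol n f \<Longrightarrow> (LINT x|M4. h x * f x) = 0"
  shows "AE x in lebesgue. h x = 0"
proof -
  have hm: "h \<in> borel_measurable lebesgue" using L2fn_measurable[OF h] by simp
  have "integrable M4 (\<lambda>x. h x * 1)" by (rule L2fn_mult[OF h]) (rule bounded_L2fn_M4[of _ 1], auto)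
  then have i: "integrable lebesgue (\<lambda>x. omega x ^ 4 * h x)" using hm by (simp add: integrable_M4)
  have "AE x in lebesgue. omega x ^ 4 * h x = 0"
  proof (rule spol_total[OF i])
    fix n f assume f: "spol n f"
    then show "(LINT x|lebesgue. omega x ^ 4 * h x * f x) = 0"
      using orth[OF f] hm spol_measurable[OF f] by (simp add: integral_M4 mult.assoc)
  qed
  then show ?thesis by eventually_elim simp
qed

section \<open>The algebra of polynomials on the sphere and its density in L^2\<close>

definition Pol :: "(real^4 \<Rightarrow> real) set" where "Pol = {f. \<exists>n. spol n f}"

lemma Pol_L2fn: "f \<in> Pol \<Longrightarrow> f \<in> L2fn M4"
  by (auto simp: Pol_def spol_L2fn)

lemma Pol_smooth: "f \<in> Pol \<Longrightarrow> smooth f"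
  by (auto simp: Pol_def spol_smooth)

lemma Pol_measurable: "f \<in> Pol \<Longrightarrow> f \<in> borel_measurable lebesgue"
  by (auto simp: Pol_def spol_measurable)

lemma Pol_add: "f \<in> Pol \<Longrightarrow> g \<in> Pol \<Longrightarrow> (\<lambda>x. f x + g x) \<in> Pol"
proof -
  assume "f \<in> Pol" "g \<in> Pol"
  then obtain n m where "spol n f" "spol m g" by (auto simp: Pol_def)
  then have "spol (max n m) (\<lambda>x. f x + g x)"
    using spol_mono[of n f "max n m"] spol_mono[of m g "max n m"] by (intro spol_add) auto
  then show ?thesis by (auto simp: Pol_def)
qed

lemma Pol_cmult: "f \<in> Pol \<Longrightarrow> (\<lambda>x. c * f x) \<in> Pol"
  using spol_cmult by (auto simp: Pol_def)

lemma Pol_diff: "f \<in> Pol \<Longrightarrow> g \<in> Pol \<Longrightarrow> (\<lambda>x. f x - g x) \<in> Pol"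
  using Pol_add[of f "\<lambda>x. -1 * g x"] Pol_cmult[of g "-1"] by simp

lemma Pol_mult: "f \<in> Pol \<Longrightarrow> g \<in> Pol \<Longrightarrow> (\<lambda>x. f x * g x) \<in> Pol"
  using spol_mult unfolding Pol_def by blast

lemma Pol_Lop: "f \<in> Pol \<Longrightarrow> Lop f \<in> Pol"
  using spol_Lop_spol by (auto simp: Pol_def)

lemma Pol_const: "(\<lambda>x. c) \<in> Pol" using spol_const by (auto simp: Pol_def)

lemma Pol_sc: "sc v \<in> Pol" unfolding Pol_def using spol_sc[of v] by blast

lemma Pol_sum: "(\<And>i. i \<in> I \<Longrightarrow> f i \<in> Pol) \<Longrightarrow> (\<lambda>x. \<Sum>i\<in>I. f i x) \<in> Pol"
  by (induction I rule: infinite_finite_induct) (auto intro: Pol_add Pol_const)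

lemma Pol_bounded: assumes "f \<in> Pol" obtains C where "C \<ge> 0" "\<And>x. \<bar>f x\<bar> \<le> C"
  using assms spol_bounded unfolding Pol_def by blast

lemma Pol_symb0: "f \<in> Pol \<Longrightarrow> symb 0 (\<lambda>k. f)"
  by (auto simp: Pol_def spol_symb0)

lemma Pol_integrable: "f \<in> Pol \<Longrightarrow> g \<in> Pol \<Longrightarrow> integrable M4 (\<lambda>x. f x * g x)"
  by (intro L2fn_mult Pol_L2fn)

lemma Pol_total:
  assumes "h \<in> L2fn M4" "\<And>f. f \<in> Pol \<Longrightarrow> (LINT x|M4. h x * f x) = 0"
  shows "AE x in lebesgue. h x = 0"
  by (rule spol_total_M4[OF assms(1)]) (use assms(2) in \<open>auto simp: Pol_def\<close>)

lemma Pol_dense: "u \<in> L2fn M4 \<Longrightarrow> \<exists>f. (\<forall>n. f n \<in> Pol) \<and> L2conv M4 f u"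
proof (rule L2fn_dense)
  show "Pol \<subseteq> L2fn M4" using Pol_L2fn by blast
  show "Pol \<noteq> {}" using Pol_const by blast
  show "(\<lambda>x. f x + c * g x) \<in> Pol" if "f \<in> Pol" "g \<in> Pol" for f g c
    using that by (intro Pol_add Pol_cmult)
  show "AE x in M4. h x = 0" if "h \<in> L2fn M4" "\<And>f. f \<in> Pol \<Longrightarrow> (LINT x|M4. h x * f x) = 0" for h
    unfolding AE_M4 using Pol_total that by blast
qed

subsection \<open>Symmetry of the operators\<close>

text \<open>Integration by parts is legitimate after cutting off \<open>g\<close>. The limit is
  harmless: the gradients of \<open>f\<close> and of all cutoffs of \<open>g\<close> are at most a
  constant times omega^(1/2), and omega^3 is integrable.\<close>

lemma Dirichlet_form:
  assumes f: "f \<in> Pol" and g: "g \<in> Pol"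
  shows "(LINT x|M4. Lop f x * g x) = - (\<Sum>b\<in>Basis. LINT x|lebesgue. (omega x)\<^sup>2 * partial b f x * partial b g x)"
proof -
  have sf: "smooth f" "smooth g" "smooth (Lop f)" using f g by (auto intro: Pol_smooth Pol_Lop)
  have so: "smooth (\<lambda>x. (omega x)\<^sup>2 * partial b f x)" if "b \<in> Basis" for b
    using sf that by (intro smooth_mult smooth_power omega_smooth smooth_partial)
  obtain F where F: "symb 0 F" "\<And>n. cutoff n g = F (real (Suc n))" using cutoff_symb[OF Pol_symb0[OF g]] by blast
  obtain Cg where Cg: "\<And>n x. \<bar>cutoff n g x\<bar> \<le> Cg" using symb_bound[OF F(1)] F(2) by auto
  obtain CL where CL: "CL \<ge> 0" "\<And>x. \<bar>Lop f x\<bar> \<le> CL" using Pol_bounded[OF Pol_Lop[OF f]] by blast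
  have tg: "test_fun (cutoff n g)" for n using sf by (intro cutoff_test_fun)
  have byparts: "(LINT x|lebesgue. omega x ^ 4 * (Lop f x * cutoff n g x))
     = - (\<Sum>b\<in>Basis. LINT x|lebesgue. (omega x)\<^sup>2 * partial b f x * partial b (cutoff n g) x)" for n
  proof -
    have i: "integrable lebesgue (\<lambda>x. partial b (\<lambda>x. (omega x)\<^sup>2 * partial b f x) x * cutoff n g x)" if "b \<in> Basis" for b
      using so that tg by (intro L1_loc_mult_test smooth_L1_loc smooth_partial)
    have "(LINT x|lebesgue. omega x ^ 4 * (Lop f x * cutoff n g x))
       = (LINT x|lebesgue. (\<Sum>b\<in>Basis. partial b (\<lambda>x. (omega x)\<^sup>2 * partial b f x) x * cutoff n g x))"
      by (simp add: Lop_divergence[OF sf(1), symmetric] sum_distrib_right mult.assoc[symmetric])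
    also have "\<dots> = (\<Sum>b\<in>Basis. LINT x|lebesgue. partial b (\<lambda>x. (omega x)\<^sup>2 * partial b f x) x * cutoff n g x)"
      using i by (intro Bochner_Integration.integral_sum)
    also have "\<dots> = (\<Sum>b\<in>Basis. - (LINT x|lebesgue. (omega x)\<^sup>2 * partial b f x * partial b (cutoff n g) x))"
      using integral_by_parts[OF so tg] by (intro sum.cong refl) simp
    finally show ?thesis by (simp add: sum_negf)
  qed
  have "(\<lambda>n. LINT x|lebesgue. omega x ^ 4 * (Lop f x * cutoff n g x)) \<longlonglongrightarrow> (LINT x|lebesgue. omega x ^ 4 * (Lop f x * g x))"
  proof (rule integral_dominated_convergence[where w="\<lambda>x. omega x powr real 4 * (CL * Cg)"])
    show "integrable lebesgue (\<lambda>x. omega x powr real 4 * (CL * Cg))" by (intro integrable_mult_left omega_L1) simp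
    show "AE x in lebesgue. norm (omega x ^ 4 * (Lop f x * cutoff n g x)) \<le> omega x powr real 4 * (CL * Cg)" for n
      using CL Cg unfolding omega_powr_nat by (auto simp: abs_mult intro!: mult_left_mono mult_mono)
    show "(\<lambda>x. omega x ^ 4 * (Lop f x * cutoff n g x)) \<in> borel_measurable lebesgue" for n
      by (intro smooth_lebesgue_measurable smooth_mult smooth_power omega_smooth sf test_fun_smooth[OF tg])
    show "(\<lambda>x. omega x ^ 4 * (Lop f x * g x)) \<in> borel_measurable lebesgue"
      using sf by (intro smooth_lebesgue_measurable smooth_mult smooth_power omega_smooth)
    show "AE x in lebesgue. (\<lambda>n. omega x ^ 4 * (Lop f x * cutoff n g x)) \<longlonglongrightarrow> omega x ^ 4 * (Lop f x * g x)"
      by (intro AE_I2 tendsto_mult tendsto_const cutoff_limit)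
  qed
  moreover have "(\<lambda>n. LINT x|lebesgue. (omega x)\<^sup>2 * partial b f x * partial b (cutoff n g) x)
     \<longlonglongrightarrow> (LINT x|lebesgue. (omega x)\<^sup>2 * partial b f x * partial b g x)" if b: "b \<in> Basis" for b
  proof -
    obtain A where A: "A \<ge> 0" "\<And>x. \<bar>partial b f x\<bar> \<le> A * sqrt (omega x)"
      using symb_bound[OF symb_partial[OF Pol_symb0[OF f]], of b] by auto
    obtain B where B: "B \<ge> 0" "\<And>n x. \<bar>partial b (cutoff n g) x\<bar> \<le> B * sqrt (omega x)"
      using symb_bound[OF symb_partial[OF F(1)], of b] F(2) by auto
    show ?thesis
    proof (rule integral_dominated_convergence[where w="\<lambda>x. omega x powr real 3 * (A * B)"])
      show "integrable lebesgue (\<lambda>x. omega x powr real 3 * (A * B))" by (intro integrable_mult_left omega_L1) simp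
      show "AE x in lebesgue. norm ((omega x)\<^sup>2 * partial b f x * partial b (cutoff n g) x) \<le> omega x powr real 3 * (A * B)" for n
      proof (intro AE_I2)
        fix x
        have "norm ((omega x)\<^sup>2 * partial b f x * partial b (cutoff n g) x)
          = (omega x)\<^sup>2 * (\<bar>partial b f x\<bar> * \<bar>partial b (cutoff n g) x\<bar>)" by (simp add: abs_mult)
        also have "\<dots> \<le> (omega x)\<^sup>2 * ((A * sqrt (omega x)) * (B * sqrt (omega x)))"
          using A B by (intro mult_left_mono mult_mono) auto
        also have "\<dots> = omega x powr real 3 * (A * B)"
          unfolding omega_powr_nat by (simp add: power2_eq_square power3_eq_cube)
        finally show "norm ((omega x)\<^sup>2 * partial b f x * partial b (cutoff n g) x) \<le> omega x powr real 3 * (A * B)" .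
      qed
      show "(\<lambda>x. (omega x)\<^sup>2 * partial b f x * partial b (cutoff n g) x) \<in> borel_measurable lebesgue" for n
        by (intro smooth_lebesgue_measurable smooth_mult[OF so[OF b]] smooth_partial test_fun_smooth[OF tg] b)
      show "(\<lambda>x. (omega x)\<^sup>2 * partial b f x * partial b g x) \<in> borel_measurable lebesgue"
        using so[OF b] sf b by (intro smooth_lebesgue_measurable smooth_mult[of "\<lambda>x. (omega x)\<^sup>2 * partial b f x"] smooth_partial)
      show "AE x in lebesgue. (\<lambda>n. (omega x)\<^sup>2 * partial b f x * partial b (cutoff n g) x) \<longlonglongrightarrow> (omega x)\<^sup>2 * partial b f x * partial b g x"
        by (intro AE_I2 tendsto_mult tendsto_const cutoff_limit)
    qed
  qed
  ultimately have "(LINT x|lebesgue. omega x ^ 4 * (Lop f x * g x))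
     = - (\<Sum>b\<in>Basis. LINT x|lebesgue. (omega x)\<^sup>2 * partial b f x * partial b g x)"
    unfolding byparts by (intro LIMSEQ_unique[OF _ tendsto_minus[OF tendsto_sum]])
  then show ?thesis using sf by (simp add: integral_M4 smooth_lebesgue_measurable smooth_mult)
qed

lemma Lop_symmetric:
  assumes "f \<in> Pol" "g \<in> Pol"
  shows "(LINT x|M4. Lop f x * g x) = (LINT x|M4. f x * Lop g x)"
proof -
  have "(LINT x|M4. Lop f x * g x) = (LINT x|M4. Lop g x * f x)"
    unfolding Dirichlet_form[OF assms] Dirichlet_form[OF assms(2,1)] by (simp add: mult_ac)
  then show ?thesis by (simp add: mult.commute)
qed

lemma Lop_nonpos: assumes "f \<in> Pol" shows "(LINT x|M4. Lop f x * f x) \<le> 0"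
proof -
  have "0 \<le> (LINT x|lebesgue. (omega x)\<^sup>2 * partial b f x * partial b f x)" for b
    by (intro Bochner_Integration.integral_nonneg) (simp add: mult.assoc)
  then show ?thesis unfolding Dirichlet_form[OF assms assms] by (simp add: sum_nonneg)
qed

text \<open>The Laplacian drops the constant of \<open>f\<close>, so the weight is 1 + 2 and not 0 +
  2. This matters for square integrability: omega^3 is integrable, omega^2 is not.\<close>

lemma Pol_laplacian_bound:
  assumes "f \<in> Pol" obtains C where "C \<ge> 0" "\<And>x. \<bar>laplacian f x\<bar> \<le> C * sqrt (omega x) ^ 3"
proof -
  obtain n where "spol n f" using assms by (auto simp: Pol_def)
  then obtain c g where g: "symb 1 (\<lambda>k. g)" "f = (\<lambda>x. g x + c)" using spol_symb by blast
  have "laplacian f x = laplacian g x" for x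
    unfolding g(2) using laplacian_add[OF symb_smooth[OF g(1)] smooth_const] by simp
  moreover obtain C where "C \<ge> 0" "\<And>x. \<bar>laplacian g x\<bar> \<le> C * sqrt (omega x) ^ (1 + 2)"
    using symb_bound[OF symb_laplacian[OF g(1)]] by blast
  ultimately show ?thesis using that[of C] by (simp only: one_plus_numeral semiring_norm)
qed

lemma Pol_laplacian_L2:
  assumes "f \<in> Pol" shows "laplacian f \<in> L2fn lebesgue"
proof (rule L2fnI)
  show m: "laplacian f \<in> borel_measurable lebesgue"
    using assms by (intro smooth_lebesgue_measurable smooth_laplacian Pol_smooth)
  obtain C where C: "C \<ge> 0" "\<And>x. \<bar>laplacian f x\<bar> \<le> C * sqrt (omega x) ^ 3"
    using Pol_laplacian_bound[OF assms] by blast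
  show "integrable lebesgue (\<lambda>x. (laplacian f x)\<^sup>2)"
  proof (rule Bochner_Integration.integrable_bound[OF integrable_mult_left[OF omega_L1[of "real 3"], of "C\<^sup>2"]])
    show "AE x in lebesgue. norm ((laplacian f x)\<^sup>2) \<le> norm (omega x powr real 3 * C\<^sup>2)"
    proof (rule AE_I2)
      fix x
      have "\<bar>laplacian f x\<bar>\<^sup>2 \<le> (C * sqrt (omega x) ^ 3)\<^sup>2" using C by (intro power_mono) auto
      also have "\<dots> = omega x powr real 3 * C\<^sup>2"
      proof -
        have "(sqrt (omega x) ^ 3)\<^sup>2 = (sqrt (omega x) ^ 2) ^ 3"
          unfolding power_mult[symmetric] by (simp only: mult.commute)
        then show ?thesis unfolding omega_powr_nat power_mult_distrib by simp
      qed
      finally show "norm ((laplacian f x)\<^sup>2) \<le> norm (omega x powr real 3 * C\<^sup>2)" by simp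
    qed
  qed (use m in auto)
qed

definition Pop :: "(real^4 \<Rightarrow> real) \<Rightarrow> real^4 \<Rightarrow> real" where
  "Pop f x = Lop (Lop f) x - 2 * Lop f x"

lemma Pol_Pop: "f \<in> Pol \<Longrightarrow> Pop f \<in> Pol"
  unfolding Pop_def[abs_def] by (intro Pol_diff Pol_cmult Pol_Lop)

lemma Pol_bilaplacian: "f \<in> Pol \<Longrightarrow> laplacian (laplacian f) x = omega x ^ 4 * Pop f x"
  by (auto simp: Pol_def Pop_def spol_bilaplacian)

text \<open>The cutoff of \<open>g\<close> is only a symbol of weight zero, so its Laplacian is of
  order omega, while that of \<open>f\<close> is of order omega^(3/2); the exponent 5/2 of the
  product still exceeds the threshold 2.\<close>

lemma laplacian_Dirichlet_form:
  assumes f: "f \<in> Pol" and g: "g \<in> Pol"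
  shows "(LINT x|lebesgue. laplacian f x * laplacian g x) = (LINT x|M4. Pop f x * g x)"
proof -
  have sf: "smooth f" "smooth g" "smooth (Pop f)" "smooth (laplacian f)" using f g by (auto intro: Pol_smooth Pol_Pop smooth_laplacian)
  obtain F where F: "symb 0 F" "\<And>n. cutoff n g = F (real (Suc n))" using cutoff_symb[OF Pol_symb0[OF g]] by blast
  obtain Cg where Cg: "\<And>n x. \<bar>cutoff n g x\<bar> \<le> Cg" using symb_bound[OF F(1)] F(2) by auto
  obtain CL where CL: "CL \<ge> 0" "\<And>x. \<bar>Pop f x\<bar> \<le> CL" using Pol_bounded[OF Pol_Pop[OF f]] by blast
  have tg: "test_fun (cutoff n g)" for n using sf by (intro cutoff_test_fun)
  have byparts: "(LINT x|lebesgue. omega x ^ 4 * (Pop f x * cutoff n g x))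
     = (LINT x|lebesgue. laplacian f x * laplacian (cutoff n g) x)" for n
    unfolding integral_laplacian_by_parts[OF sf(4) tg] by (simp add: Pol_bilaplacian[OF f] mult.assoc)
  have "(\<lambda>n. LINT x|lebesgue. omega x ^ 4 * (Pop f x * cutoff n g x)) \<longlonglongrightarrow> (LINT x|lebesgue. omega x ^ 4 * (Pop f x * g x))"
  proof (rule integral_dominated_convergence[where w="\<lambda>x. omega x powr real 4 * (CL * Cg)"])
    show "integrable lebesgue (\<lambda>x. omega x powr real 4 * (CL * Cg))" by (intro integrable_mult_left omega_L1) simp
    show "AE x in lebesgue. norm (omega x ^ 4 * (Pop f x * cutoff n g x)) \<le> omega x powr real 4 * (CL * Cg)" for n
      using CL Cg unfolding omega_powr_nat by (auto simp: abs_mult intro!: mult_left_mono mult_mono)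
    show "(\<lambda>x. omega x ^ 4 * (Pop f x * cutoff n g x)) \<in> borel_measurable lebesgue" for n
      by (intro smooth_lebesgue_measurable smooth_mult smooth_power omega_smooth sf test_fun_smooth[OF tg])
    show "(\<lambda>x. omega x ^ 4 * (Pop f x * g x)) \<in> borel_measurable lebesgue"
      using sf by (intro smooth_lebesgue_measurable smooth_mult smooth_power omega_smooth)
    show "AE x in lebesgue. (\<lambda>n. omega x ^ 4 * (Pop f x * cutoff n g x)) \<longlonglongrightarrow> omega x ^ 4 * (Pop f x * g x)"
      by (intro AE_I2 tendsto_mult tendsto_const cutoff_limit)
  qed
  moreover have "(\<lambda>n. LINT x|lebesgue. laplacian f x * laplacian (cutoff n g) x)
     \<longlonglongrightarrow> (LINT x|lebesgue. laplacian f x * laplacian g x)"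
  proof -
    obtain A where A: "A \<ge> 0" "\<And>x. \<bar>laplacian f x\<bar> \<le> A * sqrt (omega x) ^ 3"
      using Pol_laplacian_bound[OF f] by blast
    obtain B where B: "B \<ge> 0" "\<And>n x. \<bar>laplacian (cutoff n g) x\<bar> \<le> B * sqrt (omega x) ^ 2"
      using symb_bound[OF symb_laplacian[OF F(1)]] F(2) by auto
    show ?thesis
    proof (rule integral_dominated_convergence[where w="\<lambda>x. omega x powr (5/2) * (A * B)"])
      show "integrable lebesgue (\<lambda>x. omega x powr (5/2) * (A * B))" by (intro integrable_mult_left omega_L1) simp
      show "AE x in lebesgue. norm (laplacian f x * laplacian (cutoff n g) x) \<le> omega x powr (5/2) * (A * B)" for n
      proof (intro AE_I2)
        fix x
        have "\<bar>laplacian f x\<bar> * \<bar>laplacian (cutoff n g) x\<bar> \<le> (A * sqrt (omega x) ^ 3) * (B * sqrt (omega x) ^ 2)"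
          using A B by (intro mult_mono) auto
        also have "\<dots> = sqrt (omega x) ^ 5 * (A * B)"
        proof -
          have "(A * s ^ 3) * (B * s ^ 2) = s ^ 5 * (A * B)" for s :: real by (simp add: eval_nat_numeral)
          then show ?thesis .
        qed
        also have "sqrt (omega x) ^ 5 = omega x powr (5/2)"
          by (simp add: powr_half_sqrt[symmetric] powr_power)
        finally show "norm (laplacian f x * laplacian (cutoff n g) x) \<le> omega x powr (5/2) * (A * B)"
          by (simp add: abs_mult)
      qed
      show "(\<lambda>x. laplacian f x * laplacian (cutoff n g) x) \<in> borel_measurable lebesgue" for n
        by (intro smooth_lebesgue_measurable smooth_mult smooth_laplacian sf test_fun_smooth[OF tg])
      show "(\<lambda>x. laplacian f x * laplacian g x) \<in> borel_measurable lebesgue"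
        using sf by (intro smooth_lebesgue_measurable smooth_mult smooth_laplacian)
      show "AE x in lebesgue. (\<lambda>n. laplacian f x * laplacian (cutoff n g) x) \<longlonglongrightarrow> laplacian f x * laplacian g x"
        by (intro AE_I2 tendsto_mult tendsto_const cutoff_limit)
    qed
  qed
  ultimately have "(LINT x|lebesgue. omega x ^ 4 * (Pop f x * g x)) = (LINT x|lebesgue. laplacian f x * laplacian g x)"
    unfolding byparts by (rule LIMSEQ_unique)
  then show ?thesis using sf by (simp add: integral_M4 smooth_lebesgue_measurable smooth_mult)
qed

section \<open>Spectral theory on polynomials\<close>

lemma Pop_symmetric:
  assumes "f \<in> Pol" "g \<in> Pol"
  shows "(LINT x|M4. Pop f x * g x) = (LINT x|M4. f x * Pop g x)"
  using laplacian_Dirichlet_form[OF assms] laplacian_Dirichlet_form[OF assms(2,1)]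
  by (simp add: mult.commute)

lemma Pol_decomposition:
  assumes "f \<in> Pol"
  obtains n g where "n \<ge> 1" "\<And>l. l \<le> n \<Longrightarrow> harm l (g l)" "f = (\<lambda>x. \<Sum>l\<le>n. g l x)"
proof -
  obtain n where "spol n f" using assms by (auto simp: Pol_def)
  then have "spol (Suc (Suc n)) f" by (intro spol_lift)
  then show ?thesis using harmonic_decomposition[of "Suc n" f] that[of "Suc n"] by auto
qed

lemma harm_Pol: "harm l f \<Longrightarrow> f \<in> Pol"
  by (auto simp: harm_def Pol_def)

lemma harm_Lop: "harm l f \<Longrightarrow> Lop f x = - (real l * (real l + 3)) * f x"
  by (simp add: harm_def)

lemma harm_orthogonal:
  assumes "harm l f" "harm k g" "l \<noteq> k"
  shows "(LINT x|M4. f x * g x) = 0"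
proof -
  let ?I = "LINT x|M4. f x * g x"
  have "(LINT x|M4. Lop f x * g x) = - (real l * (real l + 3)) * ?I"
    using assms(1) by (simp add: harm_Lop mult.assoc)
  moreover have "(LINT x|M4. f x * Lop g x) = - (real k * (real k + 3)) * ?I"
    using assms(2) by (simp add: harm_Lop mult.left_commute[of "f _"])
  moreover have "(LINT x|M4. Lop f x * g x) = (LINT x|M4. f x * Lop g x)"
    using assms by (intro Lop_symmetric harm_Pol)
  ultimately have "- (real l * (real l + 3)) * ?I = - (real k * (real k + 3)) * ?I" by (simp only:)
  then have "real l * (real l + 3) * ?I = real k * (real k + 3) * ?I"
    by (simp only: mult_minus_left neg_equal_iff_equal)
  moreover have "real l * (real l + 3) \<noteq> real k * (real k + 3)"
  proof (cases "l < k")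
    case True
    then have "real l * (real l + 3) < real k * (real k + 3)" by (intro mult_strict_mono) auto
    then show ?thesis by simp
  next
    case False
    then have "real k * (real k + 3) < real l * (real l + 3)" using assms(3) by (intro mult_strict_mono) auto
    then show ?thesis by simp
  qed
  ultimately show ?thesis by auto
qed

section \<open>The operator 1 - L and the passage from weak to strong\<close>

definition Res :: "(real^4 \<Rightarrow> real) \<Rightarrow> real^4 \<Rightarrow> real" where "Res g x = g x - Lop g x"

lemma Pol_Res: "g \<in> Pol \<Longrightarrow> Res g \<in> Pol"
  unfolding Res_def[abs_def] by (intro Pol_diff Pol_Lop)

text \<open>On harmonics of degree l the operator 1 - L is the positive number 1 + l (l + 3), so it
  is inverted degree by degree.\<close>

lemma Res_onto: assumes "f \<in> Pol" obtains g where "g \<in> Pol" "Res g = f"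
proof -
  obtain n h where h: "n \<ge> 1" "\<And>l. l \<le> n \<Longrightarrow> harm l (h l)" "f = (\<lambda>x. \<Sum>l\<le>n. h l x)"
    using Pol_decomposition[OF assms] by blast
  define c where "c l = 1 + real l * (real l + 3)" for l
  have c: "c l > 0" for l unfolding c_def by (intro add_pos_nonneg mult_nonneg_nonneg) auto
  define q where "q l = (\<lambda>x. (1 / c l) * h l x)" for l
  have q: "harm l (q l)" if "l \<le> n" for l unfolding q_def using h that by (intro harm_cmult) auto
  define g where "g = (\<lambda>x. \<Sum>l\<le>n. q l x)"
  have "g \<in> Pol" unfolding g_def using q by (intro Pol_sum) (auto intro: harm_Pol)
  moreover have "Res g x = f x" for x
  proof -
    have "Lop g x = (\<Sum>l\<le>n. Lop (q l) x)"
      unfolding g_def using q by (intro Lop_sum) (auto intro: harm_Pol Pol_smooth)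
    then have "Res g x = (\<Sum>l\<le>n. q l x - Lop (q l) x)" by (simp add: Res_def g_def sum_subtractf)
    also have "\<dots> = (\<Sum>l\<le>n. h l x)"
    proof (intro sum.cong refl)
      fix l assume "l \<in> {..n}"
      then have "l \<le> n" by simp
      then have "q l x - Lop (q l) x = c l * q l x"
        unfolding harm_Lop[OF q[OF \<open>l \<le> n\<close>]] c_def by (simp add: algebra_simps)
      then show "q l x - Lop (q l) x = h l x" using c[of l] by (simp add: q_def)
    qed
    finally show ?thesis by (simp add: h)
  qed
  ultimately show ?thesis using that by blast
qed

lemma Res_diff: "f \<in> Pol \<Longrightarrow> g \<in> Pol \<Longrightarrow> Res (\<lambda>x. f x - g x) x = Res f x - Res g x"
  by (simp add: Res_def Lop_diff Pol_smooth)

lemma Pol_integral_diff: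
  assumes "f \<in> Pol" "g \<in> Pol" "h \<in> Pol"
  shows "(LINT x|M4. (f x - g x) * h x) = (LINT x|M4. f x * h x) - (LINT x|M4. g x * h x)"
    "(LINT x|M4. h x * (f x - g x)) = (LINT x|M4. h x * f x) - (LINT x|M4. h x * g x)"
  using Pol_integrable assms by (simp_all add: left_diff_distrib right_diff_distrib)

lemma Res_symmetric:
  assumes "f \<in> Pol" "g \<in> Pol"
  shows "(LINT x|M4. Res f x * g x) = (LINT x|M4. f x * Res g x)"
  unfolding Res_def using assms by (simp add: Pol_integral_diff Pol_Lop Lop_symmetric)

text \<open>(1 - L)^2 = 1 + P with P = L^2 - 2 L, and L is symmetric and nonpositive. Hence 1 - L
  dominates both the identity and, through P, the Laplacian on R^4.\<close>

lemma Res_square: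
  assumes "g \<in> Pol"
  shows "(LINT x|M4. (Res g x)\<^sup>2) = (LINT x|M4. (g x)\<^sup>2) + (LINT x|M4. Pop g x * g x)"
    "(LINT x|M4. Pop g x * g x) \<ge> 0"
proof -
  have nn: "0 \<le> (LINT x|M4. Lop g x * Lop g x)" by simp
  have "(LINT x|M4. Lop (Lop g) x * g x) = (LINT x|M4. Lop g x * Lop g x)"
    using Lop_symmetric[OF Pol_Lop assms, OF assms] .
  moreover have "(LINT x|M4. Pop g x * g x) = (LINT x|M4. Lop (Lop g) x * g x - 2 * (Lop g x * g x))"
    by (simp add: Pop_def left_diff_distrib mult.assoc)
  moreover have "(LINT x|M4. (Res g x)\<^sup>2) = (LINT x|M4. g x * g x - 2 * (Lop g x * g x) + Lop g x * Lop g x)"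
    by (simp add: Res_def power2_eq_square algebra_simps)
  ultimately have *: "(LINT x|M4. (Res g x)\<^sup>2) = (LINT x|M4. (g x)\<^sup>2) + (LINT x|M4. Pop g x * g x)"
    "(LINT x|M4. Pop g x * g x) = (LINT x|M4. Lop g x * Lop g x) - 2 * (LINT x|M4. Lop g x * g x)"
    using assms Pol_Lop[OF assms] Pol_Lop[OF Pol_Lop[OF assms]]
    by (simp_all add: Pol_integrable power2_eq_square)
  show "(LINT x|M4. (Res g x)\<^sup>2) = (LINT x|M4. (g x)\<^sup>2) + (LINT x|M4. Pop g x * g x)" by (rule *(1))
  show "(LINT x|M4. Pop g x * g x) \<ge> 0" using nn *(2) Lop_nonpos[OF assms] by argo
qed

lemma Res_bound: "g \<in> Pol \<Longrightarrow> (LINT x|M4. (g x)\<^sup>2) \<le> (LINT x|M4. (Res g x)\<^sup>2)"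
  using Res_square[of g] by linarith

lemma laplacian_square: "g \<in> Pol \<Longrightarrow> (LINT x|lebesgue. (laplacian g x)\<^sup>2) = (LINT x|M4. Pop g x * g x)"
  using laplacian_Dirichlet_form[of g g] by (simp add: power2_eq_square)

lemma laplacian_Res_bound: "g \<in> Pol \<Longrightarrow> (LINT x|lebesgue. (laplacian g x)\<^sup>2) \<le> (LINT x|M4. (Res g x)\<^sup>2)"
  using Res_square[of g] laplacian_square[of g] by simp

lemma Res_Res: "g \<in> Pol \<Longrightarrow> Res (Res g) x = Pop g x + g x"
proof -
  assume g: "g \<in> Pol"
  have "Res g = (\<lambda>x. g x - Lop g x)" by (simp add: Res_def fun_eq_iff)
  then have "Lop (Res g) x = Lop g x - Lop (Lop g) x" using g by (simp add: Lop_diff Pol_smooth Pol_Lop)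
  then show ?thesis by (simp add: Res_def[of "Res g"] Res_def[of g] Pop_def)
qed

text \<open>Weak equals strong for a symmetric operator that is onto and bounded below on
  polynomials: the preimages \<open>g n\<close> of approximants of \<open>u\<close> form a Cauchy
  sequence, and their limit is \<open>\<phi>\<close> because every polynomial used for testing has
  the form \<open>T k\<close>.\<close>

lemma operator_approximation:
  assumes T: "\<And>f. f \<in> Pol \<Longrightarrow> T f \<in> Pol"
    and diff: "\<And>f g x. f \<in> Pol \<Longrightarrow> g \<in> Pol \<Longrightarrow> T (\<lambda>x. f x - g x) x = T f x - T g x"
    and sym: "\<And>f g. f \<in> Pol \<Longrightarrow> g \<in> Pol \<Longrightarrow> (LINT x|M4. T f x * g x) = (LINT x|M4. f x * T g x)"
    and onto: "\<And>f. f \<in> Pol \<Longrightarrow> \<exists>g\<in>Pol. T g = f"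
    and bound: "\<And>g. g \<in> Pol \<Longrightarrow> (LINT x|M4. (g x)\<^sup>2) \<le> (LINT x|M4. (T g x)\<^sup>2)"
    and L2: "\<phi> \<in> L2fn M4" "u \<in> L2fn M4"
    and eq: "\<And>f. f \<in> Pol \<Longrightarrow> (LINT x|M4. \<phi> x * T f x) = (LINT x|M4. u x * f x)"
  shows "\<exists>g. (\<forall>n. g n \<in> Pol) \<and> L2conv M4 g \<phi> \<and> L2conv M4 (\<lambda>n. T (g n)) u"
proof -
  obtain f where f: "\<And>n. f n \<in> Pol" "L2conv M4 f u" using Pol_dense[OF L2(2)] by blast
  have "\<forall>n. \<exists>g\<in>Pol. T g = f n" using onto f by blast
  then obtain g where g: "\<And>n. g n \<in> Pol" "\<And>n. T (g n) = f n" by metis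
  have gL: "g n \<in> L2fn M4" "f n \<in> L2fn M4" for n using g f Pol_L2fn by auto
  have "\<exists>p. L2conv M4 g p"
  proof (rule L2fn_complete[OF gL(1)])
    fix e :: real assume "e > 0"
    have "(\<lambda>n. LINT x|M4. (f n x - u x)\<^sup>2) \<longlonglongrightarrow> 0" using f by (simp add: L2conv_def)
    then have "eventually (\<lambda>n. (LINT x|M4. (f n x - u x)\<^sup>2) < e / 4) sequentially"
      using \<open>e > 0\<close> by (intro order_tendstoD) auto
    then obtain N where N: "\<And>n. n \<ge> N \<Longrightarrow> (LINT x|M4. (f n x - u x)\<^sup>2) < e / 4"
      by (auto simp: eventually_sequentially)
    have "(LINT x|M4. (g m x - g n x)\<^sup>2) < e" if "m \<ge> N" "n \<ge> N" for m n
    proof -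
      have "(LINT x|M4. (g m x - g n x)\<^sup>2) \<le> (LINT x|M4. (T (\<lambda>x. g m x - g n x) x)\<^sup>2)"
        by (intro bound Pol_diff g)
      also have "\<dots> = (LINT x|M4. (f m x - f n x)\<^sup>2)" by (simp add: diff g)
      also have "\<dots> \<le> 2 * (LINT x|M4. (f m x - u x)\<^sup>2) + 2 * (LINT x|M4. (u x - f n x)\<^sup>2)"
        by (intro L2fn_triangle gL L2)
      also have "\<dots> = 2 * (LINT x|M4. (f m x - u x)\<^sup>2) + 2 * (LINT x|M4. (f n x - u x)\<^sup>2)"
        by (simp add: power2_commute)
      also have "\<dots> < e" using N[OF that(1)] N[OF that(2)] by simp
      finally show ?thesis .
    qed
    then show "\<exists>N. \<forall>m\<ge>N. \<forall>n\<ge>N. (LINT x|M4. (g m x - g n x)\<^sup>2) < e" by blast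
  qed
  then obtain p where p: "L2conv M4 g p" by blast
  then have pL: "p \<in> L2fn M4" by (simp add: L2conv_def)
  have "AE x in lebesgue. p x - \<phi> x = 0"
  proof (rule Pol_total)
    show "(\<lambda>x. p x - \<phi> x) \<in> L2fn M4" by (intro L2fn_diff pL L2)
    fix h assume "h \<in> Pol"
    then obtain k where k: "k \<in> Pol" "T k = h" using onto by blast
    then have kL: "k \<in> L2fn M4" "h \<in> L2fn M4" using \<open>h \<in> Pol\<close> Pol_L2fn by auto
    have "(LINT x|M4. g n x * h x) = (LINT x|M4. f n x * k x)" for n
      using sym[OF g(1) k(1), of n] by (simp add: g k)
    then have "(\<lambda>n. LINT x|M4. g n x * h x) \<longlonglongrightarrow> (LINT x|M4. u x * k x)"
      using L2conv_inner[OF f(2) kL(1)] by simp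
    then have "(LINT x|M4. p x * h x) = (LINT x|M4. u x * k x)"
      using L2conv_inner[OF p kL(2)] LIMSEQ_unique by blast
    also have "\<dots> = (LINT x|M4. \<phi> x * h x)" using eq[OF k(1)] by (simp add: k)
    finally show "(LINT x|M4. (p x - \<phi> x) * h x) = 0"
      using L2fn_mult[OF pL kL(2)] L2fn_mult[OF L2(1) kL(2)] by (simp add: left_diff_distrib)
  qed
  then have ae: "AE x in M4. p x = \<phi> x" unfolding AE_M4 by eventually_elim simp
  have "L2conv M4 g \<phi>"
  proof -
    have "(LINT x|M4. (g n x - p x)\<^sup>2) = (LINT x|M4. (g n x - \<phi> x)\<^sup>2)" for n
      using L2fn_measurable[OF gL(1)] L2fn_measurable[OF pL] L2fn_measurable[OF L2(1)] ae
      by (intro integral_cong_AE) (auto elim!: eventually_mono)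
    then show ?thesis using p gL L2 by (simp add: L2conv_def)
  qed
  moreover have "L2conv M4 (\<lambda>n. T (g n)) u" using f by (simp add: g)
  ultimately show ?thesis using g by blast
qed

lemma Res_approximation:
  assumes "\<phi> \<in> L2fn M4" "u \<in> L2fn M4"
    and "\<And>f. f \<in> Pol \<Longrightarrow> (LINT x|M4. \<phi> x * Res f x) = (LINT x|M4. u x * f x)"
  shows "\<exists>g. (\<forall>n. g n \<in> Pol) \<and> L2conv M4 g \<phi> \<and> L2conv M4 (\<lambda>n. Res (g n)) u"
  using assms by (intro operator_approximation Pol_Res Res_diff Res_symmetric Res_bound) (auto elim: Res_onto)

text \<open>P annihilates the constants and is not bounded below, so the argument is run for P + 1 =
  (1 - L)^2 with right-hand side \<open>h\<close> plus \<open>\<phi>\<close>, and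
  \<open>\<phi>\<close> is subtracted afterwards.\<close>

lemma Pop_approximation:
  assumes \<phi>: "\<phi> \<in> L2fn M4" "h \<in> L2fn M4"
    and eq: "\<And>f. f \<in> Pol \<Longrightarrow> (LINT x|M4. \<phi> x * Pop f x) = (LINT x|M4. h x * f x)"
  shows "\<exists>g. (\<forall>n. g n \<in> Pol) \<and> L2conv M4 g \<phi> \<and> L2conv M4 (\<lambda>n x. Pop (g n) x) h"
proof -
  let ?u = "\<lambda>x. h x + 1 * \<phi> x"
  have "\<exists>g. (\<forall>n. g n \<in> Pol) \<and> L2conv M4 g \<phi> \<and> L2conv M4 (\<lambda>n. Res (Res (g n))) ?u"
  proof (rule operator_approximation)
    show "\<And>f. f \<in> Pol \<Longrightarrow> Res (Res f) \<in> Pol" by (intro Pol_Res)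
    show "Res (Res (\<lambda>x. f x - g x)) x = Res (Res f) x - Res (Res g) x" if "f \<in> Pol" "g \<in> Pol" for f g x
    proof -
      have "Res (\<lambda>x. f x - g x) = (\<lambda>x. Res f x - Res g x)" using that by (intro ext Res_diff)
      then show ?thesis using that by (simp add: Res_diff Pol_Res)
    qed
    show "(LINT x|M4. Res (Res f) x * g x) = (LINT x|M4. f x * Res (Res g) x)" if "f \<in> Pol" "g \<in> Pol" for f g
      using that by (simp add: Res_symmetric Pol_Res)
    show "\<exists>g\<in>Pol. Res (Res g) = f" if "f \<in> Pol" for f by (metis Res_onto that)
    show "(LINT x|M4. (g x)\<^sup>2) \<le> (LINT x|M4. (Res (Res g) x)\<^sup>2)" if "g \<in> Pol" for g
      using Res_bound[OF that] Res_bound[OF Pol_Res[OF that]] by linarith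
    show "?u \<in> L2fn M4" using \<phi> by (intro L2fn_add L2fn_cmult)
    show "(LINT x|M4. \<phi> x * Res (Res f) x) = (LINT x|M4. ?u x * f x)" if f: "f \<in> Pol" for f
    proof -
      note [simp] = L2fn_mult[OF \<phi>(1) Pol_L2fn[OF f]] L2fn_mult[OF \<phi>(2) Pol_L2fn[OF f]]
        L2fn_mult[OF \<phi>(1) Pol_L2fn[OF Pol_Pop[OF f]]]
      show ?thesis using eq[OF f] by (simp add: Res_Res f distrib_left distrib_right)
    qed
  qed (use \<phi> in auto)
  then obtain g where g: "\<And>n. g n \<in> Pol" "L2conv M4 g \<phi>" "L2conv M4 (\<lambda>n. Res (Res (g n))) ?u" by blast
  have "L2conv M4 (\<lambda>n x. Res (Res (g n)) x + (-1) * g n x) (\<lambda>x. ?u x + (-1) * \<phi> x)"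
    by (rule L2conv_add[OF g(3) g(2)])
  then have "L2conv M4 (\<lambda>n x. Pop (g n) x) h" by (simp add: Res_Res g)
  then show ?thesis using g by blast
qed

subsection \<open>The spectral gap\<close>

definition vol4 :: real where "vol4 = 8 * pi\<^sup>2 / 3"

lemma vol4_pos: "vol4 > 0" by (simp add: vol4_def)

lemma M4_const_integral: "(LINT x|M4. c) = c * vol4" "integrable M4 (\<lambda>x. c :: real)"
  using M4_const by (auto simp: vol4_def)

lemma measure_M4 [simp]: "measure M4 UNIV = vol4"
  using M4_const_integral(1)[of 1] by simp

lemma sc_mean: "(LINT x|M4. sc v x) = 0"
  using harm_orthogonal[OF harm_sc harm_const[of 1], of v] by simp

text \<open>L has integral zero over the sphere; applied to a product of two linear functions, where
  L yields 2 (v . w) - 10 times the product, this determines the second moments.\<close>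

lemma sc_inner: "(LINT x|M4. sc v x * sc w x) = vol4 / 5 * (v \<bullet> w)"
proof -
  have L: "Lop (\<lambda>x. sc v x * sc w x) x = 2 * (v \<bullet> w) - 10 * (sc v x * sc w x)" for x
    by (simp add: Lop_mult sc_smooth Lop_sc Gam_sc)
  have "(LINT x|M4. Lop (\<lambda>x. sc v x * sc w x) x * 1) = (LINT x|M4. (sc v x * sc w x) * Lop (\<lambda>x. 1) x)"
    by (intro Lop_symmetric Pol_mult Pol_sc Pol_const)
  then have "(LINT x|M4. 2 * (v \<bullet> w) - 10 * (sc v x * sc w x)) = 0" by (simp add: L)
  then have "2 * (v \<bullet> w) * vol4 - 10 * (LINT x|M4. sc v x * sc w x) = 0"
    using Pol_integrable[OF Pol_sc Pol_sc] M4_const_integral by simp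
  then show ?thesis by simp
qed

lemma harm_Pop: "harm l f \<Longrightarrow> Pop f x = (real l * (real l + 3)) * (real l * (real l + 3) + 2) * f x"
proof -
  assume f: "harm l f"
  let ?c = "- (real l * (real l + 3))"
  have "Lop f = (\<lambda>x. ?c * f x)" using harm_Lop[OF f] by (intro ext)
  then show ?thesis unfolding Pop_def
    by (simp only: Lop_cmult[OF Pol_smooth[OF harm_Pol[OF f]]] harm_Lop[OF f]) (simp add: algebra_simps)
qed

text \<open>The terms subtracted on the left are the squared norms of the components of degree 0 and
  1; the coordinates form an orthogonal basis of the latter with squared norm
  \<open>vol4 / 5\<close>. All other degrees have Paneitz eigenvalue at least 120.\<close>

lemma spectral_gap:
  assumes f: "f \<in> Pol"
  shows "120 * ((LINT x|M4. (f x)\<^sup>2) - (LINT x|M4. f x)\<^sup>2 / vol4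
      - (\<Sum>a\<in>Basis. (LINT x|M4. f x * sc a x)\<^sup>2) / (vol4 / 5)) \<le> (LINT x|M4. Pop f x * f x)"
proof -
  obtain n g where g: "n \<ge> 1" "\<And>l. l \<le> n \<Longrightarrow> harm l (g l)" "f = (\<lambda>x. \<Sum>l\<le>n. g l x)"
    using Pol_decomposition[OF f] by blast
  have gP: "g l \<in> Pol" if "l \<le> n" for l using g that harm_Pol by blast
  define e where "e l = (LINT x|M4. g l x * g l x)" for l
  define c where "c l = (real l * (real l + 3)) * (real l * (real l + 3) + 2)" for l
  have e0: "e l \<ge> 0" for l by (simp add: e_def)
  have ip: "(LINT x|M4. f x * h x) = (LINT x|M4. g k x * h x)" if "harm k h" "k \<le> n" for h k
  proof -
    have "(LINT x|M4. f x * h x) = (LINT x|M4. (\<Sum>l\<le>n. g l x * h x))"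
      by (simp add: g sum_distrib_right)
    also have "\<dots> = (\<Sum>l\<le>n. LINT x|M4. g l x * h x)"
      using gP harm_Pol[OF that(1)] by (intro Bochner_Integration.integral_sum Pol_integrable) auto
    also have "\<dots> = (\<Sum>l\<le>n. if l = k then LINT x|M4. g l x * h x else 0)"
      using harm_orthogonal[OF g(2) that(1)] by (intro sum.cong) auto
    finally show ?thesis using that by simp
  qed
  have sq: "(LINT x|M4. (f x)\<^sup>2) = (\<Sum>l\<le>n. e l)"
  proof -
    have "(LINT x|M4. (f x)\<^sup>2) = (LINT x|M4. (\<Sum>l\<le>n. f x * g l x))"
      by (simp add: g power2_eq_square sum_distrib_left)
    also have "\<dots> = (\<Sum>l\<le>n. LINT x|M4. f x * g l x)"
      using gP f by (intro Bochner_Integration.integral_sum Pol_integrable) auto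
    also have "\<dots> = (\<Sum>l\<le>n. e l)" using ip[OF g(2)] by (intro sum.cong) (auto simp: e_def)
    finally show ?thesis .
  qed
  have P: "(LINT x|M4. Pop f x * f x) = (\<Sum>l\<le>n. c l * e l)"
  proof -
    have "(LINT x|M4. Pop f x * f x) = (LINT x|M4. (\<Sum>l\<le>n. Pop f x * g l x))"
      by (subst (2) g(3)) (simp add: sum_distrib_left)
    also have "\<dots> = (\<Sum>l\<le>n. LINT x|M4. Pop f x * g l x)"
      using gP f Pol_Pop by (intro Bochner_Integration.integral_sum Pol_integrable) auto
    also have "\<dots> = (\<Sum>l\<le>n. c l * e l)"
    proof (intro sum.cong refl)
      fix l assume "l \<in> {..n}"
      then have l: "l \<le> n" by simp
      have "(LINT x|M4. Pop f x * g l x) = (LINT x|M4. f x * Pop (g l) x)"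
        by (rule Pop_symmetric[OF f gP[OF l]])
      also have "\<dots> = (LINT x|M4. c l * (f x * g l x))"
        by (simp add: harm_Pop[OF g(2)[OF l]] c_def mult_ac)
      also have "\<dots> = c l * e l" using ip[OF g(2)[OF l] l] by (simp add: e_def)
      finally show "(LINT x|M4. Pop f x * g l x) = c l * e l" .
    qed
    finally show ?thesis .
  qed
  have E0: "(LINT x|M4. f x)\<^sup>2 / vol4 = e 0"
  proof -
    obtain k where k: "g 0 = (\<lambda>x. k)" using harm_0[OF g(2)] by blast
    have "(LINT x|M4. f x) = k * vol4" using ip[OF harm_const[of 1], of ] by (simp add: k M4_const_integral)
    then show ?thesis using vol4_pos by (simp add: e_def k M4_const_integral power2_eq_square)
  qed
  have E1: "(\<Sum>a\<in>Basis. (LINT x|M4. f x * sc a x)\<^sup>2) / (vol4 / 5) = e 1"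
  proof -
    obtain v where v: "g 1 = sc v" using harm_1[OF g(2)[OF g(1)]] by blast
    have "(LINT x|M4. f x * sc a x) = vol4 / 5 * (v \<bullet> a)" for a
      using ip[OF harm_sc g(1), of a] by (simp only: v sc_inner)
    then have "(\<Sum>a\<in>Basis. (LINT x|M4. f x * sc a x)\<^sup>2) = (\<Sum>a\<in>Basis. (vol4 / 5 * (v \<bullet> a))\<^sup>2)"
      by (simp only:)
    also have "\<dots> = (vol4 / 5)\<^sup>2 * (v \<bullet> v)"
      by (simp add: power_mult_distrib sum_distrib_left euclidean_inner[of v v] power2_eq_square mult_ac)
    finally have *: "(\<Sum>a\<in>Basis. (LINT x|M4. f x * sc a x)\<^sup>2) = (vol4 / 5)\<^sup>2 * (v \<bullet> v)" .
    have "(w / 5)\<^sup>2 * q / (w / 5) = w / 5 * q" if "w > 0" for w q :: real using that by (simp add: power2_eq_square)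
    from this[OF vol4_pos] show ?thesis unfolding e_def v sc_inner * .
  qed
  have c0: "c l \<ge> 0" for l unfolding c_def by (intro mult_nonneg_nonneg add_nonneg_nonneg) auto
  have c2: "c l \<ge> 120" if "l \<ge> 2" for l
  proof -
    \<comment> \<open>Degree two is extremal: 2 * 5 = 10, and 10 * 12 = 120.\<close>
    have "10 \<le> real l * (real l + 3)" using that mult_mono[of 2 "real l" 5 "real l + 3"] by simp
    then have "10 * 12 \<le> c l" unfolding c_def by (intro mult_mono) auto
    then show ?thesis by simp
  qed
  have "120 * ((\<Sum>l\<le>n. e l) - e 0 - e 1) = (\<Sum>l\<le>n. 120 * (e l - (if l = 0 then e 0 else 0) - (if l = 1 then e 1 else 0)))"
    using g(1) by (simp only: sum_distrib_left[symmetric] sum_subtractf) (simp add: sum.delta)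
  also have "\<dots> \<le> (\<Sum>l\<le>n. c l * e l)"
  proof (rule sum_mono)
    fix l
    have "120 * e l \<le> c l * e l" if "l \<ge> 2" using c2[OF that] e0 by (intro mult_right_mono) auto
    moreover have "l = 0 \<or> l = 1 \<or> l \<ge> 2" by auto
    ultimately show "120 * (e l - (if l = 0 then e 0 else 0) - (if l = 1 then e 1 else 0)) \<le> c l * e l"
      using mult_nonneg_nonneg[OF c0[of l] e0[of l]] by auto
  qed
  finally show ?thesis unfolding sq P E0 E1 .
qed

text \<open>Only a limit of Paneitz energies is assumed, not an energy of \<open>\<phi>\<close>
  itself, so that weak solutions and elements of the form domain are both covered.\<close>

lemma spectral_gap_limit:
  assumes g: "\<And>n. g n \<in> Pol" "L2conv M4 g \<phi>" and q: "(\<lambda>n. LINT x|M4. Pop (g n) x * g n x) \<longlonglongrightarrow> q"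
    and o: "(LINT x|M4. \<phi> x) = 0" "\<And>a. (LINT x|M4. \<phi> x * sc a x) = 0"
  shows "120 * (LINT x|M4. (\<phi> x)\<^sup>2) \<le> q"
proof -
  have 1: "(\<lambda>n. LINT x|M4. g n x) \<longlonglongrightarrow> 0"
    using L2conv_inner[OF g(2) Pol_L2fn[OF Pol_const[of 1]]] o by simp
  have 2: "(\<lambda>n. LINT x|M4. g n x * sc a x) \<longlonglongrightarrow> 0" for a
    using L2conv_inner[OF g(2) Pol_L2fn[OF Pol_sc[of a]]] o by simp
  have "(\<lambda>n. 120 * ((LINT x|M4. (g n x)\<^sup>2) - (LINT x|M4. g n x)\<^sup>2 / vol4
      - (\<Sum>a\<in>Basis. (LINT x|M4. g n x * sc a x)\<^sup>2) / (vol4 / 5)))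
     \<longlonglongrightarrow> 120 * ((LINT x|M4. (\<phi> x)\<^sup>2) - 0\<^sup>2 / vol4 - (\<Sum>a\<in>(Basis :: ((real^4) \<times> real) set). 0\<^sup>2) / (vol4 / 5))"
    using vol4_pos by (intro tendsto_intros L2conv_square[OF g(2)] 1 2) auto
  then show ?thesis
    using LIMSEQ_le[OF _ q] spectral_gap[OF g(1)] by (auto intro!: LIMSEQ_le[OF _ q])
qed

subsection \<open>Weak Laplacians\<close>

lemma one_over_omega: "1 / omega x = (1 + x \<bullet> x) / 2"
  by (simp add: omega_def power2_norm_eq_inner)

lemma inverse_omega_smooth: "smooth (\<lambda>x. 1 / omega x)"
proof -
  have "x \<bullet> x = (\<Sum>b\<in>Basis. (x \<bullet> b) * (x \<bullet> b))" for x :: "real^4" by (rule euclidean_inner)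
  then have "(\<lambda>x. 1 / omega x) = (\<lambda>x. (1/2) * (1 + (\<Sum>b\<in>Basis. (x \<bullet> b) * (x \<bullet> b))))"
    by (simp add: one_over_omega fun_eq_iff)
  then show ?thesis by (simp only:) (intro smooth_mult smooth_add smooth_sum smooth_inner smooth_const)
qed

lemma test_fun_div_omega: "test_fun f \<Longrightarrow> test_fun (\<lambda>x. f x / omega x ^ 4)"
  using test_fun_mult[OF smooth_power[OF inverse_omega_smooth, of 4], of f] by (simp add: power_divide mult.commute)

lemma test_fun_L2fn_M4: "test_fun f \<Longrightarrow> f \<in> L2fn M4"
proof -
  assume f: "test_fun f"
  obtain C where "\<And>x. \<bar>f x\<bar> \<le> C" using test_fun_bound[OF f] by blast
  then show ?thesis using f by (intro bounded_L2fn_M4 smooth_lebesgue_measurable test_fun_smooth)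
qed

lemma test_fun_L2fn: "test_fun f \<Longrightarrow> f \<in> L2fn lebesgue"
  by (rule L2fnI)
     (auto simp: power2_eq_square intro: smooth_lebesgue_measurable test_fun_smooth L1_loc_mult_test smooth_L1_loc)

lemma integral_M4_div_omega:
  assumes "\<phi> \<in> borel_measurable lebesgue" "test_fun f"
  shows "(LINT x|lebesgue. \<phi> x * f x) = (LINT x|M4. \<phi> x * (f x / omega x ^ 4))"
proof -
  have "(LINT x|M4. \<phi> x * (f x / omega x ^ 4)) = (LINT x|lebesgue. omega x ^ 4 * (\<phi> x * (f x / omega x ^ 4)))"
    by (intro integral_M4 borel_measurable_times assms(1) smooth_lebesgue_measurable test_fun_smooth test_fun_div_omega assms(2))
  then show ?thesis by simp
qed

lemma L2fn_M4_L1_loc: assumes "\<phi> \<in> L2fn M4" shows "\<phi> \<in> L1_loc"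
  unfolding L1_loc_def
proof (intro CollectI allI impI)
  fix K :: "(real^4) set" assume K: "compact K"
  have m: "\<phi> \<in> borel_measurable lebesgue" using L2fn_measurable[OF assms] by simp
  have Ks: "K \<in> sets lebesgue" using K by (simp add: lmeasurable_compact fmeasurableD)
  have "integrable M4 (\<lambda>x. \<phi> x * 1)" by (rule L2fn_mult[OF assms Pol_L2fn[OF Pol_const]])
  then have i: "integrable lebesgue (\<lambda>x. omega x ^ 4 * \<phi> x)" using m by (simp add: integrable_M4)
  have "bounded ((\<lambda>x. (1 / omega x) ^ 4) ` K)"
    by (intro compact_imp_bounded compact_continuous_image K smooth_continuous smooth_power inverse_omega_smooth)
  then obtain C where C: "\<And>x. x \<in> K \<Longrightarrow> \<bar>(1 / omega x) ^ 4\<bar> \<le> C" unfolding bounded_real by blast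
  show "set_integrable lebesgue K \<phi>" unfolding set_integrable_def
  proof (rule Bochner_Integration.integrable_bound[OF integrable_mult_left[OF i, of C]])
    show "(\<lambda>x. indicator K x *\<^sub>R \<phi> x) \<in> borel_measurable lebesgue" using m Ks by measurable
    show "AE x in lebesgue. norm (indicator K x *\<^sub>R \<phi> x) \<le> norm (omega x ^ 4 * \<phi> x * C)"
    proof (rule AE_I2)
      fix x
      show "norm (indicator K x *\<^sub>R \<phi> x) \<le> norm (omega x ^ 4 * \<phi> x * C)"
      proof (cases "x \<in> K")
        case True
        have "\<bar>\<phi> x\<bar> = omega x ^ 4 * \<bar>\<phi> x\<bar> * \<bar>(1 / omega x) ^ 4\<bar>" by (simp add: power_divide)
        also have "\<dots> \<le> omega x ^ 4 * \<bar>\<phi> x\<bar> * \<bar>C\<bar>" using C[OF True] by (intro mult_left_mono) auto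
        finally show ?thesis using True by (simp add: abs_mult)
      qed simp
    qed
  qed
qed

lemma L2fn_L1_loc: assumes "f \<in> L2fn lebesgue" shows "f \<in> L1_loc"
  unfolding L1_loc_def
proof (intro CollectI allI impI)
  fix K :: "'a set" assume K: "compact K"
  then have Ks: "K \<in> lmeasurable" by (rule lmeasurable_compact)
  have "indicator K \<in> L2fn lebesgue"
  proof (rule L2fnI)
    have e: "(indicator K x :: real)\<^sup>2 = indicator K x" for x by (auto simp: indicator_def)
    show "integrable lebesgue (\<lambda>x. (indicator K x :: real)\<^sup>2)"
      unfolding e using Ks by (intro integrable_real_indicator) (auto simp: fmeasurable_def)
  qed (use Ks in \<open>auto simp: fmeasurableD\<close>)
  from L2fn_mult[OF this assms] show "set_integrable lebesgue K f" by (simp add: set_integrable_def)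
qed

lemma L1_loc_diff: "f \<in> L1_loc \<Longrightarrow> g \<in> L1_loc \<Longrightarrow> (\<lambda>x. f x - g x) \<in> L1_loc"
  by (auto simp: L1_loc_def)

lemma has_weak_laplacian_unique:
  fixes f :: "real^4 \<Rightarrow> real"
  assumes "has_weak_laplacian f G" "has_weak_laplacian f' G'" and ae: "AE x in lebesgue. f x = f' x"
  shows "AE x in lebesgue. G x = G' x"
proof -
  have L: "f \<in> L1_loc" "f' \<in> L1_loc" "G \<in> L1_loc" "G' \<in> L1_loc" using assms by (auto simp: has_weak_laplacian_def)
  have "AE x in lebesgue. G x - G' x = 0"
  proof (rule test_fun_total)
    show "(\<lambda>x. G x - G' x) \<in> L1_loc" using L by (intro L1_loc_diff)
    fix \<psi> :: "real^4 \<Rightarrow> real" assume \<psi>: "test_fun \<psi>"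
    have "(LINT x|lebesgue. f x * laplacian \<psi> x) = (LINT x|lebesgue. f' x * laplacian \<psi> x)"
      using L1_loc_mult_test[OF L(1) test_fun_laplacian[OF \<psi>]] L1_loc_mult_test[OF L(2) test_fun_laplacian[OF \<psi>]] ae
      by (intro integral_cong_AE) (auto elim!: eventually_mono)
    then show "(LINT x|lebesgue. (G x - G' x) * \<psi> x) = 0"
      using assms(1,2) \<psi> L1_loc_mult_test[OF L(3) \<psi>] L1_loc_mult_test[OF L(4) \<psi>]
      by (simp add: has_weak_laplacian_def left_diff_distrib)
  qed
  then show ?thesis by eventually_elim simp
qed

text \<open>The weak Laplacian is an arbitrarily selected representative; uniqueness up to null sets
  ties it to any other one.\<close>

lemma weak_laplacian_AE:
  fixes f :: "real^4 \<Rightarrow> real"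
  assumes "has_weak_laplacian f G" "AE x in lebesgue. f' x = f x" "f' \<in> L1_loc"
  shows "AE x in lebesgue. weak_laplacian f' x = G x" "weak_laplacian f' \<in> borel_measurable lebesgue"
proof -
  have L: "f \<in> L1_loc" "G \<in> L1_loc" using assms by (auto simp: has_weak_laplacian_def)
  have "has_weak_laplacian f' G" unfolding has_weak_laplacian_def
  proof (intro conjI allI impI assms(3) L)
    fix \<psi> :: "real^4 \<Rightarrow> real" assume \<psi>: "test_fun \<psi>"
    have "(LINT x|lebesgue. f' x * laplacian \<psi> x) = (LINT x|lebesgue. f x * laplacian \<psi> x)"
      using L1_loc_mult_test[OF L(1) test_fun_laplacian[OF \<psi>]] L1_loc_mult_test[OF assms(3) test_fun_laplacian[OF \<psi>]] assms(2)
      by (intro integral_cong_AE) (auto elim!: eventually_mono)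
    then show "(LINT x|lebesgue. f' x * laplacian \<psi> x) = (LINT x|lebesgue. G x * \<psi> x)"
      using assms(1) \<psi> by (simp add: has_weak_laplacian_def)
  qed
  then have w: "has_weak_laplacian f' (weak_laplacian f')" unfolding weak_laplacian_def by (rule someI[of "has_weak_laplacian f'"])
  show ae: "AE x in lebesgue. weak_laplacian f' x = G x"
    by (rule has_weak_laplacian_unique[OF w assms(1) assms(2)])
  \<comment> \<open>\<open>L1_loc\<close> speaks about compact sets only; measurability on the whole
    space is obtained from the cutoffs as a pointwise limit.\<close>
  have "(\<lambda>x. weak_laplacian f' x * eta (real (Suc n) * omega x)) \<in> borel_measurable lebesgue" for n
    using w cut_test_fun[OF cut_eta, of "real (Suc n)"]
    by (intro borel_measurable_integrable L1_loc_mult_test) (auto simp: has_weak_laplacian_def)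
  moreover have "(\<lambda>n. weak_laplacian f' x * eta (real (Suc n) * omega x)) \<longlonglongrightarrow> weak_laplacian f' x" for x
    using tendsto_mult[OF tendsto_const cutoff_limit(1)[of "\<lambda>_. 1" x]] by (simp add: cutoff_def)
  ultimately show "weak_laplacian f' \<in> borel_measurable lebesgue"
    by (rule borel_measurable_LIMSEQ_metric)
qed

text \<open>In L^2 the Laplacian of a polynomial is dominated by its image under 1 - L, so the
  Laplacians converge along with \<open>Res (g n)\<close>; testing identifies their limit.\<close>

lemma weak_laplacian_limit:
  assumes g: "\<And>n. g n \<in> Pol" "L2conv M4 g \<phi>" "L2conv M4 (\<lambda>n. Res (g n)) u"
  shows "\<exists>G. L2conv lebesgue (\<lambda>n. laplacian (g n)) G \<and> has_weak_laplacian \<phi> G"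
proof -
  have lapL: "laplacian (g n) \<in> L2fn lebesgue" for n by (intro Pol_laplacian_L2 g)
  have rL: "Res (g n) \<in> L2fn M4" "u \<in> L2fn M4" "\<phi> \<in> L2fn M4" for n using g by (auto simp: L2conv_def)
  have "\<exists>G. L2conv lebesgue (\<lambda>n. laplacian (g n)) G"
  proof (rule L2fn_complete[OF lapL])
    fix e :: real assume "e > 0"
    have "(\<lambda>n. LINT x|M4. (Res (g n) x - u x)\<^sup>2) \<longlonglongrightarrow> 0" using g by (simp add: L2conv_def)
    then have "eventually (\<lambda>n. (LINT x|M4. (Res (g n) x - u x)\<^sup>2) < e / 4) sequentially"
      using \<open>e > 0\<close> by (intro order_tendstoD) auto
    then obtain N where N: "\<And>n. n \<ge> N \<Longrightarrow> (LINT x|M4. (Res (g n) x - u x)\<^sup>2) < e / 4"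
      by (auto simp: eventually_sequentially)
    have "(LINT x|lebesgue. (laplacian (g m) x - laplacian (g n) x)\<^sup>2) < e" if "m \<ge> N" "n \<ge> N" for m n
    proof -
      have "(LINT x|lebesgue. (laplacian (g m) x - laplacian (g n) x)\<^sup>2) = (LINT x|lebesgue. (laplacian (\<lambda>x. g m x - g n x) x)\<^sup>2)"
        using g by (simp add: laplacian_diff Pol_smooth)
      also have "\<dots> \<le> (LINT x|M4. (Res (\<lambda>x. g m x - g n x) x)\<^sup>2)"
        by (intro laplacian_Res_bound Pol_diff g)
      also have "\<dots> = (LINT x|M4. (Res (g m) x - Res (g n) x)\<^sup>2)" by (simp add: Res_diff g)
      also have "\<dots> \<le> 2 * (LINT x|M4. (Res (g m) x - u x)\<^sup>2) + 2 * (LINT x|M4. (u x - Res (g n) x)\<^sup>2)"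
        by (intro L2fn_triangle rL)
      also have "\<dots> = 2 * (LINT x|M4. (Res (g m) x - u x)\<^sup>2) + 2 * (LINT x|M4. (Res (g n) x - u x)\<^sup>2)"
        by (simp add: power2_commute)
      also have "\<dots> < e" using N[OF that(1)] N[OF that(2)] by simp
      finally show ?thesis .
    qed
    then show "\<exists>N. \<forall>m\<ge>N. \<forall>n\<ge>N. (LINT x|lebesgue. (laplacian (g m) x - laplacian (g n) x)\<^sup>2) < e" by blast
  qed
  then obtain G where G: "L2conv lebesgue (\<lambda>n. laplacian (g n)) G" by blast
  have "has_weak_laplacian \<phi> G" unfolding has_weak_laplacian_def
  proof (intro conjI allI impI)
    show "\<phi> \<in> L1_loc" using rL by (intro L2fn_M4_L1_loc)
    show "G \<in> L1_loc" using G by (intro L2fn_L1_loc) (simp add: L2conv_def)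
    fix \<psi> :: "real^4 \<Rightarrow> real" assume \<psi>: "test_fun \<psi>"
    have e: "(LINT x|M4. g n x * (laplacian \<psi> x / omega x ^ 4)) = (LINT x|lebesgue. laplacian (g n) x * \<psi> x)" for n
      using integral_laplacian_by_parts[OF Pol_smooth[OF g(1)] \<psi>, of n]
        integral_M4_div_omega[OF Pol_measurable[OF g(1)] test_fun_laplacian[OF \<psi>], of n] by simp
    have "(\<lambda>n. LINT x|M4. g n x * (laplacian \<psi> x / omega x ^ 4)) \<longlonglongrightarrow> (LINT x|M4. \<phi> x * (laplacian \<psi> x / omega x ^ 4))"
      by (rule L2conv_inner[OF g(2) test_fun_L2fn_M4[OF test_fun_div_omega[OF test_fun_laplacian[OF \<psi>]]]])
    moreover have "(\<lambda>n. LINT x|lebesgue. laplacian (g n) x * \<psi> x) \<longlonglongrightarrow> (LINT x|lebesgue. G x * \<psi> x)"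
      by (rule L2conv_inner[OF G test_fun_L2fn[OF \<psi>]])
    ultimately have "(LINT x|M4. \<phi> x * (laplacian \<psi> x / omega x ^ 4)) = (LINT x|lebesgue. G x * \<psi> x)"
      unfolding e by (rule LIMSEQ_unique)
    then show "(LINT x|lebesgue. \<phi> x * laplacian \<psi> x) = (LINT x|lebesgue. G x * \<psi> x)"
      using integral_M4_div_omega[OF _ test_fun_laplacian[OF \<psi>], of \<phi>] L2fn_measurable[OF rL(3)] by simp
  qed
  then show ?thesis using G by blast
qed

section \<open>The convolution part of the linearized operator\<close>

definition eU :: "real \<Rightarrow> real^4 \<Rightarrow> real" where "eU \<alpha> x = exp (bubble \<alpha> 1 0 x)"

lemma C_alpha_pos: "0 < \<alpha> \<Longrightarrow> \<alpha> < 4 \<Longrightarrow> C_alpha \<alpha> > 0"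
  unfolding C_alpha_def by simp

lemma eU_eq:
  assumes "0 < \<alpha>" "\<alpha> < 4"
  shows "eU \<alpha> x = (C_alpha \<alpha> / 2) powr (4 - \<alpha> / 2) * omega x powr (4 - \<alpha> / 2)"
proof -
  have n: "1 + (norm x)\<^sup>2 > 0" by (intro add_pos_nonneg) auto
  have c: "C_alpha \<alpha> / (1 + (norm x)\<^sup>2) > 0" using C_alpha_pos[OF assms] n by simp
  have "(8 - \<alpha>) / 2 = 4 - \<alpha> / 2" by (simp add: field_simps)
  then have "eU \<alpha> x = (C_alpha \<alpha> / (1 + (norm x)\<^sup>2)) powr (4 - \<alpha> / 2)"
    using c C_alpha_pos[OF assms] n by (simp add: eU_def bubble_def powr_def)
  also have "C_alpha \<alpha> / (1 + (norm x)\<^sup>2) = C_alpha \<alpha> / 2 * omega x" by (simp add: omega_def)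
  finally show ?thesis by (simp only: powr_mult)
qed

lemma eU_pos: "eU \<alpha> x > 0" by (simp add: eU_def)

lemma eU_measurable [measurable]: "0 < \<alpha> \<Longrightarrow> \<alpha> < 4 \<Longrightarrow> eU \<alpha> \<in> borel_measurable borel"
  by (subst measurable_cong[OF eU_eq]) measurable

text \<open>Both bubble factors are included, which makes the kernel symmetric and its row integrals
  multiples of omega^4, the density of \<open>M4\<close>.\<close>

definition kern :: "real \<Rightarrow> real^4 \<Rightarrow> real^4 \<Rightarrow> real" where
  "kern \<alpha> x y = eU \<alpha> x * eU \<alpha> y / norm (x - y) powr \<alpha>"

lemma kern_nonneg: "kern \<alpha> x y \<ge> 0"
  unfolding kern_def using eU_pos less_imp_le by (intro divide_nonneg_nonneg mult_nonneg_nonneg) auto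

lemma kern_commute: "kern \<alpha> x y = kern \<alpha> y x"
  by (simp add: kern_def norm_minus_commute mult.commute)

lemma kern_measurable:
  assumes "0 < \<alpha>" "\<alpha> < 4"
  shows "(\<lambda>z. kern \<alpha> (fst z) (snd z)) \<in> borel_measurable (lborel \<Otimes>\<^sub>M lborel)" "kern \<alpha> x \<in> borel_measurable borel"
  using eU_measurable[OF assms] unfolding kern_def[abs_def] by measurable

lemma kern_eq:
  assumes \<alpha>: "0 < \<alpha>" "\<alpha> < 4"
  shows "kern \<alpha> x y = (C_alpha \<alpha> / 2) powr (8 - \<alpha>) * omega x powr (4 - \<alpha> / 2) * (omega y powr (4 - \<alpha> / 2) / norm (x - y) powr \<alpha>)"
proof -
  have "(C_alpha \<alpha> / 2) powr (8 - \<alpha>) = (C_alpha \<alpha> / 2) powr (4 - \<alpha> / 2) * (C_alpha \<alpha> / 2) powr (4 - \<alpha> / 2)"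
    by (subst powr_add[symmetric]) simp
  then show ?thesis by (simp add: kern_def eU_eq[OF \<alpha>] mult_ac)
qed

text \<open>Here the choice of \<open>C_alpha\<close> takes effect: its power 8 - \<alpha> cancels
  pi^2, 6 - \<alpha> and 4 - \<alpha> from the integral of the weight and leaves 3 (8 -
  \<alpha>).\<close>

lemma kern_constant:
  assumes \<alpha>: "0 < \<alpha>" "\<alpha> < 4"
  shows "(C_alpha \<alpha> / 2) powr (8 - \<alpha>) * omega x powr (4 - \<alpha> / 2)
     * ((omega x / 2) powr (\<alpha> / 2) * (LINT z|lebesgue. omega z powr (4 - \<alpha> / 2))) = 3 * (8 - \<alpha>) * omega x ^ 4"
proof -
  let ?p = "4 - \<alpha> / 2"
  have J: "(LINT z|lebesgue. omega z powr ?p) = 2 powr ?p * pi\<^sup>2 / ((3 - \<alpha> / 2) * (2 - \<alpha> / 2))"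
    using \<alpha> by (subst omega_powr_integral) auto
  define A where "A = 12 * (8 - \<alpha>) * (6 - \<alpha>) * (4 - \<alpha>) / pi\<^sup>2"
  have A: "A > 0" using \<alpha> by (simp add: A_def)
  have C: "(C_alpha \<alpha> / 2) powr (8 - \<alpha>) = A * 2 powr (\<alpha> - 8)"
  proof -
    have "C_alpha \<alpha> powr (8 - \<alpha>) = A" using \<alpha> A unfolding C_alpha_def A_def[symmetric] powr_powr by simp
    moreover have "1 / 2 powr (8 - \<alpha>) = 2 powr (\<alpha> - 8)" by (simp add: powr_minus_divide[symmetric])
    ultimately show ?thesis unfolding powr_divide by (simp add: divide_inverse)
  qed
  have o: "omega x powr ?p * (omega x / 2) powr (\<alpha> / 2) = omega x ^ 4 * 2 powr (- \<alpha> / 2)"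
  proof -
    have "omega x powr ?p * omega x powr (\<alpha> / 2) = omega x ^ 4"
      using powr_add[of "omega x" ?p "\<alpha> / 2"] omega_powr_nat[of x 4] by simp
    moreover have "(omega x / 2) powr (\<alpha> / 2) = omega x powr (\<alpha> / 2) * 2 powr (- \<alpha> / 2)"
      unfolding powr_divide by (simp add: powr_minus_divide)
    ultimately show ?thesis by (simp add: mult.assoc[symmetric])
  qed
  \<comment> \<open>The powers of 2 stem from the halved \<open>C_alpha\<close>, the halved
    \<open>omega x\<close> and the integral; the exponents add up to -4.\<close>
  have t: "2 powr (\<alpha> - 8) * 2 powr (- \<alpha> / 2) * 2 powr ?p = (1 / 16 :: real)"
  proof -
    have "2 powr (\<alpha> - 8) * 2 powr (- \<alpha> / 2) * 2 powr ?p = 2 powr (- real 4)"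
      by (subst powr_add[symmetric])+ simp
    also have "\<dots> = 1 / 2 ^ 4" by (subst powr_minus_divide, subst powr_realpow) auto
    finally show ?thesis by simp
  qed
  have "(C_alpha \<alpha> / 2) powr (8 - \<alpha>) * omega x powr ?p * ((omega x / 2) powr (\<alpha> / 2) * (LINT z|lebesgue. omega z powr ?p))
    = A * (2 powr (\<alpha> - 8) * 2 powr (- \<alpha> / 2) * 2 powr ?p) * (omega x ^ 4 * (pi\<^sup>2 / ((3 - \<alpha> / 2) * (2 - \<alpha> / 2))))"
    unfolding C J using o by (simp add: mult_ac)
  also have "\<dots> = A * (1 / 16) * (omega x ^ 4 * (pi\<^sup>2 / ((3 - \<alpha> / 2) * (2 - \<alpha> / 2))))" unfolding t ..
  also have "\<dots> = A * pi\<^sup>2 / (4 * ((6 - \<alpha>) * (4 - \<alpha>))) * omega x ^ 4"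
  proof -
    have q: "(3 - \<alpha> / 2) * (2 - \<alpha> / 2) = (6 - \<alpha>) * (4 - \<alpha>) / 4" by (simp add: field_simps)
    show ?thesis unfolding q by simp
  qed
  also have "A * pi\<^sup>2 / (4 * ((6 - \<alpha>) * (4 - \<alpha>))) = 3 * (8 - \<alpha>)"
  proof -
    have "12 * a * b * c / pi\<^sup>2 * pi\<^sup>2 / (4 * (b * c)) = 3 * a" if "b \<noteq> 0" "c \<noteq> 0" for a b c :: real
      using that by simp
    from this[of "6 - \<alpha>" "4 - \<alpha>" "8 - \<alpha>"] \<alpha> show ?thesis unfolding A_def by argo
  qed
  finally show ?thesis .
qed

lemma kern_const:
  assumes \<alpha>: "0 < \<alpha>" "\<alpha> < 4"
  shows "integrable lebesgue (kern \<alpha> x)" "(LINT y|lebesgue. kern \<alpha> x y) = 3 * (8 - \<alpha>) * omega x ^ 4"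
proof -
  have k: "kern \<alpha> x = (\<lambda>y. (C_alpha \<alpha> / 2) powr (8 - \<alpha>) * omega x powr (4 - \<alpha> / 2) * (omega y powr (4 - \<alpha> / 2) / norm (x - y) powr \<alpha>))"
    by (intro ext kern_eq \<alpha>)
  show "integrable lebesgue (kern \<alpha> x)" unfolding k using Riesz_kernel_const(1)[OF \<alpha>] by (rule integrable_mult_right)
  show "(LINT y|lebesgue. kern \<alpha> x y) = 3 * (8 - \<alpha>) * omega x ^ 4"
    unfolding k integral_mult_right_zero Riesz_kernel_const(2)[OF \<alpha>] by (rule kern_constant[OF \<alpha>])
qed

lemma kern_sc:
  assumes \<alpha>: "0 < \<alpha>" "\<alpha> < 4"
  shows "(LINT y|lebesgue. kern \<alpha> x y * sc v y) = 3 * \<alpha> * omega x ^ 4 * sc v x"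
proof -
  let ?c = "(C_alpha \<alpha> / 2) powr (8 - \<alpha>) * omega x powr (4 - \<alpha> / 2)"
  have k: "kern \<alpha> x y * sc v y = ?c * (omega y powr (4 - \<alpha> / 2) / norm (x - y) powr \<alpha> * sc v y)" for y
    by (simp only: kern_eq[OF \<alpha>] mult.assoc)
  have "(LINT y|lebesgue. kern \<alpha> x y * sc v y)
    = \<alpha> / (8 - \<alpha>) * sc v x * (?c * ((omega x / 2) powr (\<alpha> / 2) * (LINT z|lebesgue. omega z powr (4 - \<alpha> / 2))))"
    unfolding k integral_mult_right_zero Riesz_kernel_sc(2)[OF \<alpha>] by (simp only: mult_ac)
  also have "\<dots> = \<alpha> / (8 - \<alpha>) * sc v x * (3 * (8 - \<alpha>) * omega x ^ 4)" unfolding kern_constant[OF \<alpha>] ..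
  also have "\<dots> = 3 * \<alpha> * omega x ^ 4 * sc v x"
  proof -
    have "\<alpha> / d * s * (3 * d * t) = 3 * \<alpha> * t * s" if "d \<noteq> 0" for d s t :: real using that by simp
    from this[of "8 - \<alpha>" "sc v x" "omega x ^ 4"] show ?thesis using \<alpha> by argo
  qed
  finally show ?thesis .
qed

lemma riesz_eU_mult: "riesz \<alpha> (\<lambda>y. eU \<alpha> y * f y) x * eU \<alpha> x = (LINT y|lebesgue. kern \<alpha> x y * f y)"
proof -
  have "riesz \<alpha> (\<lambda>y. eU \<alpha> y * f y) x * eU \<alpha> x = (LINT y|lebesgue. eU \<alpha> y * f y / norm (x - y) powr \<alpha> * eU \<alpha> x)"
    unfolding riesz_def by (rule integral_mult_left_zero[symmetric])
  then show ?thesis by (simp add: kern_def mult_ac)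
qed

lemma riesz_eU:
  assumes \<alpha>: "0 < \<alpha>" "\<alpha> < 4"
  shows "riesz \<alpha> (eU \<alpha>) x * eU \<alpha> x = 3 * (8 - \<alpha>) * omega x ^ 4"
  using riesz_eU_mult[of \<alpha> "\<lambda>_. 1" x] kern_const[OF \<alpha>] by simp

text \<open>Iterated integrals are taken with respect to products of Borel measures, for which a
  Lebesgue measurable function must first be replaced by a Borel representative.\<close>

lemma L2fn_M4_borel:
  assumes "\<phi> \<in> L2fn M4"
  obtains \<phi>' where "\<phi>' \<in> borel_measurable borel" "AE x in lborel. \<phi> x = \<phi>' x" "\<phi>' \<in> L2fn M4"
proof -
  have "\<phi> \<in> borel_measurable lebesgue" using L2fn_measurable[OF assms] by simp
  from completion_ex_borel_measurable_real[OF this]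
  obtain \<phi>' where p: "\<phi>' \<in> borel_measurable lborel" "AE x in lborel. \<phi> x = \<phi>' x" by blast
  then have "\<phi>' \<in> borel_measurable lebesgue" by (intro measurable_completion)
  then have "\<phi>' \<in> L2fn M4"
    using p by (intro L2fn_AE[OF assms]) (auto simp: AE_M4 AE_completion_iff)
  then show ?thesis using that p by auto
qed

lemma omega4_integrable:
  assumes "\<phi> \<in> L2fn M4" "\<psi> \<in> L2fn M4"
  shows "integrable lebesgue (\<lambda>x. omega x ^ 4 * (\<phi> x * \<psi> x))" "(LINT x|lebesgue. omega x ^ 4 * (\<phi> x * \<psi> x)) = (LINT x|M4. \<phi> x * \<psi> x)"
  using L2fn_mult[OF assms] L2fn_measurable[OF assms(1)] L2fn_measurable[OF assms(2)]
  by (simp_all add: integrable_M4 integral_M4)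

text \<open>The two halves of a Schur test: the kernel is symmetric with row integrals 3 (8 -
  \<alpha>) omega^4, so integrating out the variable on which \<open>p\<close> does not depend
  leaves an \<open>M4\<close> norm.\<close>

lemma kern_square:
  assumes \<alpha>: "0 < \<alpha>" "\<alpha> < 4" and p: "p \<in> borel_measurable borel" "p \<in> L2fn M4"
  shows "integrable (lborel \<Otimes>\<^sub>M lborel) (\<lambda>z. kern \<alpha> (fst z) (snd z) * (p (fst z))\<^sup>2)"
    "(LINT z|(lborel \<Otimes>\<^sub>M lborel). kern \<alpha> (fst z) (snd z) * (p (fst z))\<^sup>2) = 3 * (8 - \<alpha>) * (LINT x|M4. (p x)\<^sup>2)"
    "integrable (lborel \<Otimes>\<^sub>M lborel) (\<lambda>z. kern \<alpha> (fst z) (snd z) * (p (snd z))\<^sup>2)"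
    "(LINT z|(lborel \<Otimes>\<^sub>M lborel). kern \<alpha> (fst z) (snd z) * (p (snd z))\<^sup>2) = 3 * (8 - \<alpha>) * (LINT x|M4. (p x)\<^sup>2)"
proof -
  let ?F = "\<lambda>z. kern \<alpha> (fst z) (snd z) * (p (fst z))\<^sup>2"
  have pm: "p \<in> borel_measurable lborel" using p by simp
  have F: "?F \<in> borel_measurable (lborel \<Otimes>\<^sub>M lborel)"
    using kern_measurable(1)[OF \<alpha>] pm by measurable
  have k: "integrable lborel (kern \<alpha> x)" "(LINT y|lborel. kern \<alpha> x y) = 3 * (8 - \<alpha>) * omega x ^ 4" for x
    using kern_const[OF \<alpha>, of x] kern_measurable(2)[OF \<alpha>, of x] by (simp_all add: integrable_completion integral_completion)
  have in1: "(LINT y|lborel. kern \<alpha> x y * (p x)\<^sup>2) = 3 * (8 - \<alpha>) * (omega x ^ 4 * (p x * p x))" for x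
    by (simp add: k power2_eq_square)
  have om: "integrable lborel (\<lambda>x. omega x ^ 4 * (p x * p x))" "(LINT x|lborel. omega x ^ 4 * (p x * p x)) = (LINT x|M4. (p x)\<^sup>2)"
    using omega4_integrable[OF p(2) p(2)] p(1)
    by (simp_all add: integrable_completion integral_completion power2_eq_square)
  show i: "integrable (lborel \<Otimes>\<^sub>M lborel) ?F"
  proof (rule lborel_pair.Fubini_integrable[OF F])
    have "norm (kern \<alpha> x y * (p x)\<^sup>2) = kern \<alpha> x y * (p x)\<^sup>2" for x y
      using kern_nonneg[of \<alpha> x y] by simp
    then show "integrable lborel (\<lambda>x. LINT y|lborel. norm (kern \<alpha> (fst (x, y)) (snd (x, y)) * (p (fst (x, y)))\<^sup>2))"
      unfolding fst_conv snd_conv using om(1) by (simp only: in1 integrable_mult_right)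
    show "AE x in lborel. integrable lborel (\<lambda>y. kern \<alpha> (fst (x, y)) (snd (x, y)) * (p (fst (x, y)))\<^sup>2)"
      using k by simp
  qed
  show v: "(LINT z|(lborel \<Otimes>\<^sub>M lborel). ?F z) = 3 * (8 - \<alpha>) * (LINT x|M4. (p x)\<^sup>2)"
    unfolding lborel_pair.integral_fst'[OF i, symmetric] fst_conv snd_conv in1 integral_mult_right_zero om(2) ..
  have e: "(\<lambda>(x, y). ?F (y, x)) = (\<lambda>z. kern \<alpha> (fst z) (snd z) * (p (snd z))\<^sup>2)"
    by (auto simp: fun_eq_iff kern_commute)
  show "integrable (lborel \<Otimes>\<^sub>M lborel) (\<lambda>z. kern \<alpha> (fst z) (snd z) * (p (snd z))\<^sup>2)"
    using lborel_pair.integrable_product_swap[OF i] unfolding e .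
  show "(LINT z|(lborel \<Otimes>\<^sub>M lborel). kern \<alpha> (fst z) (snd z) * (p (snd z))\<^sup>2) = 3 * (8 - \<alpha>) * (LINT x|M4. (p x)\<^sup>2)"
    using lborel_pair.integral_product_swap[OF F] v unfolding e by simp
qed

text \<open>|a b| <= (a^2 + b^2) / 2 reduces the mixed integral to the two squares; for
  \<open>p = q\<close> the bound is the operator norm estimate 3 (8 - \<alpha>).\<close>

lemma kern_product_borel:
  assumes \<alpha>: "0 < \<alpha>" "\<alpha> < 4" and p: "p \<in> borel_measurable borel" "p \<in> L2fn M4" and q: "q \<in> borel_measurable borel" "q \<in> L2fn M4"
  shows "integrable (lborel \<Otimes>\<^sub>M lborel) (\<lambda>z. kern \<alpha> (fst z) (snd z) * (p (fst z) * q (snd z)))"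
    "\<bar>LINT z|(lborel \<Otimes>\<^sub>M lborel). kern \<alpha> (fst z) (snd z) * (p (fst z) * q (snd z))\<bar>
      \<le> 3 * (8 - \<alpha>) * ((LINT x|M4. (p x)\<^sup>2) + (LINT x|M4. (q x)\<^sup>2)) / 2"
proof -
  let ?F = "\<lambda>z. kern \<alpha> (fst z) (snd z) * (p (fst z) * q (snd z))"
  let ?G = "\<lambda>z. (kern \<alpha> (fst z) (snd z) * (p (fst z))\<^sup>2 + kern \<alpha> (fst z) (snd z) * (q (snd z))\<^sup>2) / 2"
  have m: "p \<in> borel_measurable lborel" "q \<in> borel_measurable lborel" using p q by simp_all
  have F: "?F \<in> borel_measurable (lborel \<Otimes>\<^sub>M lborel)"
    using kern_measurable(1)[OF \<alpha>] m by measurable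
  have iG: "integrable (lborel \<Otimes>\<^sub>M lborel) ?G" using kern_square[OF \<alpha> p] kern_square[OF \<alpha> q] by simp
  have b: "\<bar>?F z\<bar> \<le> ?G z" for z
  proof -
    have "\<bar>?F z\<bar> = kern \<alpha> (fst z) (snd z) * \<bar>p (fst z) * q (snd z)\<bar>"
      using kern_nonneg[of \<alpha> "fst z" "snd z"] by (simp add: abs_mult)
    also have "\<dots> \<le> kern \<alpha> (fst z) (snd z) * (((p (fst z))\<^sup>2 + (q (snd z))\<^sup>2) / 2)"
      by (intro mult_left_mono abs_mult_le_squares kern_nonneg)
    finally show ?thesis by (simp add: distrib_left)
  qed
  show i: "integrable (lborel \<Otimes>\<^sub>M lborel) ?F"
    by (rule Bochner_Integration.integrable_bound[OF iG F]) (use b in \<open>auto intro!: AE_I2 order_trans[OF _ abs_ge_self]\<close>)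
  have "\<bar>LINT z|(lborel \<Otimes>\<^sub>M lborel). ?F z\<bar> \<le> (LINT z|(lborel \<Otimes>\<^sub>M lborel). ?G z)"
    by (rule order_trans[OF integral_abs_bound]) (intro integral_mono integrable_abs i iG b)
  also have "\<dots> = 3 * (8 - \<alpha>) * ((LINT x|M4. (p x)\<^sup>2) + (LINT x|M4. (q x)\<^sup>2)) / 2"
    using kern_square[OF \<alpha> p] kern_square[OF \<alpha> q] by (simp add: distrib_left)
  finally show "\<bar>LINT z|(lborel \<Otimes>\<^sub>M lborel). ?F z\<bar> \<le> 3 * (8 - \<alpha>) * ((LINT x|M4. (p x)\<^sup>2) + (LINT x|M4. (q x)\<^sup>2)) / 2" .
qed

section \<open>The kernel as a bilinear form and as an operator on the sphere\<close>

definition kern_form :: "real \<Rightarrow> (real^4 \<Rightarrow> real) \<Rightarrow> (real^4 \<Rightarrow> real) \<Rightarrow> real" where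
  "kern_form \<alpha> \<phi> \<psi> = (LINT (x, y)|lebesgue. eU \<alpha> x * \<phi> x * (eU \<alpha> y * \<psi> y) / norm (x - y) powr \<alpha>)"

text \<open>The operator \<open>3 (8 - \<alpha>) K\<close> on the sphere, \<open>K\<close> being the Markov operator of the kernel.\<close>

definition Kop :: "real \<Rightarrow> (real^4 \<Rightarrow> real) \<Rightarrow> real^4 \<Rightarrow> real" where
  "Kop \<alpha> \<phi> x = (LINT y|lebesgue. kern \<alpha> x y * \<phi> y) / omega x ^ 4"

text \<open>\<open>kern_form\<close> integrates over the Lebesgue measure of the product type; this
  carries the choice of representatives in each factor over to it.\<close>

lemma AE_lborel_prod:
  fixes P :: "'a::euclidean_space \<Rightarrow> bool" and Q :: "'b::euclidean_space \<Rightarrow> bool"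
  assumes "AE x in lborel. P x" "AE y in lborel. Q y"
  shows "AE z in lborel. P (fst z) \<and> Q (snd z)"
proof -
  obtain N where N: "N \<in> null_sets lborel" "{x \<in> space lborel. \<not> P x} \<subseteq> N"
    using assms(1) by (auto simp: eventually_ae_filter)
  obtain N' where N': "N' \<in> null_sets lborel" "{x \<in> space lborel. \<not> Q x} \<subseteq> N'"
    using assms(2) by (auto simp: eventually_ae_filter)
  have [measurable]: "N \<in> sets lborel" "N' \<in> sets lborel" using N N' by auto
  have "AE z in lborel \<Otimes>\<^sub>M lborel. fst z \<notin> N \<and> snd z \<notin> N'"
  proof (rule lborel_pair.AE_pair_measure)
    show "{x \<in> space (lborel \<Otimes>\<^sub>M lborel). fst x \<notin> N \<and> snd x \<notin> N'} \<in> sets (lborel \<Otimes>\<^sub>M lborel)" by measurable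
    have "AE x in lborel. x \<notin> N" "AE y in lborel. y \<notin> N'" using N N' by (auto intro: AE_not_in)
    then show "AE x in lborel. AE y in lborel. fst (x, y) \<notin> N \<and> snd (x, y) \<notin> N'"
      unfolding fst_conv snd_conv by (elim eventually_mono) simp
  qed
  then have "AE z in lborel. fst z \<notin> N \<and> snd z \<notin> N'" by (simp only: lborel_prod)
  then show ?thesis by eventually_elim (use N N' in auto)
qed

lemma kern_form_borel:
  assumes \<alpha>: "0 < \<alpha>" "\<alpha> < 4"
    and p: "p \<in> borel_measurable borel" "p \<in> L2fn M4" "AE x in lborel. \<phi> x = p x"
    and q: "q \<in> borel_measurable borel" "q \<in> L2fn M4" "AE x in lborel. \<psi> x = q x"
  shows "integrable lebesgue (\<lambda>(x, y). eU \<alpha> x * \<phi> x * (eU \<alpha> y * \<psi> y) / norm (x - y) powr \<alpha>)"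
    "kern_form \<alpha> \<phi> \<psi> = (LINT z|(lborel \<Otimes>\<^sub>M lborel). kern \<alpha> (fst z) (snd z) * (p (fst z) * q (snd z)))"
proof -
  let ?F = "\<lambda>z. kern \<alpha> (fst z) (snd z) * (p (fst z) * q (snd z))"
  let ?H = "\<lambda>(x, y). eU \<alpha> x * \<phi> x * (eU \<alpha> y * \<psi> y) / norm (x - y) powr \<alpha>"
  have i: "integrable lborel ?F" using kern_product_borel(1)[OF \<alpha> p(1,2) q(1,2)] by (simp only: lborel_prod)
  then have Fm: "?F \<in> borel_measurable lborel" by auto
  have iL: "integrable lebesgue ?F" using i integrable_completion[OF Fm] by simp
  have ae: "AE z in lebesgue. ?F z = ?H z"
    using AE_completion[OF AE_lborel_prod[OF p(3) q(3)]]
    by eventually_elim (auto simp: kern_def mult_ac split: prod.split)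
  have Hm: "?H \<in> borel_measurable lebesgue"
    by (rule borel_measurable_AE[OF _ ae]) (use iL in auto)
  show "integrable lebesgue ?H" by (rule integrable_cong_AE_imp[OF iL Hm]) (use ae in \<open>auto elim!: eventually_mono\<close>)
  have "(LINT z|lebesgue. ?H z) = (LINT z|lebesgue. ?F z)"
    using Hm iL ae by (intro integral_cong_AE) (auto elim!: eventually_mono)
  then show "kern_form \<alpha> \<phi> \<psi> = (LINT z|(lborel \<Otimes>\<^sub>M lborel). ?F z)"
    using Fm by (simp add: kern_form_def integral_completion lborel_prod)
qed

lemma Kop_AE:
  assumes \<alpha>: "0 < \<alpha>" "\<alpha> < 4"
    and p: "p \<in> borel_measurable borel" "\<phi> \<in> borel_measurable lebesgue" "AE x in lborel. \<phi> x = p x"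
  shows "Kop \<alpha> \<phi> x = (LINT y|lborel. kern \<alpha> x y * p y) / omega x ^ 4"
proof -
  have k: "kern \<alpha> x \<in> borel_measurable lborel" using kern_measurable(2)[OF \<alpha>] by simp
  have pm: "p \<in> borel_measurable lborel" using p by simp
  have km: "(\<lambda>y. kern \<alpha> x y * p y) \<in> borel_measurable lborel" using k pm by (rule borel_measurable_times)
  have "(LINT y|lebesgue. kern \<alpha> x y * \<phi> y) = (LINT y|lebesgue. kern \<alpha> x y * p y)"
  proof (rule integral_cong_AE)
    show "(\<lambda>y. kern \<alpha> x y * \<phi> y) \<in> borel_measurable lebesgue"
      by (intro borel_measurable_times p(2) measurable_completion[OF k])
    show "(\<lambda>y. kern \<alpha> x y * p y) \<in> borel_measurable lebesgue" by (rule measurable_completion[OF km])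
    show "AE y in lebesgue. kern \<alpha> x y * \<phi> y = kern \<alpha> x y * p y"
      using AE_completion[OF p(3)] by eventually_elim simp
  qed
  then show ?thesis using integral_completion[OF km] by (simp add: Kop_def)
qed

text \<open>Cauchy-Schwarz in y with the integrand split as sqrt kern times sqrt kern * p: the first
  factor yields the row integral, the second a function of x that is integrable by the Schur
  bound.\<close>

lemma Kop_L2fn:
  assumes \<alpha>: "0 < \<alpha>" "\<alpha> < 4" and \<phi>: "\<phi> \<in> L2fn M4"
  shows "Kop \<alpha> \<phi> \<in> L2fn M4"
proof -
  obtain p where p: "p \<in> borel_measurable borel" "AE x in lborel. \<phi> x = p x" "p \<in> L2fn M4"
    using L2fn_M4_borel[OF \<phi>] by blast
  have pm: "p \<in> borel_measurable lborel" using p by simp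
  have one: "(\<lambda>x. 1) \<in> L2fn M4" by (rule Pol_L2fn[OF Pol_const])
  have K: "Kop \<alpha> \<phi> = (\<lambda>x. (LINT y|lborel. kern \<alpha> x y * p y) / omega x ^ 4)"
    using L2fn_measurable[OF \<phi>] by (intro ext Kop_AE[OF \<alpha> p(1) _ p(2)]) simp
  have "(\<lambda>z. kern \<alpha> (fst z) (snd z) * p (snd z)) \<in> borel_measurable (lborel \<Otimes>\<^sub>M lborel)"
    using kern_measurable(1)[OF \<alpha>] pm by measurable
  then have Im: "(\<lambda>x. LINT y|lborel. kern \<alpha> x y * p y) \<in> borel_measurable lborel"
    by (intro lborel.borel_measurable_lebesgue_integral) (simp add: case_prod_unfold)
  then have Km: "Kop \<alpha> \<phi> \<in> borel_measurable lborel" unfolding K by measurable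
  let ?S = "\<lambda>x. LINT y|lborel. kern \<alpha> x y * (p y)\<^sup>2"
  have iS: "integrable lborel ?S"
    using lborel_pair.integrable_fst'[OF kern_square(3)[OF \<alpha> p(1,3)]] by simp
  have aeS: "AE x in lborel. integrable lborel (\<lambda>y. kern \<alpha> x y * (p y)\<^sup>2)"
    using lborel_pair.AE_integrable_fst'[OF kern_square(3)[OF \<alpha> p(1,3)]] by simp
  have k: "integrable lborel (kern \<alpha> x)" "(LINT y|lborel. kern \<alpha> x y) = 3 * (8 - \<alpha>) * omega x ^ 4" for x
    using kern_const[OF \<alpha>, of x] kern_measurable(2)[OF \<alpha>, of x] by (simp_all add: integrable_completion integral_completion)
  have bound: "AE x in lborel. omega x ^ 4 * (Kop \<alpha> \<phi> x)\<^sup>2 \<le> 3 * (8 - \<alpha>) * ?S x"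
    using aeS
  proof eventually_elim
    case (elim x)
    have km: "kern \<alpha> x \<in> borel_measurable lborel" using kern_measurable(2)[OF \<alpha>] by simp
    have sq: "sqrt (kern \<alpha> x y) * sqrt (kern \<alpha> x y) = kern \<alpha> x y" for y using kern_nonneg by simp
    have 1: "(\<lambda>y. sqrt (kern \<alpha> x y)) \<in> L2fn lborel"
      using k km by (intro L2fnI) (auto simp: power2_eq_square sq)
    have 2: "(\<lambda>y. sqrt (kern \<alpha> x y) * p y) \<in> L2fn lborel"
    proof (rule L2fnI)
      show "(\<lambda>y. sqrt (kern \<alpha> x y) * p y) \<in> borel_measurable lborel" using km pm by measurable
      have "(sqrt (kern \<alpha> x y) * p y)\<^sup>2 = kern \<alpha> x y * (p y)\<^sup>2" for y
        using kern_nonneg by (simp add: power_mult_distrib)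
      then show "integrable lborel (\<lambda>y. (sqrt (kern \<alpha> x y) * p y)\<^sup>2)" using elim by simp
    qed
    have "(LINT y|lborel. kern \<alpha> x y * p y)\<^sup>2 \<le> (3 * (8 - \<alpha>) * omega x ^ 4) * ?S x"
      using L2fn_Cauchy_Schwarz[OF 1 2] kern_nonneg k(2)[of x]
      by (simp add: mult.assoc[symmetric] sq power_mult_distrib)
    then have "omega x ^ 4 * (LINT y|lborel. kern \<alpha> x y * p y)\<^sup>2 \<le> omega x ^ 4 * ((3 * (8 - \<alpha>) * omega x ^ 4) * ?S x)"
      by (intro mult_left_mono) auto
    moreover have "omega x ^ 4 * (Kop \<alpha> \<phi> x)\<^sup>2 = omega x ^ 4 * (LINT y|lborel. kern \<alpha> x y * p y)\<^sup>2 / (omega x ^ 4 * omega x ^ 4)"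
      unfolding K by (simp add: power_divide power2_eq_square)
    ultimately have "omega x ^ 4 * (Kop \<alpha> \<phi> x)\<^sup>2 \<le> omega x ^ 4 * ((3 * (8 - \<alpha>) * omega x ^ 4) * ?S x) / (omega x ^ 4 * omega x ^ 4)"
      by (simp only: divide_right_mono mult_nonneg_nonneg zero_le_power omega_nonneg)
    moreover have "w * ((c * w) * S) / (w * w) = c * S" if "w \<noteq> 0" for w c S :: real using that by simp
    ultimately show ?case by (simp only: zero_neq_one omega_nonzero power_not_zero not_False_eq_True)
  qed
  have iK: "integrable lborel (\<lambda>x. omega x ^ 4 * (Kop \<alpha> \<phi> x)\<^sup>2)"
  proof (rule Bochner_Integration.integrable_bound[OF integrable_mult_right[OF iS, of "3 * (8 - \<alpha>)"]])
    show "(\<lambda>x. omega x ^ 4 * (Kop \<alpha> \<phi> x)\<^sup>2) \<in> borel_measurable lborel" using Km by measurable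
    show "AE x in lborel. norm (omega x ^ 4 * (Kop \<alpha> \<phi> x)\<^sup>2) \<le> norm (3 * (8 - \<alpha>) * ?S x)"
      using bound by eventually_elim simp
  qed
  have "Kop \<alpha> \<phi> \<in> borel_measurable lebesgue" using Km by (rule measurable_completion)
  moreover have "integrable lebesgue (\<lambda>x. omega x ^ 4 * (Kop \<alpha> \<phi> x)\<^sup>2)"
    using iK integrable_completion[OF borel_measurable_integrable[OF iK]] by simp
  ultimately show ?thesis by (intro L2fnI) (auto simp: integrable_M4)
qed

lemma kern_form_Kop:
  assumes \<alpha>: "0 < \<alpha>" "\<alpha> < 4" and \<phi>: "\<phi> \<in> L2fn M4" and \<psi>: "\<psi> \<in> L2fn M4"
  shows "kern_form \<alpha> \<psi> \<phi> = (LINT x|M4. \<psi> x * Kop \<alpha> \<phi> x)"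
proof -
  obtain p where p: "p \<in> borel_measurable borel" "AE x in lborel. \<phi> x = p x" "p \<in> L2fn M4"
    using L2fn_M4_borel[OF \<phi>] by blast
  obtain q where q: "q \<in> borel_measurable borel" "AE x in lborel. \<psi> x = q x" "q \<in> L2fn M4"
    using L2fn_M4_borel[OF \<psi>] by blast
  have K: "Kop \<alpha> \<phi> x * omega x ^ 4 = (LINT y|lborel. kern \<alpha> x y * p y)" for x
    using Kop_AE[OF \<alpha> p(1) _ p(2), of x] L2fn_measurable[OF \<phi>] by simp
  have i: "integrable (lborel \<Otimes>\<^sub>M lborel) (\<lambda>z. kern \<alpha> (fst z) (snd z) * (q (fst z) * p (snd z)))"
    by (rule kern_product_borel(1)[OF \<alpha> q(1,3) p(1,3)])
  have "kern_form \<alpha> \<psi> \<phi> = (LINT z|(lborel \<Otimes>\<^sub>M lborel). kern \<alpha> (fst z) (snd z) * (q (fst z) * p (snd z)))"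
    by (rule kern_form_borel(2)[OF \<alpha> q(1,3,2) p(1,3,2)])
  also have "\<dots> = (LINT x|lborel. LINT y|lborel. kern \<alpha> x y * (q x * p y))"
    using lborel_pair.integral_fst'[OF i] by simp
  also have "\<dots> = (LINT x|lborel. q x * (Kop \<alpha> \<phi> x * omega x ^ 4))"
    unfolding K by (simp add: mult.left_commute)
  also have "\<dots> = (LINT x|lebesgue. q x * (Kop \<alpha> \<phi> x * omega x ^ 4))"
  proof -
    have "(\<lambda>x. LINT y|lborel. kern \<alpha> x y * (q x * p y)) \<in> borel_measurable lborel"
      using lborel_pair.integrable_fst'[OF i] by auto
    then have "(\<lambda>x. q x * (Kop \<alpha> \<phi> x * omega x ^ 4)) \<in> borel_measurable lborel"
      unfolding K by (simp add: mult.left_commute)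
    then show ?thesis by (simp add: integral_completion)
  qed
  also have "\<dots> = (LINT x|M4. q x * Kop \<alpha> \<phi> x)"
    using omega4_integrable(2)[OF q(3) Kop_L2fn[OF \<alpha> \<phi>]] by (simp add: mult_ac)
  also have "\<dots> = (LINT x|M4. \<psi> x * Kop \<alpha> \<phi> x)"
  proof (rule integral_cong_AE)
    show "AE x in M4. q x * Kop \<alpha> \<phi> x = \<psi> x * Kop \<alpha> \<phi> x"
      unfolding AE_M4 using AE_completion[OF q(2)] by eventually_elim simp
  qed (use L2fn_mult[OF q(3) Kop_L2fn[OF \<alpha> \<phi>]] L2fn_mult[OF \<psi> Kop_L2fn[OF \<alpha> \<phi>]] in auto)
  finally show ?thesis .
qed

lemma kern_form_commute:
  assumes \<alpha>: "0 < \<alpha>" "\<alpha> < 4" and \<phi>: "\<phi> \<in> L2fn M4" and \<psi>: "\<psi> \<in> L2fn M4"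
  shows "kern_form \<alpha> \<phi> \<psi> = kern_form \<alpha> \<psi> \<phi>"
proof -
  obtain p where p: "p \<in> borel_measurable borel" "AE x in lborel. \<phi> x = p x" "p \<in> L2fn M4"
    using L2fn_M4_borel[OF \<phi>] by blast
  obtain q where q: "q \<in> borel_measurable borel" "AE x in lborel. \<psi> x = q x" "q \<in> L2fn M4"
    using L2fn_M4_borel[OF \<psi>] by blast
  let ?F = "\<lambda>z. kern \<alpha> (fst z) (snd z) * (p (fst z) * q (snd z))"
  have F: "?F \<in> borel_measurable (lborel \<Otimes>\<^sub>M lborel)"
    using kern_product_borel(1)[OF \<alpha> p(1,3) q(1,3)] by auto
  have e: "(\<lambda>(x, y). ?F (y, x)) = (\<lambda>z. kern \<alpha> (fst z) (snd z) * (q (fst z) * p (snd z)))"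
    by (auto simp: fun_eq_iff kern_commute mult.commute)
  show ?thesis
    using lborel_pair.integral_product_swap[OF F] unfolding e
    by (simp add: kern_form_borel(2)[OF \<alpha> q(1,3,2) p(1,3,2)] kern_form_borel(2)[OF \<alpha> p(1,3,2) q(1,3,2)])
qed

lemma kern_form_bound:
  assumes \<alpha>: "0 < \<alpha>" "\<alpha> < 4" and \<phi>: "\<phi> \<in> L2fn M4"
  shows "\<bar>kern_form \<alpha> \<phi> \<phi>\<bar> \<le> 3 * (8 - \<alpha>) * (LINT x|M4. (\<phi> x)\<^sup>2)"
proof -
  obtain p where p: "p \<in> borel_measurable borel" "AE x in lborel. \<phi> x = p x" "p \<in> L2fn M4"
    using L2fn_M4_borel[OF \<phi>] by blast
  have "(LINT x|M4. (\<phi> x)\<^sup>2) = (LINT x|M4. (p x)\<^sup>2)"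
  proof (rule integral_cong_AE)
    show "AE x in M4. (\<phi> x)\<^sup>2 = (p x)\<^sup>2"
      unfolding AE_M4 using AE_completion[OF p(2)] by eventually_elim simp
  qed (use L2fn_measurable[OF p(3)] L2fn_measurable[OF \<phi>] in auto)
  then show ?thesis
    using kern_product_borel(2)[OF \<alpha> p(1,3) p(1,3)] kern_form_borel(2)[OF \<alpha> p(1,3,2) p(1,3,2)] by simp
qed

lemma Kop_const: "0 < \<alpha> \<Longrightarrow> \<alpha> < 4 \<Longrightarrow> Kop \<alpha> (\<lambda>x. 1) x = 3 * (8 - \<alpha>)"
  using kern_const[of \<alpha> x] by (simp add: Kop_def)

lemma Kop_sc: "0 < \<alpha> \<Longrightarrow> \<alpha> < 4 \<Longrightarrow> Kop \<alpha> (sc v) x = 3 * \<alpha> * sc v x"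
  using kern_sc[of \<alpha> x v] by (simp add: Kop_def)

section \<open>Distributional solutions\<close>

lemma sc_add: "sc (v + w) x = sc v x + sc w x" by (simp add: sc_def inner_add_left)
lemma sc_scaleR: "sc (c *\<^sub>R v) x = c * sc v x" by (simp add: sc_def)

lemma omega_Pol: "omega \<in> Pol"
proof -
  have "omega = (\<lambda>x. sc (0, 1) x + 1)" by (simp add: fun_eq_iff sc_eq xi_def)
  then show ?thesis using Pol_add[OF Pol_sc Pol_const, of "(0, 1)" 1] by simp
qed

text \<open>Modulo the span of the coordinate functions every polynomial vanishes to second order at the
  pole, which is the point at infinity.\<close>

lemma Pol_second_order:
  assumes "f \<in> Pol" obtains v g where "g \<in> Pol" "symb 2 (\<lambda>k. g)" "f = (\<lambda>x. sc v x + g x)"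
proof -
  define D where "D f \<longleftrightarrow> (\<exists>v g. g \<in> Pol \<and> symb 2 (\<lambda>k. g) \<and> f = (\<lambda>x. sc v x + g x))" for f :: "real^4 \<Rightarrow> real"
  have add: "D (\<lambda>x. f x + g x)" if "D f" "D g" for f g
  proof -
    obtain v p w q where *: "p \<in> Pol" "symb 2 (\<lambda>k. p)" "f = (\<lambda>x. sc v x + p x)" "q \<in> Pol" "symb 2 (\<lambda>k. q)" "g = (\<lambda>x. sc w x + q x)"
      using \<open>D f\<close> \<open>D g\<close> unfolding D_def by blast
    then show ?thesis unfolding D_def
      by (intro exI[of _ "v + w"] exI[of _ "\<lambda>x. p x + q x"] conjI Pol_add symb_add) (auto simp: sc_add fun_eq_iff)
  qed
  have cm: "D (\<lambda>x. c * f x)" if "D f" for c f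
  proof -
    obtain v p where *: "p \<in> Pol" "symb 2 (\<lambda>k. p)" "f = (\<lambda>x. sc v x + p x)"
      using \<open>D f\<close> unfolding D_def by blast
    then show ?thesis unfolding D_def
      by (intro exI[of _ "c *\<^sub>R v"] exI[of _ "\<lambda>x. c * p x"] conjI Pol_cmult symb_cmult) (auto simp: sc_scaleR fun_eq_iff distrib_left)
  qed
  have two: "D g" if "g \<in> Pol" "symb 2 (\<lambda>k. g)" for g
    unfolding D_def using that by (intro exI[of _ 0] exI[of _ g]) (auto simp: sc_def)
  have sc1: "D (sc v)" for v
    unfolding D_def by (intro exI[of _ v] exI[of _ "\<lambda>x. 0"]) (auto intro: Pol_const symb.intros)
  have one: "D (\<lambda>x. c)" for c
  proof -
    \<comment> \<open>A constant does not vanish at the pole, but 1 = omega -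
      \<open>sc (0, 1)\<close> and \<open>omega\<close> is of second order there.\<close>
    have "(\<lambda>x. c) = (\<lambda>x. (-c) * sc (0, 1) x + c * omega x)" by (simp add: fun_eq_iff sc_eq xi_def algebra_simps)
    moreover have "D (\<lambda>x. (-c) * sc (0, 1) x + c * omega x)"
      by (intro add cm sc1 two omega_Pol symb_omega)
    ultimately show ?thesis by simp
  qed
  have "spol n f \<Longrightarrow> D f" for n f
  proof (induction rule: spol.induct)
    case (spol_mult_sc n f w)
    then obtain v g where g: "g \<in> Pol" "symb 2 (\<lambda>k. g)" "f = (\<lambda>x. sc v x + g x)" unfolding D_def by blast
    \<comment> \<open>The linear function minus its value at the pole, hence of weight one. A
      product of two such functions has weight two; the terms left over are linear, constant or
      multiples of \<open>g\<close>.\<close>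
    let ?s = "\<lambda>v x. xi (fst v) x + snd v * omega x"
    have s: "?s v x = sc v x + snd v" for v x by (simp add: sc_alt)
    have sP: "?s v \<in> Pol" for v unfolding s by (intro Pol_add Pol_sc Pol_const)
    have e: "(\<lambda>x. sc w x * f x) = (\<lambda>x. (?s w x * ?s v x + sc w x * g x) + ((- snd w) * sc v x + ((- snd v) * sc w x + (- snd w * snd v))))"
      unfolding s g(3) by (intro ext) (simp add: algebra_simps)
    have "symb 2 (\<lambda>k x. ?s w x * ?s v x)" using symb_mult[OF sc_symb[of w] sc_symb[of v]] by (simp only: one_add_one)
    moreover have "symb 2 (\<lambda>k x. sc w x * g x)" using symb_mult[OF Pol_symb0[OF Pol_sc] g(2), of w] by (simp only: add_0)
    ultimately have "symb 2 (\<lambda>k x. ?s w x * ?s v x + sc w x * g x)" by (rule symb_add)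
    then have "D (\<lambda>x. ?s w x * ?s v x + sc w x * g x)"
      by (intro two Pol_add Pol_mult sP Pol_sc g(1))
    moreover have "D (\<lambda>x. (- snd w) * sc v x + ((- snd v) * sc w x + (- snd w * snd v)))"
      by (intro add cm sc1 one)
    ultimately show ?case unfolding e by (rule add)
  qed (use add one in auto)
  then show ?thesis using assms that unfolding D_def Pol_def by blast
qed

lemma bilaplacian_cong_open:
  assumes "open U" "x \<in> U" "\<And>y. y \<in> U \<Longrightarrow> f y = g y"
  shows "laplacian (laplacian f) x = laplacian (laplacian g) x"
  by (intro laplacian_cong_open[OF assms(1,2)] laplacian_cong_open[OF assms(1) _ assms(3)])

lemma core_integral_tendsto_0:
  assumes "\<phi> \<in> L2fn M4"
  shows "(\<lambda>n. LINT x|M4. (\<phi> x * indicator (- core n) x)\<^sup>2) \<longlonglongrightarrow> 0"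
    "(\<lambda>x. \<phi> x * indicator (- core n) x) \<in> L2fn M4"
proof -
  have m: "\<phi> \<in> borel_measurable lebesgue" using L2fn_measurable[OF assms] by simp
  have cs: "- core n \<in> sets lebesgue" for n
    using open_core by (simp add: borel_open borel_comp)
  have pm: "(\<lambda>x. \<phi> x * indicator (- core n) x) \<in> borel_measurable lebesgue" for n
    by (intro borel_measurable_times m borel_measurable_indicator cs)
  have b: "norm ((\<phi> x * indicator (- core n) x)\<^sup>2) \<le> (\<phi> x)\<^sup>2" for n x by (simp add: indicator_def)
  have "(\<lambda>n. LINT x|M4. (\<phi> x * indicator (- core n) x)\<^sup>2) \<longlonglongrightarrow> (LINT x|M4. 0)"
  proof (rule integral_dominated_convergence[where w="\<lambda>x. (\<phi> x)\<^sup>2"])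
    show "AE x in M4. (\<lambda>n. (\<phi> x * indicator (- core n) x)\<^sup>2) \<longlonglongrightarrow> 0"
    proof (intro AE_I2 tendsto_eventually)
      fix x
      show "\<forall>\<^sub>F n in sequentially. (\<phi> x * indicator (- core n) x)\<^sup>2 = 0"
        using eventually_core[of x] by eventually_elim (simp add: indicator_def)
    qed
  qed (use pm b L2fn_square[OF assms] in auto)
  then show "(\<lambda>n. LINT x|M4. (\<phi> x * indicator (- core n) x)\<^sup>2) \<longlonglongrightarrow> 0" by simp
  show "(\<lambda>x. \<phi> x * indicator (- core n) x) \<in> L2fn M4"
    by (rule L2fnI, simp add: pm,
        rule Bochner_Integration.integrable_bound[OF L2fn_square[OF assms]]) (use pm b in auto)
qed

text \<open>The cutoff error is bounded in \<open>L\<^sup>2\<close> uniformly in \<open>n\<close>: it is of size \<open>\<omega>\<^sup>-\<^sup>1\<close> on an annulus of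
  radius about \<open>n\<^sup>1\<^sup>/\<^sup>2\<close>. It does not tend to \<open>0\<close>, and it would be unbounded for \<open>f\<close> of weight one.\<close>

lemma cutoff_error_bounded:
  assumes f: "f \<in> Pol" "symb 2 (\<lambda>k. f)"
  defines "e \<equiv> \<lambda>n x. laplacian (laplacian (cutoff n f)) x / omega x ^ 4 - Pop f x"
  shows "e n \<in> L2fn M4" "\<exists>B\<ge>0. \<forall>n. (LINT x|M4. (e n x)\<^sup>2) \<le> B" "x \<in> core n \<Longrightarrow> e n x = 0"
proof -
  obtain F where F: "symb 2 F" "\<And>n. cutoff n f = F (real (Suc n))" using cutoff_symb[OF f(2)] by blast
  have tf: "test_fun (cutoff n f)" for n using f by (intro cutoff_test_fun Pol_smooth)
  obtain A where A: "A \<ge> 0" "\<And>n x. \<bar>laplacian (laplacian (cutoff n f)) x\<bar> \<le> A * sqrt (omega x) ^ 6"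
    using symb_bound[OF symb_laplacian[OF symb_laplacian[OF F(1)]]] F(2) by auto
  obtain C where C: "C \<ge> 0" "\<And>x. \<bar>Pop f x\<bar> \<le> C" using Pol_bounded[OF Pol_Pop[OF f(1)]] by blast
  have tb: "test_fun (\<lambda>x. laplacian (laplacian (cutoff n f)) x / omega x ^ 4)" for n
    by (intro test_fun_div_omega test_fun_laplacian tf)
  show eL: "e n \<in> L2fn M4" for n
    unfolding e_def by (intro L2fn_diff test_fun_L2fn_M4 tb Pol_L2fn Pol_Pop f)
  show e0: "e n x = 0" if "x \<in> core n" for n x
  proof -
    have "laplacian (laplacian (cutoff n f)) x = laplacian (laplacian f) x"
      by (rule bilaplacian_cong_open[OF open_core that cutoff_core])
    then show ?thesis by (simp add: e_def Pol_bilaplacian[OF f(1)])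
  qed
  \<comment> \<open>The transition region, where 1 + |x|^2 lies between n + 1 and 2 (n + 1); beyond
    it the cutoff factor is locally 1 or 0.\<close>
  define S where "S n = {x. 1 \<le> real (Suc n) * omega x \<and> real (Suc n) * omega x \<le> 2}" for n
  have z: "laplacian (laplacian (cutoff n f)) x = 0" if "real (Suc n) * omega x < 1" for n x
  proof -
    have "laplacian (laplacian (cutoff n f)) x = laplacian (laplacian (\<lambda>x. 0)) x"
    proof (rule bilaplacian_cong_open[of "{x. real (Suc n) * omega x < 1}"])
      show "open {x. real (Suc n) * omega x < 1}"
        by (intro open_Collect_less continuous_intros smooth_continuous omega_smooth)
    qed (use that in \<open>auto simp: cutoff_def eta_0\<close>)
    then show ?thesis by simp
  qed
  have bnd: "omega x ^ 4 * (e n x)\<^sup>2 \<le> 2 * C\<^sup>2 * omega x ^ 4 + 2 * A\<^sup>2 * (4 / (real (Suc n))\<^sup>2) * indicator (S n) x" for n x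
  proof (cases "x \<in> core n")
    case True
    then show ?thesis using e0[OF True] by (simp add: indicator_def)
  next
    case False
    let ?b = "laplacian (laplacian (cutoff n f)) x"
    have "omega x ^ 4 * (e n x)\<^sup>2 \<le> omega x ^ 4 * (2 * (?b / omega x ^ 4)\<^sup>2 + 2 * (Pop f x)\<^sup>2)"
      using square_add_le[of "?b / omega x ^ 4" "- Pop f x"] unfolding e_def by (intro mult_left_mono) auto
    also have "\<dots> = 2 * (?b\<^sup>2 / omega x ^ 4) + 2 * (Pop f x)\<^sup>2 * omega x ^ 4"
      by (simp add: power_divide field_simps power2_eq_square)
    also have "\<dots> \<le> 2 * (A\<^sup>2 * (4 / (real (Suc n))\<^sup>2) * indicator (S n) x) + 2 * C\<^sup>2 * omega x ^ 4"
    proof (intro add_mono mult_left_mono mult_right_mono)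
      have "\<bar>Pop f x\<bar>\<^sup>2 \<le> C\<^sup>2" using C by (intro power_mono) auto
      then show "(Pop f x)\<^sup>2 \<le> C\<^sup>2" by simp
      show "?b\<^sup>2 / omega x ^ 4 \<le> A\<^sup>2 * (4 / (real (Suc n))\<^sup>2) * indicator (S n) x"
      proof (cases "x \<in> S n")
        case True
        \<comment> \<open>Weight two and four derivatives give omega^3. Squared and divided by
          omega^4 this is omega^2, of size n^-2 on a set whose volume is of order n^2.\<close>
        have "sqrt (omega x) ^ 6 = (sqrt (omega x) ^ 2) ^ 3" by (subst power_mult[symmetric]) simp
        then have s: "sqrt (omega x) ^ 6 = omega x ^ 3" by simp
        have "\<bar>?b\<bar>\<^sup>2 \<le> (A * omega x ^ 3)\<^sup>2" using A(2)[of n x] unfolding s by (intro power_mono) auto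
        then have "?b\<^sup>2 / omega x ^ 4 \<le> (A * omega x ^ 3)\<^sup>2 / omega x ^ 4" by (intro divide_right_mono) auto
        also have "\<dots> = A\<^sup>2 * (omega x)\<^sup>2" by (simp add: power_mult_distrib eval_nat_numeral)
        also have "\<dots> \<le> A\<^sup>2 * (4 / (real (Suc n))\<^sup>2)"
        proof (rule mult_left_mono)
          have "omega x \<le> 2 / real (Suc n)" using True by (simp add: S_def field_simps)
          then have "(omega x)\<^sup>2 \<le> (2 / real (Suc n))\<^sup>2" by (intro power_mono) auto
          then show "(omega x)\<^sup>2 \<le> 4 / (real (Suc n))\<^sup>2" by (simp add: power_divide)
        qed simp
        finally show ?thesis using True by simp
      next
        case F2: False
        then have "real (Suc n) * omega x < 1" using False by (auto simp: S_def core_def)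
        from z[OF this] show ?thesis by simp
      qed
    qed auto
    finally show ?thesis by simp
  qed
  have Sb: "S n \<in> lmeasurable \<and> measure lebesgue (S n) \<le> 2 * pi\<^sup>2 * (real (Suc n))\<^sup>2" for n
  proof -
    let ?k = "real (Suc n)"
    have sub: "S n \<subseteq> cball 0 (sqrt (2 * ?k))"
    proof
      fix x assume "x \<in> S n"
      then have "1 \<le> ?k * omega x" by (simp add: S_def)
      moreover have "1 + (norm x)\<^sup>2 > 0" by (intro add_pos_nonneg) auto
      ultimately have "1 + (norm x)\<^sup>2 \<le> 2 * ?k" by (simp add: omega_def field_simps)
      then have "(norm x)\<^sup>2 \<le> 2 * ?k" by simp
      then show "x \<in> cball 0 (sqrt (2 * ?k))" by (simp add: real_le_rsqrt)
    qed
    have "closed (S n)" unfolding S_def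
      by (intro closed_Collect_conj closed_Collect_le continuous_intros smooth_continuous omega_smooth)
    then have "compact (S n)" using sub bounded_subset[OF bounded_cball sub] by (simp add: compact_eq_bounded_closed)
    then have l: "S n \<in> lmeasurable" by (rule lmeasurable_compact)
    have "measure lebesgue (S n) \<le> measure lebesgue (cball 0 (sqrt (2 * ?k)) :: (real^4) set)"
      using l sub by (intro measure_mono_fmeasurable) (auto simp: fmeasurableD)
    also have "\<dots> = pi\<^sup>2 / 2 * (sqrt (2 * ?k)) ^ 4"
    proof -
      have "measure lebesgue (cball 0 (sqrt (2 * ?k)) :: (real^4) set) = measure lborel (cball 0 (sqrt (2 * ?k)) :: (real^4) set)"
        by (intro measure_completion) simp
      also have "\<dots> = pi\<^sup>2 / 2 * (sqrt (2 * ?k)) ^ 4"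
        by (subst content_cball) (auto simp: eval_unit_ball_vol)
      finally show ?thesis .
    qed
    also have "(sqrt (2 * ?k)) ^ 4 = (2 * ?k)\<^sup>2"
    proof -
      have "(sqrt (2 * ?k)) ^ 4 = ((sqrt (2 * ?k))\<^sup>2)\<^sup>2" by (subst power_mult[symmetric]) simp
      then show ?thesis by simp
    qed
    also have "pi\<^sup>2 / 2 * (2 * ?k)\<^sup>2 = 2 * pi\<^sup>2 * ?k\<^sup>2" unfolding power_mult_distrib by simp
    finally show ?thesis using l by simp
  qed
  define B where "B = 2 * C\<^sup>2 * (LINT x|lebesgue. omega x ^ 4) + 2 * A\<^sup>2 * 4 * (2 * pi\<^sup>2)"
  have "(LINT x|M4. (e n x)\<^sup>2) \<le> B" for n
  proof -
    have i4: "integrable lebesgue (\<lambda>x. omega x ^ 4)" using omega_L1[of "real 4"] unfolding omega_powr_nat by simp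
    have iS: "integrable lebesgue (indicator (S n) :: _ \<Rightarrow> real)"
      using Sb[of n] by (intro integrable_real_indicator) (auto simp: fmeasurable_def)
    have "(LINT x|M4. (e n x)\<^sup>2) = (LINT x|lebesgue. omega x ^ 4 * (e n x)\<^sup>2)"
      using L2fn_measurable[OF eL[of n]] by (intro integral_M4) auto
    also have "\<dots> \<le> (LINT x|lebesgue. 2 * C\<^sup>2 * omega x ^ 4 + 2 * A\<^sup>2 * (4 / (real (Suc n))\<^sup>2) * indicator (S n) x)"
    proof (rule integral_mono[OF _ _ bnd])
      show "integrable lebesgue (\<lambda>x. omega x ^ 4 * (e n x)\<^sup>2)"
        using omega4_integrable(1)[OF eL eL, of n n] by (simp add: power2_eq_square)
      show "integrable lebesgue (\<lambda>x. 2 * C\<^sup>2 * omega x ^ 4 + 2 * A\<^sup>2 * (4 / (real (Suc n))\<^sup>2) * indicator (S n) x)"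
        by (intro Bochner_Integration.integrable_add integrable_mult_right i4 iS)
    qed
    also have "\<dots> = 2 * C\<^sup>2 * (LINT x|lebesgue. omega x ^ 4) + 2 * A\<^sup>2 * (4 / (real (Suc n))\<^sup>2) * measure lebesgue (S n)"
      using i4 iS by simp
    also have "\<dots> \<le> 2 * C\<^sup>2 * (LINT x|lebesgue. omega x ^ 4) + 2 * A\<^sup>2 * (4 / (real (Suc n))\<^sup>2) * (2 * pi\<^sup>2 * (real (Suc n))\<^sup>2)"
      using Sb[of n] by (intro add_left_mono mult_left_mono) auto
    also have "\<dots> = B" by (simp add: B_def)
    finally show ?thesis .
  qed
  moreover have "B \<ge> 0" unfolding B_def by (intro add_nonneg_nonneg mult_nonneg_nonneg Bochner_Integration.integral_nonneg) auto
  ultimately show "\<exists>B\<ge>0. \<forall>n. (LINT x|M4. (e n x)\<^sup>2) \<le> B" by blast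
qed

text \<open>The cutoff error is bounded in L^2 and vanishes on \<open>core n\<close>, and the L^2
  mass of \<open>\<phi>\<close> outside \<open>core n\<close> tends to 0. By Cauchy-Schwarz the
  pairing tends to 0 although the error does not.\<close>

lemma distributional_second_order:
  assumes \<phi>: "\<phi> \<in> L2fn M4" and h: "h \<in> L2fn M4"
    and sol: "\<And>\<psi>. test_fun \<psi> \<Longrightarrow> (LINT x|lebesgue. \<phi> x * laplacian (laplacian \<psi>) x) = (LINT x|M4. h x * \<psi> x)"
    and f: "f \<in> Pol" "symb 2 (\<lambda>k. f)"
  shows "(LINT x|M4. \<phi> x * Pop f x) = (LINT x|M4. h x * f x)"
proof -
  define e where "e = (\<lambda>n x. laplacian (laplacian (cutoff n f)) x / omega x ^ 4 - Pop f x)"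
  have eL: "e n \<in> L2fn M4" for n unfolding e_def by (rule cutoff_error_bounded(1)[OF f])
  have e0: "x \<in> core n \<Longrightarrow> e n x = 0" for n x unfolding e_def by (rule cutoff_error_bounded(3)[OF f])
  obtain B where B: "B \<ge> 0" "\<And>n. (LINT x|M4. (e n x)\<^sup>2) \<le> B"
    using cutoff_error_bounded(2)[OF f] unfolding e_def by blast
  have m: "\<phi> \<in> borel_measurable lebesgue" using L2fn_measurable[OF \<phi>] by simp
  have tf: "test_fun (cutoff n f)" for n using f by (intro cutoff_test_fun Pol_smooth)
  have id: "(LINT x|M4. \<phi> x * Pop f x) + (LINT x|M4. \<phi> x * e n x) = (LINT x|M4. h x * cutoff n f x)" for n
  proof -
    have tl: "test_fun (laplacian (laplacian (cutoff n f)))" by (intro test_fun_laplacian tf)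
    have "(LINT x|M4. h x * cutoff n f x) = (LINT x|M4. \<phi> x * (laplacian (laplacian (cutoff n f)) x / omega x ^ 4))"
      using sol[OF tf] integral_M4_div_omega[OF m tl] by simp
    also have "\<dots> = (LINT x|M4. \<phi> x * Pop f x + \<phi> x * e n x)"
      by (simp add: e_def right_diff_distrib)
    also have "\<dots> = (LINT x|M4. \<phi> x * Pop f x) + (LINT x|M4. \<phi> x * e n x)"
      by (intro Bochner_Integration.integral_add L2fn_mult \<phi> eL Pol_L2fn Pol_Pop f)
    finally show ?thesis by simp
  qed
  have "(\<lambda>n. (LINT x|M4. \<phi> x * e n x)\<^sup>2) \<longlonglongrightarrow> 0"
  proof (rule tendsto_sandwich[of "\<lambda>_. 0" _ _ "\<lambda>n. (LINT x|M4. (\<phi> x * indicator (- core n) x)\<^sup>2) * B"])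
    show "\<forall>\<^sub>F n in sequentially. (LINT x|M4. \<phi> x * e n x)\<^sup>2 \<le> (LINT x|M4. (\<phi> x * indicator (- core n) x)\<^sup>2) * B"
    proof (rule always_eventually, rule allI)
      fix n
      have "(LINT x|M4. \<phi> x * e n x) = (LINT x|M4. (\<phi> x * indicator (- core n) x) * e n x)"
        by (intro Bochner_Integration.integral_cong refl) (auto simp: indicator_def e0)
      then have "(LINT x|M4. \<phi> x * e n x)\<^sup>2 \<le> (LINT x|M4. (\<phi> x * indicator (- core n) x)\<^sup>2) * (LINT x|M4. (e n x)\<^sup>2)"
        using L2fn_Cauchy_Schwarz[OF core_integral_tendsto_0(2)[OF \<phi>] eL] by simp
      also have "\<dots> \<le> (LINT x|M4. (\<phi> x * indicator (- core n) x)\<^sup>2) * B"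
        using B by (intro mult_left_mono) auto
      finally show "(LINT x|M4. \<phi> x * e n x)\<^sup>2 \<le> (LINT x|M4. (\<phi> x * indicator (- core n) x)\<^sup>2) * B" .
    qed
    show "(\<lambda>n. (LINT x|M4. (\<phi> x * indicator (- core n) x)\<^sup>2) * B) \<longlonglongrightarrow> 0"
      by (intro tendsto_mult_left_zero core_integral_tendsto_0 \<phi>)
  qed auto
  then have "(\<lambda>n. LINT x|M4. \<phi> x * e n x) \<longlonglongrightarrow> 0"
    using tendsto_real_sqrt[of "\<lambda>n. (LINT x|M4. \<phi> x * e n x)\<^sup>2" 0] tendsto_rabs_zero_cancel by simp
  then have l1: "(\<lambda>n. (LINT x|M4. \<phi> x * Pop f x) + (LINT x|M4. \<phi> x * e n x)) \<longlonglongrightarrow> (LINT x|M4. \<phi> x * Pop f x) + 0"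
    by (intro tendsto_add tendsto_const)
  have "(\<lambda>n. LINT x|M4. h x * cutoff n f x) \<longlonglongrightarrow> (LINT x|M4. h x * f x)"
  proof -
    obtain F where F: "symb 0 F" "\<And>n. cutoff n f = F (real (Suc n))" using cutoff_symb[OF Pol_symb0[OF f(1)]] by blast
    obtain C where C: "\<And>n x. \<bar>cutoff n f x\<bar> \<le> C" using symb_bound[OF F(1)] F(2) by auto
    have hm: "h \<in> borel_measurable lebesgue" using L2fn_measurable[OF h] by simp
    show ?thesis
    proof (rule integral_dominated_convergence[where w="\<lambda>x. \<bar>h x\<bar> * C"])
      have "integrable M4 (\<lambda>x. h x * 1)" by (intro L2fn_mult h Pol_L2fn Pol_const)
      then show "integrable M4 (\<lambda>x. \<bar>h x\<bar> * C)" by (intro integrable_mult_left integrable_abs) simp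
      show "AE x in M4. norm (h x * cutoff n f x) \<le> \<bar>h x\<bar> * C" for n
        using C by (intro AE_I2) (auto simp: abs_mult intro!: mult_left_mono)
      show "(\<lambda>x. h x * cutoff n f x) \<in> borel_measurable M4" for n
        unfolding measurable_M4 by (intro borel_measurable_times hm smooth_lebesgue_measurable test_fun_smooth tf)
      show "(\<lambda>x. h x * f x) \<in> borel_measurable M4"
        unfolding measurable_M4 by (intro borel_measurable_times hm Pol_measurable f)
      show "AE x in M4. (\<lambda>n. h x * cutoff n f x) \<longlonglongrightarrow> h x * f x"
        by (intro AE_I2 tendsto_mult tendsto_const cutoff_limit)
    qed
  qed
  then show ?thesis using LIMSEQ_unique[OF l1] unfolding id by simp
qed

section \<open>Nondegeneracy at the standard bubble\<close>

text \<open>Polarization of the convergence of squared norms.\<close>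

lemma L2conv_both:
  assumes "L2conv M f g" "L2conv M f' g'"
  shows "(\<lambda>n. \<integral>x. f n x * f' n x \<partial>M) \<longlonglongrightarrow> (\<integral>x. g x * g' x \<partial>M)"
proof -
  have L: "f n \<in> L2fn M" "f' n \<in> L2fn M" "g \<in> L2fn M" "g' \<in> L2fn M" for n using assms by (auto simp: L2conv_def)
  have "L2conv M (\<lambda>n x. f n x + 1 * f' n x) (\<lambda>x. g x + 1 * g' x)" by (rule L2conv_add[OF assms])
  note sq = L2conv_square[OF this]
  have "(\<lambda>n. ((\<integral>x. (f n x + 1 * f' n x)\<^sup>2 \<partial>M) - (\<integral>x. (f n x)\<^sup>2 \<partial>M) - (\<integral>x. (f' n x)\<^sup>2 \<partial>M)) / 2)
     \<longlonglongrightarrow> ((\<integral>x. (g x + 1 * g' x)\<^sup>2 \<partial>M) - (\<integral>x. (g x)\<^sup>2 \<partial>M) - (\<integral>x. (g' x)\<^sup>2 \<partial>M)) / 2"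
    by (intro tendsto_divide tendsto_diff sq L2conv_square assms tendsto_const) auto
  then show ?thesis unfolding square_sum_expand[OF L(1,2)] square_sum_expand[OF L(3,4)] by simp
qed

text \<open>The vector whose linear function is the orthogonal projection onto the harmonics of
  degree one; \<open>vol4 / 5\<close> is the squared norm of a coordinate function.\<close>

definition sc_part :: "(real^4 \<Rightarrow> real) \<Rightarrow> (real^4) \<times> real" where
  "sc_part \<phi> = (\<Sum>b\<in>Basis. ((LINT x|M4. \<phi> x * sc b x) / (vol4 / 5)) *\<^sub>R b)"

lemma sc_part_orthogonal:
  assumes "\<phi> \<in> L2fn M4"
  shows "(LINT x|M4. (\<phi> x - sc (sc_part \<phi>) x) * sc a x) = 0"
proof -
  have i: "integrable M4 (\<lambda>x. \<phi> x * sc b x)" for b by (intro L2fn_mult assms Pol_L2fn Pol_sc)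
  have "(LINT x|M4. \<phi> x * sc a x) = (LINT x|M4. (\<Sum>b\<in>Basis. (a \<bullet> b) * (\<phi> x * sc b x)))"
  proof (intro Bochner_Integration.integral_cong refl)
    fix x
    have "sc a x = (\<Sum>b\<in>Basis. (a \<bullet> b) * sc b x)"
      unfolding sc_def by (subst euclidean_inner) (simp add: inner_commute)
    then show "\<phi> x * sc a x = (\<Sum>b\<in>Basis. (a \<bullet> b) * (\<phi> x * sc b x))"
      by (simp add: sum_distrib_left mult.left_commute)
  qed
  also have "\<dots> = (\<Sum>b\<in>Basis. (a \<bullet> b) * (LINT x|M4. \<phi> x * sc b x))"
    using i by (simp add: Bochner_Integration.integral_sum)
  also have "\<dots> = vol4 / 5 * (sc_part \<phi> \<bullet> a)"
    unfolding sc_part_def inner_sum_left sum_distrib_left inner_scaleR_left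
    using vol4_pos by (intro sum.cong refl) (simp add: inner_commute)
  finally have 1: "(LINT x|M4. \<phi> x * sc a x) = vol4 / 5 * (sc_part \<phi> \<bullet> a)" .
  have "(LINT x|M4. (\<phi> x - sc (sc_part \<phi>) x) * sc a x) = (LINT x|M4. \<phi> x * sc a x) - (LINT x|M4. sc (sc_part \<phi>) x * sc a x)"
    using i Pol_integrable[OF Pol_sc Pol_sc] by (simp add: left_diff_distrib)
  then show ?thesis by (simp add: 1 sc_inner)
qed

text \<open>By symmetry of the kernel the operator moves onto its eigenfunctions.\<close>

lemma Kop_mult_sc:
  assumes \<alpha>: "0 < \<alpha>" "\<alpha> < 4" and \<phi>: "\<phi> \<in> L2fn M4"
  shows "(LINT x|M4. Kop \<alpha> \<phi> x * sc v x) = 3 * \<alpha> * (LINT x|M4. \<phi> x * sc v x)"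
    "(LINT x|M4. Kop \<alpha> \<phi> x) = 3 * (8 - \<alpha>) * (LINT x|M4. \<phi> x)"
proof -
  have L: "sc v \<in> L2fn M4" "(\<lambda>x. 1) \<in> L2fn M4" by (intro Pol_L2fn Pol_sc Pol_const)+
  have "(LINT x|M4. sc v x * Kop \<alpha> \<phi> x) = (LINT x|M4. \<phi> x * Kop \<alpha> (sc v) x)"
    using kern_form_Kop[OF \<alpha> \<phi> L(1)] kern_form_Kop[OF \<alpha> L(1) \<phi>] kern_form_commute[OF \<alpha> \<phi> L(1)] by simp
  also have "\<dots> = (LINT x|M4. (3 * \<alpha>) * (\<phi> x * sc v x))"
    by (intro Bochner_Integration.integral_cong refl) (simp add: Kop_sc[OF \<alpha>])
  also have "\<dots> = 3 * \<alpha> * (LINT x|M4. \<phi> x * sc v x)" by (rule integral_mult_right_zero)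
  finally show "(LINT x|M4. Kop \<alpha> \<phi> x * sc v x) = 3 * \<alpha> * (LINT x|M4. \<phi> x * sc v x)"
    by (simp only: mult.commute[of "sc v _"])
  have "(LINT x|M4. 1 * Kop \<alpha> \<phi> x) = (LINT x|M4. \<phi> x * Kop \<alpha> (\<lambda>x. 1) x)"
    using kern_form_Kop[OF \<alpha> \<phi> L(2)] kern_form_Kop[OF \<alpha> L(2) \<phi>] kern_form_commute[OF \<alpha> \<phi> L(2)] by simp
  then show "(LINT x|M4. Kop \<alpha> \<phi> x) = 3 * (8 - \<alpha>) * (LINT x|M4. \<phi> x)"
    using \<alpha> by (simp add: Kop_const mult.commute)
qed

lemma Pop_sc: "Pop (sc v) x = 24 * sc v x"
  using harm_Pop[OF harm_sc, of v x] by simp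

lemma Pop_const: "Pop (\<lambda>x. c) x = 0"
  using harm_Pop[OF harm_const, of c x] by simp

lemma L2fn_M4_null:
  assumes "\<phi> \<in> L2fn M4" "(LINT x|M4. (\<phi> x)\<^sup>2) \<le> 0"
  shows "AE x in lebesgue. \<phi> x = 0"
proof -
  have "(LINT x|M4. (\<phi> x)\<^sup>2) = 0" using assms(2) by (intro antisym) auto
  then have "AE x in M4. (\<phi> x)\<^sup>2 = 0"
    using integral_nonneg_eq_0_iff_AE[OF L2fn_square[OF assms(1)]] by simp
  then show ?thesis unfolding AE_M4 by simp
qed

text \<open>The equation is first extended to all polynomials. On the part of \<open>\<phi>\<close>
  orthogonal to the linear functions, the gap 120 then meets an upper bound 48 for the right-hand
  side, which leaves only zero.\<close>

theorem distributional_solution_L2: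
  assumes \<alpha>: "0 < \<alpha>" "\<alpha> < 4" and \<phi>: "\<phi> \<in> L2fn M4" and sol: "distributional_solution \<alpha> (bubble \<alpha> 1 0) \<phi>"
  shows "\<exists>v. AE x in lebesgue. \<phi> x = sc v x"
proof -
  define \<kappa> where "\<kappa> = 3 * (8 - \<alpha>)"
  define h where "h = (\<lambda>x. Kop \<alpha> \<phi> x + \<kappa> * \<phi> x)"
  have KL: "Kop \<alpha> \<phi> \<in> L2fn M4" by (rule Kop_L2fn[OF \<alpha> \<phi>])
  have hL: "h \<in> L2fn M4" unfolding h_def by (intro L2fn_add L2fn_cmult KL \<phi>)
  have sol': "(LINT x|lebesgue. \<phi> x * laplacian (laplacian \<psi>) x) = (LINT x|M4. h x * \<psi> x)" if \<psi>: "test_fun \<psi>" for \<psi>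
  proof -
    have "(LINT x|lebesgue. \<phi> x * laplacian (laplacian \<psi>) x) = (LINT x|lebesgue. omega x ^ 4 * (h x * \<psi> x))"
    proof -
      have "(riesz \<alpha> (\<lambda>y. exp (bubble \<alpha> 1 0 y) * \<phi> y) x * exp (bubble \<alpha> 1 0 x)
            + riesz \<alpha> (\<lambda>y. exp (bubble \<alpha> 1 0 y)) x * exp (bubble \<alpha> 1 0 x) * \<phi> x) * \<psi> x = omega x ^ 4 * (h x * \<psi> x)" for x
      proof -
        have "riesz \<alpha> (\<lambda>y. eU \<alpha> y * \<phi> y) x * eU \<alpha> x = omega x ^ 4 * Kop \<alpha> \<phi> x"
          unfolding riesz_eU_mult Kop_def by simp
        moreover have "riesz \<alpha> (\<lambda>y. eU \<alpha> y) x * eU \<alpha> x = \<kappa> * omega x ^ 4"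
          using riesz_eU[OF \<alpha>, of x] by (simp add: \<kappa>_def)
        ultimately show ?thesis unfolding eU_def[symmetric] h_def by (simp add: algebra_simps)
      qed
      note e = this
      have "(LINT x|lebesgue. \<phi> x * laplacian (laplacian \<psi>) x) =
        (LINT x|lebesgue. (riesz \<alpha> (\<lambda>y. exp (bubble \<alpha> 1 0 y) * \<phi> y) x * exp (bubble \<alpha> 1 0 x)
            + riesz \<alpha> (\<lambda>y. exp (bubble \<alpha> 1 0 y)) x * exp (bubble \<alpha> 1 0 x) * \<phi> x) * \<psi> x)"
        using sol \<psi> unfolding distributional_solution_def by blast
      then show ?thesis unfolding e .
    qed
    also have "\<dots> = (LINT x|M4. h x * \<psi> x)" by (rule omega4_integrable(2)[OF hL test_fun_L2fn_M4[OF \<psi>]])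
    finally show ?thesis .
  qed
  have i: "integrable M4 (\<lambda>x. \<phi> x * f x)" "integrable M4 (\<lambda>x. Kop \<alpha> \<phi> x * f x)" "integrable M4 (\<lambda>x. h x * f x)" if "f \<in> Pol" for f
    by (intro L2fn_mult \<phi> KL hL Pol_L2fn that)+
  \<comment> \<open>Degree one: 3 \<alpha> from \<open>Kop\<close> and 3 (8 - \<alpha>) from the
    potential add up to the Paneitz eigenvalue 24. On linear functions the tested equation thus
    holds for every \<open>\<phi>\<close>, solution or not.\<close>
  have h_sc: "(LINT x|M4. h x * sc v x) = 24 * (LINT x|M4. \<phi> x * sc v x)" for v
    using i[OF Pol_sc, of v] Kop_mult_sc(1)[OF \<alpha> \<phi>, of v]
    by (simp add: h_def distrib_right mult.assoc \<kappa>_def) (simp add: algebra_simps)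
  have eq: "(LINT x|M4. \<phi> x * Pop f x) = (LINT x|M4. h x * f x)" if f: "f \<in> Pol" for f
  proof -
    obtain v g where g: "g \<in> Pol" "symb 2 (\<lambda>k. g)" "f = (\<lambda>x. sc v x + g x)" using Pol_second_order[OF f] by blast
    have P: "Pop f x = 24 * sc v x + Pop g x" for x
    proof -
      have "Lop f = (\<lambda>x. Lop (sc v) x + Lop g x)"
        unfolding g(3) by (intro ext Lop_add sc_smooth Pol_smooth g)
      moreover from this have "Lop (Lop f) x = Lop (Lop (sc v)) x + Lop (Lop g) x"
        using Lop_add[OF Pol_smooth[OF Pol_Lop[OF Pol_sc]] Pol_smooth[OF Pol_Lop[OF g(1)]], of v x] by simp
      ultimately show ?thesis using Pop_sc[of v x] by (simp add: Pop_def)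
    qed
    have "(LINT x|M4. \<phi> x * Pop f x) = (LINT x|M4. 24 * (\<phi> x * sc v x) + \<phi> x * Pop g x)"
      by (simp add: P algebra_simps)
    also have "\<dots> = 24 * (LINT x|M4. \<phi> x * sc v x) + (LINT x|M4. \<phi> x * Pop g x)"
      using i(1)[OF Pol_sc] i(1)[OF Pol_Pop[OF g(1)]] by simp
    also have "\<dots> = (LINT x|M4. h x * sc v x) + (LINT x|M4. h x * g x)"
      using h_sc distributional_second_order[OF \<phi> hL sol' g(1,2)] by simp
    also have "\<dots> = (LINT x|M4. h x * f x)"
      using i(3)[OF Pol_sc] i(3)[OF g(1)] by (simp add: g(3) distrib_left)
    finally show ?thesis .
  qed
  define v where "v = sc_part \<phi>"
  define \<phi>0 where "\<phi>0 = (\<lambda>x. \<phi> x - sc v x)"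
  have \<phi>0L: "\<phi>0 \<in> L2fn M4" unfolding \<phi>0_def by (intro L2fn_diff \<phi> Pol_L2fn Pol_sc)
  have orth: "(LINT x|M4. \<phi>0 x * sc a x) = 0" for a unfolding \<phi>0_def v_def by (rule sc_part_orthogonal[OF \<phi>])
  \<comment> \<open>Testing with 1: the Paneitz side vanishes, while the convolution and the
    potential each contribute \<open>\<kappa>\<close> times the mean.\<close>
  have mean: "(LINT x|M4. \<phi>0 x) = 0"
  proof -
    have "(LINT x|M4. h x) = 0" using eq[OF Pol_const[of 1]] by (simp add: Pop_const)
    moreover have "(LINT x|M4. h x) = (LINT x|M4. Kop \<alpha> \<phi> x) + \<kappa> * (LINT x|M4. \<phi> x)"
      using i[OF Pol_const[of 1]] by (simp add: h_def)
    ultimately have "\<kappa> * (LINT x|M4. \<phi> x) + \<kappa> * (LINT x|M4. \<phi> x) = 0"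
      using Kop_mult_sc(2)[OF \<alpha> \<phi>, folded \<kappa>_def] by linarith
    then have "2 * \<kappa> * (LINT x|M4. \<phi> x) = 0" by linarith
    then have "(LINT x|M4. \<phi> x) = 0" using \<alpha> by (simp add: \<kappa>_def)
    then show ?thesis using i(1)[OF Pol_const[of 1]] Pol_integrable[OF Pol_sc Pol_const[of 1], of v] sc_mean[of v]
      by (simp add: \<phi>0_def)
  qed
  \<comment> \<open>The right-hand side belonging to \<open>\<phi>0\<close>, as the Paneitz operator
    multiplies \<open>sc v\<close> by 24.\<close>
  define h0 where "h0 = (\<lambda>x. h x - 24 * sc v x)"
  have h0L: "h0 \<in> L2fn M4" unfolding h0_def by (intro L2fn_diff hL L2fn_cmult Pol_L2fn Pol_sc)
  have eq0: "(LINT x|M4. \<phi>0 x * Pop f x) = (LINT x|M4. h0 x * f x)" if f: "f \<in> Pol" for f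
  proof -
    have "(LINT x|M4. \<phi>0 x * Pop f x) = (LINT x|M4. \<phi> x * Pop f x) - (LINT x|M4. sc v x * Pop f x)"
      using i(1)[OF Pol_Pop[OF f]] Pol_integrable[OF Pol_sc Pol_Pop[OF f]] by (simp add: \<phi>0_def left_diff_distrib)
    also have "(LINT x|M4. sc v x * Pop f x) = (LINT x|M4. 24 * (sc v x * f x))"
      using Pop_symmetric[OF Pol_sc f, of v] by (simp add: Pop_sc mult.assoc)
    also have "(LINT x|M4. \<phi> x * Pop f x) - (LINT x|M4. 24 * (sc v x * f x)) = (LINT x|M4. h0 x * f x)"
      using i(3)[OF f] Pol_integrable[OF Pol_sc f, of v] by (simp add: eq[OF f] h0_def left_diff_distrib mult.assoc)
    finally show ?thesis .
  qed
  obtain g where g: "\<And>n. g n \<in> Pol" "L2conv M4 g \<phi>0" "L2conv M4 (\<lambda>n x. Pop (g n) x) h0"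
    using Pop_approximation[OF \<phi>0L h0L eq0] by blast
  have gap: "120 * (LINT x|M4. (\<phi>0 x)\<^sup>2) \<le> (LINT x|M4. h0 x * \<phi>0 x)"
    by (rule spectral_gap_limit[OF g(1,2) L2conv_both[OF g(3,2)] mean orth])
  \<comment> \<open>The mixed term drops out because \<open>Kop\<close> preserves orthogonality to
    the linear functions.\<close>
  have K0: "(LINT x|M4. \<phi>0 x * Kop \<alpha> \<phi> x) = kern_form \<alpha> \<phi>0 \<phi>0"
  proof -
    have K0L: "Kop \<alpha> \<phi>0 \<in> L2fn M4" by (rule Kop_L2fn[OF \<alpha> \<phi>0L])
    have "(LINT x|M4. \<phi>0 x * Kop \<alpha> \<phi> x) = (LINT x|M4. \<phi> x * Kop \<alpha> \<phi>0 x)"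
      using kern_form_Kop[OF \<alpha> \<phi> \<phi>0L] kern_form_Kop[OF \<alpha> \<phi>0L \<phi>] kern_form_commute[OF \<alpha> \<phi> \<phi>0L] by simp
    also have "\<dots> = (LINT x|M4. \<phi>0 x * Kop \<alpha> \<phi>0 x + Kop \<alpha> \<phi>0 x * sc v x)"
      by (simp add: \<phi>0_def[of] algebra_simps)
    also have "\<dots> = (LINT x|M4. \<phi>0 x * Kop \<alpha> \<phi>0 x) + (LINT x|M4. Kop \<alpha> \<phi>0 x * sc v x)"
      by (intro Bochner_Integration.integral_add L2fn_mult \<phi>0L K0L Pol_L2fn Pol_sc)
    also have "\<dots> = kern_form \<alpha> \<phi>0 \<phi>0"
      unfolding Kop_mult_sc(1)[OF \<alpha> \<phi>0L] orth kern_form_Kop[OF \<alpha> \<phi>0L \<phi>0L] by simp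
    finally show ?thesis .
  qed
  have "(LINT x|M4. h0 x * \<phi>0 x) = (LINT x|M4. \<phi>0 x * Kop \<alpha> \<phi> x + \<kappa> * (\<phi>0 x)\<^sup>2 + (\<kappa> - 24) * (\<phi>0 x * sc v x))"
    by (simp add: h0_def h_def \<phi>0_def power2_eq_square algebra_simps)
  also have "\<dots> = kern_form \<alpha> \<phi>0 \<phi>0 + \<kappa> * (LINT x|M4. (\<phi>0 x)\<^sup>2) + (\<kappa> - 24) * 0"
    using L2fn_mult[OF \<phi>0L KL] L2fn_square[OF \<phi>0L] L2fn_mult[OF \<phi>0L Pol_L2fn[OF Pol_sc, of v]]
    by (simp add: K0 orth)
  also have "\<dots> \<le> 48 * (LINT x|M4. (\<phi>0 x)\<^sup>2)"
  proof -
    have "2 * \<kappa> \<le> 48" using \<alpha> by (simp add: \<kappa>_def)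
    then have "2 * \<kappa> * (LINT x|M4. (\<phi>0 x)\<^sup>2) \<le> 48 * (LINT x|M4. (\<phi>0 x)\<^sup>2)" by (intro mult_right_mono) auto
    moreover have "kern_form \<alpha> \<phi>0 \<phi>0 \<le> \<kappa> * (LINT x|M4. (\<phi>0 x)\<^sup>2)"
      using kern_form_bound[OF \<alpha> \<phi>0L] by (simp add: \<kappa>_def)
    ultimately show ?thesis by argo
  qed
  finally have "(LINT x|M4. (\<phi>0 x)\<^sup>2) \<le> 0" using gap by argo
  from L2fn_M4_null[OF \<phi>0L this] have "AE x in lebesgue. \<phi> x = sc v x"
    by eventually_elim (simp add: \<phi>0_def)
  then show ?thesis by blast
qed

section \<open>The inversion as a reflection of the sphere\<close>

abbreviation inv0 :: "real^4 \<Rightarrow> real^4" where "inv0 \<equiv> inversion 0 1"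

lemma inv0_eq: "inv0 z = (1 / (norm z)\<^sup>2) *\<^sub>R z" by (simp add: inversion_def)

lemma inv0_inv0: "z \<noteq> 0 \<Longrightarrow> inv0 (inv0 z) = z" by (rule inversion_inversion) auto

lemma inv0_nonzero: "z \<noteq> 0 \<Longrightarrow> inv0 z \<noteq> 0" by (rule inversion_neq) auto

lemma omega_inv0: "z \<noteq> 0 \<Longrightarrow> omega (inv0 z) = 2 - omega z" "z \<noteq> 0 \<Longrightarrow> omega (inv0 z) = omega z * (norm z)\<^sup>2"
  using omega_inversion_alt[of z 0] omega_inversion[of z 0] by (auto simp: xi_def omega_def[of 0])

lemma xi_inv0: "z \<noteq> 0 \<Longrightarrow> xi b (inv0 z) = xi b z"
  using xi_inversion[of z 0 b] by auto

text \<open>The second chart is the first one after the inversion at 0, which is the reflection of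
  the sphere exchanging the poles. At 0 this fails, since \<open>inv0 0 = 0\<close> by the
  convention for division by zero.\<close>

lemma stereo'_eq: "x \<noteq> 0 \<Longrightarrow> stereo' x = stereo (inv0 x)"
proof -
  assume x: "x \<noteq> 0"
  have n: "1 + (norm x)\<^sup>2 > 0" by (intro add_pos_nonneg) auto
  have "stereo' x = (omega x *\<^sub>R x, 1 - omega x)"
    using n by (simp add: stereo'_def omega_def field_simps)
  moreover have "omega (inv0 x) *\<^sub>R inv0 x = omega x *\<^sub>R x"
  proof -
    have "omega (inv0 x) *\<^sub>R inv0 x = (omega x * (norm x)\<^sup>2) *\<^sub>R inv0 x" by (simp only: omega_inv0(2)[OF x])
    then show ?thesis using x by (simp add: inv0_eq)
  qed
  ultimately show ?thesis by (simp add: stereo_alt omega_inv0(1)[OF x])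
qed

lemma AE_nonzero: "AE x in lebesgue. x \<noteq> (0::real^4)" by (rule AE_off_point[of 0]) simp

text \<open>The change of variables applied to the indicator of a null set gives integral zero, with
  a density that is positive off 0.\<close>

lemma AE_inv0:
  assumes "AE x in lebesgue. P x" shows "AE x in lebesgue. P (inv0 x)"
proof -
  obtain N where N: "N \<in> null_sets lebesgue" "{x \<in> space lebesgue. \<not> P x} \<subseteq> N"
    using assms by (auto simp: eventually_ae_filter)
  let ?h = "indicator N :: real^4 \<Rightarrow> real"
  let ?g = "\<lambda>z. 1 ^ 4 / norm (z - 0) ^ 8 * ?h (inv0 z)"
  have h: "integrable lebesgue ?h" "(LINT x|lebesgue. ?h x) = 0"
    using N(1) by (auto intro!: integrable_real_indicator simp: null_sets_def measure_def)
  have "integrable lebesgue ?g" "(LINT x|lebesgue. ?g x) = 0"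
    using inversion_change_of_variables[of 1 0 ?h] h by simp_all
  then have "AE x in lebesgue. ?g x = 0"
    using integral_nonneg_eq_0_iff_AE[of lebesgue ?g] by (auto simp: indicator_def)
  then show ?thesis using AE_nonzero
  proof eventually_elim
    case (elim x)
    then have "inv0 x \<notin> N" by (auto simp: indicator_def)
    then show ?case using N(2) by auto
  qed
qed

lemma inv0_borel [measurable]: "inv0 \<in> borel_measurable borel"
  unfolding inversion_def by measurable

lemma measurable_inv0:
  assumes "f \<in> borel_measurable lebesgue" shows "(\<lambda>x. f (inv0 x) :: real) \<in> borel_measurable lebesgue"
proof -
  obtain p where p: "p \<in> borel_measurable lborel" "AE x in lborel. f x = p x"
    using completion_ex_borel_measurable_real[OF assms] by blast
  then have "(\<lambda>x. p (inv0 x)) \<in> borel_measurable lborel"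
    using measurable_compose[OF inv0_borel, of p borel] by simp
  then have "(\<lambda>x. p (inv0 x)) \<in> borel_measurable lebesgue" by (rule measurable_completion)
  moreover have "AE x in lebesgue. p (inv0 x) = f (inv0 x)"
    using AE_inv0[OF AE_completion[OF p(2)]] by eventually_elim simp
  ultimately show ?thesis by (rule borel_measurable_AE)
qed

text \<open>The reflection preserves the surface measure: the Jacobian |z|^-8 cancels the fourth
  power of the factor |z|^2 by which \<open>omega\<close> changes.\<close>

lemma M4_inv0:
  fixes f :: "real^4 \<Rightarrow> real"
  assumes m: "f \<in> borel_measurable lebesgue"
  shows "integrable M4 (\<lambda>x. f (inv0 x)) \<longleftrightarrow> integrable M4 f" "(LINT x|M4. f (inv0 x)) = (LINT x|M4. f x)"
proof -
  let ?F = "\<lambda>x. omega x ^ 4 * f x"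
  let ?G = "\<lambda>z. 1 ^ 4 / norm (z - 0) ^ 8 * ?F (inv0 z)"
  let ?H = "\<lambda>z. omega z ^ 4 * f (inv0 z)"
  have eq: "?G z = ?H z" if "z \<notin> {0}" for z
  proof -
    have "z \<noteq> 0" using that by simp
    then have "norm z ^ 8 \<noteq> 0" by simp
    have "((norm z)\<^sup>2) ^ 4 = norm z ^ 8" by (simp add: power_mult[symmetric])
    then show ?thesis using \<open>z \<noteq> 0\<close> unfolding omega_inv0(2)[OF \<open>z \<noteq> 0\<close>] power_mult_distrib by simp
  qed
  have Hm: "?H \<in> borel_measurable lebesgue" using measurable_inv0[OF m] by measurable
  have "AE z in lebesgue. ?H z = ?G z" using eq by (intro AE_off_point[of 0]) auto
  then have Gm: "?G \<in> borel_measurable lebesgue" by (rule borel_measurable_AE[OF Hm])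
  have "integrable lebesgue ?G \<longleftrightarrow> integrable lebesgue ?H" "(LINT z|lebesgue. ?G z) = (LINT z|lebesgue. ?H z)"
    by (intro integrable_cong_AE integral_cong_AE Gm Hm AE_off_point[of 0] eq; assumption)+
  then show "integrable M4 (\<lambda>x. f (inv0 x)) \<longleftrightarrow> integrable M4 f" "(LINT x|M4. f (inv0 x)) = (LINT x|M4. f x)"
    using inversion_change_of_variables[of 1 0 ?F] m measurable_inv0[OF m]
    by (simp_all add: integrable_M4 integral_M4)
qed

lemma L2fn_M4_inv0: "f \<in> L2fn M4 \<Longrightarrow> (\<lambda>x. f (inv0 x)) \<in> L2fn M4"
  using M4_inv0(1)[of "\<lambda>x. (f x)\<^sup>2"] by (auto simp: L2fn_def intro: measurable_inv0)

lemma partial_expand: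
  fixes f :: "real^4 \<Rightarrow> real"
  assumes "f differentiable (at x)"
  shows "frechet_derivative f (at x) h = (\<Sum>c\<in>Basis. (h \<bullet> c) * partial c f x)"
proof -
  have l: "linear (frechet_derivative f (at x))"
    using assms frechet_derivative_works has_derivative_linear by blast
  have "frechet_derivative f (at x) h = frechet_derivative f (at x) (\<Sum>c\<in>Basis. (h \<bullet> c) *\<^sub>R c)"
    by (simp only: euclidean_representation)
  also have "\<dots> = (\<Sum>c\<in>Basis. (h \<bullet> c) * frechet_derivative f (at x) c)"
    by (simp add: linear_sum[OF l] linear_cmul[OF l])
  finally show ?thesis by (simp add: partial_def)
qed

text \<open>The differential of the inversion is self-adjoint and equals 1 / |z|^2 times an
  orthogonal map; the change of \<open>omega\<close> compensates the factor. Isometries of the round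
  metric preserve products of gradients.\<close>

lemma Gam_inv0:
  assumes s: "smooth f" "smooth g" "smooth f'" "smooth g'"
    and e: "\<And>z. z \<noteq> 0 \<Longrightarrow> f (inv0 z) = f' z" "\<And>z. z \<noteq> 0 \<Longrightarrow> g (inv0 z) = g' z" and z: "z \<noteq> 0"
  shows "Gam f g (inv0 z) = Gam f' g' z"
proof -
  let ?D = "inversion_derivative 0 1 z"
  define r where "r = 1 / (norm z)\<^sup>2"
  have Dsym: "?D b \<bullet> c = ?D c \<bullet> b" for b c
    by (simp add: inversion_derivative_def inner_diff_left inner_diff_right inner_commute)
  have pd: "partial b f' z = (\<Sum>c\<in>Basis. (?D c \<bullet> b) * partial c f (inv0 z))"
    if "smooth f" "\<And>z. z \<noteq> 0 \<Longrightarrow> f (inv0 z) = f' z" for f f' b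
  proof -
    have df: "(f has_derivative frechet_derivative f (at (inv0 z))) (at (inv0 z))"
      using smooth_differentiable[OF that(1)] frechet_derivative_works by blast
    have "((\<lambda>z. f (inv0 z)) has_derivative (\<lambda>h. frechet_derivative f (at (inv0 z)) (?D h))) (at z)"
      by (rule has_derivative_compose[OF inversion_has_derivative[OF z] df])
    then have "(f' has_derivative (\<lambda>h. frechet_derivative f (at (inv0 z)) (?D h))) (at z)"
      by (rule has_derivative_transform_within_open[of _ _ _ _ "- {0}"]) (use z that in auto)
    then have "partial b f' z = frechet_derivative f (at (inv0 z)) (?D b)" by (rule partial_eqI)
    then show ?thesis unfolding partial_expand[OF smooth_differentiable[OF that(1)]] by (simp only: Dsym[of b])
  qed
  have pd1: "partial b f' z = (\<Sum>c\<in>Basis. (?D c \<bullet> b) * partial c f (inv0 z))" for b by (rule pd[OF s(1)]) (rule e(1))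
  have pd2: "partial b g' z = (\<Sum>c\<in>Basis. (?D c \<bullet> b) * partial c g (inv0 z))" for b by (rule pd[OF s(2)]) (rule e(2))
  have Dorth: "?D c \<bullet> ?D d = r\<^sup>2 * (c \<bullet> d)" for c d
    using reflection_inner[OF z, of c d] by (simp add: inversion_derivative_def r_def power2_eq_square)
  have "(\<Sum>b\<in>Basis. partial b f' z * partial b g' z)
    = (\<Sum>b\<in>Basis. \<Sum>c\<in>Basis. \<Sum>d\<in>Basis. ((?D c \<bullet> b) * (?D d \<bullet> b)) * (partial c f (inv0 z) * partial d g (inv0 z)))"
    by (intro sum.cong refl) (simp only: pd1 pd2 sum_product mult_ac)
  also have "\<dots> = (\<Sum>c\<in>Basis. \<Sum>d\<in>Basis. \<Sum>b\<in>Basis. ((?D c \<bullet> b) * (?D d \<bullet> b)) * (partial c f (inv0 z) * partial d g (inv0 z)))"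
    by (subst sum.swap) (intro sum.cong refl sum.swap)
  also have "\<dots> = (\<Sum>c\<in>Basis. \<Sum>d\<in>Basis. if c = d then r\<^sup>2 * (partial c f (inv0 z) * partial d g (inv0 z)) else 0)"
    unfolding sum_distrib_right[symmetric] euclidean_inner[symmetric] Dorth
    by (intro sum.cong refl) (auto simp: inner_Basis)
  also have "\<dots> = r\<^sup>2 * (\<Sum>c\<in>Basis. partial c f (inv0 z) * partial c g (inv0 z))"
    by (simp add: sum_distrib_left)
  finally have "(\<Sum>b\<in>Basis. partial b f' z * partial b g' z) = r\<^sup>2 * (\<Sum>c\<in>Basis. partial c f (inv0 z) * partial c g (inv0 z))" .
  then show ?thesis unfolding Gam_def omega_inv0(2)[OF z] using z
    by (simp add: r_def field_simps power2_eq_square)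
qed

text \<open>\<open>f'\<close> is the expression of \<open>f\<close> in the other chart. The
  composition with \<open>inv0\<close> cannot take its place, as it is in general not continuous at
  0. The invariance of L is recorded along with it so that it passes through sums, products and
  compositions.\<close>

definition refl_pair :: "(real^4 \<Rightarrow> real) \<Rightarrow> (real^4 \<Rightarrow> real) \<Rightarrow> bool" where
  "refl_pair f f' \<longleftrightarrow> smooth f \<and> smooth f' \<and> (\<forall>z. z \<noteq> 0 \<longrightarrow> f (inv0 z) = f' z \<and> Lop f (inv0 z) = Lop f' z)"

lemma refl_pair_const: "refl_pair (\<lambda>x. c) (\<lambda>x. c)" by (simp add: refl_pair_def)

lemma refl_pair_xi: "refl_pair (xi b) (xi b)" by (simp add: refl_pair_def xi_smooth xi_inv0 Lop_xi)

lemma refl_pair_omega: "refl_pair omega (\<lambda>x. 2 - omega x)"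
proof -
  have "Lop (\<lambda>x. 2 - omega x) z = - Lop omega z" for z
    using Lop_diff[OF smooth_const omega_smooth, of 2 z] by simp
  then show ?thesis by (auto simp: refl_pair_def omega_smooth smooth_diff omega_inv0(1) Lop_omega)
qed

lemma refl_pair_add: "refl_pair f f' \<Longrightarrow> refl_pair g g' \<Longrightarrow> refl_pair (\<lambda>x. f x + g x) (\<lambda>x. f' x + g' x)"
  by (auto simp: refl_pair_def Lop_add smooth_add)

lemma refl_pair_mult: "refl_pair f f' \<Longrightarrow> refl_pair g g' \<Longrightarrow> refl_pair (\<lambda>x. f x * g x) (\<lambda>x. f' x * g' x)"
  using Gam_inv0[of f g f' g'] by (auto simp: refl_pair_def Lop_mult smooth_mult)

lemma Lop_compose:
  assumes "smooth1 G" "smooth f"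
  shows "Lop (\<lambda>x. G (f x)) x = deriv G (f x) * Lop f x + deriv (deriv G) (f x) * Gam f f x"
proof -
  have p: "partial b (\<lambda>x. G (f x)) = (\<lambda>x. deriv G (f x) * partial b f x)" for b
    by (intro ext partial_compose_real smooth1_DERIV assms smooth_differentiable)
  have G': "smooth1 (deriv G)" "smooth (\<lambda>x. deriv G (f x))" using assms smooth1_DERIV smooth_compose_real by blast+
  have "partial b (partial b (\<lambda>x. G (f x))) x = deriv G (f x) * partial b (partial b f) x + deriv (deriv G) (f x) * (partial b f x * partial b f x)"
    if "b \<in> Basis" for b
  proof -
    have "partial b (\<lambda>x. deriv G (f x)) x = deriv (deriv G) (f x) * partial b f x"
      by (intro partial_compose_real smooth1_DERIV G' smooth_differentiable assms)
    then show ?thesis unfolding p using assms that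
      by (subst partial_mult) (auto intro: smooth_differentiable smooth_partial G')
  qed
  then have "laplacian (\<lambda>x. G (f x)) x = deriv G (f x) * laplacian f x + deriv (deriv G) (f x) * (\<Sum>b\<in>Basis. partial b f x * partial b f x)"
    by (simp add: laplacian_def sum.distrib sum_distrib_left)
  moreover have "(\<Sum>b\<in>Basis. xi b x * partial b (\<lambda>x. G (f x)) x) = deriv G (f x) * (\<Sum>b\<in>Basis. xi b x * partial b f x)"
    by (simp add: p sum_distrib_left mult.left_commute)
  ultimately show ?thesis by (simp add: Lop_def Gam_def field_simps)
qed

lemma refl_pair_compose: "smooth1 G \<Longrightarrow> refl_pair f f' \<Longrightarrow> refl_pair (\<lambda>x. G (f x)) (\<lambda>x. G (f' x))"
  using Gam_inv0[of f f f' f'] by (auto simp: refl_pair_def Lop_compose smooth_compose_real)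

lemma refl_pair_sc: "refl_pair (sc v) (\<lambda>x. sc (fst v, - snd v) x)"
proof -
  have "refl_pair (\<lambda>x. (xi (fst v) x + snd v * omega x) + (- snd v)) (\<lambda>x. (xi (fst v) x + snd v * (2 - omega x)) + (- snd v))"
    by (intro refl_pair_add refl_pair_mult refl_pair_const refl_pair_xi refl_pair_omega)
  then show ?thesis by (simp add: sc_eq[abs_def] algebra_simps)
qed

lemma Pol_refl_pair: assumes "f \<in> Pol" shows "\<exists>f'. refl_pair f f'"
proof -
  have "spol n f \<Longrightarrow> \<exists>f'. refl_pair f f'" for n f
    by (induction rule: spol.induct) (blast intro: refl_pair_const refl_pair_mult refl_pair_sc refl_pair_add)+
  then show ?thesis using assms by (auto simp: Pol_def)
qed

section \<open>Local Sobolev spaces\<close>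

lemma L2_loc_measurable: "f \<in> L2_loc \<Longrightarrow> f \<in> borel_measurable lebesgue" by (simp add: L2_loc_def)

lemma compact_lebesgue: "compact K \<Longrightarrow> K \<in> sets lebesgue" by (simp add: lmeasurable_compact fmeasurableD)

lemma L2_loc_iff: "f \<in> L2_loc \<longleftrightarrow> f \<in> borel_measurable lebesgue \<and> (\<forall>K. compact K \<longrightarrow> (\<lambda>x. indicator K x * f x) \<in> L2fn lebesgue)"
proof -
  have "(\<lambda>x. indicator K x * f x) \<in> L2fn lebesgue \<longleftrightarrow> set_integrable lebesgue K (\<lambda>x. (f x)\<^sup>2)"
    if "f \<in> borel_measurable lebesgue" "compact K" for K
  proof -
    have "(\<lambda>x. indicator K x * f x) \<in> borel_measurable lebesgue"
      by (intro borel_measurable_times borel_measurable_indicator compact_lebesgue that)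
    moreover have "(indicator K x * f x)\<^sup>2 = indicator K x *\<^sub>R (f x)\<^sup>2" for x by (simp add: indicator_def)
    ultimately show ?thesis by (simp add: L2fn_def set_integrable_def)
  qed
  then show ?thesis by (auto simp: L2_loc_def)
qed

lemma L2_loc_add: "f \<in> L2_loc \<Longrightarrow> g \<in> L2_loc \<Longrightarrow> (\<lambda>x. f x + c * g x) \<in> L2_loc"
proof -
  assume "f \<in> L2_loc" "g \<in> L2_loc"
  then have "(\<lambda>x. indicator K x * f x + c * (indicator K x * g x)) \<in> L2fn lebesgue" if "compact K" for K
    using that by (intro L2fn_add L2fn_cmult) (auto simp: L2_loc_iff)
  moreover have "(\<lambda>x. f x + c * g x) \<in> borel_measurable lebesgue"
    using \<open>f \<in> L2_loc\<close> \<open>g \<in> L2_loc\<close> L2_loc_measurable by (intro borel_measurable_add borel_measurable_times) auto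
  ultimately show ?thesis by (simp add: L2_loc_iff distrib_left mult.left_commute)
qed

lemma L2_loc_sum: "(\<And>i. i \<in> I \<Longrightarrow> f i \<in> L2_loc) \<Longrightarrow> (\<lambda>x. \<Sum>i\<in>I. f i x) \<in> L2_loc"
proof (induction I rule: infinite_finite_induct)
  case (insert i I)
  then show ?case using L2_loc_add[of "f i" "\<lambda>x. \<Sum>i\<in>I. f i x" 1] by simp
qed (auto simp: L2_loc_def set_integrable_def)

lemma L2_loc_mult:
  assumes "f \<in> L2_loc" "continuous_on UNIV g" shows "(\<lambda>x. g x * f x) \<in> L2_loc"
  unfolding L2_loc_iff
proof (intro conjI allI impI)
  have m: "f \<in> borel_measurable lebesgue" "g \<in> borel_measurable lebesgue"
    using assms L2_loc_measurable continuous_lebesgue_measurable by auto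
  then show "(\<lambda>x. g x * f x) \<in> borel_measurable lebesgue" by (intro borel_measurable_times)
  fix K :: "'a set" assume K: "compact K"
  have "bounded (g ` K)"
    using assms K by (intro compact_imp_bounded compact_continuous_image) (auto intro: continuous_on_subset)
  then obtain C where C: "\<And>x. x \<in> K \<Longrightarrow> \<bar>g x\<bar> \<le> C" unfolding bounded_real by blast
  have L: "(\<lambda>x. indicator K x * f x) \<in> L2fn lebesgue" using assms K by (simp add: L2_loc_iff)
  show "(\<lambda>x. indicator K x * (g x * f x)) \<in> L2fn lebesgue"
  proof (rule L2fnI)
    show i: "(\<lambda>x. indicator K x * (g x * f x)) \<in> borel_measurable lebesgue"
      by (intro borel_measurable_times borel_measurable_indicator compact_lebesgue K m)
    show "integrable lebesgue (\<lambda>x. (indicator K x * (g x * f x))\<^sup>2)"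
    proof (rule Bochner_Integration.integrable_bound[OF integrable_mult_right[OF L2fn_square[OF L], of "C\<^sup>2"]])
      show "(\<lambda>x. (indicator K x * (g x * f x))\<^sup>2) \<in> borel_measurable lebesgue" using i by measurable
      show "AE x in lebesgue. norm ((indicator K x * (g x * f x))\<^sup>2) \<le> norm (C\<^sup>2 * (indicator K x * f x)\<^sup>2)"
      proof (rule AE_I2)
        fix x
        show "norm ((indicator K x * (g x * f x))\<^sup>2) \<le> norm (C\<^sup>2 * (indicator K x * f x)\<^sup>2)"
        proof (cases "x \<in> K")
          case True
          have "\<bar>g x\<bar>\<^sup>2 \<le> C\<^sup>2" using C[OF True] by (intro power_mono) auto
          then show ?thesis using True by (simp add: power_mult_distrib mult_right_mono)
        qed simp
      qed
    qed
  qed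
qed

lemma L2_loc_L1_loc: assumes "f \<in> L2_loc" shows "f \<in> L1_loc"
  unfolding L1_loc_def
proof (intro CollectI allI impI)
  fix K :: "'a set" assume K: "compact K"
  then have "(\<lambda>x. indicator K x * f x) \<in> L2fn lebesgue" using assms by (simp add: L2_loc_iff)
  from L2fn_L1_loc[OF this] K have "set_integrable lebesgue K (\<lambda>x. indicator K x * f x)" by (simp add: L1_loc_def)
  moreover have "indicator K x *\<^sub>R (indicator K x * f x) = indicator K x *\<^sub>R f x" for x by (simp add: indicator_def)
  ultimately show "set_integrable lebesgue K f" by (simp only: set_integrable_def)
qed

lemma L2_loc_continuous: assumes "continuous_on UNIV f" shows "f \<in> L2_loc"
  using assms continuous_lebesgue_measurable
  by (auto simp: L2_loc_def intro!: set_integrable_continuous_lebesgue continuous_intros)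

lemma L2_loc_AE:
  assumes "f \<in> L2_loc" "AE x in lebesgue. f x = g x" shows "g \<in> L2_loc"
proof -
  have gm: "g \<in> borel_measurable lebesgue" using borel_measurable_AE[OF L2_loc_measurable[OF assms(1)] assms(2)] .
  have "(\<lambda>x. indicator K x * g x) \<in> L2fn lebesgue" if K: "compact K" for K
  proof (rule L2fn_AE)
    show "(\<lambda>x. indicator K x * f x) \<in> L2fn lebesgue" using assms K by (simp add: L2_loc_iff)
    show "(\<lambda>x. indicator K x * g x) \<in> borel_measurable lebesgue"
      by (intro borel_measurable_times borel_measurable_indicator compact_lebesgue K gm)
    show "AE x in lebesgue. indicator K x * f x = indicator K x * g x" using assms(2) by eventually_elim simp
  qed
  then show ?thesis using gm by (simp add: L2_loc_iff)
qed

lemma L2_loc_mult_test: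
  assumes "f \<in> L2_loc" "test_fun g" shows "(\<lambda>x. f x * g x) \<in> L2fn lebesgue"
proof -
  let ?K = "closure {x. g x \<noteq> 0}"
  have K: "compact ?K" using assms by (simp add: test_fun_def)
  have "(\<lambda>x. g x * f x) \<in> L2_loc"
    using assms by (intro L2_loc_mult smooth_continuous test_fun_smooth)
  then have "(\<lambda>x. indicator ?K x * (g x * f x)) \<in> L2fn lebesgue" using K by (simp add: L2_loc_iff)
  moreover have "indicator ?K x * (g x * f x) = f x * g x" for x
    using subsetD[OF closure_subset, of x "{x. g x \<noteq> 0}"] by (auto simp: indicator_def)
  ultimately show ?thesis by simp
qed

lemma L2_loc_mult_test_M4:
  assumes "f \<in> L2_loc" "test_fun g" shows "(\<lambda>x. f x * g x) \<in> L2fn M4"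
proof (rule L2fnI)
  have L: "(\<lambda>x. f x * g x) \<in> L2fn lebesgue" by (rule L2_loc_mult_test[OF assms])
  then have m: "(\<lambda>x. f x * g x) \<in> borel_measurable lebesgue" by (rule L2fn_measurable)
  then show "(\<lambda>x. f x * g x) \<in> borel_measurable M4" by simp
  have "integrable lebesgue (\<lambda>x. omega x ^ 4 * (f x * g x)\<^sup>2)"
  proof (rule Bochner_Integration.integrable_bound[OF integrable_mult_right[OF L2fn_square[OF L], of "2 ^ 4"]])
    show "(\<lambda>x. omega x ^ 4 * (f x * g x)\<^sup>2) \<in> borel_measurable lebesgue" using m by measurable
    show "AE x in lebesgue. norm (omega x ^ 4 * (f x * g x)\<^sup>2) \<le> norm (2 ^ 4 * (f x * g x)\<^sup>2)"
    proof (rule AE_I2)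
      fix x
      have "omega x ^ 4 \<le> 2 ^ 4" by (intro power_mono omega_le_2 omega_nonneg)
      then have "omega x ^ 4 * (f x * g x)\<^sup>2 \<le> 2 ^ 4 * (f x * g x)\<^sup>2"
        by (intro mult_right_mono) auto
      moreover have "0 \<le> omega x ^ 4 * (f x * g x)\<^sup>2" by (intro mult_nonneg_nonneg) auto
      ultimately show "norm (omega x ^ 4 * (f x * g x)\<^sup>2) \<le> norm (2 ^ 4 * (f x * g x)\<^sup>2)"
        unfolding real_norm_def by linarith
    qed
  qed
  then show "integrable M4 (\<lambda>x. (f x * g x)\<^sup>2)"
    using m by (subst integrable_M4) auto
qed

lemma L1_loc_add: "f \<in> L1_loc \<Longrightarrow> g \<in> L1_loc \<Longrightarrow> (\<lambda>x. f x + c * g x) \<in> L1_loc"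
  using L1_loc_diff[of f "\<lambda>x. - c * g x"] by (auto simp: L1_loc_def)

lemma L1_loc_test_add:
  assumes "f \<in> L1_loc" "g \<in> L1_loc" "test_fun \<psi>"
  shows "(LINT x|lebesgue. (f x + c * g x) * \<psi> x) = (LINT x|lebesgue. f x * \<psi> x) + c * (LINT x|lebesgue. g x * \<psi> x)"
  using L1_loc_mult_test[OF assms(1,3)] L1_loc_mult_test[OF assms(2,3)] by (simp add: distrib_right mult.assoc)

lemma has_weak_partial_add:
  assumes "has_weak_partial f b p" "has_weak_partial g b q" and b: "b \<in> Basis"
  shows "has_weak_partial (\<lambda>x. f x + c * g x) b (\<lambda>x. p x + c * q x)"
proof -
  have L: "f \<in> L1_loc" "g \<in> L1_loc" "p \<in> L1_loc" "q \<in> L1_loc" using assms by (auto simp: has_weak_partial_def)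
  show ?thesis unfolding has_weak_partial_def
  proof (intro conjI allI impI L1_loc_add L)
    fix \<psi> :: "'a \<Rightarrow> real" assume \<psi>: "test_fun \<psi>"
    show "(LINT x|lebesgue. (f x + c * g x) * partial b \<psi> x) = - (LINT x|lebesgue. (p x + c * q x) * \<psi> x)"
      using assms \<psi> unfolding L1_loc_test_add[OF L(1,2) test_fun_partial[OF \<psi> b]] L1_loc_test_add[OF L(3,4) \<psi>] has_weak_partial_def by simp
  qed
qed

section \<open>The form domain\<close>

lemma Hk_loc_L2_loc: "f \<in> Hk_loc k \<Longrightarrow> f \<in> L2_loc" by (cases k) auto

lemma Hk_loc_add: "f \<in> Hk_loc k \<Longrightarrow> g \<in> Hk_loc k \<Longrightarrow> (\<lambda>x. f x + c * g x) \<in> Hk_loc k"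
proof (induction k arbitrary: f g)
  case 0
  then show ?case by (simp add: L2_loc_add)
next
  case (Suc k)
  have "\<exists>r\<in>Hk_loc k. has_weak_partial (\<lambda>x. f x + c * g x) b r" if b: "b \<in> Basis" for b
  proof -
    obtain p q where "p \<in> Hk_loc k" "has_weak_partial f b p" "q \<in> Hk_loc k" "has_weak_partial g b q"
      using Suc.prems b unfolding Hk_loc.simps by blast
    then show ?thesis using has_weak_partial_add[OF _ _ b] Suc.IH by blast
  qed
  then show ?case using Suc.prems by (simp add: L2_loc_add)
qed

lemma Hk_loc_AE:
  assumes "f \<in> Hk_loc k" "AE x in lebesgue. f x = g x" shows "g \<in> Hk_loc k"
proof (cases k)
  case 0
  then show ?thesis using assms by (auto intro: L2_loc_AE)
next
  case (Suc m)
  have g: "g \<in> L2_loc" using L2_loc_AE[OF Hk_loc_L2_loc[OF assms(1)] assms(2)] .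
  have "has_weak_partial g b p" if p: "has_weak_partial f b p" "b \<in> Basis" for b p
    unfolding has_weak_partial_def
  proof (intro conjI allI impI L2_loc_L1_loc[OF g])
    show "p \<in> L1_loc" using p by (simp add: has_weak_partial_def)
    fix \<psi> :: "'a \<Rightarrow> real" assume \<psi>: "test_fun \<psi>"
    have d: "partial b \<psi> \<in> borel_measurable lebesgue"
      by (intro smooth_lebesgue_measurable test_fun_smooth test_fun_partial \<psi> p)
    have "(LINT x|lebesgue. g x * partial b \<psi> x) = (LINT x|lebesgue. f x * partial b \<psi> x)"
    proof (rule integral_cong_AE)
      show "AE x in lebesgue. g x * partial b \<psi> x = f x * partial b \<psi> x" using assms(2) by eventually_elim simp
    qed (intro borel_measurable_times d L2_loc_measurable[OF g] L2_loc_measurable[OF Hk_loc_L2_loc[OF assms(1)]])+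
    then show "(LINT x|lebesgue. g x * partial b \<psi> x) = - (LINT x|lebesgue. p x * \<psi> x)"
      using p \<psi> by (simp add: has_weak_partial_def)
  qed
  moreover have "\<exists>p\<in>Hk_loc m. has_weak_partial f b p" if "b \<in> Basis" for b using assms(1) that unfolding Suc by simp
  ultimately have "\<forall>b\<in>Basis. \<exists>p\<in>Hk_loc m. has_weak_partial g b p" by blast
  then show ?thesis using g unfolding Suc by simp
qed

lemma smooth_Hk_loc: "smooth f \<Longrightarrow> f \<in> Hk_loc k"
proof (induction k arbitrary: f)
  case (Suc k)
  have "\<exists>g\<in>Hk_loc k. has_weak_partial f b g" if "b \<in> Basis" for b
    using smooth_weak_partial[OF Suc.prems that] Suc.IH[OF smooth_partial[OF Suc.prems that]] by blast
  then show ?case by (simp add: L2_loc_continuous smooth_continuous Suc.prems)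
qed (simp add: L2_loc_continuous smooth_continuous)

text \<open>Regularity in both charts becomes a condition on \<open>\<phi>\<close> and its
  inversion: the two descriptions of the second chart differ only at the null point 0.\<close>

lemma form_domain_iff: "\<phi> \<in> form_domain \<longleftrightarrow> \<phi> \<in> Hk_loc 2 \<and> (\<lambda>x. \<phi> (inv0 x)) \<in> Hk_loc 2"
proof
  assume "\<phi> \<in> form_domain"
  then obtain \<Phi> where \<Phi>: "\<phi> = \<Phi> \<circ> stereo" "\<Phi> \<circ> stereo \<in> Hk_loc 2" "\<Phi> \<circ> stereo' \<in> Hk_loc 2"
    by (auto simp: form_domain_def H2_sphere_def)
  have "AE x in lebesgue. (\<Phi> \<circ> stereo') x = \<phi> (inv0 x)" using AE_nonzero
    by eventually_elim (simp add: \<Phi>(1) stereo'_eq)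
  from Hk_loc_AE[OF \<Phi>(3) this] show "\<phi> \<in> Hk_loc 2 \<and> (\<lambda>x. \<phi> (inv0 x)) \<in> Hk_loc 2"
    using \<Phi>(2) unfolding \<Phi>(1)[symmetric] by (rule conjI[rotated])
next
  assume \<phi>: "\<phi> \<in> Hk_loc 2 \<and> (\<lambda>x. \<phi> (inv0 x)) \<in> Hk_loc 2"
  \<comment> \<open>The function on the sphere is recovered through the inverse of the chart; its
    value at the missing pole is arbitrary and concerns only the point 0 of the second
    chart.\<close>
  define \<Phi> where "\<Phi> = \<phi> \<circ> inv stereo"
  have "inv stereo (stereo x) = x" for x using stereo_inj by (intro inv_f_f injI) auto
  then have e: "\<Phi> (stereo x) = \<phi> x" for x by (simp add: \<Phi>_def)
  have "AE x in lebesgue. \<phi> (inv0 x) = (\<Phi> \<circ> stereo') x" using AE_nonzero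
    by eventually_elim (simp add: stereo'_eq e)
  from Hk_loc_AE[OF conjunct2[OF \<phi>] this] have "\<Phi> \<circ> stereo' \<in> Hk_loc 2" .
  moreover have "\<Phi> \<circ> stereo = \<phi>" by (simp add: fun_eq_iff e)
  ultimately show "\<phi> \<in> form_domain" unfolding form_domain_def H2_sphere_def using conjunct1[OF \<phi>]
    by (intro CollectI exI[of _ \<Phi>] conjI) simp_all
qed

lemma form_domain_add: "\<phi> \<in> form_domain \<Longrightarrow> \<psi> \<in> form_domain \<Longrightarrow> (\<lambda>x. \<phi> x + c * \<psi> x) \<in> form_domain"
  unfolding form_domain_iff by (auto intro: Hk_loc_add simp del: Hk_loc.simps)

lemma form_domain_AE: "\<phi> \<in> form_domain \<Longrightarrow> AE x in lebesgue. \<phi> x = \<psi> x \<Longrightarrow> \<psi> \<in> form_domain"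
  unfolding form_domain_iff
  using Hk_loc_AE[of \<phi> 2 \<psi>] Hk_loc_AE[of "\<lambda>x. \<phi> (inv0 x)" 2 "\<lambda>x. \<psi> (inv0 x)"] AE_inv0[of "\<lambda>x. \<phi> x = \<psi> x"] by blast

lemma Pol_form_domain: assumes "f \<in> Pol" shows "f \<in> form_domain"
  unfolding form_domain_iff
proof
  obtain f' where f': "refl_pair f f'" using Pol_refl_pair[OF assms] by blast
  show "f \<in> Hk_loc 2" using f' smooth_Hk_loc by (auto simp: refl_pair_def)
  have "f' \<in> Hk_loc 2" using f' smooth_Hk_loc by (auto simp: refl_pair_def)
  moreover have "AE x in lebesgue. f' x = f (inv0 x)" using AE_nonzero
    by eventually_elim (use f' in \<open>simp add: refl_pair_def\<close>)
  ultimately show "(\<lambda>x. f (inv0 x)) \<in> Hk_loc 2" by (rule Hk_loc_AE)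
qed

lemma Lop_smooth: assumes "smooth f" shows "smooth (Lop f)"
proof -
  have "Lop f = (\<lambda>x. (1 / omega x) ^ 4 * (\<Sum>b\<in>Basis. partial b (\<lambda>x. (omega x)\<^sup>2 * partial b f x) x))"
    unfolding Lop_divergence[OF assms] by (simp add: fun_eq_iff power_divide)
  then show ?thesis
    by (simp only:) (intro smooth_mult smooth_power smooth_sum smooth_partial omega_smooth inverse_omega_smooth assms)
qed

lemma test_fun_omega_partial: "test_fun \<psi> \<Longrightarrow> b \<in> Basis \<Longrightarrow> test_fun (\<lambda>x. (omega x)\<^sup>2 * partial b \<psi> x)"
  by (intro test_fun_mult smooth_power omega_smooth test_fun_partial)

lemma test_fun_omega_Lop: assumes "test_fun \<psi>" shows "test_fun (\<lambda>x. omega x ^ 4 * Lop \<psi> x)"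
  unfolding Lop_divergence[OF test_fun_smooth[OF assms], symmetric]
  by (intro test_fun_sum test_fun_partial test_fun_omega_partial assms)

lemma test_fun_Lop: assumes "test_fun \<psi>" shows "test_fun (Lop \<psi>)"
  using test_fun_div_omega[OF test_fun_omega_Lop[OF assms]] by simp

text \<open>The weak form of omega^-4 div (omega^2 grad \<phi>). Only first and unmixed second
  derivatives enter, and \<open>Hk_loc 2\<close> provides them.\<close>

lemma weak_Lop_chart:
  assumes "\<phi> \<in> Hk_loc 2"
  shows "\<exists>H\<in>L2_loc. \<forall>\<psi>. test_fun \<psi> \<longrightarrow> (LINT x|M4. \<phi> x * Lop \<psi> x) = (LINT x|M4. H x * \<psi> x)"
proof -
  have \<phi>: "\<phi> \<in> L2_loc" using assms by (rule Hk_loc_L2_loc)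
  have "\<phi> \<in> Hk_loc (Suc (Suc 0))" using assms by (simp only: numeral_2_eq_2)
  then have "\<exists>g h. g \<in> L2_loc \<and> h \<in> L2_loc \<and> has_weak_partial \<phi> b g \<and> has_weak_partial g b h" if "b \<in> Basis" for b
    using that by (auto simp: Ball_def Bex_def) blast
  then obtain g h where gh: "\<And>b. b \<in> Basis \<Longrightarrow> g b \<in> L2_loc" "\<And>b. b \<in> Basis \<Longrightarrow> h b \<in> L2_loc"
    "\<And>b. b \<in> Basis \<Longrightarrow> has_weak_partial \<phi> b (g b)" "\<And>b. b \<in> Basis \<Longrightarrow> has_weak_partial (g b) b (h b)"
    by metis
  let ?w = "\<lambda>x. (omega x)\<^sup>2"
  define H where "H x = (1 / omega x) ^ 4 * (\<Sum>b\<in>Basis. ?w x * h b x + partial b ?w x * g b x)" for x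
  have sw: "smooth ?w" by (intro smooth_power omega_smooth)
  have HL: "H \<in> L2_loc"
    unfolding H_def[abs_def]
  proof (intro L2_loc_mult L2_loc_sum smooth_continuous smooth_power inverse_omega_smooth)
    fix b :: "real^4" assume b: "b \<in> Basis"
    have "(\<lambda>x. ?w x * h b x) \<in> L2_loc" "(\<lambda>x. partial b ?w x * g b x) \<in> L2_loc"
      by (intro L2_loc_mult gh b smooth_continuous smooth_partial sw)+
    from L2_loc_add[OF this, of 1] show "(\<lambda>x. ?w x * h b x + partial b ?w x * g b x) \<in> L2_loc" by simp
  qed
  have "(LINT x|M4. \<phi> x * Lop \<psi> x) = (LINT x|M4. H x * \<psi> x)" if \<psi>: "test_fun \<psi>" for \<psi>
  proof -
    have s\<psi>: "smooth \<psi>" by (rule test_fun_smooth[OF \<psi>])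
    have "(LINT x|M4. \<phi> x * Lop \<psi> x) = (LINT x|lebesgue. \<phi> x * (omega x ^ 4 * Lop \<psi> x))"
      using integral_M4_div_omega[OF L2_loc_measurable[OF \<phi>] test_fun_omega_Lop[OF \<psi>]] by simp
    also have "\<dots> = (LINT x|lebesgue. (\<Sum>b\<in>Basis. \<phi> x * partial b (\<lambda>x. ?w x * partial b \<psi> x) x))"
      unfolding Lop_divergence[OF s\<psi>, symmetric] sum_distrib_left ..
    also have "\<dots> = (\<Sum>b\<in>Basis. LINT x|lebesgue. \<phi> x * partial b (\<lambda>x. ?w x * partial b \<psi> x) x)"
      by (intro Bochner_Integration.integral_sum L1_loc_mult_test L2_loc_L1_loc \<phi> test_fun_partial test_fun_omega_partial \<psi>)
    also have "\<dots> = (\<Sum>b\<in>Basis. LINT x|lebesgue. (?w x * h b x + partial b ?w x * g b x) * \<psi> x)"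
    proof (intro sum.cong refl)
      fix b :: "real^4" assume b: "b \<in> Basis"
      have t: "test_fun (\<lambda>x. ?w x * \<psi> x)" "test_fun (\<lambda>x. partial b ?w x * \<psi> x)"
        by (intro test_fun_mult sw smooth_partial b \<psi>)+
      have gl: "g b \<in> L1_loc" "h b \<in> L1_loc" by (intro L2_loc_L1_loc gh b)+
      have i: "integrable lebesgue (\<lambda>x. g b x * (?w x * partial b \<psi> x))" "integrable lebesgue (\<lambda>x. g b x * (partial b ?w x * \<psi> x))"
        "integrable lebesgue (\<lambda>x. h b x * (?w x * \<psi> x))"
        by (intro L1_loc_mult_test gl t test_fun_omega_partial \<psi> b)+
      have pe: "partial b (\<lambda>x. ?w x * \<psi> x) x = ?w x * partial b \<psi> x + partial b ?w x * \<psi> x" for x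
        by (intro partial_mult smooth_differentiable sw s\<psi>)
      have "- (LINT x|lebesgue. h b x * (?w x * \<psi> x)) = (LINT x|lebesgue. g b x * partial b (\<lambda>x. ?w x * \<psi> x) x)"
        using gh(4)[OF b] t(1) by (simp add: has_weak_partial_def)
      also have "\<dots> = (LINT x|lebesgue. g b x * (?w x * partial b \<psi> x)) + (LINT x|lebesgue. g b x * (partial b ?w x * \<psi> x))"
        using i by (simp add: pe distrib_left)
      finally have 1: "- (LINT x|lebesgue. g b x * (?w x * partial b \<psi> x))
        = (LINT x|lebesgue. h b x * (?w x * \<psi> x)) + (LINT x|lebesgue. g b x * (partial b ?w x * \<psi> x))" by simp
      have "(LINT x|lebesgue. \<phi> x * partial b (\<lambda>x. ?w x * partial b \<psi> x) x) = - (LINT x|lebesgue. g b x * (?w x * partial b \<psi> x))"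
        using gh(3)[OF b] test_fun_omega_partial[OF \<psi> b] by (simp add: has_weak_partial_def)
      also have "\<dots> = (LINT x|lebesgue. h b x * (?w x * \<psi> x) + g b x * (partial b ?w x * \<psi> x))"
        unfolding 1 using i by simp
      finally show "(LINT x|lebesgue. \<phi> x * partial b (\<lambda>x. ?w x * partial b \<psi> x) x) = (LINT x|lebesgue. (?w x * h b x + partial b ?w x * g b x) * \<psi> x)"
        by (simp only: distrib_left distrib_right mult_ac)
    qed
    also have "\<dots> = (LINT x|lebesgue. (\<Sum>b\<in>Basis. (?w x * h b x + partial b ?w x * g b x) * \<psi> x))"
    proof (rule Bochner_Integration.integral_sum[symmetric])
      fix b :: "real^4" assume b: "b \<in> Basis"
      have "(\<lambda>x. ?w x * h b x) \<in> L2_loc" "(\<lambda>x. partial b ?w x * g b x) \<in> L2_loc"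
        by (intro L2_loc_mult gh b smooth_continuous smooth_partial sw)+
      from L2_loc_add[OF this, of 1] show "integrable lebesgue (\<lambda>x. (?w x * h b x + partial b ?w x * g b x) * \<psi> x)"
        by (intro L1_loc_mult_test[OF L2_loc_L1_loc \<psi>]) simp
    qed
    also have "\<dots> = (LINT x|lebesgue. omega x ^ 4 * (H x * \<psi> x))"
      unfolding H_def sum_distrib_right[symmetric] by (simp add: power_divide)
    also have "\<dots> = (LINT x|M4. H x * \<psi> x)"
      by (intro integral_M4[symmetric] borel_measurable_times L2_loc_measurable[OF HL] smooth_lebesgue_measurable s\<psi>)
    finally show ?thesis .
  qed
  then show ?thesis using HL by blast
qed

text \<open>A partition of unity \<open>chi\<close>, \<open>1 - chi\<close> on the sphere; \<open>chi'\<close> is \<open>1 - chi\<close> in the other chart.\<close>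

definition chi :: "real^4 \<Rightarrow> real" where "chi x = eta (2 * omega x)"

definition chi' :: "real^4 \<Rightarrow> real" where "chi' x = 1 - eta (2 * (2 - omega x))"

lemma chi_test_fun: "test_fun chi"
  using cut_test_fun[OF cut_eta, of 2] by (simp add: chi_def[abs_def])

lemma chi_refl_pair: "refl_pair (\<lambda>x. 1 - chi x) chi'"
proof -
  have "smooth1 (\<lambda>s. 1 + -1 * eta (0 + 2 * s))" by (intro smooth1_affine eta_smooth1)
  from refl_pair_compose[OF this refl_pair_omega] show ?thesis by (simp add: chi_def chi'_def[abs_def])
qed

lemma chi'_test_fun: "test_fun chi'"
proof (rule test_fun_support)
  show "smooth chi'" using chi_refl_pair by (simp add: refl_pair_def)
  have "{x. chi' x \<noteq> 0} \<subseteq> cball 0 1"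
  proof
    fix x assume "x \<in> {x. chi' x \<noteq> 0}"
    then have "\<not> 2 * (2 - omega x) \<ge> 2" using eta_1 by (auto simp: chi'_def)
    then have o: "omega x > 1" by simp
    have "1 + (norm x)\<^sup>2 > 0" by (intro add_pos_nonneg) auto
    then have "(norm x)\<^sup>2 \<le> 1\<^sup>2" using o by (simp add: omega_def field_simps)
    then show "x \<in> cball 0 1" using power2_le_imp_le[of "norm x" 1] by simp
  qed
  then show "bounded {x. chi' x \<noteq> 0}" using bounded_cball bounded_subset by blast
qed

lemma chi'_inv0: "z \<noteq> 0 \<Longrightarrow> chi' (inv0 z) = 1 - chi z"
  using chi_refl_pair inv0_inv0[of z] inv0_nonzero[of z] unfolding refl_pair_def by metis

lemma glue_L2fn:
  assumes "f \<in> L2_loc" "g \<in> L2_loc" shows "(\<lambda>x. f x * chi x + g (inv0 x) * chi' (inv0 x)) \<in> L2fn M4"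
  by (intro L2fn_add L2_loc_mult_test_M4 chi_test_fun assms L2fn_M4_inv0[of "\<lambda>x. g x * chi' x"] chi'_test_fun)

lemma form_domain_L2fn: assumes "\<phi> \<in> form_domain" shows "\<phi> \<in> L2fn M4"
proof (rule L2fn_AE)
  have L: "\<phi> \<in> L2_loc" "(\<lambda>x. \<phi> (inv0 x)) \<in> L2_loc" using assms Hk_loc_L2_loc by (auto simp: form_domain_iff simp del: Hk_loc.simps)
  show "(\<lambda>x. \<phi> x * chi x + \<phi> (inv0 (inv0 x)) * chi' (inv0 x)) \<in> L2fn M4" using glue_L2fn[OF L] .
  show "AE x in M4. \<phi> x * chi x + \<phi> (inv0 (inv0 x)) * chi' (inv0 x) = \<phi> x"
    unfolding AE_M4 using AE_nonzero by eventually_elim (simp add: inv0_inv0 chi'_inv0 algebra_simps)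
  show "\<phi> \<in> borel_measurable M4" using L2_loc_measurable[OF L(1)] by simp
qed

text \<open>The partition of unity splits a polynomial into two pieces, each a test function in one
  of the charts. The piece near the pole is moved by the inversion, which preserves the measure and
  L, and the two local densities are glued.\<close>

lemma form_domain_weak_Lop:
  assumes "\<phi> \<in> form_domain"
  shows "\<exists>h\<in>L2fn M4. \<forall>f\<in>Pol. (LINT x|M4. \<phi> x * Lop f x) = (LINT x|M4. h x * f x)"
proof -
  let ?\<phi>' = "\<lambda>x. \<phi> (inv0 x)"
  have D: "\<phi> \<in> Hk_loc 2" "?\<phi>' \<in> Hk_loc 2" using assms by (auto simp: form_domain_iff simp del: Hk_loc.simps)
  note \<phi>L = form_domain_L2fn[OF assms]
  have \<phi>m: "\<phi> \<in> borel_measurable lebesgue" "?\<phi>' \<in> borel_measurable lebesgue"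
    using L2_loc_measurable Hk_loc_L2_loc D by blast+
  obtain H H' where H: "H \<in> L2_loc" "\<And>\<psi>. test_fun \<psi> \<Longrightarrow> (LINT x|M4. \<phi> x * Lop \<psi> x) = (LINT x|M4. H x * \<psi> x)"
    and H': "H' \<in> L2_loc" "\<And>\<psi>. test_fun \<psi> \<Longrightarrow> (LINT x|M4. ?\<phi>' x * Lop \<psi> x) = (LINT x|M4. H' x * \<psi> x)"
    using weak_Lop_chart[OF D(1)] weak_Lop_chart[OF D(2)] by blast
  have hL: "(\<lambda>x. H x * chi x) \<in> L2fn M4" "(\<lambda>x. H' x * chi' x) \<in> L2fn M4"
    by (intro L2_loc_mult_test_M4 H(1) H'(1) chi_test_fun chi'_test_fun)+
  let ?h2 = "\<lambda>x. H' (inv0 x) * chi' (inv0 x)"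
  have h2L: "?h2 \<in> L2fn M4" using L2fn_M4_inv0[OF hL(2)] .
  have "(LINT x|M4. \<phi> x * Lop f x) = (LINT x|M4. (H x * chi x + ?h2 x) * f x)" if f: "f \<in> Pol" for f
  proof -
    obtain f' where f': "refl_pair f f'" using Pol_refl_pair[OF f] by blast
    have sf: "smooth f" "smooth f'" using f' by (auto simp: refl_pair_def)
    let ?p = "\<lambda>x. f x * chi x" and ?q = "\<lambda>x. (1 - chi x) * f x" and ?q' = "\<lambda>x. chi' x * f' x"
    have q: "refl_pair ?q ?q'" by (intro refl_pair_mult chi_refl_pair f')
    have tp: "test_fun ?p" by (intro test_fun_mult sf chi_test_fun)
    have tq: "test_fun ?q'" using test_fun_mult[OF sf(2) chi'_test_fun] by (simp add: mult.commute)
    have sp: "smooth ?p" "smooth ?q" using tp test_fun_smooth q by (auto simp: refl_pair_def)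
    have "f = (\<lambda>x. ?p x + ?q x)" by (simp add: fun_eq_iff algebra_simps)
    then have Lf: "Lop f x = Lop ?p x + Lop ?q x" for x using Lop_add[OF sp, of x] by simp
    have i1: "integrable M4 (\<lambda>x. \<phi> x * Lop ?p x)" by (intro L2fn_mult \<phi>L test_fun_L2fn_M4 test_fun_Lop tp)
    moreover have "integrable M4 (\<lambda>x. \<phi> x * Lop f x)" by (intro L2fn_mult \<phi>L Pol_L2fn Pol_Lop f)
    \<comment> \<open>The piece \<open>?q\<close> has no compact support in this chart, so
      integrability is obtained as a difference of two integrable terms.\<close>
    ultimately have "integrable M4 (\<lambda>x. \<phi> x * Lop f x - \<phi> x * Lop ?p x)" by (rule Bochner_Integration.integrable_diff[rotated])
    then have i2: "integrable M4 (\<lambda>x. \<phi> x * Lop ?q x)" by (simp add: Lf algebra_simps)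
    have m: "(\<lambda>x. \<phi> x * Lop ?q x) \<in> borel_measurable lebesgue" "(\<lambda>x. ?\<phi>' x * Lop ?q' x) \<in> borel_measurable lebesgue"
      by (intro borel_measurable_times \<phi>m smooth_lebesgue_measurable Lop_smooth sp test_fun_smooth[OF tq])+
    have fm: "f \<in> borel_measurable lebesgue" by (rule Pol_measurable[OF f])
    have "(LINT x|M4. \<phi> x * Lop ?q x) = (LINT x|M4. \<phi> (inv0 x) * Lop ?q (inv0 x))"
      using M4_inv0(2)[OF m(1)] by simp
    also have "\<dots> = (LINT x|M4. ?\<phi>' x * Lop ?q' x)"
    proof (rule integral_cong_AE)
      show "AE x in M4. \<phi> (inv0 x) * Lop ?q (inv0 x) = \<phi> (inv0 x) * Lop ?q' x"
        unfolding AE_M4 using AE_nonzero by eventually_elim (use q in \<open>simp add: refl_pair_def\<close>)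
    qed (use measurable_inv0[OF m(1)] m(2) in simp_all)
    also have "\<dots> = (LINT x|M4. H' x * ?q' x)" by (rule H'(2)[OF tq])
    also have "\<dots> = (LINT x|M4. H' (inv0 x) * ?q' (inv0 x))"
    proof (rule M4_inv0(2)[symmetric])
      show "(\<lambda>x. H' x * ?q' x) \<in> borel_measurable lebesgue"
        by (intro borel_measurable_times[OF L2_loc_measurable[OF H'(1)]] smooth_lebesgue_measurable test_fun_smooth[OF tq])
    qed
    also have "\<dots> = (LINT x|M4. ?h2 x * f x)"
    proof (rule integral_cong_AE)
      show "AE x in M4. H' (inv0 x) * ?q' (inv0 x) = ?h2 x * f x"
        unfolding AE_M4 using AE_nonzero
      proof eventually_elim
        case (elim x)
        then have "f' (inv0 x) = f x" using f' inv0_nonzero[of x] inv0_inv0[of x] unfolding refl_pair_def by metis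
        then show ?case by simp
      qed
      show "(\<lambda>x. H' (inv0 x) * ?q' (inv0 x)) \<in> borel_measurable M4"
        using measurable_inv0[OF borel_measurable_times[OF L2_loc_measurable[OF H'(1)] smooth_lebesgue_measurable[OF test_fun_smooth[OF tq]]]] by simp
      show "(\<lambda>x. ?h2 x * f x) \<in> borel_measurable M4" using L2fn_measurable[OF h2L] fm by simp
    qed
    finally have 2: "(LINT x|M4. \<phi> x * Lop ?q x) = (LINT x|M4. ?h2 x * f x)" .
    have "(LINT x|M4. \<phi> x * Lop f x) = (LINT x|M4. \<phi> x * Lop ?p x) + (LINT x|M4. \<phi> x * Lop ?q x)"
      using i1 i2 by (simp add: Lf distrib_left)
    also have "\<dots> = (LINT x|M4. H x * chi x * f x) + (LINT x|M4. ?h2 x * f x)"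
      unfolding 2 H(2)[OF tp] by (simp add: mult_ac)
    also have "\<dots> = (LINT x|M4. (H x * chi x + ?h2 x) * f x)"
      using L2fn_mult[OF hL(1) Pol_L2fn[OF f]] L2fn_mult[OF h2L Pol_L2fn[OF f]] by (simp add: distrib_right)
    finally show ?thesis .
  qed
  then show ?thesis using L2fn_add[OF hL(1) h2L] by (intro bexI[of _ "\<lambda>x. H x * chi x + ?h2 x"]) auto
qed

lemma L2conv_AE:
  assumes "AE x in M. g x = g' x" "g' \<in> borel_measurable M" "L2conv M f g" shows "L2conv M f g'"
proof -
  have L: "f n \<in> L2fn M" "g \<in> L2fn M" for n using assms(3) by (auto simp: L2conv_def)
  have "(\<integral>x. (f n x - g x)\<^sup>2 \<partial>M) = (\<integral>x. (f n x - g' x)\<^sup>2 \<partial>M)" for n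
  proof (rule integral_cong_AE)
    show "AE x in M. (f n x - g x)\<^sup>2 = (f n x - g' x)\<^sup>2" using assms(1) by eventually_elim simp
  qed (use L L2fn_measurable assms(2) in \<open>auto intro!: borel_measurable_power borel_measurable_diff\<close>)
  then show ?thesis using assms L2fn_AE[OF L(2) assms(1,2)] by (simp add: L2conv_def)
qed

text \<open>With L \<phi> = h weakly in L^2, also (1 - L) \<phi> is in L^2. Hence polynomials
  approximate \<open>\<phi>\<close> together with their images under 1 - L, and these control the
  Laplacians.\<close>

lemma form_domain_approximation:
  assumes "\<phi> \<in> form_domain"
  shows "\<exists>g. (\<forall>n. g n \<in> Pol) \<and> L2conv M4 g \<phi> \<and> L2conv lebesgue (\<lambda>n. laplacian (g n)) (weak_laplacian \<phi>)"
    "has_weak_laplacian \<phi> (weak_laplacian \<phi>)"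
proof -
  note \<phi>L = form_domain_L2fn[OF assms]
  obtain h where h: "h \<in> L2fn M4" "\<And>f. f \<in> Pol \<Longrightarrow> (LINT x|M4. \<phi> x * Lop f x) = (LINT x|M4. h x * f x)"
    using form_domain_weak_Lop[OF assms] by blast
  have "(LINT x|M4. \<phi> x * Res f x) = (LINT x|M4. (\<phi> x - h x) * f x)" if f: "f \<in> Pol" for f
    using L2fn_mult[OF \<phi>L Pol_L2fn[OF f]] L2fn_mult[OF \<phi>L Pol_L2fn[OF Pol_Lop[OF f]]] L2fn_mult[OF h(1) Pol_L2fn[OF f]] h(2)[OF f]
    by (simp add: Res_def right_diff_distrib left_diff_distrib)
  from Res_approximation[OF \<phi>L L2fn_diff[OF \<phi>L h(1)] this]
  obtain g where g: "\<And>n. g n \<in> Pol" "L2conv M4 g \<phi>" "L2conv M4 (\<lambda>n. Res (g n)) (\<lambda>x. \<phi> x - h x)" by blast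
  obtain G where G: "L2conv lebesgue (\<lambda>n. laplacian (g n)) G" "has_weak_laplacian \<phi> G"
    using weak_laplacian_limit[OF g] by blast
  show W: "has_weak_laplacian \<phi> (weak_laplacian \<phi>)" unfolding weak_laplacian_def by (rule someI[where P = "has_weak_laplacian \<phi>", OF G(2)])
  have "AE x in lebesgue. G x = weak_laplacian \<phi> x" by (rule has_weak_laplacian_unique[OF G(2) W]) simp
  moreover have "weak_laplacian \<phi> \<in> borel_measurable lebesgue"
    using weak_laplacian_AE(2)[OF G(2)] L2fn_M4_L1_loc[OF \<phi>L] by simp
  ultimately have "L2conv lebesgue (\<lambda>n. laplacian (g n)) (weak_laplacian \<phi>)" using G(1) by (rule L2conv_AE)
  then show "\<exists>g. (\<forall>n. g n \<in> Pol) \<and> L2conv M4 g \<phi> \<and> L2conv lebesgue (\<lambda>n. laplacian (g n)) (weak_laplacian \<phi>)" using g by blast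
qed

section \<open>General bubbles\<close>

lemma affine_change_of_variables:
  fixes f :: "real^4 \<Rightarrow> real"
  assumes "\<mu> > 0"
  shows "integrable lebesgue (\<lambda>x. f (\<mu> *\<^sub>R x + a)) \<longleftrightarrow> integrable lebesgue f"
    "\<mu> ^ 4 * (LINT x|lebesgue. f (\<mu> *\<^sub>R x + a)) = (LINT x|lebesgue. f x)"
proof -
  let ?g = "\<lambda>x::real^4. \<mu> *\<^sub>R x + a"
  have d: "\<bar>det (matrix ((*\<^sub>R) \<mu>) :: real^4^4)\<bar> = \<mu> ^ 4"
    using assms by (simp add: matrix_scaleR) (subst det_diagonal, auto simp: mat_def)
  have hd: "(?g has_derivative (*\<^sub>R) \<mu>) (at x)" for x by (auto intro!: derivative_eq_intros)
  have "y = ?g ((1 / \<mu>) *\<^sub>R (y - a))" for y using assms by simp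
  then have "range ?g = UNIV" by blast
  then have s: "negligible (- range ?g)" by simp
  have "inj ?g" using assms by (auto simp: inj_def)
  note cov = integrable_lebesgue_change_of_variables[OF _ hd this _ s, of f, unfolded d]
  show "integrable lebesgue (\<lambda>x. f (?g x)) \<longleftrightarrow> integrable lebesgue f"
    using cov(1) assms by simp
  show "\<mu> ^ 4 * (LINT x|lebesgue. f (?g x)) = (LINT x|lebesgue. f x)"
    using cov(2) by simp
qed

lemma AE_affine:
  fixes a :: "real^4"
  assumes \<mu>: "\<mu> > 0" and "AE x in lebesgue. P x" shows "AE x in lebesgue. P (\<mu> *\<^sub>R x + a)"
proof -
  obtain N where N: "N \<in> null_sets lebesgue" "{x \<in> space lebesgue. \<not> P x} \<subseteq> N"
    using assms(2) by (auto simp: eventually_ae_filter)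
  let ?h = "indicator N :: real^4 \<Rightarrow> real"
  have "integrable lebesgue ?h" "(LINT x|lebesgue. ?h x) = 0"
    using N(1) by (auto intro!: integrable_real_indicator simp: null_sets_def measure_def)
  then have "AE x in lebesgue. ?h (\<mu> *\<^sub>R x + a) = 0"
    using affine_change_of_variables[OF \<mu>, of ?h a] integral_nonneg_eq_0_iff_AE[of lebesgue "\<lambda>x. ?h (\<mu> *\<^sub>R x + a)"] \<mu> by simp
  then show ?thesis
  proof eventually_elim
    case (elim x)
    then have "\<mu> *\<^sub>R x + a \<notin> N" by (auto simp: indicator_def)
    then show ?case using N(2) by auto
  qed
qed

lemma measurable_affine:
  fixes f :: "real^4 \<Rightarrow> real"
  assumes "\<mu> > 0" "f \<in> borel_measurable lebesgue" shows "(\<lambda>x. f (\<mu> *\<^sub>R x + a)) \<in> borel_measurable lebesgue"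
proof -
  obtain p where p: "p \<in> borel_measurable lborel" "AE x in lborel. f x = p x"
    using completion_ex_borel_measurable_real[OF assms(2)] by blast
  have "(\<lambda>x. p (\<mu> *\<^sub>R x + a)) \<in> borel_measurable lborel" using p(1) by measurable
  then have "(\<lambda>x. p (\<mu> *\<^sub>R x + a)) \<in> borel_measurable lebesgue" by (rule measurable_completion)
  moreover have "AE x in lebesgue. p (\<mu> *\<^sub>R x + a) = f (\<mu> *\<^sub>R x + a)"
    using AE_affine[OF assms(1) AE_completion[OF p(2)], of a] by eventually_elim simp
  ultimately show ?thesis by (rule borel_measurable_AE)
qed

lemma exp_bubble:
  assumes "0 < \<alpha>" "\<alpha> < 4" "\<mu> > 0"
  shows "exp (bubble \<alpha> \<mu> \<zeta> x) = \<mu> powr ((8 - \<alpha>) / 2) * eU \<alpha> (\<mu> *\<^sub>R x + (- \<mu> *\<^sub>R \<zeta>))"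
proof -
  have n: "1 + \<mu>\<^sup>2 * (norm (x - \<zeta>))\<^sup>2 > 0" by (intro add_pos_nonneg) auto
  have "\<mu> *\<^sub>R x + (- \<mu> *\<^sub>R \<zeta>) = \<mu> *\<^sub>R (x - \<zeta>)" by (simp add: scaleR_diff_right)
  then have e: "(norm (\<mu> *\<^sub>R x + (- \<mu> *\<^sub>R \<zeta>)))\<^sup>2 = \<mu>\<^sup>2 * (norm (x - \<zeta>))\<^sup>2" by (simp add: power_mult_distrib)
  have "C_alpha \<alpha> * \<mu> / (1 + \<mu>\<^sup>2 * (norm (x - \<zeta>))\<^sup>2) = \<mu> * (C_alpha \<alpha> / (1 + \<mu>\<^sup>2 * (norm (x - \<zeta>))\<^sup>2))" by simp
  then have "ln (C_alpha \<alpha> * \<mu> / (1 + \<mu>\<^sup>2 * (norm (x - \<zeta>))\<^sup>2)) = ln \<mu> + ln (C_alpha \<alpha> / (1 + \<mu>\<^sup>2 * (norm (x - \<zeta>))\<^sup>2))"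
    using C_alpha_pos[OF assms(1,2)] n assms by (simp only:) (intro ln_mult_pos divide_pos_pos)
  moreover have "bubble \<alpha> 1 0 (\<mu> *\<^sub>R x + (- \<mu> *\<^sub>R \<zeta>)) = (8 - \<alpha>) / 2 * ln (C_alpha \<alpha> / (1 + \<mu>\<^sup>2 * (norm (x - \<zeta>))\<^sup>2))"
    unfolding bubble_def diff_zero e by simp
  ultimately show ?thesis using assms by (simp add: eU_def bubble_def[of \<alpha> \<mu>] powr_def exp_add[symmetric] distrib_left)
qed

text \<open>The kernel contributes the power \<alpha> of \<mu>, the volume element the power
  -4.\<close>

lemma riesz_affine:
  assumes \<mu>: "\<mu> > 0"
  shows "riesz \<alpha> (\<lambda>y. E * f (\<mu> *\<^sub>R y + a)) x = E * \<mu> powr (\<alpha> - 4) * riesz \<alpha> f (\<mu> *\<^sub>R x + a)"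
proof -
  have "riesz \<alpha> (\<lambda>y. E * f (\<mu> *\<^sub>R y + a)) x
    = (LINT y|lebesgue. E * \<mu> powr \<alpha> * (f (\<mu> *\<^sub>R y + a) / norm ((\<mu> *\<^sub>R x + a) - (\<mu> *\<^sub>R y + a)) powr \<alpha>))"
    unfolding riesz_def
  proof (intro Bochner_Integration.integral_cong refl)
    fix y
    have "norm ((\<mu> *\<^sub>R x + a) - (\<mu> *\<^sub>R y + a)) = \<mu> * norm (x - y)"
      using \<mu> by (simp add: scaleR_diff_right[symmetric])
    then have "norm ((\<mu> *\<^sub>R x + a) - (\<mu> *\<^sub>R y + a)) powr \<alpha> = \<mu> powr \<alpha> * norm (x - y) powr \<alpha>"
      by (simp only: powr_mult)
    then show "E * f (\<mu> *\<^sub>R y + a) / norm (x - y) powr \<alpha>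
      = E * \<mu> powr \<alpha> * (f (\<mu> *\<^sub>R y + a) / norm ((\<mu> *\<^sub>R x + a) - (\<mu> *\<^sub>R y + a)) powr \<alpha>)" using \<mu> by simp
  qed
  also have "\<dots> = E * \<mu> powr \<alpha> * (LINT y|lebesgue. f (\<mu> *\<^sub>R y + a) / norm ((\<mu> *\<^sub>R x + a) - (\<mu> *\<^sub>R y + a)) powr \<alpha>)"
    by (rule integral_mult_right_zero)
  also have "(LINT y|lebesgue. f (\<mu> *\<^sub>R y + a) / norm ((\<mu> *\<^sub>R x + a) - (\<mu> *\<^sub>R y + a)) powr \<alpha>) = riesz \<alpha> f (\<mu> *\<^sub>R x + a) / \<mu> ^ 4"
    unfolding riesz_def using affine_change_of_variables(2)[OF \<mu>, of "\<lambda>y. f y / norm (\<mu> *\<^sub>R x + a - y) powr \<alpha>" a] \<mu>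
    by (simp add: field_simps)
  also have "E * \<mu> powr \<alpha> * (riesz \<alpha> f (\<mu> *\<^sub>R x + a) / \<mu> ^ 4) = E * \<mu> powr (\<alpha> - 4) * riesz \<alpha> f (\<mu> *\<^sub>R x + a)"
    using \<mu> by (simp add: powr_diff)
  finally show ?thesis .
qed

lemma weighted_L2_weight: "weighted_L2 weight = L2fn M4"
proof -
  have w: "\<bar>f x\<bar>\<^sup>2 * weight x = (1 / 16) * (omega x ^ 4 * (f x)\<^sup>2)" for f :: "real^4 \<Rightarrow> real" and x
    by (simp add: weight_def omega_def power_divide)
  have "integrable lebesgue (\<lambda>x. \<bar>f x\<bar>\<^sup>2 * weight x) \<longleftrightarrow> integrable M4 (\<lambda>x. (f x)\<^sup>2)" if "f \<in> borel_measurable lebesgue" for f :: "real^4 \<Rightarrow> real"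
    unfolding w integrable_mult_left_iff using that by (subst integrable_M4) auto
  then show ?thesis by (auto simp: weighted_L2_def L2fn_def)
qed

lemma distributional_solution_affine:
  assumes \<alpha>: "0 < \<alpha>" "\<alpha> < 4" and \<mu>: "\<mu> > 0" and sol: "distributional_solution \<alpha> (bubble \<alpha> \<mu> \<zeta>) (\<lambda>x. \<phi> (\<mu> *\<^sub>R x + (- \<mu> *\<^sub>R \<zeta>)))"
  shows "distributional_solution \<alpha> (bubble \<alpha> 1 0) \<phi>"
  unfolding distributional_solution_def
proof (intro allI impI)
  let ?a = "- \<mu> *\<^sub>R \<zeta>" and ?E = "\<mu> powr ((8 - \<alpha>) / 2)"
  let ?S = "\<lambda>x. \<mu> *\<^sub>R x + ?a"
  let ?R = "\<lambda>x. riesz \<alpha> (\<lambda>y. exp (bubble \<alpha> 1 0 y) * \<phi> y) x * exp (bubble \<alpha> 1 0 x)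
            + riesz \<alpha> (\<lambda>y. exp (bubble \<alpha> 1 0 y)) x * exp (bubble \<alpha> 1 0 x) * \<phi> x"
  fix \<psi> :: "real^4 \<Rightarrow> real" assume \<psi>: "test_fun \<psi>"
  have s\<psi>: "smooth \<psi>" by (rule test_fun_smooth[OF \<psi>])
  have "test_fun (\<lambda>x. \<psi> (?S x))"
  proof (rule test_fun_support)
    show "smooth (\<lambda>x. \<psi> (?S x))" by (rule smooth_affine[OF s\<psi>])
    have "{x. \<psi> (?S x) \<noteq> 0} \<subseteq> (\<lambda>y. (1 / \<mu>) *\<^sub>R (y + (- 1) *\<^sub>R ?a)) ` {y. \<psi> y \<noteq> 0}"
    proof
      fix x assume "x \<in> {x. \<psi> (?S x) \<noteq> 0}"
      then show "x \<in> (\<lambda>y. (1 / \<mu>) *\<^sub>R (y + (- 1) *\<^sub>R ?a)) ` {y. \<psi> y \<noteq> 0}"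
        using \<mu> by (intro image_eqI[of _ _ "?S x"]) auto
    qed
    moreover have "bounded ((\<lambda>y. (1 / \<mu>) *\<^sub>R (y + (- 1) *\<^sub>R ?a)) ` {y. \<psi> y \<noteq> 0})"
      using bounded_scaling[OF bounded_translation[OF test_fun_bounded_support[OF \<psi>], of "(- 1) *\<^sub>R ?a"], of "1 / \<mu>"]
      by (simp add: image_image add.commute)
    ultimately show "bounded {x. \<psi> (?S x) \<noteq> 0}" by (rule bounded_subset[rotated])
  qed
  then have "(LINT x|lebesgue. \<phi> (?S x) * laplacian (laplacian (\<lambda>x. \<psi> (?S x))) x) =
        (LINT x|lebesgue.
           (riesz \<alpha> (\<lambda>y. exp (bubble \<alpha> \<mu> \<zeta> y) * \<phi> (?S y)) x * exp (bubble \<alpha> \<mu> \<zeta> x)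
            + riesz \<alpha> (\<lambda>y. exp (bubble \<alpha> \<mu> \<zeta> y)) x * exp (bubble \<alpha> \<mu> \<zeta> x) * \<phi> (?S x)) * \<psi> (?S x))"
    using sol unfolding distributional_solution_def by blast
  moreover have "laplacian (laplacian (\<lambda>x. \<psi> (?S x))) x = \<mu> ^ 4 * laplacian (laplacian \<psi>) (?S x)" for x
  proof -
    have "laplacian (\<lambda>x. \<psi> (?S x)) = (\<lambda>x. \<mu>\<^sup>2 * laplacian \<psi> (?S x))" by (intro ext laplacian_affine s\<psi>)
    then have "laplacian (laplacian (\<lambda>x. \<psi> (?S x))) x = \<mu>\<^sup>2 * laplacian (\<lambda>x. laplacian \<psi> (?S x)) x"
      by (simp only:) (intro laplacian_cmult smooth_affine smooth_laplacian s\<psi>)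
    also have "\<dots> = \<mu>\<^sup>2 * (\<mu>\<^sup>2 * laplacian (laplacian \<psi>) (?S x))"
      by (simp only: laplacian_affine[OF smooth_laplacian[OF s\<psi>]])
    finally show ?thesis by (simp add: power2_eq_square power4_eq_xxxx mult.assoc)
  qed
  moreover have "(riesz \<alpha> (\<lambda>y. exp (bubble \<alpha> \<mu> \<zeta> y) * \<phi> (?S y)) x * exp (bubble \<alpha> \<mu> \<zeta> x)
            + riesz \<alpha> (\<lambda>y. exp (bubble \<alpha> \<mu> \<zeta> y)) x * exp (bubble \<alpha> \<mu> \<zeta> x) * \<phi> (?S x)) = \<mu> ^ 4 * ?R (?S x)" for x
  proof -
    \<comment> \<open>Scaling balance: the two bubbles contribute (8 - \<alpha>)/2 each and the
      convolution \<alpha> - 4, which matches the power 4 from the bilaplacian.\<close>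
    have "?E * \<mu> powr (\<alpha> - 4) * ?E = \<mu> powr ((8 - \<alpha>) / 2 + (\<alpha> - 4) + (8 - \<alpha>) / 2)" by (simp only: powr_add)
    also have "(8 - \<alpha>) / 2 + (\<alpha> - 4) + (8 - \<alpha>) / 2 = 4" by (simp add: field_simps)
    finally have E: "?E * \<mu> powr (\<alpha> - 4) * ?E = \<mu> ^ 4" using \<mu> by simp
    have 1: "riesz \<alpha> (\<lambda>y. exp (bubble \<alpha> \<mu> \<zeta> y) * \<phi> (?S y)) x = ?E * \<mu> powr (\<alpha> - 4) * riesz \<alpha> (\<lambda>y. eU \<alpha> y * \<phi> y) (?S x)"
      unfolding exp_bubble[OF \<alpha> \<mu>] mult.assoc[of ?E] using riesz_affine[OF \<mu>, of \<alpha> ?E "\<lambda>y. eU \<alpha> y * \<phi> y" ?a x] by simp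
    have 2: "riesz \<alpha> (\<lambda>y. exp (bubble \<alpha> \<mu> \<zeta> y)) x = ?E * \<mu> powr (\<alpha> - 4) * riesz \<alpha> (eU \<alpha>) (?S x)"
      unfolding exp_bubble[OF \<alpha> \<mu>] by (rule riesz_affine[OF \<mu>])
    have "(riesz \<alpha> (\<lambda>y. exp (bubble \<alpha> \<mu> \<zeta> y) * \<phi> (?S y)) x * exp (bubble \<alpha> \<mu> \<zeta> x)
            + riesz \<alpha> (\<lambda>y. exp (bubble \<alpha> \<mu> \<zeta> y)) x * exp (bubble \<alpha> \<mu> \<zeta> x) * \<phi> (?S x))
      = (?E * \<mu> powr (\<alpha> - 4) * ?E) * (riesz \<alpha> (\<lambda>y. eU \<alpha> y * \<phi> y) (?S x) * eU \<alpha> (?S x) + riesz \<alpha> (eU \<alpha>) (?S x) * eU \<alpha> (?S x) * \<phi> (?S x))"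
      unfolding 1 2 unfolding exp_bubble[OF \<alpha> \<mu>, of \<zeta> x] by (simp only: distrib_left mult_ac)
    then show ?thesis unfolding E by (simp add: eU_def[abs_def])
  qed
  ultimately have "\<mu> ^ 4 * (LINT x|lebesgue. \<phi> (?S x) * laplacian (laplacian \<psi>) (?S x)) = \<mu> ^ 4 * (LINT x|lebesgue. ?R (?S x) * \<psi> (?S x))"
    by (simp add: mult.assoc mult.left_commute[of _ "\<mu> ^ 4"])
  then show "(LINT x|lebesgue. \<phi> x * laplacian (laplacian \<psi>) x) = (LINT x|lebesgue. ?R x * \<psi> x)"
    unfolding affine_change_of_variables(2)[OF \<mu>, of "\<lambda>x. \<phi> x * laplacian (laplacian \<psi>) x" ?a]
      affine_change_of_variables(2)[OF \<mu>, of "\<lambda>x. ?R x * \<psi> x" ?a] .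
qed

lemma distributional_solution_bubble:
  assumes \<alpha>: "0 < \<alpha>" "\<alpha> < 4" and \<mu>: "\<mu> > 0"
    and \<phi>: "\<phi> \<in> weighted_L2 (\<lambda>x. weight (\<mu> *\<^sub>R (x - \<zeta>)))" "distributional_solution \<alpha> (bubble \<alpha> \<mu> \<zeta>) \<phi>"
  shows "\<exists>v. AE x in lebesgue. \<phi> x = sc v (\<mu> *\<^sub>R (x - \<zeta>))"
proof -
  let ?S = "\<lambda>x. \<mu> *\<^sub>R x + (- \<mu> *\<^sub>R \<zeta>)"
  define \<phi>0 where "\<phi>0 y = \<phi> ((1 / \<mu>) *\<^sub>R y + \<zeta>)" for y
  have S: "\<mu> *\<^sub>R (x - \<zeta>) = ?S x" for x by (simp add: scaleR_diff_right)
  have \<phi>S: "\<phi> = (\<lambda>x. \<phi>0 (?S x))" using \<mu> by (simp add: \<phi>0_def fun_eq_iff scaleR_diff_right)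
  have "\<phi>0 \<in> borel_measurable lebesgue"
    unfolding \<phi>0_def[abs_def] using \<phi>(1) \<mu> by (intro measurable_affine) (auto simp: weighted_L2_def)
  moreover have "integrable lebesgue (\<lambda>x. \<bar>\<phi>0 (?S x)\<bar>\<^sup>2 * weight (?S x))"
    using \<phi>(1) unfolding weighted_L2_def S by (simp add: \<phi>S)
  then have "integrable lebesgue (\<lambda>x. \<bar>\<phi>0 x\<bar>\<^sup>2 * weight x)"
    unfolding affine_change_of_variables(1)[OF \<mu>, of "\<lambda>x. \<bar>\<phi>0 x\<bar>\<^sup>2 * weight x"] .
  ultimately have "\<phi>0 \<in> L2fn M4" by (simp add: weighted_L2_weight[symmetric] weighted_L2_def)
  moreover have "distributional_solution \<alpha> (bubble \<alpha> 1 0) \<phi>0"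
    using \<phi>(2) unfolding \<phi>S by (rule distributional_solution_affine[OF \<alpha> \<mu>])
  ultimately obtain v where "AE x in lebesgue. \<phi>0 x = sc v x" using distributional_solution_L2[OF \<alpha>] by blast
  from AE_affine[OF \<mu> this] show ?thesis unfolding S by (subst \<phi>S) blast
qed

section \<open>The functions phi\<close>

lemma phi_eq:
  "phi \<alpha> j x = (8 - \<alpha>) / 2 * (if j \<le> 4 then omega x * x $ of_nat j else omega x - 1)"
proof -
  have "1 + (norm x)\<^sup>2 > 0" by (intro add_pos_nonneg) auto
  then have "(1 - (norm x)\<^sup>2) / (1 + (norm x)\<^sup>2) = omega x - 1" by (simp add: omega_def field_simps)
  then show ?thesis by (simp add: phi_def) (simp add: omega_def)
qed

lemma sum_phi:
  "(\<Sum>j=1..5. a j * phi \<alpha> j x) = (8 - \<alpha>) / 2 *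
    (omega x * (a 1 * x $ 1 + a 2 * x $ 2 + a 3 * x $ 3 + a 4 * x $ 4) + a 5 * (omega x - 1))"
proof -
  have s: "sum f {1..5::nat} = f 1 + f 2 + f 3 + f 4 + f 5" for f :: "nat \<Rightarrow> real" by (simp add: eval_nat_numeral)
  have d: "(8 - \<alpha>) / 2 * (p + q) = (8 - \<alpha>) / 2 * p + (8 - \<alpha>) / 2 * q" for p q by (rule distrib_left)
  show ?thesis unfolding s phi_eq by (simp del: times_divide_eq_left add: d distrib_left mult_ac)
qed

lemma sc_coordinates:
  "sc v x = omega x * (fst v $ 1 * x $ 1 + fst v $ 2 * x $ 2 + fst v $ 3 * x $ 3 + fst v $ 4 * x $ 4) + snd v * (omega x - 1)"
  by (simp add: sc_eq xi_def inner_vec_def sum_4 mult.commute)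

lemma sc_eq_sum_phi:
  assumes "\<alpha> < 4" obtains a where "\<And>x. sc v x = (\<Sum>j=1..5. a j * phi \<alpha> j x)"
proof
  \<comment> \<open>The factor 2 / (8 - \<alpha>) undoes the normalization of the
    \<open>phi\<close>.\<close>
  define a :: "nat \<Rightarrow> real" where "a j = 2 / (8 - \<alpha>) * (if j \<le> 4 then fst v $ of_nat j else snd v)" for j
  have c: "(8 - \<alpha>) / 2 * (2 / (8 - \<alpha>) * t) = t" for t using assms by simp
  show "sc v x = (\<Sum>j=1..5. a j * phi \<alpha> j x)" for x
  proof -
    have "(\<Sum>j=1..5. a j * phi \<alpha> j x) = (8 - \<alpha>) / 2 * (2 / (8 - \<alpha>) * sc v x)"
      unfolding sum_phi sc_coordinates a_def by (rule arg_cong[where f = "\<lambda>t. (8 - \<alpha>) / 2 * t"]) (simp add: distrib_left mult_ac)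
    then show ?thesis unfolding c by simp
  qed
qed

lemma sum_phi_eq_sc: obtains v where "\<And>x. (\<Sum>j=1..5. a j * phi \<alpha> j x) = sc v x"
proof
  define p :: "real^4" where "p = (\<chi> i. if i = 1 then a 1 else if i = 2 then a 2 else if i = 3 then a 3 else a 4)"
  show "(\<Sum>j=1..5. a j * phi \<alpha> j x) = sc (((8 - \<alpha>) / 2) *\<^sub>R (p, a 5)) x" for x
    unfolding sum_phi sc_scaleR by (subst sc_coordinates) (simp add: p_def)
qed

lemma sc_bounded: "\<bar>sc v x\<bar> \<le> norm v"
  using Cauchy_Schwarz_ineq2[of v "stereo x"] by (simp add: sc_def norm_stereo)

lemma solution_conclusion:
  assumes "\<alpha> < 4" "AE x in lebesgue. \<phi> x = sc v (\<mu> *\<^sub>R (x - \<zeta>))"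
  shows "\<exists>\<phi>'. (AE x in lebesgue. \<phi> x = \<phi>' x) \<and> smooth \<phi>' \<and> bounded (range \<phi>') \<and>
    (\<exists>a::nat \<Rightarrow> real. \<forall>x. \<phi>' x = (\<Sum>j=1..5. a j * phi \<alpha> j (\<mu> *\<^sub>R (x - \<zeta>))))"
proof -
  obtain a where a: "\<And>x. sc v x = (\<Sum>j=1..5. a j * phi \<alpha> j x)" using sc_eq_sum_phi[OF assms(1)] by blast
  show ?thesis
  proof (intro exI conjI)
    show "AE x in lebesgue. \<phi> x = sc v (\<mu> *\<^sub>R (x - \<zeta>))" by fact
    show "smooth (\<lambda>x. sc v (\<mu> *\<^sub>R (x - \<zeta>)))"
      using smooth_affine[OF sc_smooth, of v \<mu> "- (\<mu> *\<^sub>R \<zeta>)"] by (simp add: scaleR_diff_right)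
    show "bounded (range (\<lambda>x. sc v (\<mu> *\<^sub>R (x - \<zeta>))))" unfolding bounded_real using sc_bounded by blast
    show "\<forall>x. sc v (\<mu> *\<^sub>R (x - \<zeta>)) = (\<Sum>j=1..5. a j * phi \<alpha> j (\<mu> *\<^sub>R (x - \<zeta>)))" using a by simp
  qed
qed

section \<open>The second variation\<close>

lemma has_weak_laplacian_smooth: "smooth f \<Longrightarrow> has_weak_laplacian f (laplacian f)"
  by (simp add: has_weak_laplacian_def smooth_L1_loc smooth_laplacian integral_laplacian_by_parts)

lemma has_weak_laplacian_add:
  assumes "has_weak_laplacian f F" "has_weak_laplacian g G"
  shows "has_weak_laplacian (\<lambda>x. f x + c * g x) (\<lambda>x. F x + c * G x)"
  using assms by (auto simp: has_weak_laplacian_def L1_loc_add L1_loc_test_add test_fun_laplacian)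

lemma weak_laplacian_L2fn: "\<phi> \<in> form_domain \<Longrightarrow> weak_laplacian \<phi> \<in> L2fn lebesgue"
  using form_domain_approximation(1)[of \<phi>] by (auto simp: L2conv_def)

lemma form_domain_L1_loc: "\<phi> \<in> form_domain \<Longrightarrow> \<phi> \<in> L1_loc"
  by (intro L2fn_M4_L1_loc form_domain_L2fn)

lemma weak_laplacian_cong_AE:
  assumes "\<phi> \<in> form_domain" "AE x in lebesgue. \<phi> x = \<psi> x"
  shows "AE x in lebesgue. weak_laplacian \<psi> x = weak_laplacian \<phi> x"
proof (rule weak_laplacian_AE(1))
  show "has_weak_laplacian \<phi> (weak_laplacian \<phi>)" by (rule form_domain_approximation(2)[OF assms(1)])
  show "AE x in lebesgue. \<psi> x = \<phi> x" using assms(2) by eventually_elim simp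
  show "\<psi> \<in> L1_loc" using form_domain_AE[OF assms] by (rule form_domain_L1_loc)
qed

lemma weak_laplacian_add:
  assumes "\<phi> \<in> form_domain" "\<psi> \<in> form_domain"
  shows "AE x in lebesgue. weak_laplacian (\<lambda>x. \<phi> x + c * \<psi> x) x = weak_laplacian \<phi> x + c * weak_laplacian \<psi> x"
proof (rule weak_laplacian_AE(1))
  show "has_weak_laplacian (\<lambda>x. \<phi> x + c * \<psi> x) (\<lambda>x. weak_laplacian \<phi> x + c * weak_laplacian \<psi> x)"
    by (intro has_weak_laplacian_add form_domain_approximation(2) assms)
  show "(\<lambda>x. \<phi> x + c * \<psi> x) \<in> L1_loc" by (intro form_domain_L1_loc form_domain_add assms)
qed simp

lemma weak_laplacian_Pol: "f \<in> Pol \<Longrightarrow> AE x in lebesgue. weak_laplacian f x = laplacian f x"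
  by (rule weak_laplacian_AE(1)[OF has_weak_laplacian_smooth]) (auto simp: Pol_smooth smooth_L1_loc)

text \<open>Weak Laplacians are selected for each function separately, so additivity and
  independence of the representative hold almost everywhere only; they become equalities for this
  integral.\<close>

definition Dir :: "(real^4 \<Rightarrow> real) \<Rightarrow> (real^4 \<Rightarrow> real) \<Rightarrow> real" where
  "Dir \<phi> \<psi> = (LINT x|lebesgue. weak_laplacian \<phi> x * weak_laplacian \<psi> x)"

lemma Dir_cong:
  assumes "\<phi> \<in> form_domain" "AE x in lebesgue. \<phi> x = \<phi>' x" "\<psi> \<in> form_domain" shows "Dir \<phi> \<psi> = Dir \<phi>' \<psi>"
  unfolding Dir_def
proof (rule integral_cong_AE)
  show "AE x in lebesgue. weak_laplacian \<phi> x * weak_laplacian \<psi> x = weak_laplacian \<phi>' x * weak_laplacian \<psi> x"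
    using weak_laplacian_cong_AE[OF assms(1,2)] by eventually_elim simp
qed (intro borel_measurable_times L2fn_measurable weak_laplacian_L2fn assms form_domain_AE[OF assms(1,2)])+

lemma Dir_add:
  assumes "\<phi> \<in> form_domain" "\<psi> \<in> form_domain" "\<eta> \<in> form_domain"
  shows "Dir (\<lambda>x. \<phi> x + c * \<psi> x) \<eta> = Dir \<phi> \<eta> + c * Dir \<psi> \<eta>"
proof -
  note W = weak_laplacian_L2fn[OF assms(1)] weak_laplacian_L2fn[OF assms(2)] weak_laplacian_L2fn[OF assms(3)]
  have "Dir (\<lambda>x. \<phi> x + c * \<psi> x) \<eta>
    = (LINT x|lebesgue. (weak_laplacian \<phi> x + c * weak_laplacian \<psi> x) * weak_laplacian \<eta> x)"
    unfolding Dir_def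
  proof (rule integral_cong_AE)
    show "AE x in lebesgue. weak_laplacian (\<lambda>x. \<phi> x + c * \<psi> x) x * weak_laplacian \<eta> x
      = (weak_laplacian \<phi> x + c * weak_laplacian \<psi> x) * weak_laplacian \<eta> x"
      using weak_laplacian_add[OF assms(1,2), of c] by eventually_elim simp
  qed (intro borel_measurable_times L2fn_measurable L2fn_add L2fn_cmult W weak_laplacian_L2fn form_domain_add assms)+
  also have "\<dots> = Dir \<phi> \<eta> + c * Dir \<psi> \<eta>"
    using L2fn_mult[OF W(1,3)] L2fn_mult[OF W(2,3)] by (simp add: Dir_def distrib_right mult.assoc)
  finally show ?thesis .
qed

text \<open>Along approximating polynomials the integrals of the two sides coincide, and both
  converge.\<close>

lemma Dir_Pol:
  assumes \<phi>: "\<phi> \<in> form_domain" and f: "f \<in> Pol"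
  shows "Dir \<phi> f = (LINT x|M4. \<phi> x * Pop f x)"
proof -
  obtain g where g: "\<And>n. g n \<in> Pol" "L2conv M4 g \<phi>" "L2conv lebesgue (\<lambda>n. laplacian (g n)) (weak_laplacian \<phi>)"
    using form_domain_approximation(1)[OF \<phi>] by blast
  have "(\<lambda>n. LINT x|lebesgue. laplacian (g n) x * laplacian f x) \<longlonglongrightarrow> (LINT x|lebesgue. weak_laplacian \<phi> x * laplacian f x)"
    by (rule L2conv_inner[OF g(3) Pol_laplacian_L2[OF f]])
  moreover have "(\<lambda>n. LINT x|lebesgue. laplacian (g n) x * laplacian f x) \<longlonglongrightarrow> (LINT x|M4. \<phi> x * Pop f x)"
    unfolding laplacian_Dirichlet_form[OF g(1) f] Pop_symmetric[OF g(1) f]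
    by (rule L2conv_inner[OF g(2) Pol_L2fn[OF Pol_Pop[OF f]]])
  ultimately have "(LINT x|lebesgue. weak_laplacian \<phi> x * laplacian f x) = (LINT x|M4. \<phi> x * Pop f x)" by (rule LIMSEQ_unique)
  moreover have "Dir \<phi> f = (LINT x|lebesgue. weak_laplacian \<phi> x * laplacian f x)"
    unfolding Dir_def
  proof (rule integral_cong_AE)
    show "AE x in lebesgue. weak_laplacian \<phi> x * weak_laplacian f x = weak_laplacian \<phi> x * laplacian f x"
      using weak_laplacian_Pol[OF f] by eventually_elim simp
  qed (intro borel_measurable_times L2fn_measurable weak_laplacian_L2fn Pol_laplacian_L2 Pol_form_domain \<phi> f)+
  ultimately show ?thesis by simp
qed

lemma Dir_gap:
  assumes \<phi>: "\<phi> \<in> form_domain" and o: "(LINT x|M4. \<phi> x) = 0" "\<And>a. (LINT x|M4. \<phi> x * sc a x) = 0"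
  shows "120 * (LINT x|M4. (\<phi> x)\<^sup>2) \<le> Dir \<phi> \<phi>"
proof -
  obtain g where g: "\<And>n. g n \<in> Pol" "L2conv M4 g \<phi>" "L2conv lebesgue (\<lambda>n. laplacian (g n)) (weak_laplacian \<phi>)"
    using form_domain_approximation(1)[OF \<phi>] by blast
  have "(\<lambda>n. LINT x|M4. Pop (g n) x * g n x) \<longlonglongrightarrow> (LINT x|lebesgue. (weak_laplacian \<phi> x)\<^sup>2)"
    unfolding laplacian_square[OF g(1), symmetric] by (rule L2conv_square[OF g(3)])
  from spectral_gap_limit[OF g(1,2) this o] show ?thesis by (simp add: Dir_def power2_eq_square)
qed

lemma bilin_form_eq:
  assumes \<alpha>: "0 < \<alpha>" "\<alpha> < 4" and L: "\<phi> \<in> form_domain" "\<psi> \<in> form_domain"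
  shows "bilin_form \<alpha> (bubble \<alpha> 1 0) \<phi> \<psi>
    = Dir \<phi> \<psi> - (LINT x|M4. \<phi> x * Kop \<alpha> \<psi> x) - 3 * (8 - \<alpha>) * (LINT x|M4. \<phi> x * \<psi> x)"
proof -
  have "(LINT x|lebesgue. riesz \<alpha> (\<lambda>y. eU \<alpha> y) x * eU \<alpha> x * (\<phi> x * \<psi> x))
    = (LINT x|lebesgue. 3 * (8 - \<alpha>) * (omega x ^ 4 * (\<phi> x * \<psi> x)))"
    using riesz_eU[OF \<alpha>] by (simp add: mult.assoc)
  also have "\<dots> = 3 * (8 - \<alpha>) * (LINT x|M4. \<phi> x * \<psi> x)"
    unfolding omega4_integrable(2)[OF form_domain_L2fn[OF L(1)] form_domain_L2fn[OF L(2)], symmetric]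
    by (rule integral_mult_right_zero)
  finally show ?thesis
    using kern_form_Kop[OF \<alpha> form_domain_L2fn[OF L(2)] form_domain_L2fn[OF L(1)]]
    unfolding bilin_form_def Dir_def kern_form_def eU_def[symmetric] by simp
qed

section \<open>Coercivity, kernel and Morse index of the second variation\<close>

context
  fixes \<alpha> :: real
  assumes \<alpha>: "0 < \<alpha>" "\<alpha> < 4"
begin

abbreviation (input) bil where "bil \<equiv> bilin_form \<alpha> (bubble \<alpha> 1 0)"

lemma bilin_form_commute:
  assumes L: "\<phi> \<in> form_domain" "\<psi> \<in> form_domain" shows "bil \<phi> \<psi> = bil \<psi> \<phi>"
  using kern_form_commute[OF \<alpha> form_domain_L2fn[OF L(1)] form_domain_L2fn[OF L(2)]]
    kern_form_Kop[OF \<alpha> form_domain_L2fn[OF L(1)] form_domain_L2fn[OF L(2)]]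
    kern_form_Kop[OF \<alpha> form_domain_L2fn[OF L(2)] form_domain_L2fn[OF L(1)]]
  by (simp add: bilin_form_eq[OF \<alpha>] L Dir_def mult.commute)

lemma bilin_form_add:
  assumes L: "\<phi> \<in> form_domain" "\<psi> \<in> form_domain" "\<eta> \<in> form_domain"
  shows "bil (\<lambda>x. \<phi> x + c * \<psi> x) \<eta> = bil \<phi> \<eta> + c * bil \<psi> \<eta>"
proof -
  note L' = form_domain_L2fn[OF L(1)] form_domain_L2fn[OF L(2)] form_domain_L2fn[OF L(3)]
  have i: "(LINT x|M4. (\<phi> x + c * \<psi> x) * k x) = (LINT x|M4. \<phi> x * k x) + c * (LINT x|M4. \<psi> x * k x)" if "k \<in> L2fn M4" for k
    using L2fn_mult[OF L'(1) that] L2fn_mult[OF L'(2) that] by (simp add: distrib_right mult.assoc)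
  show ?thesis
    unfolding bilin_form_eq[OF \<alpha> form_domain_add[OF L(1,2)] L(3)] bilin_form_eq[OF \<alpha> L(1,3)] bilin_form_eq[OF \<alpha> L(2,3)]
      Dir_add[OF L] i[OF L'(3)] i[OF Kop_L2fn[OF \<alpha> L'(3)]] by (simp add: algebra_simps)
qed

lemma bilin_form_cong:
  assumes "\<phi> \<in> form_domain" "AE x in lebesgue. \<phi> x = \<phi>' x" "\<psi> \<in> form_domain" shows "bil \<phi> \<psi> = bil \<phi>' \<psi>"
proof -
  have \<phi>': "\<phi>' \<in> form_domain" by (rule form_domain_AE[OF assms(1,2)])
  note L = form_domain_L2fn[OF assms(1)] form_domain_L2fn[OF \<phi>'] form_domain_L2fn[OF assms(3)]
  have i: "(LINT x|M4. \<phi> x * k x) = (LINT x|M4. \<phi>' x * k x)" if "k \<in> L2fn M4" for k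
  proof (rule integral_cong_AE)
    show "AE x in M4. \<phi> x * k x = \<phi>' x * k x" unfolding AE_M4 using assms(2) by eventually_elim simp
  qed (intro borel_measurable_times L2fn_measurable L that)+
  show ?thesis unfolding bilin_form_eq[OF \<alpha> assms(1,3)] bilin_form_eq[OF \<alpha> \<phi>' assms(3)] Dir_cong[OF assms]
      i[OF L(3)] i[OF Kop_L2fn[OF \<alpha> L(3)]] ..
qed

lemma bilin_form_sc: assumes "\<phi> \<in> form_domain" shows "bil \<phi> (sc v) = 0"
proof -
  have "(LINT x|M4. \<phi> x * (k * sc v x)) = k * (LINT x|M4. \<phi> x * sc v x)" for k
    by (simp only: mult.left_commute[of _ k] integral_mult_right_zero)
  note k = this
  show ?thesis
    unfolding bilin_form_eq[OF \<alpha> assms Pol_form_domain[OF Pol_sc]] Dir_Pol[OF assms Pol_sc] Pop_sc Kop_sc[OF \<alpha>] k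
    by (simp add: algebra_simps)
qed

lemma bilin_form_const:
  assumes "\<phi> \<in> form_domain" shows "bil \<phi> (\<lambda>x. c) = - 6 * (8 - \<alpha>) * c * (LINT x|M4. \<phi> x)"
proof -
  have K: "Kop \<alpha> (\<lambda>x. c) x = 3 * (8 - \<alpha>) * c" for x using kern_const[OF \<alpha>, of x] by (simp add: Kop_def)
  show ?thesis
    unfolding bilin_form_eq[OF \<alpha> assms Pol_form_domain[OF Pol_const]] Dir_Pol[OF assms Pol_const] Pop_const K integral_mult_left_zero
    by (simp add: algebra_simps)
qed

text \<open>3/5 = 1 - 48/120: the two negative terms amount to at most 6 (8 - \<alpha>) < 48 times
  the squared norm, and the gap bounds the squared norm by \<open>Dir \<phi> \<phi>\<close> /
  120.\<close>

lemma bilin_form_coercive: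
  assumes \<phi>: "\<phi> \<in> form_domain" and o: "(LINT x|M4. \<phi> x) = 0" "\<And>a. (LINT x|M4. \<phi> x * sc a x) = 0"
  shows "3 / 5 * Dir \<phi> \<phi> \<le> bil \<phi> \<phi>"
proof -
  let ?n = "LINT x|M4. (\<phi> x)\<^sup>2"
  note L = form_domain_L2fn[OF \<phi>]
  have "\<bar>LINT x|M4. \<phi> x * Kop \<alpha> \<phi> x\<bar> \<le> 3 * (8 - \<alpha>) * ?n"
    using kern_form_bound[OF \<alpha> L] unfolding kern_form_Kop[OF \<alpha> L L] .
  moreover have "3 * (8 - \<alpha>) * ?n \<le> 24 * ?n" using \<alpha> by (intro mult_right_mono) auto
  moreover have "120 * ?n \<le> Dir \<phi> \<phi>" by (rule Dir_gap[OF \<phi> o])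
  moreover have "bil \<phi> \<phi> = Dir \<phi> \<phi> - (LINT x|M4. \<phi> x * Kop \<alpha> \<phi> x) - 3 * (8 - \<alpha>) * ?n"
    by (simp add: bilin_form_eq[OF \<alpha> \<phi> \<phi>] power2_eq_square)
  ultimately show ?thesis by argo
qed

lemma Dir_nonneg: "Dir \<phi> \<phi> \<ge> 0" by (simp add: Dir_def)

text \<open>Linear functions pair to zero with the whole form domain and have mean zero, so
  subtracting the projection changes neither the form nor the mean.\<close>

lemma sc_part_reduction:
  assumes \<phi>: "\<phi> \<in> form_domain"
  defines "\<eta> \<equiv> \<lambda>x. \<phi> x + (- 1) * sc (sc_part \<phi>) x"
  shows "\<eta> \<in> form_domain" "(LINT x|M4. \<eta> x) = (LINT x|M4. \<phi> x)" "(LINT x|M4. \<eta> x * sc a x) = 0" "bil \<eta> \<eta> = bil \<phi> \<phi>"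
proof -
  let ?s = "sc (sc_part \<phi>)"
  have s: "?s \<in> form_domain" by (intro Pol_form_domain Pol_sc)
  show \<eta>: "\<eta> \<in> form_domain" unfolding \<eta>_def by (intro form_domain_add \<phi> s)
  note L = form_domain_L2fn[OF \<phi>]
  have "integrable M4 \<phi>" using L2fn_mult[OF L Pol_L2fn[OF Pol_const[of 1]]] by simp
  moreover have "integrable M4 ?s" using Pol_integrable[OF Pol_sc Pol_const[of 1]] by simp
  ultimately show "(LINT x|M4. \<eta> x) = (LINT x|M4. \<phi> x)" unfolding \<eta>_def by (simp add: sc_mean)
  show "(LINT x|M4. \<eta> x * sc a x) = 0" using sc_part_orthogonal[OF L, of a] by (simp add: \<eta>_def)
  have "bil \<eta> \<eta> = bil \<phi> \<eta>" unfolding \<eta>_def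
    using bilin_form_add[OF \<phi> s \<eta>, of "- 1"] bilin_form_sc[OF \<eta>] bilin_form_commute[OF s \<eta>] by (simp add: \<eta>_def)
  also have "\<dots> = bil \<eta> \<phi>" by (rule bilin_form_commute[OF \<phi> \<eta>])
  also have "\<dots> = bil \<phi> \<phi>" unfolding \<eta>_def
    using bilin_form_add[OF \<phi> s \<phi>, of "- 1"] bilin_form_sc[OF \<phi>] bilin_form_commute[OF s \<phi>] by simp
  finally show "bil \<eta> \<eta> = bil \<phi> \<phi>" .
qed

lemma bilin_form_mean_zero:
  assumes "\<phi> \<in> form_domain" "(LINT x|M4. \<phi> x) = 0" shows "bil \<phi> \<phi> \<ge> 0"
proof -
  note r = sc_part_reduction[OF assms(1)]
  have "3 / 5 * Dir (\<lambda>x. \<phi> x + (- 1) * sc (sc_part \<phi>) x) (\<lambda>x. \<phi> x + (- 1) * sc (sc_part \<phi>) x) \<le> bil \<phi> \<phi>"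
    using bilin_form_coercive[OF r(1) _ r(3)] r(2,4) assms(2) by simp
  then show ?thesis using Dir_nonneg[of "\<lambda>x. \<phi> x + (- 1) * sc (sc_part \<phi>) x"] by linarith
qed

text \<open>Testing with 1 shows that a kernel element has mean zero; coercivity then kills its part
  orthogonal to the linear functions.\<close>

lemma form_kernel_eq: "form_kernel form_domain bil = {\<phi>. \<exists>v. AE x in lebesgue. \<phi> x = sc v x}"
proof (intro equalityI subsetI)
  fix \<phi> assume "\<phi> \<in> form_kernel form_domain bil"
  then have \<phi>: "\<phi> \<in> form_domain" and 0: "\<And>\<psi>. \<psi> \<in> form_domain \<Longrightarrow> bil \<phi> \<psi> = 0" by (auto simp: form_kernel_def)
  let ?\<eta> = "\<lambda>x. \<phi> x + (- 1) * sc (sc_part \<phi>) x"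
  note r = sc_part_reduction[OF \<phi>]
  have "(LINT x|M4. \<phi> x) = 0" using 0[OF Pol_form_domain[OF Pol_const[of 1]]] bilin_form_const[OF \<phi>, of 1] \<alpha> by simp
  then have m: "(LINT x|M4. ?\<eta> x) = 0" using r(2) by simp
  have "3 / 5 * Dir ?\<eta> ?\<eta> \<le> 0" using bilin_form_coercive[OF r(1) m r(3)] unfolding r(4) 0[OF \<phi>] .
  then have "(LINT x|M4. (?\<eta> x)\<^sup>2) \<le> 0" using Dir_gap[OF r(1) m r(3)] by linarith
  from L2fn_M4_null[OF form_domain_L2fn[OF r(1)] this] have "AE x in lebesgue. \<phi> x = sc (sc_part \<phi>) x" by eventually_elim simp
  then show "\<phi> \<in> {\<phi>. \<exists>v. AE x in lebesgue. \<phi> x = sc v x}" by blast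
next
  fix \<phi> assume "\<phi> \<in> {\<phi>. \<exists>v. AE x in lebesgue. \<phi> x = sc v x}"
  then obtain v where v: "AE x in lebesgue. \<phi> x = sc v x" by blast
  then have v: "AE x in lebesgue. sc v x = \<phi> x" by eventually_elim simp
  have s: "sc v \<in> form_domain" by (intro Pol_form_domain Pol_sc)
  have "\<phi> \<in> form_domain" by (rule form_domain_AE[OF s v])
  moreover have "bil \<phi> \<psi> = 0" if "\<psi> \<in> form_domain" for \<psi>
    using bilin_form_cong[OF s v that] bilin_form_commute[OF s that] bilin_form_sc[OF that, of v] by simp
  ultimately show "\<phi> \<in> form_kernel form_domain bil" by (simp add: form_kernel_def)
qed

text \<open>The form is nonnegative on functions of mean zero, so the mean is injective on a
  negative subspace, whose dimension is therefore at most one. The constants attain it.\<close>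

lemma morse_index_eq: "morse_index form_domain (quad_form \<alpha> (bubble \<alpha> 1 0)) = 1"
  unfolding morse_index_def
proof (rule antisym)
  let ?Q = "quad_form \<alpha> (bubble \<alpha> 1 0)"
  show "Sup {enat (fun_space.dim V) |V. fun_space.subspace V \<and> V \<subseteq> form_domain \<and>
       (\<exists>B. finite B \<and> V = fun_space.span B) \<and> (\<forall>\<phi>\<in>V. \<phi> \<noteq> 0 \<longrightarrow> ?Q \<phi> < 0)} \<le> 1"
  proof (rule Sup_least, clarify)
    fix S assume V: "fun_space.subspace (fun_space.span S)" "fun_space.span S \<subseteq> form_domain" "finite S"
      "\<forall>\<phi>\<in>fun_space.span S. \<phi> \<noteq> 0 \<longrightarrow> ?Q \<phi> < 0"
    let ?V = "fun_space.span S"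
    have neg: "bil \<phi> \<phi> < 0" if "\<phi> \<in> ?V" "\<phi> \<noteq> 0" for \<phi> using V(4) that by (simp add: quad_form_eq_bilin_form)
    have fd: "\<phi> \<in> form_domain" if "\<phi> \<in> ?V" for \<phi> using V(2) that by blast
    have mean: "(LINT x|M4. \<phi> x) \<noteq> 0" if "\<phi> \<in> ?V" "\<phi> \<noteq> 0" for \<phi>
      using bilin_form_mean_zero[OF fd[OF that(1)]] neg[OF that] by linarith
    obtain A where A: "A \<subseteq> ?V" "fun_space.independent A" "card A = fun_space.dim ?V"
      using fun_space.basis_exists[of ?V] by metis
    have "f = g" if fg: "f \<in> A" "g \<in> A" for f g
    proof (rule ccontr)
      assume ne: "f \<noteq> g"
      let ?I = "\<lambda>\<phi>::real^4 \<Rightarrow> real. LINT x|M4. \<phi> x"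
      have fV: "f \<in> ?V" "g \<in> ?V" using A(1) fg by auto
      have f0: "f \<noteq> 0" using A(2) fg fun_space.dependent_zero by blast
      \<comment> \<open>The combination of \<open>f\<close> and \<open>g\<close> with mean zero. It
        lies in the negative space, hence is zero, and \<open>g\<close> is a multiple of
        \<open>f\<close>.\<close>
      define h where "h = g + (\<lambda>x. (- ?I g / ?I f) * f x)"
      have hV: "h \<in> ?V" unfolding h_def by (intro fun_space.span_add fun_space.span_scale fV)
      have i: "integrable M4 f" "integrable M4 g"
        using L2fn_mult[OF form_domain_L2fn[OF fd[OF fV(1)]] Pol_L2fn[OF Pol_const[of 1]]]
          L2fn_mult[OF form_domain_L2fn[OF fd[OF fV(2)]] Pol_L2fn[OF Pol_const[of 1]]] by simp_all
      have "?I h = ?I g + (- ?I g / ?I f) * ?I f" using i by (simp add: h_def)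
      then have "?I h = 0" using mean[OF fV(1) f0] by simp
      then have "h = 0" using mean[OF hV] by blast
      then have gf: "g = (\<lambda>x. (?I g / ?I f) * f x)" by (auto simp: h_def fun_eq_iff)
      have "(\<lambda>x. (?I g / ?I f) * f x) \<in> fun_space.span {f}" by (intro fun_space.span_scale fun_space.span_base) simp
      then have "g \<in> fun_space.span {f}" by (simp only: gf[symmetric])
      moreover have "{f} \<subseteq> A - {g}" using fg ne by auto
      ultimately have "g \<in> fun_space.span (A - {g})" using fun_space.span_mono by blast
      then show False using A(2) fg unfolding fun_space.dependent_def by blast
    qed
    \<comment> \<open>For infinite \<open>A\<close> the bound holds by the convention that its
      cardinality is 0.\<close>
    then have "card A \<le> 1"
      by (cases "finite A") (auto simp: card_le_Suc0_iff_eq)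
    then show "enat (fun_space.dim ?V) \<le> 1" using A(3) by (simp add: one_enat_def)
  qed
  let ?one = "(\<lambda>x. 1) :: real^4 \<Rightarrow> real"
  have ind: "fun_space.independent {?one}"
    by (simp add: fun_space.dependent_def fun_eq_iff)
  have sp: "fun_space.span {?one} = {(\<lambda>x. c) |c. True}"
    unfolding fun_space.span_singleton by auto
  have "quad_form \<alpha> (bubble \<alpha> 1 0) (\<lambda>x. c) < 0" if "c \<noteq> 0" for c :: real
  proof -
    have "quad_form \<alpha> (bubble \<alpha> 1 0) (\<lambda>x. c) = - (6 * (8 - \<alpha>) * (c * c) * vol4)"
      using bilin_form_const[OF Pol_form_domain[OF Pol_const[of c]], of c] M4_const_integral(1)[of c]
      by (simp add: quad_form_eq_bilin_form algebra_simps)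
    moreover have "6 * (8 - \<alpha>) * (c * c) * vol4 > 0"
    proof -
      have "c * c > 0" using that by (auto simp: zero_less_mult_iff)
      then show ?thesis using mult_pos_pos[OF _ vol4_pos, of "6 * (8 - \<alpha>) * (c * c)"] mult_pos_pos[of "6 * (8 - \<alpha>)" "c * c"] \<alpha> by argo
    qed
    ultimately show ?thesis by linarith
  qed
  note neg = this
  have "\<forall>\<phi>\<in>fun_space.span {?one}. \<phi> \<noteq> 0 \<longrightarrow> ?Q \<phi> < 0"
  proof (intro ballI impI)
    fix \<phi> assume "\<phi> \<in> fun_space.span {?one}" and n: "\<phi> \<noteq> 0"
    then obtain c where c: "\<phi> = (\<lambda>x. c)" unfolding sp by blast
    then have "c \<noteq> 0" using n by (auto simp: fun_eq_iff)
    then show "?Q \<phi> < 0" unfolding c by (rule neg)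
  qed
  moreover have "fun_space.span {?one} \<subseteq> form_domain" unfolding sp using Pol_form_domain[OF Pol_const] by auto
  moreover have "fun_space.dim (fun_space.span {?one}) = 1"
    using fun_space.dim_span_eq_card_independent[OF ind] by simp
  ultimately show "1 \<le> Sup {enat (fun_space.dim V) |V. fun_space.subspace V \<and> V \<subseteq> form_domain \<and>
       (\<exists>B. finite B \<and> V = fun_space.span B) \<and> (\<forall>\<phi>\<in>V. \<phi> \<noteq> 0 \<longrightarrow> ?Q \<phi> < 0)}"
    by (intro Sup_upper CollectI exI[of _ "fun_space.span {?one}"] conjI exI[of _ "{?one}"] fun_space.subspace_span)
       (simp_all add: one_enat_def)
qed

lemma coercive_on_eq:
  "coercive_on
       {\<phi> \<in> form_domain. orthogonal_omega \<phi> (\<lambda>x. 1) \<and> (\<forall>j\<in>{1..5}. orthogonal_omega \<phi> (phi \<alpha> j))}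
       (quad_form \<alpha> (bubble \<alpha> 1 0))"
  unfolding coercive_on_def
proof (intro exI[of _ "3 / 5 :: real"] conjI ballI)
  fix \<phi> assume "\<phi> \<in> {\<phi> \<in> form_domain. orthogonal_omega \<phi> (\<lambda>x. 1) \<and> (\<forall>j\<in>{1..5}. orthogonal_omega \<phi> (phi \<alpha> j))}"
  then have \<phi>: "\<phi> \<in> form_domain" and o: "orthogonal_omega \<phi> (\<lambda>x. 1)" "\<And>j. j \<in> {1..5} \<Longrightarrow> orthogonal_omega \<phi> (phi \<alpha> j)" by auto
  note L = form_domain_L2fn[OF \<phi>]
  have oM: "orthogonal_omega \<phi> k \<longleftrightarrow> (LINT x|M4. \<phi> x * k x) = 0" if "k \<in> L2fn M4" for k
    unfolding orthogonal_omega_def omega4_integrable(2)[OF L that, symmetric] by (simp add: mult_ac)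
  have phiP: "phi \<alpha> j \<in> L2fn M4" if "j \<in> {1..5}" for j
  proof -
    \<comment> \<open>A single \<open>phi\<close> is the combination whose coefficients are an
      indicator, hence a linear function on the sphere.\<close>
    obtain v where v: "\<And>x. (\<Sum>i=1..5. (if i = j then 1 else 0) * phi \<alpha> i x) = sc v x"
      using sum_phi_eq_sc[where \<alpha> = \<alpha> and a = "\<lambda>i. if i = j then 1 else 0"] by metis
    have "(if i = j then 1 else 0) * phi \<alpha> i x = (if i = j then phi \<alpha> i x else 0)" for i x by simp
    then have "phi \<alpha> j = sc v" unfolding fun_eq_iff v[symmetric] using that by (simp only: sum.delta finite_atLeastAtMost if_True simp_thms)
    then show ?thesis using Pol_L2fn[OF Pol_sc] by simp
  qed
  have 1: "(LINT x|M4. \<phi> x) = 0" using o(1) oM[OF Pol_L2fn[OF Pol_const]] by simp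
  have 2: "(LINT x|M4. \<phi> x * sc v x) = 0" for v
  proof -
    obtain a where a: "\<And>x. sc v x = (\<Sum>j=1..5. a j * phi \<alpha> j x)" using sc_eq_sum_phi[OF \<alpha>(2)] by blast
    have "(LINT x|M4. \<phi> x * sc v x) = (LINT x|M4. (\<Sum>j=1..5. a j * (\<phi> x * phi \<alpha> j x)))"
      by (simp add: a sum_distrib_left mult.left_commute)
    also have "\<dots> = (\<Sum>j=1..5. LINT x|M4. a j * (\<phi> x * phi \<alpha> j x))"
      by (intro Bochner_Integration.integral_sum integrable_mult_right L2fn_mult L phiP)
    also have "\<dots> = 0" using oM[OF phiP] o(2) by (intro sum.neutral ballI) simp
    finally show ?thesis .
  qed
  show "3 / 5 * (LINT x|lebesgue. \<bar>weak_laplacian \<phi> x\<bar>\<^sup>2) \<le> quad_form \<alpha> (bubble \<alpha> 1 0) \<phi>"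
    using bilin_form_coercive[OF \<phi> 1 2] by (simp add: quad_form_eq_bilin_form Dir_def power2_eq_square)
qed simp

end

theorem corollary1p3:
  fixes \<alpha> :: real
  assumes "0 < \<alpha>" and "\<alpha> < 4"
  shows
    "(\<forall>\<phi>. \<phi> \<in> weighted_L2 weight \<and> distributional_solution \<alpha> (bubble \<alpha> 1 0) \<phi> \<longrightarrow>
        (\<exists>\<phi>'. (AE x in lebesgue. \<phi> x = \<phi>' x) \<and> smooth \<phi>' \<and> bounded (range \<phi>') \<and>
           (\<exists>a::nat \<Rightarrow> real. \<forall>x. \<phi>' x = (\<Sum>j=1..5. a j * phi \<alpha> j x)))) \<and>
     (\<forall>\<mu> \<zeta>. \<mu> > 0 \<longrightarrow>
        (\<forall>\<phi>. \<phi> \<in> weighted_L2 (\<lambda>x. weight (\<mu> *\<^sub>R (x - \<zeta>))) \<and>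
             distributional_solution \<alpha> (bubble \<alpha> \<mu> \<zeta>) \<phi> \<longrightarrow>
           (\<exists>\<phi>'. (AE x in lebesgue. \<phi> x = \<phi>' x) \<and> smooth \<phi>' \<and> bounded (range \<phi>') \<and>
              (\<exists>a::nat \<Rightarrow> real. \<forall>x. \<phi>' x = (\<Sum>j=1..5. a j * phi \<alpha> j (\<mu> *\<^sub>R (x - \<zeta>))))))) \<and>
     morse_index form_domain (quad_form \<alpha> (bubble \<alpha> 1 0)) = 1 \<and>
     form_kernel form_domain (bilin_form \<alpha> (bubble \<alpha> 1 0)) =
       {\<phi>. \<exists>a::nat \<Rightarrow> real. AE x in lebesgue. \<phi> x = (\<Sum>j=1..5. a j * phi \<alpha> j x)} \<and>
     coercive_on
       {\<phi> \<in> form_domain. orthogonal_omega \<phi> (\<lambda>x. 1) \<and>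
          (\<forall>j\<in>{1..5}. orthogonal_omega \<phi> (phi \<alpha> j))}
       (quad_form \<alpha> (bubble \<alpha> 1 0))"
proof (intro conjI)
  have general: "\<forall>\<mu> \<zeta>. \<mu> > 0 \<longrightarrow>
        (\<forall>\<phi>. \<phi> \<in> weighted_L2 (\<lambda>x. weight (\<mu> *\<^sub>R (x - \<zeta>))) \<and>
             distributional_solution \<alpha> (bubble \<alpha> \<mu> \<zeta>) \<phi> \<longrightarrow>
           (\<exists>\<phi>'. (AE x in lebesgue. \<phi> x = \<phi>' x) \<and> smooth \<phi>' \<and> bounded (range \<phi>') \<and>
              (\<exists>a::nat \<Rightarrow> real. \<forall>x. \<phi>' x = (\<Sum>j=1..5. a j * phi \<alpha> j (\<mu> *\<^sub>R (x - \<zeta>))))))"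
  proof (intro allI impI, elim conjE)
    fix \<mu> \<zeta> \<phi> assume "\<mu> > 0" "\<phi> \<in> weighted_L2 (\<lambda>x. weight (\<mu> *\<^sub>R (x - \<zeta>)))" "distributional_solution \<alpha> (bubble \<alpha> \<mu> \<zeta>) \<phi>"
    from distributional_solution_bubble[OF assms this]
    obtain v where "AE x in lebesgue. \<phi> x = sc v (\<mu> *\<^sub>R (x - \<zeta>))" by blast
    from solution_conclusion[OF assms(2) this]
    show "\<exists>\<phi>'. (AE x in lebesgue. \<phi> x = \<phi>' x) \<and> smooth \<phi>' \<and> bounded (range \<phi>') \<and>
              (\<exists>a::nat \<Rightarrow> real. \<forall>x. \<phi>' x = (\<Sum>j=1..5. a j * phi \<alpha> j (\<mu> *\<^sub>R (x - \<zeta>))))" .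
  qed
  then show "\<forall>\<mu> \<zeta>. \<mu> > 0 \<longrightarrow>
        (\<forall>\<phi>. \<phi> \<in> weighted_L2 (\<lambda>x. weight (\<mu> *\<^sub>R (x - \<zeta>))) \<and>
             distributional_solution \<alpha> (bubble \<alpha> \<mu> \<zeta>) \<phi> \<longrightarrow>
           (\<exists>\<phi>'. (AE x in lebesgue. \<phi> x = \<phi>' x) \<and> smooth \<phi>' \<and> bounded (range \<phi>') \<and>
              (\<exists>a::nat \<Rightarrow> real. \<forall>x. \<phi>' x = (\<Sum>j=1..5. a j * phi \<alpha> j (\<mu> *\<^sub>R (x - \<zeta>))))))" .
  show "\<forall>\<phi>. \<phi> \<in> weighted_L2 weight \<and> distributional_solution \<alpha> (bubble \<alpha> 1 0) \<phi> \<longrightarrow>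
        (\<exists>\<phi>'. (AE x in lebesgue. \<phi> x = \<phi>' x) \<and> smooth \<phi>' \<and> bounded (range \<phi>') \<and>
           (\<exists>a::nat \<Rightarrow> real. \<forall>x. \<phi>' x = (\<Sum>j=1..5. a j * phi \<alpha> j x)))"
    \<comment> \<open>The standard bubble is the case \<mu> = 1, \<zeta> = 0.\<close>
    using general[THEN spec[of _ 1], THEN spec[of _ 0]] by simp
  show "morse_index form_domain (quad_form \<alpha> (bubble \<alpha> 1 0)) = 1" by (rule morse_index_eq[OF assms])
  show "form_kernel form_domain (bilin_form \<alpha> (bubble \<alpha> 1 0)) =
       {\<phi>. \<exists>a::nat \<Rightarrow> real. AE x in lebesgue. \<phi> x = (\<Sum>j=1..5. a j * phi \<alpha> j x)}"
    unfolding form_kernel_eq[OF assms]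
  proof (intro Collect_cong iffI; elim exE)
    fix \<phi> v assume "AE x in lebesgue. \<phi> x = sc v x"
    moreover obtain a where "\<And>x. sc v x = (\<Sum>j=1..5. a j * phi \<alpha> j x)" using sc_eq_sum_phi[OF assms(2)] by blast
    ultimately show "\<exists>a::nat \<Rightarrow> real. AE x in lebesgue. \<phi> x = (\<Sum>j=1..5. a j * phi \<alpha> j x)" by (intro exI[of _ a]) simp
  next
    fix \<phi> and a :: "nat \<Rightarrow> real" assume h: "AE x in lebesgue. \<phi> x = (\<Sum>j=1..5. a j * phi \<alpha> j x)"
    obtain v where v: "\<And>x. (\<Sum>j=1..5. a j * phi \<alpha> j x) = sc v x" using sum_phi_eq_sc by blast
    show "\<exists>v. AE x in lebesgue. \<phi> x = sc v x" using h unfolding v by blast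
  qed
  show "coercive_on
       {\<phi> \<in> form_domain. orthogonal_omega \<phi> (\<lambda>x. 1) \<and>
          (\<forall>j\<in>{1..5}. orthogonal_omega \<phi> (phi \<alpha> j))}
       (quad_form \<alpha> (bubble \<alpha> 1 0))"
    by (rule coercive_on_eq[OF assms])
qed

end
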